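(* Assume that $V$ satisfies $(V_1)$--$(V_2)$, $f$ satisfies $(f_1)$--$(f_3)$ and $M$ fulfills $(M_1)$--$(M_2)$. If $1<p<N/s$ and $0\le h\in L^{\frac{N}{N-sp}}(\mathbb{R}^N)$, then there exists $\lambda_*>0$ such that for all $0<\lambda<\lambda_*$ the problem $$M\big(\|u\|^{N/s}\big)\left[(-\Delta)^s_{N/s}u+V(x)|u|^{N/s-2}u\right]=f(x,u)+\lambda h(x)|u|^{p-2}u\quad\text{in }\mathbb{R}^N$$ admits a nontrivial nonnegative least energy (weak) solution $u_\lambda$ in $W_V^{s,N/s}(\mathbb{R}^N)$. Moreover, $\lim_{\lambda\to0}\|u_\lambda\|=0$.
   Context: Setting. $s\in(0,1)$, $N\ge2$ is an integer, $\lambda>0$ is a parameter, $h:\mathbb{R}^N\to[0,\infty)$ is a measurable weight function. $(-\Delta)^s_{N/s}$ is the fractional $N/s$-Laplacian, $(-\Delta)_{N/s}^s\varphi(x)=2\lim_{\varepsilon\to0^+}\int_{\mathbb{R}^N\setminus B_\varepsilon(x)}\frac{|\varphi(x)-\varphi(y)|^{N/s-2}(\varphi(x)-\varphi(y))}{|x-y|^{2N}}dy$ for $\varphi\in C_0^\infty(\mathbb{R}^N)$. Norm and space. $[u]_{s,N/s}=\left(\iint_{\mathbb{R}^{2N}}\frac{|u(x)-u(y)|^{N/s}}{|x-y|^{2N}}dxdy\right)^{s/N}$, $\|u\|=\left([u]_{s,N/s}^{N/s}+\int_{\mathbb{R}^N}V(x)|u|^{N/s}dx\right)^{s/N}$,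 and $W_V^{s,N/s}(\mathbb{R}^N)$ is the completion of $C_0^\infty(\mathbb{R}^N)$ with respect to $\|\cdot\|$. Hypotheses on $V$. $(V_1)$: $V:\mathbb{R}^N\to(0,\infty)$ is continuous and there is $V_0>0$ with $\inf_{\mathbb{R}^N}V\ge V_0$. $(V_2)$: there is $r>0$ such that $\lim_{|y|\to\infty}\mathrm{meas}\{x\in B_r(y):V(x)\le c\}=0$ for all $c>0$. Hypotheses on $M$. $M:[0,\infty)\to[0,\infty)$ is continuous. $(M_1)$: for any $\tau>0$ there is $\kappa=\kappa(\tau)>0$ with $M(t)\ge\kappa$ for all $t\ge\tau$. $(M_2)$: there is $\theta\ge1$ such that $tM(t)\le\theta\mathscr{M}(t)$ for all $t\ge0$, where $\mathscr{M}(t)=\int_0^tM(\tau)d\tau$. This $\theta$ is used below. Constants. $\lambda_1=\inf\left\{\|u\|^{\theta N/s}/\|u\|_{L^{\theta N/s}(\mathbb{R}^N)}^{\theta N/s}:u\in W_V^{s,N/s}(\mathbb{R}^N)\setminus\{0\}\right\}$, which is positive. For $\alpha>0$, $\Phi_\alpha(t)=\exp\left(\alpha|t|^{\frac{N}{N-s}}\right)-\sum_{0\le j<N/s-1,\ j\in\mathbb{N}}\frac{\alpha^j}{j!}|t|^{\frac{jN}{N-s}}$ ($j=0$ included). $\alpha_{N,s}>0$ is the constant of the fractional Trudinger--Moser inequality, depending only on $N$ and $s$; the paper gives it as $\alpha_{N,s}=\frac{N}{\omega_{N-1}}\left(\frac{\Gamma((N-s)/2)}{\Gamma(s/2)2^s\pi^{N/2}}\right)^{-\frac{N}{N-s}}$,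 with $\omega_{N-1}$ the surface area of the unit sphere in $\mathbb{R}^N$. Hypotheses on $f$. $f:\mathbb{R}^N\times\mathbb{R}\to\mathbb{R}$ is continuous with $f(x,t)=0$ for $t\le0$, $x\in\mathbb{R}^N$. $(f_1)$: there are $b_1,b_2>0$ and $0<\alpha_0<\alpha_{N,s}$ with $|f(x,t)|\le b_1t^{\theta N/s-1}+b_2\Phi_{\alpha_0}(t)$ for all $x\in\mathbb{R}^N$, $t>0$. $(f_2)$: there is $\mu>\theta N/s$ such that $0<\mu F(x,t)\le f(x,t)t$ for all $x\in\mathbb{R}^N$, $t>0$, where $F(x,t)=\int_0^tf(x,\tau)d\tau$. $(f_3)$: $\limsup_{t\to0^+}\frac{F(x,t)}{t^{\theta N/s}}<\frac{s\mathscr{M}(1)}{N}\lambda_1$ uniformly in $x\in\mathbb{R}^N$. Weak solution. $u\in W_V^{s,N/s}(\mathbb{R}^N)$ is a (weak) solution if for all $\varphi\in W_V^{s,N/s}(\mathbb{R}^N)$, $M(\|u\|^{N/s})\left(\langle u,\varphi\rangle_{s,N/s}+\int_{\mathbb{R}^N}V|u|^{N/s-2}u\varphi\,dx\right)=\int_{\mathbb{R}^N}(f(x,u)+\lambda h(x)|u|^{p-2}u)\varphi\,dx$, where $\langle u,\varphi\rangle_{s,N/s}=\iint_{\mathbb{R}^{2N}}\frac{|u(x)-u(y)|^{N/s-2}(u(x)-u(y))(\varphi(x)-\varphi(y))}{|x-y|^{2N}}dxdy$. Least energy solution. Let $I_\lambda(u)=\frac{s}{N}\mathscr{M}(\|u\|^{N/s})-\int_{\mathbb{R}^N}F(x,u)dx-\frac{\lambda}{p}\int_{\mathbb{R}^N}h(x)|u^+|^pdx$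 with $u^+=\max\{u,0\}$. A least energy solution is a nontrivial critical point $u$ of $I_\lambda$ with $I_\lambda(u)\le I_\lambda(w)$ for every nontrivial critical point $w$ of $I_\lambda$.
   Formalization: The weight h is additionally assumed not to vanish almost everywhere; for h = 0 the problem does not depend on λ and nontrivial solutions stay away from 0 in norm, so the claim that the norms of u_λ tend to 0 fails. *)

theory Defs
  imports "HOL-Analysis.Analysis"
begin

text \<open>
  Throughout, \<open>\<real>\<^sup>N\<close> is \<open>real^'n\<close> with \<open>N = CARD('n)\<close>. Elements of function spaces are represented
  by Lebesgue measurable functions on \<open>\<real>\<^sup>N\<close>; equality, nonnegativity and nontriviality of such
  functions are understood almost everywhere.
\<close>

section \<open>Function spaces\<close>

primrec C_k :: "nat \<Rightarrow> (real^'n \<Rightarrow> real) \<Rightarrow> bool" where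
  "C_k 0 \<phi> \<longleftrightarrow> continuous_on UNIV \<phi>"
| "C_k (Suc k) \<phi> \<longleftrightarrow> (\<forall>x. \<phi> differentiable (at x)) \<and>
     (\<forall>i. C_k k (\<lambda>x. frechet_derivative \<phi> (at x) (axis i 1)))"

definition test_functions :: "(real^'n \<Rightarrow> real) set" where
  "test_functions = {\<phi>. (\<forall>k. C_k k \<phi>) \<and> compact (closure {x. \<phi> x \<noteq> 0})}"

text \<open>The double integral \<open>[u]\<close> to the power \<open>N/s\<close>, possibly infinite. The integrand is \<open>0\<close> on the diagonal,
  which is a null set.\<close>

definition gagliardo_energy :: "real \<Rightarrow> (real^'n \<Rightarrow> real) \<Rightarrow> ennreal" where
  "gagliardo_energy s u =
     (\<integral>\<^sup>+z. ennreal (\<bar>u (fst z) - u (snd z)\<bar> powr (real CARD('n) / s)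
                     / norm (fst z - snd z) ^ (2 * CARD('n)))
      \<partial>(lebesgue \<Otimes>\<^sub>M lebesgue))"

definition WV_energy :: "real \<Rightarrow> (real^'n \<Rightarrow> real) \<Rightarrow> (real^'n \<Rightarrow> real) \<Rightarrow> ennreal" where
  "WV_energy s V u = gagliardo_energy s u
     + (\<integral>\<^sup>+x. ennreal (V x * \<bar>u x\<bar> powr (real CARD('n) / s)) \<partial>lebesgue)"

definition WV_norm :: "real \<Rightarrow> (real^'n \<Rightarrow> real) \<Rightarrow> (real^'n \<Rightarrow> real) \<Rightarrow> real" where
  "WV_norm s V u = enn2real (WV_energy s V u) powr (s / real CARD('n))"

text \<open>
  The completion of \<open>C\<^sub>0\<^sup>\<infinity>\<close> with respect to \<open>WV_norm\<close>, realised as a space of functions: since \<open>V\<close> is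
  bounded below by a positive constant, the norm dominates the \<open>L\<close>-norm with exponent \<open>N/s\<close>, and the measurable
  functions of finite norm (modulo null sets) form a Banach space; the completion is the closure of
  \<open>C\<^sub>0\<^sup>\<infinity>\<close> in it. Finiteness of the norm need not be required separately, as it follows from
  the convergence.
\<close>

definition WV_space :: "real \<Rightarrow> (real^'n \<Rightarrow> real) \<Rightarrow> (real^'n \<Rightarrow> real) set" where
  "WV_space s V = {u \<in> borel_measurable lebesgue.
     \<exists>\<phi>. (\<forall>k::nat. \<phi> k \<in> test_functions) \<and>
         (\<lambda>k. WV_energy s V (\<lambda>x. u x - \<phi> k x)) \<longlonglongrightarrow> 0}"

definition nontrivial :: "(real^'n \<Rightarrow> real) \<Rightarrow> bool" where
  "nontrivial u \<longleftrightarrow> \<not> (AE x in lebesgue. u x = 0)"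

definition L_norm :: "real \<Rightarrow> (real^'n \<Rightarrow> real) \<Rightarrow> real" where
  "L_norm q u = (LINT x|lebesgue. \<bar>u x\<bar> powr q) powr (1 / q)"

section \<open>Constants and auxiliary functions\<close>

definition primitive :: "(real \<Rightarrow> real) \<Rightarrow> real \<Rightarrow> real" where
  "primitive g t = (LBINT \<tau>=0..ereal t. g \<tau>)"

definition lambda_1 :: "real \<Rightarrow> real \<Rightarrow> (real^'n \<Rightarrow> real) \<Rightarrow> real" where
  "lambda_1 s \<theta> V = (INF u \<in> {u \<in> WV_space s V. nontrivial u}.
     WV_norm s V u powr (\<theta> * real CARD('n) / s)
     / L_norm (\<theta> * real CARD('n) / s) u powr (\<theta> * real CARD('n) / s))"

text \<open>The \<open>j\<close>-th power is a natural power, so that the summand for \<open>j = 0\<close> is \<open>1\<close> also at \<open>t = 0\<close>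
  (whereas \<open>0 powr 0 = 0\<close>).\<close>

definition Phi :: "nat \<Rightarrow> real \<Rightarrow> real \<Rightarrow> real \<Rightarrow> real" where
  "Phi N s \<alpha> t = exp (\<alpha> * \<bar>t\<bar> powr (real N / (real N - s)))
     - (\<Sum>j | real j < real N / s - 1. \<alpha> ^ j / fact j * (\<bar>t\<bar> powr (real N / (real N - s))) ^ j)"

definition sphere_area :: "nat \<Rightarrow> real" where
  "sphere_area N = 2 * pi powr (real N / 2) / Gamma (real N / 2)"

definition alpha_TM :: "nat \<Rightarrow> real \<Rightarrow> real" where
  "alpha_TM N s = real N / sphere_area N
     * (Gamma ((real N - s) / 2) / (Gamma (s / 2) * 2 powr s * pi powr (real N / 2)))
         powr (- (real N / (real N - s)))"

section \<open>Hypotheses on \<open>V\<close>, \<open>M\<close> and \<open>f\<close>\<close>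

definition cond_V1 :: "(real^'n \<Rightarrow> real) \<Rightarrow> bool" where
  "cond_V1 V \<longleftrightarrow> continuous_on UNIV V \<and> (\<forall>x. V x > 0) \<and> (\<exists>V0>0. (INF x. V x) \<ge> V0)"

definition cond_V2 :: "(real^'n \<Rightarrow> real) \<Rightarrow> bool" where
  "cond_V2 V \<longleftrightarrow> (\<exists>r>0. \<forall>c>0.
     ((\<lambda>y. measure lebesgue {x \<in> ball y r. V x \<le> c}) \<longlongrightarrow> 0) at_infinity)"

text \<open>Only the values of \<open>M\<close> on \<open>[0,\<infinity>)\<close> are relevant.\<close>

definition kirchhoff_function :: "(real \<Rightarrow> real) \<Rightarrow> bool" where
  "kirchhoff_function M \<longleftrightarrow> continuous_on {0..} M \<and> (\<forall>t\<ge>0. M t \<ge> 0)"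

definition cond_M1 :: "(real \<Rightarrow> real) \<Rightarrow> bool" where
  "cond_M1 M \<longleftrightarrow> (\<forall>\<tau>>0. \<exists>\<kappa>>0. \<forall>t\<ge>\<tau>. M t \<ge> \<kappa>)"

definition cond_M2 :: "(real \<Rightarrow> real) \<Rightarrow> real \<Rightarrow> bool" where
  "cond_M2 M \<theta> \<longleftrightarrow> \<theta> \<ge> 1 \<and> (\<forall>t\<ge>0. t * M t \<le> \<theta> * primitive M t)"

definition nonlinearity :: "(real^'n \<Rightarrow> real \<Rightarrow> real) \<Rightarrow> bool" where
  "nonlinearity f \<longleftrightarrow> continuous_on UNIV (\<lambda>(x, t). f x t) \<and> (\<forall>x. \<forall>t\<le>0. f x t = 0)"

definition cond_f1 :: "real \<Rightarrow> real \<Rightarrow> (real^'n \<Rightarrow> real \<Rightarrow> real) \<Rightarrow> bool" where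
  "cond_f1 s \<theta> f \<longleftrightarrow> (\<exists>b1>0. \<exists>b2>0. \<exists>\<alpha>0>0. \<alpha>0 < alpha_TM CARD('n) s \<and>
     (\<forall>x. \<forall>t>0. \<bar>f x t\<bar> \<le> b1 * t powr (\<theta> * real CARD('n) / s - 1) + b2 * Phi CARD('n) s \<alpha>0 t))"

definition cond_f2 :: "real \<Rightarrow> real \<Rightarrow> (real^'n \<Rightarrow> real \<Rightarrow> real) \<Rightarrow> bool" where
  "cond_f2 s \<theta> f \<longleftrightarrow> (\<exists>\<mu> > \<theta> * real CARD('n) / s.
     \<forall>x. \<forall>t>0. 0 < \<mu> * primitive (f x) t \<and> \<mu> * primitive (f x) t \<le> f x t * t)"

text \<open>The supremum over \<open>x\<close> inside the upper limit expresses uniformity in \<open>x\<close>.\<close>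

definition cond_f3 ::
    "real \<Rightarrow> real \<Rightarrow> (real^'n \<Rightarrow> real) \<Rightarrow> (real \<Rightarrow> real) \<Rightarrow> (real^'n \<Rightarrow> real \<Rightarrow> real) \<Rightarrow> bool" where
  "cond_f3 s \<theta> V M f \<longleftrightarrow>
     Limsup (at_right 0)
       (\<lambda>t. SUP x. ereal (primitive (f x) t / t powr (\<theta> * real CARD('n) / s)))
     < ereal (s * primitive M 1 / real CARD('n) * lambda_1 s \<theta> V)"

section \<open>Weak and least energy solutions\<close>

definition pairing :: "real \<Rightarrow> (real^'n \<Rightarrow> real) \<Rightarrow> (real^'n \<Rightarrow> real) \<Rightarrow> real" where
  "pairing s u \<phi> =
     (LINT z|(lebesgue \<Otimes>\<^sub>M lebesgue).
        \<bar>u (fst z) - u (snd z)\<bar> powr (real CARD('n) / s - 2) * (u (fst z) - u (snd z))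
          * (\<phi> (fst z) - \<phi> (snd z))
        / norm (fst z - snd z) ^ (2 * CARD('n)))"

text \<open>For \<open>p < 2\<close>, \<open>\<bar>u\<bar>\<^sup>p\<^sup>-\<^sup>2 u\<close> is read as \<open>0\<close> where \<open>u = 0\<close>, which is what \<open>powr\<close> yields.\<close>

definition weak_solution ::
    "real \<Rightarrow> real \<Rightarrow> (real^'n \<Rightarrow> real) \<Rightarrow> (real \<Rightarrow> real) \<Rightarrow> (real^'n \<Rightarrow> real \<Rightarrow> real)
      \<Rightarrow> (real^'n \<Rightarrow> real) \<Rightarrow> real \<Rightarrow> (real^'n \<Rightarrow> real) \<Rightarrow> bool" where
  "weak_solution s p V M f h lam u \<longleftrightarrow> u \<in> WV_space s V \<and>
     (\<forall>\<phi> \<in> WV_space s V.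
        M (WV_norm s V u powr (real CARD('n) / s)) *
          (pairing s u \<phi>
           + (LINT x|lebesgue. V x * \<bar>u x\<bar> powr (real CARD('n) / s - 2) * u x * \<phi> x))
        = (LINT x|lebesgue. (f x (u x) + lam * h x * \<bar>u x\<bar> powr (p - 2) * u x) * \<phi> x))"

definition energy_functional ::
    "real \<Rightarrow> real \<Rightarrow> (real^'n \<Rightarrow> real) \<Rightarrow> (real \<Rightarrow> real) \<Rightarrow> (real^'n \<Rightarrow> real \<Rightarrow> real)
      \<Rightarrow> (real^'n \<Rightarrow> real) \<Rightarrow> real \<Rightarrow> (real^'n \<Rightarrow> real) \<Rightarrow> real" where
  "energy_functional s p V M f h lam u =
     s / real CARD('n) * primitive M (WV_norm s V u powr (real CARD('n) / s))
     - (LINT x|lebesgue. primitive (f x) (u x))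
     - lam / p * (LINT x|lebesgue. h x * \<bar>max (u x) 0\<bar> powr p)"

text \<open>The energy functional is Frechet differentiable at \<open>u\<close> on \<open>WV_space s V\<close>, with derivative \<open>0\<close>.\<close>

definition critical_point ::
    "real \<Rightarrow> real \<Rightarrow> (real^'n \<Rightarrow> real) \<Rightarrow> (real \<Rightarrow> real) \<Rightarrow> (real^'n \<Rightarrow> real \<Rightarrow> real)
      \<Rightarrow> (real^'n \<Rightarrow> real) \<Rightarrow> real \<Rightarrow> (real^'n \<Rightarrow> real) \<Rightarrow> bool" where
  "critical_point s p V M f h lam u \<longleftrightarrow> u \<in> WV_space s V \<and>
     (\<forall>\<epsilon>>0. \<exists>\<delta>>0. \<forall>\<phi> \<in> WV_space s V. WV_norm s V \<phi> < \<delta> \<longrightarrow>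
        \<bar>energy_functional s p V M f h lam (\<lambda>x. u x + \<phi> x) - energy_functional s p V M f h lam u\<bar>
        \<le> \<epsilon> * WV_norm s V \<phi>)"

definition least_energy_solution ::
    "real \<Rightarrow> real \<Rightarrow> (real^'n \<Rightarrow> real) \<Rightarrow> (real \<Rightarrow> real) \<Rightarrow> (real^'n \<Rightarrow> real \<Rightarrow> real)
      \<Rightarrow> (real^'n \<Rightarrow> real) \<Rightarrow> real \<Rightarrow> (real^'n \<Rightarrow> real) \<Rightarrow> bool" where
  "least_energy_solution s p V M f h lam u \<longleftrightarrow>
     nontrivial u \<and> critical_point s p V M f h lam u \<and>
     (\<forall>w. nontrivial w \<and> critical_point s p V M f h lam w \<longrightarrow>
        energy_functional s p V M f h lam u \<le> energy_functional s p V M f h lam w)"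

end

theory Submission
  imports Defs "HOL-Library.Diagonal_Subsequence" "HOL-Computational_Algebra.Polynomial"
begin

text \<open>
  Write \<open>P = N/s\<close> and \<open>\<M>\<close> for the primitive of \<open>M\<close>. The solution is a minimiser of the functional \<open>I\<close> on a small closed ball
  of the function space, and it has least energy because every competitor is forced into that ball.

  The confinement of competitors is \<open>critical_points_small\<close>. By \<open>cond_f2\<close> the primitive \<open>F\<close> is superhomogeneous of order
  \<open>\<mu> > \<theta>P\<close>. Moving a critical point \<open>w\<close> along its own ray gives \<open>\<mu> \<integral>F(x,w) \<le> \<parallel>w\<parallel>\<^sup>P M(\<parallel>w\<parallel>\<^sup>P) - \<lambda> \<integral>h (w\<^sup>+)\<^sup>p\<close>; if also
  \<open>I(w) \<le> 0\<close>, then \<open>cond_M2\<close> yields \<open>(1/P - \<theta>/\<mu>) \<M>(\<parallel>w\<parallel>\<^sup>P) \<le> \<lambda> C \<parallel>w\<parallel>\<^sup>p\<close>. Since \<open>\<M>\<close> grows at least linearly away from \<open>0\<close> and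
  \<open>p < P\<close>, such \<open>w\<close> tend to \<open>0\<close> with \<open>\<lambda>\<close>. This gives both the least energy property and the limit of the norms; it also means
  that \<open>I\<close> has to be understood on a small ball only.

  On a small ball all integrals converge by a Trudinger-Moser inequality (\<open>trudinger_moser\<close>), for which any positive exponential
  rate suffices, as a smaller radius compensates for a larger rate. It is proved with averages over dyadic
  cubes. The averages of \<open>u\<close> over the cubes shrinking to a point differ from one generation to the next by at most the mean
  oscillation on the larger cube. The \<open>P\<close>-th powers of these oscillations are summable along every such sequence of cubes, because
  \<open>P = N/s\<close> makes the Gagliardo energy scale invariant, and they are also summable over all cubes. Interpolation of the two bounds controls the \<open>r\<close>-th
  moment by \<open>C\<^sup>r r\<^sup>r\<^sup>/\<^sup>P\<^sup>'\<close> with \<open>P' = P/(P-1)\<close>, which the factorials in the exponential series absorb.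

  The averages also give compactness (\<open>compact_embedding\<close>): they approximate \<open>u\<close> in \<open>L\<^sup>P\<close> at a rate given by the energy,
  they have small mass far out by \<open>cond_V2\<close>, and on a bounded set they range over finitely many values, so that a
  diagonal subsequence converges.

  On a ball of small radius \<open>\<rho>\<close> a minimiser exists (\<open>minimiser_exists\<close>). Along a minimising sequence the lower order terms converge,
  the energy is lower semicontinuous by Fatou's lemma, and the limit stays in the completion of the test functions, because
  \<open>L\<^sup>P\<close> limits of sequences of bounded energy do (\<open>WV_weakly_closed\<close>, from Clarkson's inequality). The
  concave term makes the minimum negative (\<open>I_negative\<close>), while \<open>cond_f3\<close> and \<open>cond_M2\<close> make \<open>I\<close> positive on the sphere
  (\<open>sphere_positive\<close>). Hence the minimiser lies in the open ball; replacing it by its modulus does not increase \<open>I\<close>. As \<open>I\<close> is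
  Frechet differentiable at nonzero points of the open ball (\<open>I_frechet\<close>), it is a critical point and a weak solution.
\<close>

lemma abs_add_powr_le:
  fixes a b q :: real
  assumes "0 \<le> q"
  shows "\<bar>a + b\<bar> powr q \<le> 2 powr q * (\<bar>a\<bar> powr q + \<bar>b\<bar> powr q)"
proof -
  have "\<bar>a + b\<bar> powr q \<le> (2 * max \<bar>a\<bar> \<bar>b\<bar>) powr q"
    by (intro powr_mono2) (use assms in auto)
  also have "\<dots> = 2 powr q * max \<bar>a\<bar> \<bar>b\<bar> powr q"
    by (simp add: powr_mult)
  also have "max \<bar>a\<bar> \<bar>b\<bar> powr q \<le> \<bar>a\<bar> powr q + \<bar>b\<bar> powr q"
    by (auto simp: max_def)
  finally show ?thesis by (simp add: mult_left_mono)
qed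

lemma convex_powr_nonneg:
  fixes q :: real
  assumes "1 \<le> q" "0 \<le> a" "0 \<le> b" "0 \<le> t" "t \<le> 1"
  shows "((1 - t) * a + t * b) powr q \<le> (1 - t) * a powr q + t * b powr q"
proof (cases "a = 0 \<or> b = 0 \<or> t = 0 \<or> t = 1")
  case True
  have *: "c powr q \<le> c" if "0 \<le> c" "c \<le> 1" for c :: real
    using powr_mono'[of 1 q c] that assms(1) by (cases "c = 0") auto
  from True show ?thesis
  proof (elim disjE)
    assume "a = 0"
    then show ?thesis using *[of t] assms
      by (auto simp: powr_mult intro!: mult_right_mono)
  next
    assume "b = 0"
    then show ?thesis using *[of "1 - t"] assms
      by (auto simp: powr_mult intro!: mult_right_mono)
  qed (use assms in auto)
next
  case False
  then have "0 < a" "0 < b" using assms by auto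
  with convex_onD[OF powr_convex[OF assms(1)] assms(4,5), of a b]
  show ?thesis by simp
qed

lemma convex_abs_powr:
  fixes q :: real
  assumes "1 \<le> q" "0 \<le> t" "t \<le> 1"
  shows "\<bar>(1 - t) * a + t * b\<bar> powr q \<le> (1 - t) * \<bar>a\<bar> powr q + t * \<bar>b\<bar> powr q"
proof -
  have "\<bar>(1 - t) * a + t * b\<bar> \<le> (1 - t) * \<bar>a\<bar> + t * \<bar>b\<bar>"
    using assms abs_triangle_ineq[of "(1 - t) * a" "t * b"] by (simp add: abs_mult)
  then have "\<bar>(1 - t) * a + t * b\<bar> powr q \<le> ((1 - t) * \<bar>a\<bar> + t * \<bar>b\<bar>) powr q"
    by (intro powr_mono2) (use assms in auto)
  also have "\<dots> \<le> (1 - t) * \<bar>a\<bar> powr q + t * \<bar>b\<bar> powr q"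
    using convex_powr_nonneg[of q "\<bar>a\<bar>" "\<bar>b\<bar>" t] assms by simp
  finally show ?thesis .
qed

lemma superadditive_powr:
  fixes q :: real
  assumes "1 \<le> q" "0 \<le> x" "0 \<le> y"
  shows "x powr q + y powr q \<le> (x + y) powr q"
proof (cases "x + y = 0")
  case True
  then have "x = 0" "y = 0" using assms by auto
  then show ?thesis by simp
next
  case False
  then have pos: "0 < x + y" using assms by simp
  have *: "c powr q \<le> c" if "0 \<le> c" "c \<le> 1" for c :: real
    using powr_mono'[of 1 q c] that assms(1) by (cases "c = 0") auto
  have "(x / (x + y)) powr q + (y / (x + y)) powr q \<le> x / (x + y) + y / (x + y)"
    by (intro add_mono *) (use assms pos in auto)
  also have "\<dots> = 1" using pos by (simp flip: add_divide_distrib)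
  finally have "(x powr q + y powr q) / (x + y) powr q \<le> 1"
    using assms pos by (simp add: powr_divide add_divide_distrib)
  then show ?thesis using pos by (simp add: divide_simps)
qed

text \<open>
  By superadditivity of \<open>t\<^sup>q\<^sup>/\<^sup>2\<close> the left-hand side is at most \<open>(((a+b)/2)\<^sup>2 + ((a-b)/2)\<^sup>2)\<^sup>q\<^sup>/\<^sup>2\<close>; the parallelogram identity and
  convexity of the same power conclude.
\<close>

lemma clarkson_real:
  fixes q :: real
  assumes "2 \<le> q"
  shows "\<bar>(a + b) / 2\<bar> powr q + \<bar>(a - b) / 2\<bar> powr q \<le> (\<bar>a\<bar> powr q + \<bar>b\<bar> powr q) / 2"
proof -
  have sq: "(c\<^sup>2) powr (q / 2) = \<bar>c\<bar> powr q" for c :: real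
  proof -
    have "(c\<^sup>2) powr (q / 2) = (\<bar>c\<bar> powr 2) powr (q / 2)" by (simp add: powr_numeral)
    then show ?thesis by (simp only: powr_powr) simp
  qed
  have "\<bar>(a + b) / 2\<bar> powr q + \<bar>(a - b) / 2\<bar> powr q
      = (((a + b) / 2)\<^sup>2) powr (q / 2) + (((a - b) / 2)\<^sup>2) powr (q / 2)"
    by (simp only: sq)
  also have "\<dots> \<le> (((a + b) / 2)\<^sup>2 + ((a - b) / 2)\<^sup>2) powr (q / 2)"
    by (intro superadditive_powr) (use assms in auto)
  also have "((a + b) / 2)\<^sup>2 + ((a - b) / 2)\<^sup>2 = (1 - 1 / 2) * a\<^sup>2 + 1 / 2 * b\<^sup>2"
    by (simp add: field_simps power2_eq_square)
  also have "\<dots> powr (q / 2) \<le> (1 - 1 / 2) * (a\<^sup>2) powr (q / 2) + 1 / 2 * (b\<^sup>2) powr (q / 2)"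
    by (intro convex_powr_nonneg) (use assms in auto)
  finally show ?thesis by (simp only: sq) (simp add: field_simps)
qed

lemma has_real_derivative_abs_powr:
  fixes q :: real
  assumes "1 < q"
  shows "((\<lambda>t. \<bar>t\<bar> powr q) has_real_derivative q * (\<bar>x\<bar> powr (q - 2) * x)) (at x)"
proof -
  consider "x > 0" | "x < 0" | "x = 0" by linarith
  then show ?thesis
  proof cases
    case 1
    have "((\<lambda>t. t powr q) has_real_derivative q * x powr (q - 1)) (at x)"
      using 1 by (rule has_real_derivative_powr)
    moreover have "x powr (q - 1) = \<bar>x\<bar> powr (q - 2) * x"
      using 1 powr_mult_base[of x "q - 2"] by (simp add: mult.commute)
    moreover have "\<forall>\<^sub>F t in nhds x. \<bar>t\<bar> powr q = t powr q"
      using eventually_nhds_in_open[of "{0<..}" x] 1 by (auto elim: eventually_mono)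
    ultimately show ?thesis by (simp add: DERIV_cong_ev)
  next
    case 2
    have "((\<lambda>t. (-t) powr q) has_real_derivative - (q * (-x) powr (q - 1))) (at x)"
      using 2 by (auto intro!: derivative_eq_intros)
    moreover have "(-x) powr (q - 1) = \<bar>x\<bar> powr (q - 2) * (-x)"
      using 2 powr_mult_base[of "-x" "q - 2"] by (simp add: mult.commute)
    moreover have "\<forall>\<^sub>F t in nhds x. \<bar>t\<bar> powr q = (-t) powr q"
      using eventually_nhds_in_open[of "{..<0}" x] 2 by (auto elim: eventually_mono)
    ultimately show ?thesis by (simp add: DERIV_cong_ev)
  next
    case 3
    have "((\<lambda>h. \<bar>h\<bar> powr (q - 1)) \<longlongrightarrow> 0) (at 0)"
      by (rule tendsto_eq_intros | use assms in \<open>auto intro!: always_eventually\<close>)+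
    then have "((\<lambda>h. \<bar>h\<bar> powr q / h) \<longlongrightarrow> 0) (at 0)"
    proof (rule Lim_null_comparison[rotated])
      show "\<forall>\<^sub>F h in at 0. norm (\<bar>h\<bar> powr q / h) \<le> \<bar>h\<bar> powr (q - 1)"
        by (intro always_eventually allI) (auto simp: powr_diff)
    qed
    then show ?thesis using 3 by (simp add: DERIV_def)
  qed
qed

lemma conjugate_exponent_gt_1:
  fixes q :: real
  assumes "1 < q" "q' = q / (q - 1)"
  shows "1 < q'"
  unfolding assms(2) using assms(1) by (simp add: less_divide_eq)

lemma young_powr_scaled:
  fixes q q' \<delta> a b :: real
  assumes "1 < q" "q' = q / (q - 1)" "0 < \<delta>" "0 \<le> a" "0 \<le> b"
  shows "a * b \<le> (\<delta> * a) powr q + (b / \<delta>) powr q'"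
proof -
  have q': "1 < q'" using assms(1,2) by (rule conjugate_exponent_gt_1)
  have "a * b = (\<delta> * a) * (b / \<delta>)" using assms by simp
  also have "\<dots> \<le> (\<delta> * a) powr q / q + (b / \<delta>) powr q' / q'"
    by (rule Youngs_inequality) (use assms q' in \<open>auto simp: field_simps\<close>)
  also have "\<dots> \<le> (\<delta> * a) powr q + (b / \<delta>) powr q'"
    using assms(1) q' by (intro add_mono) (auto simp: divide_le_eq mult_le_cancel_left1)
  finally show ?thesis .
qed

text \<open>
  Pairing of \<open>L\<^sup>q\<close> with \<open>L\<^sup>q\<^sup>'\<close>; the free scale \<open>\<delta>\<close> takes the role of the optimisation that turns Young's
  inequality into Hoelder's.
\<close>

lemma integrable_mult_conjugate:
  fixes a b :: "'a \<Rightarrow> real"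
  assumes q: "1 < q" "q' = q / (q - 1)" and \<delta>: "0 < \<delta>"
    and [measurable]: "a \<in> borel_measurable M" "b \<in> borel_measurable M"
    and a: "integrable M (\<lambda>x. \<bar>a x\<bar> powr q)" and b: "integrable M (\<lambda>x. \<bar>b x\<bar> powr q')"
  shows "integrable M (\<lambda>x. a x * b x)"
    and "(LINT x|M. \<bar>a x * b x\<bar>)
      \<le> \<delta> powr q * (LINT x|M. \<bar>a x\<bar> powr q) + (1 / \<delta>) powr q' * (LINT x|M. \<bar>b x\<bar> powr q')"
proof -
  have *: "\<bar>a x * b x\<bar> \<le> \<delta> powr q * \<bar>a x\<bar> powr q + (1 / \<delta>) powr q' * \<bar>b x\<bar> powr q'" for x
    using young_powr_scaled[OF q \<delta>, of "\<bar>a x\<bar>" "\<bar>b x\<bar>"] \<delta>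
    by (simp add: abs_mult powr_mult powr_divide)
  have int: "integrable M (\<lambda>x. \<delta> powr q * \<bar>a x\<bar> powr q + (1 / \<delta>) powr q' * \<bar>b x\<bar> powr q')"
    using a b by simp
  show ab: "integrable M (\<lambda>x. a x * b x)"
    by (rule Bochner_Integration.integrable_bound[OF int]) (use * in \<open>auto intro!: AE_I2\<close>)
  have "(LINT x|M. \<bar>a x * b x\<bar>) \<le> (LINT x|M. \<delta> powr q * \<bar>a x\<bar> powr q + (1 / \<delta>) powr q' * \<bar>b x\<bar> powr q')"
    by (intro integral_mono int integrable_abs ab *)
  also have "\<dots> = \<delta> powr q * (LINT x|M. \<bar>a x\<bar> powr q) + (1 / \<delta>) powr q' * (LINT x|M. \<bar>b x\<bar> powr q')"
    using a b by simp
  finally show "(LINT x|M. \<bar>a x * b x\<bar>)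
      \<le> \<delta> powr q * (LINT x|M. \<bar>a x\<bar> powr q) + (1 / \<delta>) powr q' * (LINT x|M. \<bar>b x\<bar> powr q')" .
qed

text \<open>
  The scale in the pairing estimate is first chosen large, which makes the bounded factor cheap, and then the other factor is sent to \<open>0\<close>.
\<close>

lemma tendsto_integral_mult_conjugate:
  fixes a b :: "nat \<Rightarrow> 'a \<Rightarrow> real"
  assumes q: "1 < q" "q' = q / (q - 1)"
    and m: "\<And>n. a n \<in> borel_measurable M" "\<And>n. b n \<in> borel_measurable M"
    and a: "\<And>n. integrable M (\<lambda>x. \<bar>a n x\<bar> powr q)" and b: "\<And>n. integrable M (\<lambda>x. \<bar>b n x\<bar> powr q')"
    and a0: "(\<lambda>n. LINT x|M. \<bar>a n x\<bar> powr q) \<longlonglongrightarrow> 0"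
    and bK: "\<And>n. (LINT x|M. \<bar>b n x\<bar> powr q') \<le> K"
  shows "(\<lambda>n. LINT x|M. \<bar>a n x * b n x\<bar>) \<longlonglongrightarrow> 0"
proof (rule LIMSEQ_I)
  fix e :: real assume e: "0 < e"
  have "K \<ge> 0" using order_trans[OF _ bK[of 0]] by (simp add: integral_nonneg_AE)
  have q': "1 < q'" using q by (rule conjugate_exponent_gt_1)
  define \<delta> where "\<delta> = ((2 * (K + 1)) / e) powr (1 / q')"
  have \<delta>: "0 < \<delta>" using e \<open>K \<ge> 0\<close> by (simp add: \<delta>_def)
  have "\<delta> powr q' = (2 * (K + 1)) / e" using e \<open>K \<ge> 0\<close> q' by (simp add: \<delta>_def powr_powr)
  then have "(1 / \<delta>) powr q' = e / (2 * (K + 1))" using \<delta> by (simp add: powr_divide)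
  moreover have "e / (2 * (K + 1)) * K < e / 2" using e \<open>K \<ge> 0\<close> by (simp add: field_simps)
  ultimately have K: "(1 / \<delta>) powr q' * K < e / 2" by simp
  have "(\<lambda>n. \<delta> powr q * (LINT x|M. \<bar>a n x\<bar> powr q)) \<longlonglongrightarrow> \<delta> powr q * 0"
    by (intro tendsto_intros a0)
  then have "\<forall>\<^sub>F n in sequentially. \<delta> powr q * (LINT x|M. \<bar>a n x\<bar> powr q) < e / 2"
    using e by (intro order_tendstoD) auto
  then obtain n0 where n0: "\<And>n. n \<ge> n0 \<Longrightarrow> \<delta> powr q * (LINT x|M. \<bar>a n x\<bar> powr q) < e / 2"
    by (auto simp: eventually_sequentially)
  have "norm ((LINT x|M. \<bar>a n x * b n x\<bar>) - 0) < e" if "n \<ge> n0" for n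
  proof -
    have "(LINT x|M. \<bar>a n x * b n x\<bar>)
      \<le> \<delta> powr q * (LINT x|M. \<bar>a n x\<bar> powr q) + (1 / \<delta>) powr q' * (LINT x|M. \<bar>b n x\<bar> powr q')"
      by (rule integrable_mult_conjugate(2)[OF q \<delta> m a b])
    also have "\<dots> \<le> \<delta> powr q * (LINT x|M. \<bar>a n x\<bar> powr q) + (1 / \<delta>) powr q' * K"
      by (intro add_mono mult_left_mono bK) auto
    also have "\<dots> < e" using n0[OF that] K by simp
    finally show ?thesis by (simp add: integral_nonneg_AE)
  qed
  then show "\<exists>n0. \<forall>n\<ge>n0. norm ((LINT x|M. \<bar>a n x * b n x\<bar>) - 0) < e" by blast
qed


text \<open>
  Remainder estimates for integral functionals \<open>u \<mapsto> \<integral> F x (u x)\<close>: pointwise differentiability of \<open>F x\<close> and a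
  growth bound of order \<open>L\<^sup>q\<^sup>'\<close> on the difference quotient give a remainder that is small compared with
  any quantity \<open>r\<close> controlling the \<open>L\<^sup>q\<close> size of the increment. Only the part \<open>A\<close> of the bound needs
  dominated convergence; the part \<open>B\<close> depends on the increment alone and tends to \<open>0\<close> by itself.
\<close>

lemma nemytskii_remainder:
  fixes \<phi> :: "'i \<Rightarrow> 'a \<Rightarrow> real" and r :: "'i \<Rightarrow> real"
    and F f :: "'a \<Rightarrow> real \<Rightarrow> real" and u A :: "'a \<Rightarrow> real" and B :: "real \<Rightarrow> real"
  assumes q: "1 < q" "q' = q / (q - 1)"
    and deriv: "\<And>x. (F x has_real_derivative f x (u x)) (at (u x))"
    and bound: "\<And>x t. \<bar>F x (u x + t) - F x (u x) - f x (u x) * t\<bar> \<le> \<bar>t\<bar> * (A x + B \<bar>t\<bar>)"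
    and nn: "\<And>x. 0 \<le> A x" "\<And>t. 0 \<le> t \<Longrightarrow> 0 \<le> B t"
    and [measurable]: "A \<in> borel_measurable M" "B \<in> borel_measurable borel"
    and m: "\<And>i. i \<in> I \<Longrightarrow> \<phi> i \<in> borel_measurable M"
      "\<And>i. i \<in> I \<Longrightarrow> (\<lambda>x. F x (u x + \<phi> i x) - F x (u x) - f x (u x) * \<phi> i x) \<in> borel_measurable M"
    and A: "integrable M (\<lambda>x. A x powr q')"
    and B: "\<And>i. i \<in> I \<Longrightarrow> r i \<le> \<rho> \<Longrightarrow> integrable M (\<lambda>x. B \<bar>\<phi> i x\<bar> powr q')"
      "\<And>i. i \<in> I \<Longrightarrow> r i \<le> \<rho> \<Longrightarrow> (LINT x|M. B \<bar>\<phi> i x\<bar> powr q') \<le> C * r i powr q"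
    and \<phi>: "\<And>i. i \<in> I \<Longrightarrow> integrable M (\<lambda>x. \<bar>\<phi> i x\<bar> powr q)"
      "\<And>i. i \<in> I \<Longrightarrow> (LINT x|M. \<bar>\<phi> i x\<bar> powr q) \<le> C * r i powr q"
    and r: "\<And>i. i \<in> I \<Longrightarrow> 0 \<le> r i" "0 < \<rho>" and C: "0 < C" and e: "0 < e"
  shows "\<exists>\<delta>>0. \<forall>i\<in>I. r i < \<delta> \<longrightarrow>
    integrable M (\<lambda>x. F x (u x + \<phi> i x) - F x (u x) - f x (u x) * \<phi> i x) \<and>
    (LINT x|M. \<bar>F x (u x + \<phi> i x) - F x (u x) - f x (u x) * \<phi> i x\<bar>) \<le> e * r i"
proof (rule ccontr)
  define R where "R i x = F x (u x + \<phi> i x) - F x (u x) - f x (u x) * \<phi> i x" for i x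
  define D where "D i x = R i x / \<phi> i x" for i x
  have q': "1 < q'" using q by (rule conjugate_exponent_gt_1)
  have mR: "R i \<in> borel_measurable M" if "i \<in> I" for i
    using m(2)[OF that] by (simp add: R_def[abs_def])
  have mD: "D i \<in> borel_measurable M" if "i \<in> I" for i
    using m(1)[OF that] mR[OF that] by (simp add: D_def[abs_def])
  have R_eq: "R i x = \<phi> i x * D i x" for i x
    by (simp add: D_def R_def)
  have D_le: "\<bar>D i x\<bar> \<le> A x + B \<bar>\<phi> i x\<bar>" for i x
  proof (cases "\<phi> i x = 0")
    case True
    then show ?thesis using nn(1)[of x] nn(2)[of 0] by (simp add: D_def)
  next
    case False
    then show ?thesis using bound[of x "\<phi> i x"]
      by (simp add: D_def R_def divide_le_eq abs_divide mult.commute)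
  qed
  have Dq: "\<bar>D i x\<bar> powr q' \<le> 2 powr q' * A x powr q' + 2 powr q' * B \<bar>\<phi> i x\<bar> powr q'" for i x
  proof -
    have "\<bar>D i x\<bar> powr q' \<le> \<bar>A x + B \<bar>\<phi> i x\<bar>\<bar> powr q'"
      using D_le[of i x] q' by (intro powr_mono2) auto
    also have "\<dots> \<le> 2 powr q' * (\<bar>A x\<bar> powr q' + \<bar>B \<bar>\<phi> i x\<bar>\<bar> powr q')"
      by (rule abs_add_powr_le) (use q' in simp)
    finally show ?thesis using nn by (simp add: algebra_simps)
  qed
  have Dint: "integrable M (\<lambda>x. \<bar>D i x\<bar> powr q')" if i: "i \<in> I" "r i \<le> \<rho>" for i
  proof (rule Bochner_Integration.integrable_bound)
    show "integrable M (\<lambda>x. 2 powr q' * A x powr q' + 2 powr q' * B \<bar>\<phi> i x\<bar> powr q')"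
      using A B(1)[OF i] by simp
    show "(\<lambda>x. \<bar>D i x\<bar> powr q') \<in> borel_measurable M"
      using mD[OF i(1)] by measurable
    show "AE x in M. norm (\<bar>D i x\<bar> powr q') \<le> norm (2 powr q' * A x powr q' + 2 powr q' * B \<bar>\<phi> i x\<bar> powr q')"
      using Dq by (auto intro!: AE_I2 order_trans[OF Dq])
  qed
  have Rint: "integrable M (R i)" if i: "i \<in> I" "r i \<le> \<rho>" for i
    using integrable_mult_conjugate(1)[OF q zero_less_one m(1)[OF i(1)] mD[OF i(1)] \<phi>(1)[OF i(1)] Dint[OF i]]
    by (simp add: R_eq[abs_def])
  assume "\<not> ?thesis"
  then have neg: "\<not> (\<exists>\<delta>>0. \<forall>i\<in>I. r i < \<delta> \<longrightarrow> integrable M (R i) \<and> (LINT x|M. \<bar>R i x\<bar>) \<le> e * r i)"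
    by (simp add: R_def[abs_def])
  have "\<exists>i\<in>I. r i < inverse (Suc n) \<and> r i \<le> \<rho> \<and> (LINT x|M. \<bar>R i x\<bar>) > e * r i" for n :: nat
  proof -
    have "\<not> (\<forall>i\<in>I. r i < min \<rho> (inverse (Suc n)) \<longrightarrow> integrable M (R i) \<and> (LINT x|M. \<bar>R i x\<bar>) \<le> e * r i)"
      using neg r(2) by (metis inverse_positive_iff_positive min_less_iff_conj of_nat_0_less_iff zero_less_Suc)
    then show ?thesis using Rint by (auto simp: not_le)
  qed
  then obtain j where j: "\<And>n. j n \<in> I" "\<And>n. r (j n) < inverse (Suc n)" "\<And>n. r (j n) \<le> \<rho>"
      "\<And>n. (LINT x|M. \<bar>R (j n) x\<bar>) > e * r (j n)"
    by metis
  have rpos: "0 < r (j n)" for n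
  proof (rule ccontr)
    assume "\<not> 0 < r (j n)"
    then have rj0: "r (j n) = 0" using r(1)[OF j(1)[of n]] by simp
    then have "(LINT x|M. \<bar>\<phi> (j n) x\<bar> powr q) = 0"
      using \<phi>(2)[OF j(1)[of n]] q by (intro antisym) (auto simp: integral_nonneg_AE)
    then have "AE x in M. \<bar>\<phi> (j n) x\<bar> powr q = 0"
      using integral_nonneg_eq_0_iff_AE[OF \<phi>(1)[OF j(1)[of n]]] by simp
    then have "AE x in M. \<bar>R (j n) x\<bar> = 0" by eventually_elim (simp add: R_eq)
    then have "(LINT x|M. \<bar>R (j n) x\<bar>) = (LINT x|M. 0)"
      by (intro integral_cong_AE) (use mR[OF j(1)] in auto)
    then show False using j(4)[of n] rj0 by simp
  qed
  have r_lim: "(\<lambda>n. r (j n)) \<longlonglongrightarrow> 0"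
    by (rule tendsto_sandwich[OF _ _ tendsto_const LIMSEQ_inverse_real_of_nat])
      (use rpos j(2) in \<open>auto intro!: always_eventually less_imp_le\<close>)
  then have rq_lim: "(\<lambda>n. C * r (j n) powr q) \<longlonglongrightarrow> 0"
    using q by (auto intro!: tendsto_eq_intros always_eventually rpos less_imp_le)
  have "(\<lambda>n. LINT x|M. norm (\<bar>\<phi> (j n) x\<bar> powr q)) \<longlonglongrightarrow> 0"
    by (rule tendsto_sandwich[OF _ _ tendsto_const rq_lim])
      (use \<phi>(2)[OF j(1)] in \<open>auto intro!: always_eventually\<close>)
  then obtain \<sigma> where \<sigma>: "strict_mono \<sigma>" "AE x in M. (\<lambda>n. \<bar>\<phi> (j (\<sigma> n)) x\<bar> powr q) \<longlonglongrightarrow> 0"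
    using tendsto_L1_AE_subseq[of M "\<lambda>n x. \<bar>\<phi> (j n) x\<bar> powr q"] \<phi>(1)[OF j(1)] by auto
  have \<phi>_lim: "AE x in M. (\<lambda>n. \<phi> (j (\<sigma> n)) x) \<longlonglongrightarrow> 0"
    using \<sigma>(2)
  proof eventually_elim
    case (elim x)
    have "(\<lambda>n. (\<bar>\<phi> (j (\<sigma> n)) x\<bar> powr q) powr (1 / q)) \<longlonglongrightarrow> 0 powr (1 / q)"
      using q by (intro tendsto_powr' elim tendsto_const) auto
    then have "(\<lambda>n. \<bar>\<phi> (j (\<sigma> n)) x\<bar>) \<longlonglongrightarrow> 0"
      using q by (simp add: powr_powr)
    then show ?case by (simp add: tendsto_rabs_zero_iff)
  qed
  have D_lim: "AE x in M. (\<lambda>n. D (j (\<sigma> n)) x) \<longlonglongrightarrow> 0"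
    using \<phi>_lim
  proof eventually_elim
    case (elim x)
    define Q where "Q t = (if t = 0 then 0 else (F x (u x + t) - F x (u x)) / t - f x (u x))" for t
    have "((\<lambda>t. (F x (u x + t) - F x (u x)) / t - f x (u x)) \<longlongrightarrow> f x (u x) - f x (u x)) (at 0)"
      using deriv[of x] unfolding DERIV_def by (intro tendsto_intros)
    then have "(Q \<longlongrightarrow> Q 0) (at 0)"
      by (subst Lim_cong_within[where g = "\<lambda>t. (F x (u x + t) - F x (u x)) / t - f x (u x)" and b = 0 and y = 0 and T = UNIV])
        (auto simp: Q_def)
    then have "isCont Q 0" by (simp add: isCont_def)
    then have "(\<lambda>n. Q (\<phi> (j (\<sigma> n)) x)) \<longlonglongrightarrow> Q 0"
      using elim by (rule isCont_tendsto_compose)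
    moreover have "Q (\<phi> (j (\<sigma> n)) x) = D (j (\<sigma> n)) x" for n
      by (simp add: Q_def D_def R_def field_simps)
    ultimately show ?case by (simp add: Q_def)
  qed
  define H where "H n x = max (\<bar>D (j (\<sigma> n)) x\<bar> powr q' - 2 powr q' * B \<bar>\<phi> (j (\<sigma> n)) x\<bar> powr q') 0" for n x
  note mjs = mD[OF j(1)] m(1)[OF j(1)]
  have mH: "H n \<in> borel_measurable M" for n
    unfolding H_def[abs_def] using mjs by measurable
  have H_le: "H n x \<le> 2 powr q' * A x powr q'" "0 \<le> H n x" for n x
    using Dq[of "j (\<sigma> n)" x] nn(1)[of x] by (auto simp: H_def max_def)
  have "(\<lambda>n. LINT x|M. H n x) \<longlonglongrightarrow> (LINT x|M. 0)"
  proof (rule integral_dominated_convergence[where w = "\<lambda>x. 2 powr q' * A x powr q'"])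
    show "AE x in M. (\<lambda>n. H n x) \<longlonglongrightarrow> 0"
      using D_lim
    proof eventually_elim
      case (elim x)
      have *: "(\<lambda>n. \<bar>D (j (\<sigma> n)) x\<bar> powr q') \<longlonglongrightarrow> 0"
        using elim q' by (auto intro!: tendsto_eq_intros always_eventually)
      show ?case
        by (rule tendsto_sandwich[OF _ _ tendsto_const *]) (auto simp: H_def intro!: always_eventually)
    qed
  qed (use mH A H_le in \<open>auto intro!: AE_I2\<close>)
  then have H_lim: "(\<lambda>n. LINT x|M. H n x) \<longlonglongrightarrow> 0" by simp
  have Hint: "integrable M (H n)" for n
    by (rule Bochner_Integration.integrable_bound[of M "\<lambda>x. 2 powr q' * A x powr q'"])
      (use A mH H_le in \<open>auto intro!: AE_I2\<close>)
  define d where "d n = (LINT x|M. \<bar>D (j (\<sigma> n)) x\<bar> powr q')" for n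
  have "d n \<le> (LINT x|M. H n x) + 2 powr q' * (C * r (j (\<sigma> n)) powr q)" for n
  proof -
    have "d n \<le> (LINT x|M. H n x + 2 powr q' * B \<bar>\<phi> (j (\<sigma> n)) x\<bar> powr q')"
      unfolding d_def using Hint[of n] B(1)[OF j(1,3)] Dint[OF j(1,3)]
      by (intro integral_mono) (auto simp: H_def)
    also have "\<dots> = (LINT x|M. H n x) + 2 powr q' * (LINT x|M. B \<bar>\<phi> (j (\<sigma> n)) x\<bar> powr q')"
      using Hint[of n] B(1)[OF j(1,3)] by simp
    also have "\<dots> \<le> (LINT x|M. H n x) + 2 powr q' * (C * r (j (\<sigma> n)) powr q)"
      by (intro add_left_mono mult_left_mono B(2) j) auto
    finally show ?thesis .
  qed
  moreover have "(\<lambda>n. (LINT x|M. H n x) + 2 powr q' * (C * r (j (\<sigma> n)) powr q)) \<longlonglongrightarrow> 0 + 2 powr q' * 0"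
    using LIMSEQ_subseq_LIMSEQ[OF rq_lim \<sigma>(1)] by (intro tendsto_intros H_lim) (simp add: o_def)
  ultimately have d_lim: "d \<longlonglongrightarrow> 0"
    by (intro tendsto_sandwich[of "\<lambda>_. 0" d sequentially _ 0])
      (auto intro!: always_eventually simp: d_def integral_nonneg_AE)
  \<comment> \<open>The scale is chosen so that the \<open>L\<^sup>q\<close> part of Young's inequality accounts for half of \<open>e\<close>.\<close>
  define \<delta> where "\<delta> = (e / (2 * C)) powr (1 / q)"
  have \<delta>: "0 < \<delta>" using e C by (simp add: \<delta>_def)
  have \<delta>q: "\<delta> powr q = e / (2 * C)" using e C q by (simp add: \<delta>_def powr_powr)
  have "(\<lambda>n. (1 / \<delta>) powr q' * d n) \<longlonglongrightarrow> (1 / \<delta>) powr q' * 0"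
    by (intro tendsto_intros d_lim)
  then have "\<forall>\<^sub>F n in sequentially. (1 / \<delta>) powr q' * d n < e / 2"
    using e by (intro order_tendstoD) auto
  then obtain n where n: "(1 / \<delta>) powr q' * d n < e / 2"
    by (auto simp: eventually_sequentially)
  define i where "i = j (\<sigma> n)"
  have i: "i \<in> I" "r i \<le> \<rho>" "0 < r i" using j rpos by (auto simp: i_def)
  have sc: "\<bar>\<phi> i x / r i\<bar> powr q = \<bar>\<phi> i x\<bar> powr q / r i powr q" for x
    using i by (simp add: powr_divide)
  have "(LINT x|M. \<bar>\<phi> i x / r i * D i x\<bar>)
      \<le> \<delta> powr q * (LINT x|M. \<bar>\<phi> i x / r i\<bar> powr q) + (1 / \<delta>) powr q' * (LINT x|M. \<bar>D i x\<bar> powr q')"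
    by (rule integrable_mult_conjugate(2)[OF q \<delta>])
      (use m(1)[OF i(1)] mD[OF i(1)] \<phi>(1)[OF i(1)] Dint[OF i(1,2)] in \<open>auto simp: powr_divide\<close>)
  also have "(LINT x|M. \<bar>\<phi> i x / r i\<bar> powr q) = (LINT x|M. \<bar>\<phi> i x\<bar> powr q) / r i powr q"
    by (simp only: sc integral_divide_zero)
  also have "\<dots> \<le> C"
    using \<phi>(2)[OF i(1)] i by (simp add: divide_le_eq)
  also have "(LINT x|M. \<bar>D i x\<bar> powr q') = d n" by (simp add: i_def d_def)
  finally have "(LINT x|M. \<bar>\<phi> i x / r i * D i x\<bar>) \<le> \<delta> powr q * C + (1 / \<delta>) powr q' * d n"
    by (simp add: mult_left_mono)
  also have "\<dots> < e" using n C by (simp add: \<delta>q)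
  also have "(\<lambda>x. \<bar>\<phi> i x / r i * D i x\<bar>) = (\<lambda>x. \<bar>R i x\<bar> / r i)"
    using i by (simp add: R_eq abs_mult)
  finally have "(LINT x|M. \<bar>R i x\<bar>) < e * r i" using i by (simp add: divide_less_eq)
  then show False using j(4)[of "\<sigma> n"] by (simp add: i_def)
qed

section \<open>The energy of the function space\<close>

definition lp_energy :: "'a measure \<Rightarrow> real \<Rightarrow> ('a \<Rightarrow> real) \<Rightarrow> ennreal" where
  "lp_energy M q a = (\<integral>\<^sup>+x. ennreal (\<bar>a x\<bar> powr q) \<partial>M)"

lemma lp_energy_mono_AE:
  assumes "AE x in M. \<bar>a x\<bar> \<le> \<bar>b x\<bar>" "0 \<le> q"
  shows "lp_energy M q a \<le> lp_energy M q b"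
  unfolding lp_energy_def
  by (intro nn_integral_mono_AE, use assms(1) in eventually_elim)
    (auto intro!: ennreal_leI powr_mono2 assms(2))

lemma lp_energy_scale:
  assumes [measurable]: "a \<in> borel_measurable M"
  shows "lp_energy M q (\<lambda>x. c * a x) = ennreal (\<bar>c\<bar> powr q) * lp_energy M q a"
  unfolding lp_energy_def
  by (subst nn_integral_cmult[symmetric]) (auto simp: abs_mult powr_mult ennreal_mult)

lemma lp_energy_convex:
  assumes [measurable]: "a \<in> borel_measurable M" "b \<in> borel_measurable M"
    and "1 \<le> q" "0 \<le> t" "t \<le> 1"
  shows "lp_energy M q (\<lambda>x. (1 - t) * a x + t * b x)
    \<le> ennreal (1 - t) * lp_energy M q a + ennreal t * lp_energy M q b"
proof -
  have "lp_energy M q (\<lambda>x. (1 - t) * a x + t * b x)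
      \<le> (\<integral>\<^sup>+x. ennreal (1 - t) * ennreal (\<bar>a x\<bar> powr q) + ennreal t * ennreal (\<bar>b x\<bar> powr q) \<partial>M)"
    unfolding lp_energy_def using convex_abs_powr[OF assms(3-5)] assms(4,5)
    by (intro nn_integral_mono) (simp flip: ennreal_mult ennreal_plus)
  then show ?thesis
    by (subst (asm) nn_integral_add) (auto simp: lp_energy_def nn_integral_cmult)
qed

lemma lp_energy_clarkson:
  assumes [measurable]: "a \<in> borel_measurable M" "b \<in> borel_measurable M" and q: "2 \<le> q"
  shows "2 * (lp_energy M q (\<lambda>x. (a x + b x) / 2) + lp_energy M q (\<lambda>x. (a x - b x) / 2))
    \<le> lp_energy M q a + lp_energy M q b"
proof -
  have "2 * (lp_energy M q (\<lambda>x. (a x + b x) / 2) + lp_energy M q (\<lambda>x. (a x - b x) / 2))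
      = (\<integral>\<^sup>+x. 2 * (ennreal (\<bar>(a x + b x) / 2\<bar> powr q) + ennreal (\<bar>(a x - b x) / 2\<bar> powr q)) \<partial>M)"
    unfolding lp_energy_def by (subst nn_integral_cmult) (auto simp: nn_integral_add)
  also have "\<dots> \<le> (\<integral>\<^sup>+x. ennreal (\<bar>a x\<bar> powr q) + ennreal (\<bar>b x\<bar> powr q) \<partial>M)"
  proof (intro nn_integral_mono)
    fix x
    have "2 * (ennreal (\<bar>(a x + b x) / 2\<bar> powr q) + ennreal (\<bar>(a x - b x) / 2\<bar> powr q))
        = ennreal (2 * (\<bar>(a x + b x) / 2\<bar> powr q + \<bar>(a x - b x) / 2\<bar> powr q))"
      by (subst ennreal_mult) (auto simp flip: ennreal_plus)
    also have "\<dots> \<le> ennreal (\<bar>a x\<bar> powr q + \<bar>b x\<bar> powr q)"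
      using clarkson_real[OF q, of "a x" "b x"] by (intro ennreal_leI) simp
    finally show "2 * (ennreal (\<bar>(a x + b x) / 2\<bar> powr q) + ennreal (\<bar>(a x - b x) / 2\<bar> powr q))
        \<le> ennreal (\<bar>a x\<bar> powr q) + ennreal (\<bar>b x\<bar> powr q)" by simp
  qed
  finally show ?thesis
    by (subst (asm) nn_integral_add) (auto simp: lp_energy_def)
qed

lemma lp_energy_add:
  assumes [measurable]: "a \<in> borel_measurable M" "b \<in> borel_measurable M" and q: "0 \<le> q"
  shows "lp_energy M q (\<lambda>x. a x + b x) \<le> ennreal (2 powr q) * (lp_energy M q a + lp_energy M q b)"
proof -
  have "lp_energy M q (\<lambda>x. a x + b x)
      \<le> (\<integral>\<^sup>+x. ennreal (2 powr q) * (ennreal (\<bar>a x\<bar> powr q) + ennreal (\<bar>b x\<bar> powr q)) \<partial>M)"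
    unfolding lp_energy_def using abs_add_powr_le[OF q]
    by (intro nn_integral_mono) (simp flip: ennreal_mult ennreal_plus)
  also have "\<dots> = ennreal (2 powr q) * (lp_energy M q a + lp_energy M q b)"
    unfolding lp_energy_def by (subst nn_integral_cmult) (auto simp: nn_integral_add)
  finally show ?thesis .
qed

lemma lp_energy_fatou:
  assumes m: "\<And>n. a n \<in> borel_measurable M" and q: "0 < q"
    and lim: "AE x in M. (\<lambda>n. a n x) \<longlonglongrightarrow> b x"
  shows "lp_energy M q b \<le> liminf (\<lambda>n. lp_energy M q (a n))"
proof -
  have "lp_energy M q b = (\<integral>\<^sup>+x. liminf (\<lambda>n. ennreal (\<bar>a n x\<bar> powr q)) \<partial>M)"
    unfolding lp_energy_def
  proof (intro nn_integral_cong_AE, use lim in eventually_elim)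
    fix x assume "(\<lambda>n. a n x) \<longlonglongrightarrow> b x"
    then have "(\<lambda>n. ennreal (\<bar>a n x\<bar> powr q)) \<longlonglongrightarrow> ennreal (\<bar>b x\<bar> powr q)"
      using q by (intro tendsto_ennrealI tendsto_powr' tendsto_rabs tendsto_const) auto
    then show "ennreal (\<bar>b x\<bar> powr q) = liminf (\<lambda>n. ennreal (\<bar>a n x\<bar> powr q))"
      using lim_imp_Liminf[OF trivial_limit_sequentially] by force
  qed
  also have "\<dots> \<le> liminf (\<lambda>n. lp_energy M q (a n))"
    unfolding lp_energy_def using m by (intro nn_integral_liminf) measurable
  finally show ?thesis .
qed

lemma lp_energy_finite:
  assumes [measurable]: "a \<in> borel_measurable M" and "lp_energy M q a < \<infinity>"
  shows "integrable M (\<lambda>x. \<bar>a x\<bar> powr q)"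
    and "lp_energy M q a = ennreal (LINT x|M. \<bar>a x\<bar> powr q)"
proof -
  show i: "integrable M (\<lambda>x. \<bar>a x\<bar> powr q)"
    using assms(2) by (intro integrableI_bounded) (auto simp: lp_energy_def)
  show "lp_energy M q a = ennreal (LINT x|M. \<bar>a x\<bar> powr q)"
    unfolding lp_energy_def by (rule nn_integral_eq_integral[OF i]) simp
qed

lemma abs_powr_increment_le:
  fixes q a t :: real
  assumes q: "1 < q"
  shows "\<bar>\<bar>a + t\<bar> powr q - \<bar>a\<bar> powr q - q * (\<bar>a\<bar> powr (q - 2) * a) * t\<bar>
    \<le> \<bar>t\<bar> * (q * (2 powr (q - 1) + 1) * \<bar>a\<bar> powr (q - 1) + q * 2 powr (q - 1) * \<bar>t\<bar> powr (q - 1))"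
proof -
  have ab: "\<bar>\<bar>c\<bar> powr (q - 2) * c\<bar> = \<bar>c\<bar> powr (q - 1)" for c :: real
    using powr_mult_base[of "\<bar>c\<bar>" "q - 2"] by (cases "c = 0") (auto simp: abs_mult mult.commute)
  have "\<exists>\<xi>. \<bar>\<xi>\<bar> \<le> \<bar>a\<bar> + \<bar>t\<bar> \<and> \<bar>a + t\<bar> powr q - \<bar>a\<bar> powr q = t * (q * (\<bar>\<xi>\<bar> powr (q - 2) * \<xi>))"
  proof -
    consider "t > 0" | "t < 0" | "t = 0" by linarith
    then show ?thesis
    proof cases
      case 1
      then obtain z where "a < z" "z < a + t"
        "\<bar>a + t\<bar> powr q - \<bar>a\<bar> powr q = (a + t - a) * (q * (\<bar>z\<bar> powr (q - 2) * z))"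
        using MVT2[of a "a + t" "\<lambda>t. \<bar>t\<bar> powr q" "\<lambda>z. q * (\<bar>z\<bar> powr (q - 2) * z)"] has_real_derivative_abs_powr[OF q] by auto
      then show ?thesis by (intro exI[of _ z]) auto
    next
      case 2
      then obtain z where "a + t < z" "z < a"
        "\<bar>a\<bar> powr q - \<bar>a + t\<bar> powr q = (a - (a + t)) * (q * (\<bar>z\<bar> powr (q - 2) * z))"
        using MVT2[of "a + t" a "\<lambda>t. \<bar>t\<bar> powr q" "\<lambda>z. q * (\<bar>z\<bar> powr (q - 2) * z)"] has_real_derivative_abs_powr[OF q] by auto
      then show ?thesis by (intro exI[of _ z]) auto
    qed auto
  qed
  then obtain \<xi> where \<xi>: "\<bar>\<xi>\<bar> \<le> \<bar>a\<bar> + \<bar>t\<bar>"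
    "\<bar>a + t\<bar> powr q - \<bar>a\<bar> powr q = t * (q * (\<bar>\<xi>\<bar> powr (q - 2) * \<xi>))" by blast
  have "\<bar>\<xi>\<bar> powr (q - 1) \<le> (\<bar>a\<bar> + \<bar>t\<bar>) powr (q - 1)"
    using \<xi>(1) q by (intro powr_mono2) auto
  also have "\<dots> \<le> 2 powr (q - 1) * (\<bar>a\<bar> powr (q - 1) + \<bar>t\<bar> powr (q - 1))"
    using abs_add_powr_le[of "q - 1" "\<bar>a\<bar>" "\<bar>t\<bar>"] q by simp
  finally have \<xi>_le: "\<bar>\<xi>\<bar> powr (q - 1) \<le> 2 powr (q - 1) * (\<bar>a\<bar> powr (q - 1) + \<bar>t\<bar> powr (q - 1))" .
  have "\<bar>\<bar>a + t\<bar> powr q - \<bar>a\<bar> powr q - q * (\<bar>a\<bar> powr (q - 2) * a) * t\<bar>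
      = \<bar>t\<bar> * (q * \<bar>\<bar>\<xi>\<bar> powr (q - 2) * \<xi> - \<bar>a\<bar> powr (q - 2) * a\<bar>)"
  proof -
    have "\<bar>a + t\<bar> powr q - \<bar>a\<bar> powr q - q * (\<bar>a\<bar> powr (q - 2) * a) * t
        = t * (q * (\<bar>\<xi>\<bar> powr (q - 2) * \<xi> - \<bar>a\<bar> powr (q - 2) * a))"
      unfolding \<xi>(2) by (simp add: algebra_simps)
    then show ?thesis using q by (simp only: abs_mult) simp
  qed
  also have "\<bar>\<bar>\<xi>\<bar> powr (q - 2) * \<xi> - \<bar>a\<bar> powr (q - 2) * a\<bar> \<le> \<bar>\<xi>\<bar> powr (q - 1) + \<bar>a\<bar> powr (q - 1)"
    using abs_triangle_ineq4[of "\<bar>\<xi>\<bar> powr (q - 2) * \<xi>" "\<bar>a\<bar> powr (q - 2) * a"] by (simp only: ab)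
  also have "\<dots> \<le> (2 powr (q - 1) + 1) * \<bar>a\<bar> powr (q - 1) + 2 powr (q - 1) * \<bar>t\<bar> powr (q - 1)"
    using \<xi>_le by (simp add: algebra_simps)
  finally have "\<bar>\<bar>a + t\<bar> powr q - \<bar>a\<bar> powr q - q * (\<bar>a\<bar> powr (q - 2) * a) * t\<bar>
    \<le> \<bar>t\<bar> * (q * ((2 powr (q - 1) + 1) * \<bar>a\<bar> powr (q - 1) + 2 powr (q - 1) * \<bar>t\<bar> powr (q - 1)))"
    using q by (simp add: mult_left_mono)
  then show ?thesis by (simp add: algebra_simps)
qed

text \<open>
  The family of increments is indexed by an arbitrary set, with a bound \<open>r\<close> of their size: in the energy space the increments
  are the difference quotients of all admissible directions, and \<open>r\<close> is the norm of the direction.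
\<close>

lemma lp_energy_frechet:
  fixes \<phi> :: "'i \<Rightarrow> 'a \<Rightarrow> real" and r :: "'i \<Rightarrow> real"
  assumes q: "1 < q" and [measurable]: "a \<in> borel_measurable M"
    and a: "integrable M (\<lambda>x. \<bar>a x\<bar> powr q)"
    and m: "\<And>i. i \<in> I \<Longrightarrow> \<phi> i \<in> borel_measurable M"
    and \<phi>: "\<And>i. i \<in> I \<Longrightarrow> integrable M (\<lambda>x. \<bar>\<phi> i x\<bar> powr q)"
      "\<And>i. i \<in> I \<Longrightarrow> (LINT x|M. \<bar>\<phi> i x\<bar> powr q) \<le> r i powr q"
    and r: "\<And>i. i \<in> I \<Longrightarrow> 0 \<le> r i" and e: "0 < e"
  shows "\<exists>\<delta>>0. \<forall>i\<in>I. r i < \<delta> \<longrightarrow>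
    \<bar>(LINT x|M. \<bar>a x + \<phi> i x\<bar> powr q) - (LINT x|M. \<bar>a x\<bar> powr q)
      - q * (LINT x|M. \<bar>a x\<bar> powr (q - 2) * a x * \<phi> i x)\<bar> \<le> e * r i"
proof -
  define q' where "q' = q / (q - 1)"
  have q': "1 < q'" "(q - 1) * q' = q" using q by (auto simp: q'_def less_divide_eq)
  define c where "c = q * (2 powr (q - 1) + 1)"
  define d where "d = q * 2 powr (q - 1)"
  have cd: "0 < c" "0 < d" using q by (auto simp: c_def d_def intro!: mult_pos_pos add_pos_pos)
  have pw: "(k * t powr (q - 1)) powr q' = k powr q' * t powr q" if "0 \<le> k" "0 \<le> t" for k t :: real
    using q' that by (simp add: powr_mult powr_powr)
  let ?R = "\<lambda>i x. \<bar>a x + \<phi> i x\<bar> powr q - \<bar>a x\<bar> powr q - q * (\<bar>a x\<bar> powr (q - 2) * a x) * \<phi> i x"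
  have "\<exists>\<delta>>0. \<forall>i\<in>I. r i < \<delta> \<longrightarrow> integrable M (?R i) \<and> (LINT x|M. \<bar>?R i x\<bar>) \<le> e * r i"
  proof (rule nemytskii_remainder[where F = "\<lambda>_ t. \<bar>t\<bar> powr q" and f = "\<lambda>_ t. q * (\<bar>t\<bar> powr (q - 2) * t)"
        and \<phi> = \<phi> and r = r and I = I and e = e and q' = q' and q = q and u = a and M = M and A = "\<lambda>x. c * \<bar>a x\<bar> powr (q - 1)"
        and B = "\<lambda>t. d * t powr (q - 1)" and \<rho> = 1 and C = "1 + d powr q'"])
    show "((\<lambda>t. \<bar>t\<bar> powr q) has_real_derivative q * (\<bar>a x\<bar> powr (q - 2) * a x)) (at (a x))" for x
      by (rule has_real_derivative_abs_powr[OF q])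
    show "\<bar>\<bar>a x + t\<bar> powr q - \<bar>a x\<bar> powr q - q * (\<bar>a x\<bar> powr (q - 2) * a x) * t\<bar>
      \<le> \<bar>t\<bar> * (c * \<bar>a x\<bar> powr (q - 1) + d * \<bar>t\<bar> powr (q - 1))" for x t
      unfolding c_def d_def by (rule abs_powr_increment_le[OF q])
    show "integrable M (\<lambda>x. (c * \<bar>a x\<bar> powr (q - 1)) powr q')"
      using a cd by (simp add: pw)
    fix i assume i: "i \<in> I"
    show "?R i \<in> borel_measurable M" using m[OF i] by measurable
    show "(LINT x|M. \<bar>\<phi> i x\<bar> powr q) \<le> (1 + d powr q') * r i powr q"
      using \<phi>(2)[OF i] by (simp add: distrib_right add_increasing2)
    show "integrable M (\<lambda>x. (d * \<bar>\<phi> i x\<bar> powr (q - 1)) powr q')"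
      using \<phi>(1)[OF i] cd by (simp add: pw)
    have "(LINT x|M. (d * \<bar>\<phi> i x\<bar> powr (q - 1)) powr q') = d powr q' * (LINT x|M. \<bar>\<phi> i x\<bar> powr q)"
      using cd by (simp add: pw)
    also have "\<dots> \<le> d powr q' * r i powr q" by (intro mult_left_mono \<phi>(2) i) auto
    finally show "(LINT x|M. (d * \<bar>\<phi> i x\<bar> powr (q - 1)) powr q') \<le> (1 + d powr q') * r i powr q"
      by (simp add: distrib_right add_increasing)
  qed (use q q'_def cd m \<phi> r e in \<open>auto intro!: add_pos_nonneg\<close>)
  then obtain \<delta> where \<delta>: "\<delta> > 0"
    "\<And>i. i \<in> I \<Longrightarrow> r i < \<delta> \<Longrightarrow> integrable M (?R i) \<and> (LINT x|M. \<bar>?R i x\<bar>) \<le> e * r i" by blast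
  have "\<bar>(LINT x|M. \<bar>a x + \<phi> i x\<bar> powr q) - (LINT x|M. \<bar>a x\<bar> powr q)
      - q * (LINT x|M. \<bar>a x\<bar> powr (q - 2) * a x * \<phi> i x)\<bar> \<le> e * r i" if i: "i \<in> I" "r i < \<delta>" for i
  proof -
    note [measurable] = m[OF i(1)]
    have i1: "integrable M (\<lambda>x. \<bar>a x + \<phi> i x\<bar> powr q)"
      by (rule Bochner_Integration.integrable_bound[of M "\<lambda>x. 2 powr q * (\<bar>a x\<bar> powr q + \<bar>\<phi> i x\<bar> powr q)"])
        (use a \<phi>(1)[OF i(1)] abs_add_powr_le[of q] q in \<open>auto\<close>)
    have i2: "integrable M (\<lambda>x. q * (\<bar>a x\<bar> powr (q - 2) * a x * \<phi> i x))"
    proof -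
      have "integrable M (\<lambda>x. \<bar>a x + \<phi> i x\<bar> powr q - \<bar>a x\<bar> powr q - ?R i x)"
        by (rule Bochner_Integration.integrable_diff[OF Bochner_Integration.integrable_diff[OF i1 a] conjunct1[OF \<delta>(2)[OF i]]])
      then show ?thesis by (simp add: mult.assoc)
    qed
    have "(LINT x|M. \<bar>a x + \<phi> i x\<bar> powr q) - (LINT x|M. \<bar>a x\<bar> powr q)
        - q * (LINT x|M. \<bar>a x\<bar> powr (q - 2) * a x * \<phi> i x)
      = (LINT x|M. \<bar>a x + \<phi> i x\<bar> powr q) - (LINT x|M. \<bar>a x\<bar> powr q)
        - (LINT x|M. q * (\<bar>a x\<bar> powr (q - 2) * a x * \<phi> i x))" by simp
    also have "\<dots> = (LINT x|M. ?R i x)"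
      using i1 i2 a by (simp add: mult.assoc)
    finally show ?thesis
      using \<delta>(2)[OF i] integral_abs_bound[of M "?R i"] by (simp only:) linarith
  qed
  then show ?thesis using \<delta>(1) by blast
qed

lemma sigma_finite_lebesgue: "sigma_finite_measure (lebesgue :: 'a::euclidean_space measure)"
proof
  obtain A :: "'a set set" where A: "countable A" "A \<subseteq> sets lborel" "\<Union>A = space lborel"
      "\<forall>a\<in>A. emeasure lborel a \<noteq> \<infinity>"
    using lborel.sigma_finite_countable by blast
  show "\<exists>A::'a set set. countable A \<and> A \<subseteq> sets lebesgue \<and> \<Union> A = space lebesgue \<and> (\<forall>a\<in>A. emeasure lebesgue a \<noteq> \<infinity>)"
    using A by (intro exI[of _ A]) auto
qed

interpretation lebesgue: sigma_finite_measure lebesgue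
  by (rule sigma_finite_lebesgue)

interpretation lebesgue_pair: pair_sigma_finite lebesgue lebesgue ..

text \<open>
  Null sets of one factor are null in the product, so that functions equal almost everywhere have the same Gagliardo energy.
\<close>

lemma AE_pair_lebesgue:
  fixes Q :: "'a::euclidean_space \<Rightarrow> bool"
  assumes "AE x in lebesgue. Q x"
  shows "AE z in lebesgue \<Otimes>\<^sub>M (lebesgue :: 'a measure). Q (fst z) \<and> Q (snd z)"
proof -
  obtain N where N: "N \<in> null_sets lebesgue" "\<And>x. \<not> Q x \<Longrightarrow> x \<in> N"
    using assms by (auto simp: eventually_ae_filter)
  have "N \<times> UNIV \<union> UNIV \<times> N \<in> null_sets (lebesgue \<Otimes>\<^sub>M (lebesgue :: 'a measure))"
  proof (rule null_sets.Un)
    have s: "N \<in> sets lebesgue" "UNIV \<in> sets (lebesgue :: 'a measure)" using N by auto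
    show "N \<times> UNIV \<in> null_sets (lebesgue \<Otimes>\<^sub>M (lebesgue :: 'a measure))"
      using lebesgue.emeasure_pair_measure_Times[OF s] null_setsD1[OF N(1)] s
      by (intro null_setsI) (auto simp del: emeasure_completion)
    show "UNIV \<times> N \<in> null_sets ((lebesgue :: 'a measure) \<Otimes>\<^sub>M (lebesgue :: 'a measure))"
      using lebesgue.emeasure_pair_measure_Times[OF s(2,1)] null_setsD1[OF N(1)] s
      by (intro null_setsI) (auto simp del: emeasure_completion)
  qed
  then show ?thesis by (rule AE_I') (use N(2) in auto)
qed

lemma measurable_pair_lebesgue:
  fixes u :: "'a::euclidean_space \<Rightarrow> real"
  assumes u: "u \<in> borel_measurable lebesgue"
  shows "(\<lambda>z. u (fst z)) \<in> borel_measurable (lebesgue \<Otimes>\<^sub>M (lebesgue :: 'a measure))"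
    and "(\<lambda>z. u (snd z)) \<in> borel_measurable (lebesgue \<Otimes>\<^sub>M (lebesgue :: 'a measure))"
    and "(\<lambda>z. norm (fst z - snd z)) \<in> borel_measurable (lebesgue \<Otimes>\<^sub>M (lebesgue :: 'a measure))"
proof -
  show "(\<lambda>z. u (fst z)) \<in> borel_measurable (lebesgue \<Otimes>\<^sub>M (lebesgue :: 'a measure))"
    "(\<lambda>z. u (snd z)) \<in> borel_measurable (lebesgue \<Otimes>\<^sub>M (lebesgue :: 'a measure))"
    using u by measurable
  have id: "(\<lambda>x::'a. x) \<in> lebesgue \<rightarrow>\<^sub>M borel"
    by (simp add: measurable_completion)
  have [measurable]: "fst \<in> (lebesgue :: 'a measure) \<Otimes>\<^sub>M (lebesgue :: 'a measure) \<rightarrow>\<^sub>M borel"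
    by (rule measurable_compose[OF measurable_fst id])
  have [measurable]: "snd \<in> (lebesgue :: 'a measure) \<Otimes>\<^sub>M (lebesgue :: 'a measure) \<rightarrow>\<^sub>M borel"
    by (rule measurable_compose[OF measurable_snd id])
  show "(\<lambda>z. norm (fst z - snd z)) \<in> borel_measurable (lebesgue \<Otimes>\<^sub>M (lebesgue :: 'a measure))"
    by measurable
qed

lemma liminf_add_ennreal:
  fixes a b :: "nat \<Rightarrow> ennreal"
  shows "liminf a + liminf b \<le> liminf (\<lambda>n. a n + b n)"
proof -
  have "liminf a + liminf b = (SUP n. (INF m\<in>{n..}. a m) + (INF m\<in>{n..}. b m))"
    unfolding liminf_SUP_INF
    by (intro ennreal_SUP_add[symmetric]) (auto simp: incseq_def intro!: INF_superset_mono)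
  also have "\<dots> \<le> (SUP n. INF m\<in>{n..}. a m + b m)"
    by (intro SUP_mono' INF_greatest add_mono INF_lower)
  finally show ?thesis by (simp add: liminf_SUP_INF)
qed

text \<open>
  The exponent and the dimension are parameters of the locale: an abbreviation for \<open>CARD('n) / s\<close> outside would not determine the
  index type \<open>'n\<close>.
\<close>

locale fractional_space =
  fixes s P :: real and N :: nat and V :: "real^'n \<Rightarrow> real"
  assumes P_def: "P = real CARD('n) / s" and N_def: "N = CARD('n)" and s01: "0 < s" "s < 1" and dim: "2 \<le> CARD('n)" and V1: "cond_V1 V"
begin

abbreviation "E \<equiv> WV_energy s V"
abbreviation "nrm \<equiv> WV_norm s V"

definition Er :: "(real^'n \<Rightarrow> real) \<Rightarrow> real" where
  "Er u = enn2real (E u)"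

text \<open>Both parts of the energy are \<open>L\<^sup>P\<close> energies of functions depending linearly on \<open>u\<close>.\<close>

definition dq :: "(real^'n \<Rightarrow> real) \<Rightarrow> (real^'n) \<times> (real^'n) \<Rightarrow> real" where
  "dq u z = (u (fst z) - u (snd z)) / norm (fst z - snd z) powr (2 * s)"

definition vq :: "(real^'n \<Rightarrow> real) \<Rightarrow> real^'n \<Rightarrow> real" where
  "vq u x = V x powr (1 / P) * u x"

abbreviation "leb2 \<equiv> (lebesgue :: (real^'n) measure) \<Otimes>\<^sub>M (lebesgue :: (real^'n) measure)"

lemma P_gt_2: "2 < P"
proof -
  have "2 * s < 2" using s01 by simp
  also have "2 \<le> real CARD('n)" using dim by simp
  finally show ?thesis using s01 by (simp add: P_def less_divide_eq)
qed

lemma inv_P: "s / real CARD('n) = 1 / P" and CARD_eq: "real CARD('n) = s * P"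
  using s01 by (simp_all add: P_def)

lemma V_pos: "0 < V x"
  using V1 by (auto simp: cond_V1_def)

definition V0 where "V0 = (INF x. V x)"

lemma V0: "0 < V0" "V0 \<le> V x"
proof -
  show "0 < V0" using V1 by (auto simp: cond_V1_def V0_def)
  show "V0 \<le> V x" unfolding V0_def
    by (rule cINF_lower) (auto intro!: bdd_belowI2[where m = 0] less_imp_le V_pos)
qed

lemma V_measurable[measurable]: "V \<in> borel_measurable lebesgue"
  using V1 by (intro measurable_completion) (simp add: cond_V1_def borel_measurable_continuous_onI)

lemma dq_powr: "\<bar>dq u z\<bar> powr P = \<bar>u (fst z) - u (snd z)\<bar> powr P / norm (fst z - snd z) ^ (2 * CARD('n))"
proof (cases "fst z = snd z")
  case False
  have "\<bar>dq u z\<bar> powr P = \<bar>u (fst z) - u (snd z)\<bar> powr P / (norm (fst z - snd z) powr (2 * s)) powr P"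
    by (simp add: dq_def abs_divide powr_divide)
  also have "(norm (fst z - snd z) powr (2 * s)) powr P = norm (fst z - snd z) powr real (2 * CARD('n))"
    using s01 by (simp add: powr_powr P_def)
  also have "\<dots> = norm (fst z - snd z) ^ (2 * CARD('n))"
    using False by (subst powr_realpow) auto
  finally show ?thesis .
qed (simp add: dq_def)

lemma vq_powr: "\<bar>vq u x\<bar> powr P = V x * \<bar>u x\<bar> powr P"
  using V_pos[of x] P_gt_2 by (simp add: vq_def abs_mult powr_mult powr_powr)

lemma E_eq: "E u = lp_energy leb2 P (dq u) + lp_energy lebesgue P (vq u)"
  by (simp add: WV_energy_def gagliardo_energy_def lp_energy_def dq_powr vq_powr P_def[symmetric])

lemma gagliardo_eq: "gagliardo_energy s u = lp_energy leb2 P (dq u)"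
  by (simp add: gagliardo_energy_def lp_energy_def dq_powr P_def[symmetric])

lemma dq_measurable[measurable (raw)]:
  assumes "u \<in> borel_measurable lebesgue" shows "dq u \<in> borel_measurable leb2"
  unfolding dq_def[abs_def] using measurable_pair_lebesgue[OF assms] by measurable

lemma vq_measurable[measurable (raw)]:
  assumes [measurable]: "u \<in> borel_measurable lebesgue" shows "vq u \<in> borel_measurable lebesgue"
  unfolding vq_def[abs_def] by measurable

lemma dq_linear:
  "dq (\<lambda>x. u x + v x) z = dq u z + dq v z" "dq (\<lambda>x. u x - v x) z = dq u z - dq v z"
  "dq (\<lambda>x. c * u x) z = c * dq u z" "dq (\<lambda>x. u x / c) z = dq u z / c"
  by (simp_all add: dq_def field_simps flip: add_divide_distrib diff_divide_distrib)

lemma vq_linear: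
  "vq (\<lambda>x. u x + v x) z = vq u z + vq v z" "vq (\<lambda>x. u x - v x) z = vq u z - vq v z"
  "vq (\<lambda>x. c * u x) z = c * vq u z" "vq (\<lambda>x. u x / c) z = vq u z / c"
  by (simp_all add: vq_def algebra_simps)

lemmas lin_eqs = dq_linear[abs_def] vq_linear[abs_def]

lemma E_scale:
  assumes [measurable]: "u \<in> borel_measurable lebesgue"
  shows "E (\<lambda>x. c * u x) = ennreal (\<bar>c\<bar> powr P) * E u"
  by (simp add: E_eq lin_eqs lp_energy_scale dq_measurable vq_measurable distrib_left)

lemma E_convex:
  assumes [measurable]: "u \<in> borel_measurable lebesgue" "v \<in> borel_measurable lebesgue" and t: "0 \<le> t" "t \<le> 1"
  shows "E (\<lambda>x. (1 - t) * u x + t * v x) \<le> ennreal (1 - t) * E u + ennreal t * E v"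
proof -
  have "E (\<lambda>x. (1 - t) * u x + t * v x) \<le>
      (ennreal (1 - t) * lp_energy leb2 P (dq u) + ennreal t * lp_energy leb2 P (dq v))
      + (ennreal (1 - t) * lp_energy lebesgue P (vq u) + ennreal t * lp_energy lebesgue P (vq v))"
    unfolding E_eq lin_eqs using P_gt_2 t by (intro add_mono lp_energy_convex) (auto simp: dq_measurable)
  then show ?thesis by (simp add: E_eq distrib_left ac_simps)
qed

lemma E_clarkson:
  assumes [measurable]: "u \<in> borel_measurable lebesgue" "v \<in> borel_measurable lebesgue"
  shows "2 * (E (\<lambda>x. (u x + v x) / 2) + E (\<lambda>x. (u x - v x) / 2)) \<le> E u + E v"
proof -
  have "2 * (lp_energy leb2 P (\<lambda>z. (dq u z + dq v z) / 2) + lp_energy leb2 P (\<lambda>z. (dq u z - dq v z) / 2))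
      + 2 * (lp_energy lebesgue P (\<lambda>z. (vq u z + vq v z) / 2) + lp_energy lebesgue P (\<lambda>z. (vq u z - vq v z) / 2))
      \<le> (lp_energy leb2 P (dq u) + lp_energy leb2 P (dq v)) + (lp_energy lebesgue P (vq u) + lp_energy lebesgue P (vq v))"
    using P_gt_2 by (intro add_mono lp_energy_clarkson) (auto simp: dq_measurable)
  then show ?thesis by (simp add: E_eq lin_eqs distrib_left ac_simps)
qed

lemma E_add:
  assumes [measurable]: "u \<in> borel_measurable lebesgue" "v \<in> borel_measurable lebesgue"
  shows "E (\<lambda>x. u x + v x) \<le> ennreal (2 powr P) * (E u + E v)"
proof -
  have "E (\<lambda>x. u x + v x) \<le> ennreal (2 powr P) * (lp_energy leb2 P (dq u) + lp_energy leb2 P (dq v))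
      + ennreal (2 powr P) * (lp_energy lebesgue P (vq u) + lp_energy lebesgue P (vq v))"
    unfolding E_eq lin_eqs using P_gt_2 by (intro add_mono lp_energy_add) (auto simp: dq_measurable)
  then show ?thesis by (simp add: E_eq distrib_left ac_simps)
qed

lemma E_fatou:
  assumes m: "\<And>n. u n \<in> borel_measurable lebesgue" and lim: "AE x in lebesgue. (\<lambda>n. u n x) \<longlonglongrightarrow> v x"
  shows "E v \<le> liminf (\<lambda>n. E (u n))"
proof -
  have "lp_energy leb2 P (dq v) \<le> liminf (\<lambda>n. lp_energy leb2 P (dq (u n)))"
  proof (rule lp_energy_fatou)
    show "AE z in leb2. (\<lambda>n. dq (u n) z) \<longlonglongrightarrow> dq v z"
      using AE_pair_lebesgue[OF lim]
      by eventually_elim (auto simp: dq_def divide_inverse intro!: tendsto_intros)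
  qed (use P_gt_2 m in auto)
  moreover have "lp_energy lebesgue P (vq v) \<le> liminf (\<lambda>n. lp_energy lebesgue P (vq (u n)))"
  proof (rule lp_energy_fatou)
    show "AE z in lebesgue. (\<lambda>n. vq (u n) z) \<longlonglongrightarrow> vq v z"
      using lim by eventually_elim (auto simp: vq_def intro!: tendsto_intros)
  qed (use P_gt_2 m in auto)
  ultimately have "E v \<le> liminf (\<lambda>n. lp_energy leb2 P (dq (u n))) + liminf (\<lambda>n. lp_energy lebesgue P (vq (u n)))"
    unfolding E_eq by (rule add_mono)
  also have "\<dots> \<le> liminf (\<lambda>n. E (u n))"
    unfolding E_eq by (rule liminf_add_ennreal)
  finally show ?thesis .
qed

text \<open>
  The conditions hold for \<open>v = g \<circ> u\<close> with a contraction \<open>g\<close> fixing \<open>0\<close>.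
\<close>

lemma E_contraction:
  assumes "\<And>x y. \<bar>v x - v y\<bar> \<le> \<bar>u x - u y\<bar>" "\<And>x. \<bar>v x\<bar> \<le> \<bar>u x\<bar>"
  shows "E v \<le> E u"
  unfolding E_eq
  by (intro add_mono lp_energy_mono_AE AE_I2)
    (use assms P_gt_2 in \<open>auto simp: dq_def vq_def abs_divide abs_mult intro!: divide_right_mono mult_left_mono\<close>)

lemma E_cong_AE:
  assumes "AE x in lebesgue. u x = v x"
  shows "E u = E v"
proof -
  have 1: "AE z in leb2. \<bar>dq u z\<bar> = \<bar>dq v z\<bar>"
    using AE_pair_lebesgue[OF assms] by eventually_elim (simp add: dq_def)
  have 2: "AE z in lebesgue. \<bar>vq u z\<bar> = \<bar>vq v z\<bar>"
    using assms by eventually_elim (simp add: vq_def)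
  show ?thesis unfolding E_eq
    by (intro antisym add_mono lp_energy_mono_AE)
      (use 1 2 P_gt_2 in \<open>auto elim!: eventually_mono\<close>)
qed

lemma lp_le_E:
  assumes [measurable]: "u \<in> borel_measurable lebesgue"
  shows "ennreal V0 * lp_energy lebesgue P u \<le> E u"
proof -
  have "ennreal V0 * lp_energy lebesgue P u = (\<integral>\<^sup>+x. ennreal V0 * ennreal (\<bar>u x\<bar> powr P) \<partial>lebesgue)"
    unfolding lp_energy_def by (subst nn_integral_cmult) auto
  also have "\<dots> \<le> lp_energy lebesgue P (vq u)"
    unfolding lp_energy_def vq_powr using V0
    by (intro nn_integral_mono) (auto simp flip: ennreal_mult intro!: ennreal_leI mult_right_mono)
  also have "\<dots> \<le> E u" by (simp add: E_eq)
  finally show ?thesis .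
qed

lemma Er_nonneg: "0 \<le> Er u"
  by (simp add: Er_def)

lemma E_eq_Er: "E u < \<infinity> \<Longrightarrow> E u = ennreal (Er u)"
  by (simp add: Er_def)

lemma nrm_nonneg: "0 \<le> nrm u"
  by (simp add: WV_norm_def)

lemma nrm_eq: "nrm u = Er u powr (1 / P)"
  by (simp add: WV_norm_def Er_def inv_P)

lemma nrm_powr: "nrm u powr P = Er u"
  using P_gt_2 Er_nonneg[of u] by (simp add: nrm_eq powr_powr)

lemma E_parts:
  assumes [measurable]: "u \<in> borel_measurable lebesgue" and "E u < \<infinity>"
  shows "integrable leb2 (\<lambda>z. \<bar>dq u z\<bar> powr P)" "integrable lebesgue (\<lambda>x. \<bar>vq u x\<bar> powr P)"
    and "Er u = (LINT z|leb2. \<bar>dq u z\<bar> powr P) + (LINT x|lebesgue. \<bar>vq u x\<bar> powr P)"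
proof -
  have f: "lp_energy leb2 P (dq u) < \<infinity>" "lp_energy lebesgue P (vq u) < \<infinity>"
    using assms(2) by (auto simp: E_eq)
  show "integrable leb2 (\<lambda>z. \<bar>dq u z\<bar> powr P)" "integrable lebesgue (\<lambda>x. \<bar>vq u x\<bar> powr P)"
    using lp_energy_finite(1)[OF _ f(1)] lp_energy_finite(1)[OF _ f(2)] by (auto simp: dq_measurable)
  show "Er u = (LINT z|leb2. \<bar>dq u z\<bar> powr P) + (LINT x|lebesgue. \<bar>vq u x\<bar> powr P)"
    using lp_energy_finite(2)[OF dq_measurable[OF assms(1)] f(1)]
      lp_energy_finite(2)[OF vq_measurable[OF assms(1)] f(2)]
    by (simp add: Er_def E_eq enn2real_plus integral_nonneg_AE flip: ennreal_plus)
qed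

lemma lp_bound:
  assumes [measurable]: "u \<in> borel_measurable lebesgue" and f: "E u < \<infinity>"
  shows "integrable lebesgue (\<lambda>x. \<bar>u x\<bar> powr P)" "V0 * (LINT x|lebesgue. \<bar>u x\<bar> powr P) \<le> Er u"
proof -
  have "ennreal V0 * lp_energy lebesgue P u < \<infinity>"
    using lp_le_E[OF assms(1)] f by (rule le_less_trans)
  then have fin: "lp_energy lebesgue P u < \<infinity>"
    using V0(1) by (auto simp: ennreal_mult_less_top)
  show "integrable lebesgue (\<lambda>x. \<bar>u x\<bar> powr P)" by (rule lp_energy_finite(1)[OF assms(1) fin])
  have "ennreal (V0 * (LINT x|lebesgue. \<bar>u x\<bar> powr P)) \<le> ennreal (Er u)"
    using lp_le_E[OF assms(1)] V0(1) unfolding E_eq_Er[OF f] lp_energy_finite(2)[OF assms(1) fin]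
    by (simp add: ennreal_mult integral_nonneg_AE)
  then show "V0 * (LINT x|lebesgue. \<bar>u x\<bar> powr P) \<le> Er u"
    using Er_nonneg by (simp add: ennreal_le_iff)
qed

lemma nrm_scale:
  assumes "u \<in> borel_measurable lebesgue"
  shows "Er (\<lambda>x. c * u x) = \<bar>c\<bar> powr P * Er u" "nrm (\<lambda>x. c * u x) = \<bar>c\<bar> * nrm u"
proof -
  show 1: "Er (\<lambda>x. c * u x) = \<bar>c\<bar> powr P * Er u"
    by (simp add: Er_def E_scale[OF assms] enn2real_mult)
  show "nrm (\<lambda>x. c * u x) = \<bar>c\<bar> * nrm u"
    using P_gt_2 by (simp add: nrm_eq 1 powr_mult powr_powr)
qed

lemma nrm_zero_iff: "nrm u = 0 \<longleftrightarrow> Er u = 0"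
  using P_gt_2 by (simp add: nrm_eq)

text \<open>Minkowski's inequality, from convexity and homogeneity of the energy.\<close>

lemma nrm_triangle:
  assumes [measurable]: "u \<in> borel_measurable lebesgue" "v \<in> borel_measurable lebesgue"
    and f: "E u < \<infinity>" "E v < \<infinity>"
  shows "E (\<lambda>x. u x + v x) < \<infinity>" "nrm (\<lambda>x. u x + v x) \<le> nrm u + nrm v"
proof -
  show fin: "E (\<lambda>x. u x + v x) < \<infinity>"
    by (rule le_less_trans[OF E_add]) (use f in \<open>auto simp: ennreal_mult_less_top\<close>)
  have le: "nrm (\<lambda>x. u x + v x) \<le> nrm u + nrm v + 2 * e" if e: "0 < e" for e
  proof -
    define a where "a = nrm u + e"
    define b where "b = nrm v + e"
    have ab: "0 < a" "0 < b" "nrm u \<le> a" "nrm v \<le> b" using e nrm_nonneg by (auto simp: a_def b_def add_nonneg_pos)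
    define t where "t = b / (a + b)"
    have t: "0 \<le> t" "t \<le> 1" using ab by (auto simp: t_def)
    have t1: "1 - t = a / (a + b)" using ab by (simp add: t_def field_simps)
    have *: "E (\<lambda>x. 1 / c * w x) \<le> 1"
      if w: "w \<in> borel_measurable lebesgue" "E w < \<infinity>" "0 < c" "nrm w \<le> c" for c w
    proof -
      have "Er w \<le> c powr P"
        using powr_mono2[of P "nrm w" c] w P_gt_2 nrm_nonneg by (simp add: nrm_powr)
      then have "(1 / c) powr P * Er w \<le> 1" using w by (simp add: powr_divide)
      then show ?thesis
        unfolding E_scale[OF w(1)] E_eq_Er[OF w(2)] using w(3) Er_nonneg
        by (simp add: ennreal_le_1 flip: ennreal_mult)
    qed
    have "(\<lambda>x. 1 / (a + b) * (u x + v x)) = (\<lambda>x. (1 - t) * (1 / a * u x) + t * (1 / b * v x))"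
    proof -
      have "(1 - t) * (1 / a * c) = 1 / (a + b) * c" "t * (1 / b * c) = 1 / (a + b) * c" for c
        unfolding t1 using ab by (simp_all add: t_def)
      then show ?thesis by (simp only: distrib_left)
    qed
    then have "E (\<lambda>x. 1 / (a + b) * (u x + v x)) \<le> ennreal (1 - t) * E (\<lambda>x. 1 / a * u x) + ennreal t * E (\<lambda>x. 1 / b * v x)"
      using E_convex[OF _ _ t, of "\<lambda>x. 1 / a * u x" "\<lambda>x. 1 / b * v x"] by simp
    also have "\<dots> \<le> ennreal (1 - t) * 1 + ennreal t * 1"
      using f ab by (intro add_mono mult_left_mono *) auto
    also have "\<dots> = 1" using t by (simp flip: ennreal_plus)
    finally have "Er (\<lambda>x. 1 / (a + b) * (u x + v x)) \<le> 1"
      unfolding Er_def by (metis enn2real_mono enn2real_1 ennreal_one_less_top)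
    then have "nrm (\<lambda>x. 1 / (a + b) * (u x + v x)) \<le> 1"
      using P_gt_2 Er_nonneg unfolding nrm_eq by (intro powr_le1) auto
    then show ?thesis
      using ab by (subst (asm) nrm_scale) (auto simp: a_def b_def)
  qed
  show "nrm (\<lambda>x. u x + v x) \<le> nrm u + nrm v"
  proof (rule field_le_epsilon)
    fix e :: real assume "0 < e"
    then show "nrm (\<lambda>x. u x + v x) \<le> nrm u + nrm v + e" using le[of "e / 2"] by simp
  qed
qed

text \<open>The derivative of \<open>Er\<close> at \<open>u\<close>, divided by \<open>P\<close>.\<close>

definition Lin :: "(real^'n \<Rightarrow> real) \<Rightarrow> (real^'n \<Rightarrow> real) \<Rightarrow> real" where
  "Lin u \<phi> = pairing s u \<phi> + (LINT x|lebesgue. V x * \<bar>u x\<bar> powr (P - 2) * u x * \<phi> x)"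

lemma Lin_eq:
  "Lin u \<phi> = (LINT z|leb2. \<bar>dq u z\<bar> powr (P - 2) * dq u z * dq \<phi> z)
    + (LINT x|lebesgue. \<bar>vq u x\<bar> powr (P - 2) * vq u x * vq \<phi> x)"
proof -
  have "\<bar>u (fst z) - u (snd z)\<bar> powr (P - 2) * (u (fst z) - u (snd z)) * (\<phi> (fst z) - \<phi> (snd z))
      / norm (fst z - snd z) ^ (2 * CARD('n)) = \<bar>dq u z\<bar> powr (P - 2) * dq u z * dq \<phi> z" for z
  proof (cases "fst z = snd z")
    case False
    define D where "D = norm (fst z - snd z) powr (2 * s)"
    have D: "0 < D" using False by (simp add: D_def)
    have "norm (fst z - snd z) ^ (2 * CARD('n)) = norm (fst z - snd z) powr real (2 * CARD('n))"
      using False by (subst powr_realpow) auto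
    also have "\<dots> = D powr P" by (simp add: D_def powr_powr CARD_eq mult.assoc)
    also have "\<dots> = D powr (P - 2) * (D * D)"
      using D powr_add[of D "P - 2" 2] by (simp add: powr_numeral power2_eq_square)
    finally show ?thesis
      using D by (simp add: dq_def D_def[symmetric] abs_divide powr_divide)
  qed (simp add: dq_def)
  then have 1: "pairing s u \<phi> = (LINT z|leb2. \<bar>dq u z\<bar> powr (P - 2) * dq u z * dq \<phi> z)"
    by (simp add: pairing_def P_def[symmetric])
  have "V x * \<bar>u x\<bar> powr (P - 2) * u x * \<phi> x = \<bar>vq u x\<bar> powr (P - 2) * vq u x * vq \<phi> x" for x
  proof -
    define D where "D = V x powr (1 / P)"
    have D: "0 < D" using V_pos[of x] by (simp add: D_def)
    have "V x = D powr P" using V_pos[of x] P_gt_2 by (simp add: D_def powr_powr)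
    also have "\<dots> = D powr (P - 2) * (D * D)"
      using D powr_add[of D "P - 2" 2] by (simp add: powr_numeral power2_eq_square)
    finally have "V x = D powr (P - 2) * (D * D)" .
    moreover have "vq w x = D * w x" for w by (simp add: vq_def D_def)
    ultimately show ?thesis using D by (simp add: abs_mult powr_mult)
  qed
  then show ?thesis by (simp add: Lin_def 1)
qed

lemma Lin_scale: "Lin u (\<lambda>x. c * \<phi> x) = c * Lin u \<phi>"
proof -
  have 1: "\<bar>dq u z\<bar> powr (P - 2) * dq u z * dq (\<lambda>x. c * \<phi> x) z = c * (\<bar>dq u z\<bar> powr (P - 2) * dq u z * dq \<phi> z)" for z
    by (simp add: dq_linear)
  have 2: "\<bar>vq u z\<bar> powr (P - 2) * vq u z * vq (\<lambda>x. c * \<phi> x) z = c * (\<bar>vq u z\<bar> powr (P - 2) * vq u z * vq \<phi> z)" for z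
    by (simp add: vq_linear)
  show ?thesis unfolding Lin_eq 1 2 by (simp add: distrib_left)
qed

lemma Er_frechet:
  assumes u[measurable]: "u \<in> borel_measurable lebesgue" and f: "E u < \<infinity>" and e: "0 < e"
  shows "\<exists>\<delta>>0. \<forall>\<phi>. \<phi> \<in> borel_measurable lebesgue \<and> E \<phi> < \<infinity> \<and> nrm \<phi> < \<delta> \<longrightarrow>
    \<bar>Er (\<lambda>x. u x + \<phi> x) - Er u - P * Lin u \<phi>\<bar> \<le> e * nrm \<phi>"
proof -
  define I where "I = {\<phi>. \<phi> \<in> borel_measurable lebesgue \<and> E \<phi> < \<infinity>}"
  have P1: "1 < P" using P_gt_2 by simp
  have e2: "0 < e / 2" using e by simp
  obtain \<delta>1 where \<delta>1: "\<delta>1 > 0" "\<And>\<phi>. \<phi> \<in> I \<Longrightarrow> nrm \<phi> < \<delta>1 \<Longrightarrow>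
    \<bar>(LINT z|leb2. \<bar>dq u z + dq \<phi> z\<bar> powr P) - (LINT z|leb2. \<bar>dq u z\<bar> powr P)
      - P * (LINT z|leb2. \<bar>dq u z\<bar> powr (P - 2) * dq u z * dq \<phi> z)\<bar> \<le> e / 2 * nrm \<phi>"
    using lp_energy_frechet[OF P1 dq_measurable[OF u] E_parts(1)[OF u f], of I dq nrm "e / 2"]
      E_parts(1,3) e2 by (auto simp: I_def nrm_powr nrm_nonneg dq_measurable)
  obtain \<delta>2 where \<delta>2: "\<delta>2 > 0" "\<And>\<phi>. \<phi> \<in> I \<Longrightarrow> nrm \<phi> < \<delta>2 \<Longrightarrow>
    \<bar>(LINT z|lebesgue. \<bar>vq u z + vq \<phi> z\<bar> powr P) - (LINT z|lebesgue. \<bar>vq u z\<bar> powr P)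
      - P * (LINT z|lebesgue. \<bar>vq u z\<bar> powr (P - 2) * vq u z * vq \<phi> z)\<bar> \<le> e / 2 * nrm \<phi>"
    using lp_energy_frechet[OF P1 vq_measurable[OF u] E_parts(2)[OF u f], of I vq nrm "e / 2"]
      E_parts(2,3) e2 by (auto simp: I_def nrm_powr nrm_nonneg vq_measurable)
  have "\<bar>Er (\<lambda>x. u x + \<phi> x) - Er u - P * Lin u \<phi>\<bar> \<le> e * nrm \<phi>"
    if \<phi>: "\<phi> \<in> I" "nrm \<phi> < min \<delta>1 \<delta>2" for \<phi>
  proof -
    have [measurable]: "\<phi> \<in> borel_measurable lebesgue" and f': "E \<phi> < \<infinity>" using \<phi> by (auto simp: I_def)
    have "Er (\<lambda>x. u x + \<phi> x) = (LINT z|leb2. \<bar>dq u z + dq \<phi> z\<bar> powr P) + (LINT z|lebesgue. \<bar>vq u z + vq \<phi> z\<bar> powr P)"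
      using E_parts(3)[of "\<lambda>x. u x + \<phi> x"] nrm_triangle(1)[OF _ _ f f'] by (simp add: dq_linear vq_linear)
    then have eq: "Er (\<lambda>x. u x + \<phi> x) - Er u - P * Lin u \<phi> =
      ((LINT z|leb2. \<bar>dq u z + dq \<phi> z\<bar> powr P) - (LINT z|leb2. \<bar>dq u z\<bar> powr P)
      - P * (LINT z|leb2. \<bar>dq u z\<bar> powr (P - 2) * dq u z * dq \<phi> z)) +
      ((LINT z|lebesgue. \<bar>vq u z + vq \<phi> z\<bar> powr P) - (LINT z|lebesgue. \<bar>vq u z\<bar> powr P)
      - P * (LINT z|lebesgue. \<bar>vq u z\<bar> powr (P - 2) * vq u z * vq \<phi> z))"
      using E_parts(3)[OF u f] by (simp add: Lin_eq algebra_simps)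
    have half: "\<bar>x\<bar> \<le> e * n" if "x = y + z" "\<bar>y\<bar> \<le> e / 2 * n" "\<bar>z\<bar> \<le> e / 2 * n" for x y z n :: real
      using that by (simp add: field_simps)
    show ?thesis
      by (rule half[OF eq \<delta>1(2)[OF \<phi>(1)] \<delta>2(2)[OF \<phi>(1)]]) (use \<phi>(2) in auto)
  qed
  then show ?thesis using \<delta>1(1) \<delta>2(1) by (intro exI[of _ "min \<delta>1 \<delta>2"]) (auto simp: I_def)
qed

end

section \<open>Dyadic averages\<close>

text \<open>
  The dyadic cube of side \<open>2\<^sup>-\<^sup>k\<close> containing \<open>x\<close>, as a class of an equivalence relation, which makes nestedness and symmetry
  immediate.
\<close>

definition dcube :: "nat \<Rightarrow> real^'n \<Rightarrow> (real^'n) set" where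
  "dcube k x = {y. \<forall>i. \<lfloor>2 ^ k * y $ i\<rfloor> = \<lfloor>2 ^ k * x $ i\<rfloor>}"

lemma dcube_self [simp]: "x \<in> dcube k x"
  by (simp add: dcube_def)

lemma dcube_sym: "y \<in> dcube k x \<longleftrightarrow> x \<in> dcube k y"
  by (auto simp: dcube_def)

lemma dcube_eq: "y \<in> dcube k x \<Longrightarrow> dcube k y = dcube k x"
  by (auto simp: dcube_def)

lemma dcube_Suc: "dcube (Suc k) x \<subseteq> dcube k x"
proof
  fix y assume "y \<in> dcube (Suc k) x"
  moreover have "\<lfloor>2 ^ k * c\<rfloor> = \<lfloor>2 ^ Suc k * c\<rfloor> div 2" for c :: real
    using floor_divide_real_eq_div[of 2 "2 ^ Suc k * c"] by simp
  ultimately show "y \<in> dcube k x" by (simp add: dcube_def)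
qed

lemma dcube_norm_le:
  assumes "y \<in> dcube k (x :: real^'n)"
  shows "norm (x - y) \<le> real CARD('n) / 2 ^ k"
proof -
  have "\<bar>x $ i - y $ i\<bar> \<le> 1 / 2 ^ k" for i
  proof -
    have fl: "\<bar>c - d\<bar> \<le> 1" if "\<lfloor>c\<rfloor> = \<lfloor>d\<rfloor>" for c d :: real
      using floor_correct[of c] floor_correct[of d] that by linarith
    have "\<bar>2 ^ k * x $ i - 2 ^ k * y $ i\<bar> \<le> 1"
      by (rule fl) (use assms in \<open>simp add: dcube_def\<close>)
    then have "\<bar>2 ^ k * (x $ i - y $ i)\<bar> \<le> 1" by (simp only: right_diff_distrib)
    then have "2 ^ k * \<bar>x $ i - y $ i\<bar> \<le> 1" by (simp only: abs_mult) simp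
    then show ?thesis by (simp add: field_simps)
  qed
  then have "(\<Sum>i\<in>UNIV. \<bar>(x - y) $ i\<bar>) \<le> (\<Sum>i\<in>(UNIV :: 'n set). 1 / 2 ^ k)"
    by (intro sum_mono) simp
  then show ?thesis using norm_le_l1_cart[of "x - y"] by simp
qed

lemma dcube_box:
  fixes x :: "real^'n" and k :: nat
  defines "a \<equiv> (\<chi> i. real_of_int \<lfloor>2 ^ k * x $ i\<rfloor> / 2 ^ k)" and "b \<equiv> (\<chi> i. (real_of_int \<lfloor>2 ^ k * x $ i\<rfloor> + 1) / 2 ^ k)"
  shows "box a b \<subseteq> dcube k x" "dcube k x \<subseteq> cbox a b"
proof -
  have *: "\<lfloor>2 ^ k * c\<rfloor> = m \<longleftrightarrow> real_of_int m / 2 ^ k \<le> c \<and> c < (real_of_int m + 1) / 2 ^ k" for c :: real and m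
    by (simp add: floor_eq_iff field_simps)
  show "box a b \<subseteq> dcube k x" "dcube k x \<subseteq> cbox a b"
    unfolding dcube_def * by (auto simp: mem_box_cart a_def b_def less_imp_le)
qed

lemma id_lebesgue_borel: "(\<lambda>x. x) \<in> (lebesgue :: 'a::euclidean_space measure) \<rightarrow>\<^sub>M borel"
  by (simp add: measurable_completion)

lemma component_measurable:
  "(\<lambda>x. x $ i) \<in> borel_measurable (lebesgue :: (real^'n) measure)"
proof -
  have "(\<lambda>x::real^'n. x $ i) \<in> borel_measurable borel"
    by (intro borel_measurable_continuous_onI continuous_intros)
  from measurable_compose[OF id_lebesgue_borel this] show ?thesis .
qed

lemma dcube_pred_measurable:
  assumes f[measurable]: "f \<in> M \<rightarrow>\<^sub>M (lebesgue :: (real^'n) measure)" and g[measurable]: "g \<in> M \<rightarrow>\<^sub>M (lebesgue :: (real^'n) measure)"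
  shows "Measurable.pred M (\<lambda>z. f z \<in> dcube k (g z))"
proof -
  note [measurable] = measurable_compose[OF f component_measurable] measurable_compose[OF g component_measurable]
  show ?thesis unfolding dcube_def mem_Collect_eq by measurable
qed

lemma dcube_sets: "dcube k (x::real^'n) \<in> sets lebesgue"
  using predE[OF dcube_pred_measurable[of "\<lambda>y. y" lebesgue "\<lambda>_. x" k]] by simp

lemma emeasure_dcube: "emeasure lebesgue (dcube k (x::real^'n)) = ennreal (1 / 2 ^ (k * CARD('n)))"
proof -
  define a :: "real^'n" where "a = (\<chi> i. real_of_int \<lfloor>2 ^ k * x $ i\<rfloor> / 2 ^ k)"
  define b :: "real^'n" where "b = (\<chi> i. (real_of_int \<lfloor>2 ^ k * x $ i\<rfloor> + 1) / 2 ^ k)"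
  have le: "a \<bullet> c \<le> b \<bullet> c" if "c \<in> Basis" for c
    using that by (auto simp: a_def b_def Basis_vec_def inner_axis divide_right_mono)
  have "(\<Prod>c\<in>Basis. (b - a) \<bullet> c) = (\<Prod>c\<in>(Basis :: (real^'n) set). 1 / 2 ^ k)"
    by (intro prod.cong) (auto simp: a_def b_def Basis_vec_def inner_axis diff_divide_distrib[symmetric])
  also have "\<dots> = 1 / 2 ^ (k * CARD('n))"
    by (simp add: power_one_over power_mult)
  finally have pr: "(\<Prod>c\<in>Basis. (b - a) \<bullet> c) = 1 / 2 ^ (k * CARD('n))" .
  have "emeasure lebesgue (dcube k x) \<le> emeasure lebesgue (cbox a b)"
    using dcube_box(2)[of k x] by (intro emeasure_mono) (auto simp: a_def b_def)
  moreover have "emeasure lebesgue (box a b) \<le> emeasure lebesgue (dcube k x)"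
    using dcube_box(1)[of k x] dcube_sets by (intro emeasure_mono) (auto simp: a_def b_def)
  ultimately show ?thesis
    using le pr by (intro antisym) auto
qed

text \<open>Jensen's inequality for averages; the tangent line of \<open>\<bar>t\<bar>\<^sup>q\<close> at the average comes from Young's inequality.\<close>

lemma average_powr_le:
  fixes f :: "'a \<Rightarrow> real"
  assumes q: "1 < q" and [measurable]: "f \<in> borel_measurable M" "S \<in> sets M"
    and S: "emeasure M S = ennreal m" "0 < m"
  shows "ennreal (\<bar>(LINT y|M. indicator S y * f y) / m\<bar> powr q)
    \<le> ennreal (1 / m) * (\<integral>\<^sup>+y. indicator S y * ennreal (\<bar>f y\<bar> powr q) \<partial>M)"
proof (cases "(\<integral>\<^sup>+y. indicator S y * ennreal (\<bar>f y\<bar> powr q) \<partial>M) < \<infinity>")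
  case False
  then show ?thesis using S(2) by (simp add: ennreal_mult_top not_less top_unique)
next
  case True
  define a where "a = (LINT y|M. indicator S y * f y) / m"
  have eq: "(\<integral>\<^sup>+y. indicator S y * ennreal (\<bar>f y\<bar> powr q) \<partial>M) = (\<integral>\<^sup>+y. ennreal (indicator S y * \<bar>f y\<bar> powr q) \<partial>M)"
    by (intro nn_integral_cong) (auto split: split_indicator)
  have int: "integrable M (\<lambda>y. indicator S y * \<bar>f y\<bar> powr q)"
    using True unfolding eq by (intro integrableI_nonneg) auto
  have intS: "integrable M (indicator S :: 'a \<Rightarrow> real)"
    using S by (intro integrable_real_indicator) auto
  have le1: "c \<le> 1 + c powr q" if "0 \<le> c" for c :: real
    using that q powr_mono[of 1 q c] by (cases "c \<le> 1") (auto simp: add_increasing2)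
  have intf: "integrable M (\<lambda>y. indicator S y * f y)"
    by (rule Bochner_Integration.integrable_bound[of M "\<lambda>y. indicator S y + indicator S y * \<bar>f y\<bar> powr q"])
      (use int intS le1 in \<open>auto split: split_indicator intro!: AE_I2\<close>)
  have tangent: "\<bar>t\<bar> powr q \<ge> q * (\<bar>a\<bar> powr (q - 2) * a) * t - (q - 1) * \<bar>a\<bar> powr q" for t
  proof (cases "a = 0")
    case False
    have "q * (\<bar>a\<bar> powr (q - 2) * a) * t \<le> q * (\<bar>t\<bar> * \<bar>a\<bar> powr (q - 1))"
    proof -
      have "(\<bar>a\<bar> powr (q - 2) * a) * t \<le> \<bar>(\<bar>a\<bar> powr (q - 2) * a) * t\<bar>" by simp
      also have "\<dots> = \<bar>t\<bar> * (\<bar>a\<bar> * \<bar>a\<bar> powr (q - 2))" by (simp add: abs_mult)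
      also have "\<dots> = \<bar>t\<bar> * \<bar>a\<bar> powr (q - 1)" using False by (simp add: powr_mult_base)
      finally show ?thesis using q by (simp add: mult.assoc)
    qed
    also have "\<bar>t\<bar> * \<bar>a\<bar> powr (q - 1) \<le> \<bar>t\<bar> powr q / q + (\<bar>a\<bar> powr (q - 1)) powr (q / (q - 1)) / (q / (q - 1))"
      using q by (intro Youngs_inequality) (auto simp: field_simps)
    also have "(\<bar>a\<bar> powr (q - 1)) powr (q / (q - 1)) = \<bar>a\<bar> powr q" using q by (simp add: powr_powr)
    finally have "q * (\<bar>a\<bar> powr (q - 2) * a) * t \<le> q * (\<bar>t\<bar> powr q / q + \<bar>a\<bar> powr q / (q / (q - 1)))"
      using q by simp
    also have "\<dots> = \<bar>t\<bar> powr q + (q - 1) * \<bar>a\<bar> powr q" using q by (simp add: field_simps)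
    finally show ?thesis by simp
  qed simp
  have "(LINT y|M. q * (\<bar>a\<bar> powr (q - 2) * a) * (indicator S y * f y) - (q - 1) * \<bar>a\<bar> powr q * indicator S y)
      \<le> (LINT y|M. indicator S y * \<bar>f y\<bar> powr q)"
    using int intS intf tangent
    by (intro integral_mono Bochner_Integration.integrable_diff integrable_mult_right) (auto split: split_indicator)
  also have "(LINT y|M. q * (\<bar>a\<bar> powr (q - 2) * a) * (indicator S y * f y) - (q - 1) * \<bar>a\<bar> powr q * indicator S y)
      = q * (\<bar>a\<bar> powr (q - 2) * a) * (m * a) - (q - 1) * \<bar>a\<bar> powr q * m"
    using intS intf S
    by (subst Bochner_Integration.integral_diff) (auto simp: a_def measure_def intro!: integrable_mult_right)
  also have "\<dots> = m * \<bar>a\<bar> powr q"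
  proof -
    have "\<bar>a\<bar> powr (q - 2) * a * a = \<bar>a\<bar> powr q"
      using powr_add[of "\<bar>a\<bar>" "q - 2" 2] by (simp add: powr_numeral power2_eq_square)
    then have "q * (\<bar>a\<bar> powr (q - 2) * a) * (m * a) = q * m * \<bar>a\<bar> powr q"
      by (metis (no_types, opaque_lifting) mult.assoc mult.commute)
    then show ?thesis by (simp add: algebra_simps)
  qed
  finally have "\<bar>a\<bar> powr q \<le> 1 / m * (LINT y|M. indicator S y * \<bar>f y\<bar> powr q)"
    using S(2) by (simp add: field_simps)
  then have "ennreal (\<bar>a\<bar> powr q) \<le> ennreal (1 / m) * ennreal (LINT y|M. indicator S y * \<bar>f y\<bar> powr q)"
    using S(2) by (simp add: ennreal_leI integral_nonneg_AE flip: ennreal_mult)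
  then show ?thesis
    unfolding eq a_def by (subst nn_integral_eq_integral[OF int]) auto
qed

lemma integrable_indicator_lp:
  fixes f :: "'a \<Rightarrow> real"
  assumes q: "1 < q" and [measurable]: "f \<in> borel_measurable M" "S \<in> sets M"
    and S: "emeasure M S < \<infinity>" and f: "integrable M (\<lambda>x. \<bar>f x\<bar> powr q)"
  shows "integrable M (\<lambda>x. indicator S x * f x)"
proof (rule Bochner_Integration.integrable_bound[of M "\<lambda>y. indicator S y + \<bar>f y\<bar> powr q"])
  have le1: "c \<le> 1 + c powr q" if "0 \<le> c" for c :: real
    using that q powr_mono[of 1 q c] by (cases "c \<le> 1") (auto simp: add_increasing2)
  show "AE x in M. norm (indicator S x * f x) \<le> norm (indicator S x + \<bar>f x\<bar> powr q)"
    using le1 by (auto split: split_indicator)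
  show "integrable M (\<lambda>y. indicator S y + \<bar>f y\<bar> powr q)"
    using S f by (auto intro!: integrable_real_indicator)
qed simp

lemma lp_energy_AE_subseq:
  fixes a :: "nat \<Rightarrow> 'a \<Rightarrow> real"
  assumes m: "\<And>n. a n \<in> borel_measurable M" and q: "0 < q"
    and fin: "\<And>n. lp_energy M q (a n) < \<infinity>" and lim: "(\<lambda>n. lp_energy M q (a n)) \<longlonglongrightarrow> 0"
  shows "\<exists>\<sigma>. strict_mono \<sigma> \<and> (AE x in M. (\<lambda>n. a (\<sigma> n) x) \<longlonglongrightarrow> 0)"
proof -
  have eq: "lp_energy M q (a n) = ennreal (LINT x|M. \<bar>a n x\<bar> powr q)" for n
    by (rule lp_energy_finite(2)[OF m fin])
  have "(\<lambda>n. LINT x|M. norm (\<bar>a n x\<bar> powr q)) \<longlonglongrightarrow> 0"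
    using lim unfolding eq by (simp add: integral_nonneg_AE flip: ennreal_0)
  then obtain \<sigma> where \<sigma>: "strict_mono \<sigma>" "AE x in M. (\<lambda>n. \<bar>a (\<sigma> n) x\<bar> powr q) \<longlonglongrightarrow> 0"
    using tendsto_L1_AE_subseq[of M "\<lambda>n x. \<bar>a n x\<bar> powr q"] lp_energy_finite(1)[OF m fin] by auto
  have "AE x in M. (\<lambda>n. a (\<sigma> n) x) \<longlonglongrightarrow> 0"
    using \<sigma>(2)
  proof eventually_elim
    case (elim x)
    have "(\<lambda>n. (\<bar>a (\<sigma> n) x\<bar> powr q) powr (1 / q)) \<longlonglongrightarrow> 0 powr (1 / q)"
      using q by (intro tendsto_powr' elim tendsto_const) auto
    then have "(\<lambda>n. \<bar>a (\<sigma> n) x\<bar>) \<longlonglongrightarrow> 0"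
      using q by (simp add: powr_powr)
    then show ?case by (simp add: tendsto_rabs_zero_iff)
  qed
  with \<sigma>(1) show ?thesis by blast
qed

lemma weighted_am_gm3:
  fixes x y z :: real
  assumes pos: "0 < x" "0 < y" "0 < z" and w: "0 \<le> \<alpha>" "0 \<le> \<beta>" "0 \<le> \<gamma>" "\<alpha> + \<beta> + \<gamma> = 1"
  shows "x powr \<alpha> * y powr \<beta> * z powr \<gamma> \<le> \<alpha> * x + \<beta> * y + \<gamma> * z"
proof -
  define S where "S = \<alpha> * x + \<beta> * y + \<gamma> * z"
  have S: "0 < S"
  proof -
    have "\<alpha> > 0 \<or> \<beta> > 0 \<or> \<gamma> > 0" using w by linarith
    moreover have "0 \<le> \<alpha> * x" "0 \<le> \<beta> * y" "0 \<le> \<gamma> * z" using pos w by simp_all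
    moreover have "\<alpha> > 0 \<Longrightarrow> 0 < \<alpha> * x" "\<beta> > 0 \<Longrightarrow> 0 < \<beta> * y" "\<gamma> > 0 \<Longrightarrow> 0 < \<gamma> * z" using pos by simp_all
    ultimately show ?thesis unfolding S_def by linarith
  qed
  have *: "ln t \<le> ln S + (t / S - 1)" if "0 < t" for t
    using ln_le_minus_one[of "t / S"] that S by (simp add: ln_div)
  have "\<alpha> * ln x + \<beta> * ln y + \<gamma> * ln z \<le> \<alpha> * (ln S + (x / S - 1)) + \<beta> * (ln S + (y / S - 1)) + \<gamma> * (ln S + (z / S - 1))"
    by (intro add_mono mult_left_mono * pos w)
  also have "\<dots> = (\<alpha> + \<beta> + \<gamma>) * (ln S - 1) + (\<alpha> * x + \<beta> * y + \<gamma> * z) / S"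
    by (simp add: algebra_simps add_divide_distrib)
  also have "\<dots> = ln S" using S w(4) by (simp flip: S_def)
  finally have "exp (\<alpha> * ln x + \<beta> * ln y + \<gamma> * ln z) \<le> S"
    using S by (simp add: ln_ge_iff)
  then show ?thesis using pos by (simp add: powr_def exp_add S_def)
qed

text \<open>
  A three-factor Hoelder inequality for the splitting
  \<open>m\<^sup>1\<^sup>/\<^sup>p = c\<^sup>-\<^sup>1\<^sup>/\<^sup>r \<sqdot> (m c)\<^sup>1\<^sup>/\<^sup>r \<sqdot> m\<^sup>1\<^sup>/\<^sup>p\<^sup>-\<^sup>1\<^sup>/\<^sup>r\<close>. The bound \<open>\<Sum>m \<le> 1\<close> removes the last factor, and what remains is linear in \<open>m\<close>,
  so that it can be integrated when \<open>m\<close> depends on a point.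
\<close>

lemma sum_powr_weighted_le:
  fixes m c :: "nat \<Rightarrow> real"
  assumes p: "1 < p" "p \<le> r" "p' = p / (p - 1)"
    and m: "\<And>k. k < K \<Longrightarrow> 0 \<le> m k" "(\<Sum>k<K. m k) \<le> 1" and c: "\<And>k. 0 < c k"
    and W: "(\<Sum>k<K. c k powr (- (p' / r))) \<le> W" "0 < W"
  shows "(\<Sum>k<K. m k powr (1 / p)) powr r \<le> W powr (r / p') * (\<Sum>k<K. m k * c k)"
proof -
  have p': "1 < p'" using p(1,3) by (rule conjugate_exponent_gt_1)
  have r: "0 < r" using p by simp
  define Z where "Z = (\<Sum>k<K. m k * c k)"
  have Z0: "0 \<le> Z" unfolding Z_def using m by (auto intro!: sum_nonneg mult_nonneg_nonneg less_imp_le[OF c])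
  show ?thesis
  proof (cases "Z = 0")
    case True
    then have "m k * c k = 0" if "k < K" for k
      using sum_nonneg_eq_0_iff[of "{..<K}" "\<lambda>k. m k * c k"] m c that
      by (auto simp: Z_def less_imp_le)
    then have "m k = 0" if "k < K" for k using that c by (metis mult_eq_0_iff less_irrefl)
    then have "(\<Sum>k<K. m k powr (1 / p)) = 0" by simp
    then show ?thesis using Z0 by (simp add: Z_def)
  next
    case False
    then have Z: "0 < Z" using Z0 by simp
    define A where "A = W powr (1 / p') * Z powr (1 / r)"
    have A: "0 < A" using W Z by (simp add: A_def)
    have w: "0 \<le> 1 / p'" "0 \<le> 1 / r" "0 \<le> 1 / p - 1 / r" "1 / p' + 1 / r + (1 / p - 1 / r) = 1"
    proof -
      have "1 / p' = 1 - 1 / p" unfolding p(3) using p(1) by (simp add: field_simps)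
      then show "1 / p' + 1 / r + (1 / p - 1 / r) = 1" by simp
    qed (use p p' r in \<open>auto simp: frac_le\<close>)
    have "m k powr (1 / p) \<le> A * (1 / p' * (c k powr (- (p' / r)) / W) + 1 / r * (m k * c k / Z) + (1 / p - 1 / r) * m k)"
      if k: "k < K" for k
    proof (cases "m k = 0")
      case True
      then show ?thesis using A W p' c[of k] by simp
    next
      case False
      then have cube_osc: "0 < m k" using m(1)[OF k] by simp
      have "(c k powr (- (p' / r)) / W) powr (1 / p') * (m k * c k / Z) powr (1 / r) * m k powr (1 / p - 1 / r)
          = (c k powr (- (1 / r)) * c k powr (1 / r)) * (m k powr (1 / r) * m k powr (1 / p - 1 / r)) / A"
        using cube_osc c[of k] W Z p' by (simp add: powr_divide powr_mult powr_powr A_def)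
      also have "\<dots> = m k powr (1 / p) / A"
        using cube_osc c[of k] by (simp flip: powr_add)
      finally have "m k powr (1 / p) / A \<le> 1 / p' * (c k powr (- (p' / r)) / W) + 1 / r * (m k * c k / Z) + (1 / p - 1 / r) * m k"
        using weighted_am_gm3[OF _ _ cube_osc w, of "c k powr (- (p' / r)) / W" "m k * c k / Z"] cube_osc c[of k] W Z
        by simp
      then show ?thesis using A by (simp add: divide_le_eq mult.commute)
    qed
    then have "(\<Sum>k<K. m k powr (1 / p)) \<le> (\<Sum>k<K. A * (1 / p' * (c k powr (- (p' / r)) / W) + 1 / r * (m k * c k / Z) + (1 / p - 1 / r) * m k))"
      by (intro sum_mono) simp
    also have "\<dots> = A * (1 / p' * ((\<Sum>k<K. c k powr (- (p' / r))) / W) + 1 / r * (Z / Z) + (1 / p - 1 / r) * (\<Sum>k<K. m k))"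
    proof -
      have "(\<Sum>k<K. a0 * (a1 * (f k / w) + a2 * (g k / z) + a3 * h k))
          = a0 * (a1 * (sum f {..<K} / w) + a2 * (sum g {..<K} / z) + a3 * sum h {..<K})"
        for a0 a1 a2 a3 w z :: real and f g h :: "nat \<Rightarrow> real"
        by (simp add: sum.distrib sum_distrib_left sum_divide_distrib distrib_left)
      from this[of A "1 / p'" "\<lambda>k. c k powr (- (p' / r))" W "1 / r" "\<lambda>k. m k * c k" Z "1 / p - 1 / r" m]
      show ?thesis by (simp only: Z_def[symmetric])
    qed
    also have "\<dots> \<le> A * (1 / p' * 1 + 1 / r * 1 + (1 / p - 1 / r) * 1)"
      using A W Z m w by (intro mult_left_mono add_mono) auto
    also have "\<dots> = A" using w(4) by simp
    finally have "(\<Sum>k<K. m k powr (1 / p)) powr r \<le> A powr r"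
      using r by (intro powr_mono2) (auto intro!: sum_nonneg)
    also have "A powr r = W powr (r / p') * Z"
      using r Z W by (simp add: A_def powr_mult powr_powr)
    finally show ?thesis by (simp add: Z_def)
  qed
qed

text \<open>The indices with \<open>Q\<close> form an initial segment, and a geometric sum is at most twice its last term.\<close>

lemma geometric_sum_downward_closed:
  fixes b T :: real
  assumes b: "2 \<le> b" and T: "0 \<le> T" and A: "\<And>k. Q (Suc k) \<Longrightarrow> Q k" "\<And>k. Q k \<Longrightarrow> b ^ k \<le> T"
  shows "(\<Sum>k<K. if Q k then b ^ k else 0) \<le> 2 * T"
proof (induction K)
  case (Suc K)
  show ?case
  proof (cases "Q K")
    case True
    have geo: "(\<Sum>k<n. b ^ k) \<le> b ^ n" for n
    proof (induction n)
      case (Suc n)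
      have "2 * b ^ n \<le> b * b ^ n" using b by (intro mult_right_mono) auto
      then show ?case using Suc by simp
    qed simp
    have "Q k" if "k \<le> K" for k
      using that True by (induction k rule: inc_induct) (use A in auto)
    then have "(\<Sum>k<Suc K. if Q k then b ^ k else 0) = (\<Sum>k<Suc K. b ^ k)"
      by (intro sum.cong) auto
    also have "\<dots> \<le> 2 * b ^ K" using geo[of K] by simp
    also have "\<dots> \<le> 2 * T" using A(2)[OF True] by simp
    finally show ?thesis .
  qed (use Suc in simp)
qed (use T in simp)

context fractional_space
begin

abbreviation "leb \<equiv> (lebesgue :: (real^'n) measure)"

definition P' :: real where "P' = P / (P - 1)"

lemma P': "1 < P'" "P' \<le> 2" "0 < P'" "(P - 1) * P' = P" "P / P' = P - 1"
  using P_gt_2 by (auto simp: P'_def less_divide_eq divide_le_eq)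

text \<open>The reciprocal of the volume of a dyadic cube of generation \<open>k\<close>.\<close>

definition cn :: "nat \<Rightarrow> real" where "cn k = 2 ^ (k * N)"

lemma cn_pos: "0 < cn k" by (simp add: cn_def)

lemma emeasure_dcube': "emeasure leb (dcube k x) = ennreal (1 / cn k)"
  by (simp only: emeasure_dcube cn_def) (simp only: N_def)

lemma emeasure_dcube_finite: "emeasure leb (dcube k x) < \<infinity>"
  by (simp only: emeasure_dcube') simp

lemma measure_dcube: "measure leb (dcube k x) = 1 / cn k"
  unfolding measure_def emeasure_dcube' using cn_pos[of k] by simp

definition avg :: "nat \<Rightarrow> (real^'n \<Rightarrow> real) \<Rightarrow> real^'n \<Rightarrow> real" where
  "avg k u x = cn k * (LINT y|lebesgue. indicator (dcube k x) y * u y)"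

lemma avg_cong_cube: "y \<in> dcube k x \<Longrightarrow> avg k u y = avg k u x"
  by (simp add: avg_def dcube_eq)

lemma indicator_dcube_measurable:
  "(\<lambda>z. indicator (dcube k (fst z)) (snd z) :: real) \<in> borel_measurable leb2"
  "(\<lambda>z. indicator (dcube k (fst z)) (snd z) :: ennreal) \<in> borel_measurable leb2"
proof -
  have [measurable]: "Measurable.pred leb2 (\<lambda>z. snd z \<in> dcube k (fst z))"
    by (rule dcube_pred_measurable) measurable
  show "(\<lambda>z. indicator (dcube k (fst z)) (snd z) :: real) \<in> borel_measurable leb2"
    "(\<lambda>z. indicator (dcube k (fst z)) (snd z) :: ennreal) \<in> borel_measurable leb2"
    unfolding indicator_def by measurable
qed

lemma avg_measurable[measurable (raw)]:
  assumes [measurable]: "u \<in> borel_measurable lebesgue"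
  shows "avg k u \<in> borel_measurable leb"
proof -
  note [measurable] = indicator_dcube_measurable
  have "(\<lambda>(x, y). indicator (dcube k x) y * u y) \<in> borel_measurable leb2"
    unfolding case_prod_beta by measurable
  then show ?thesis unfolding avg_def[abs_def]
    using lebesgue.borel_measurable_lebesgue_integral by (intro borel_measurable_times) auto
qed

lemma avg_jensen:
  assumes [measurable]: "f \<in> borel_measurable lebesgue"
  shows "ennreal (\<bar>avg k f x\<bar> powr P) \<le> ennreal (cn k) * (\<integral>\<^sup>+y. indicator (dcube k x) y * ennreal (\<bar>f y\<bar> powr P) \<partial>lebesgue)"
  using average_powr_le[OF _ assms dcube_sets emeasure_dcube', of P k x] P_gt_2 cn_pos[of k]
  by (simp add: avg_def mult.commute)

text \<open>Fubini: the cube relation is symmetric and all cubes of a generation have the same volume.\<close>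

lemma nn_integral_avg:
  fixes g :: "real^'n \<Rightarrow> ennreal"
  assumes [measurable]: "g \<in> borel_measurable lebesgue"
  shows "(\<integral>\<^sup>+x. ennreal (cn k) * (\<integral>\<^sup>+y. indicator (dcube k x) y * g y \<partial>lebesgue) \<partial>lebesgue) = (\<integral>\<^sup>+y. g y \<partial>lebesgue)"
proof -
  note [measurable] = indicator_dcube_measurable
  have m: "(\<lambda>(x, y). indicator (dcube k x) y * g y) \<in> borel_measurable leb2"
    unfolding case_prod_beta by measurable
  have "(\<integral>\<^sup>+x. ennreal (cn k) * (\<integral>\<^sup>+y. indicator (dcube k x) y * g y \<partial>lebesgue) \<partial>lebesgue)
      = ennreal (cn k) * (\<integral>\<^sup>+x. \<integral>\<^sup>+y. indicator (dcube k x) y * g y \<partial>lebesgue \<partial>lebesgue)"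
    using lebesgue.borel_measurable_nn_integral[OF m] by (intro nn_integral_cmult) auto
  also have "(\<integral>\<^sup>+x. \<integral>\<^sup>+y. indicator (dcube k x) y * g y \<partial>lebesgue \<partial>lebesgue)
      = (\<integral>\<^sup>+y. \<integral>\<^sup>+x. indicator (dcube k x) y * g y \<partial>lebesgue \<partial>lebesgue)"
    using lebesgue_pair.Fubini'[OF m] by simp
  also have "\<dots> = (\<integral>\<^sup>+y. ennreal (1 / cn k) * g y \<partial>lebesgue)"
  proof (intro nn_integral_cong)
    fix y :: "real^'n"
    have "(\<integral>\<^sup>+x. indicator (dcube k x) y * g y \<partial>lebesgue) = (\<integral>\<^sup>+x. g y * indicator (dcube k y) x \<partial>lebesgue)"
      by (intro nn_integral_cong) (auto simp: dcube_sym[of y] split: split_indicator)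
    then show "(\<integral>\<^sup>+x. indicator (dcube k x) y * g y \<partial>lebesgue) = ennreal (1 / cn k) * g y"
      by (simp add: nn_integral_cmult_indicator dcube_sets emeasure_dcube' mult.commute del: emeasure_completion)
  qed
  also have "\<dots> = ennreal (1 / cn k) * (\<integral>\<^sup>+y. g y \<partial>lebesgue)" by (intro nn_integral_cmult) auto
  finally show ?thesis
    using cn_pos[of k] by (simp add: mult.assoc[symmetric] flip: ennreal_mult)
qed

lemma lp_energy_avg_le:
  assumes [measurable]: "u \<in> borel_measurable lebesgue"
  shows "lp_energy lebesgue P (avg k u) \<le> lp_energy lebesgue P u"
proof -
  have "lp_energy lebesgue P (avg k u) \<le> (\<integral>\<^sup>+x. ennreal (cn k) * (\<integral>\<^sup>+y. indicator (dcube k x) y * ennreal (\<bar>u y\<bar> powr P) \<partial>lebesgue) \<partial>lebesgue)"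
    unfolding lp_energy_def by (intro nn_integral_mono avg_jensen assms)
  then show ?thesis by (subst (asm) nn_integral_avg) (auto simp: lp_energy_def)
qed

lemma integrable_cube:
  fixes u :: "real^'n \<Rightarrow> real"
  assumes [measurable]: "u \<in> borel_measurable lebesgue" and "lp_energy lebesgue P u < \<infinity>"
  shows "integrable lebesgue (\<lambda>y. indicator (dcube k x) y * u y)"
  by (rule integrable_indicator_lp[of P])
    (use P_gt_2 lp_energy_finite(1)[OF assms] emeasure_dcube_finite assms dcube_sets in \<open>auto simp del: emeasure_completion\<close>)

lemma integrable_indicator_dcube: "integrable leb (indicator (dcube k x) :: real^'n \<Rightarrow> real)"
  by (intro integrable_real_indicator dcube_sets emeasure_dcube_finite)

lemma avg_diff:
  assumes "u \<in> borel_measurable lebesgue" "lp_energy lebesgue P u < \<infinity>"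
    and "v \<in> borel_measurable lebesgue" "lp_energy lebesgue P v < \<infinity>"
  shows "avg k (\<lambda>x. u x - v x) x = avg k u x - avg k v x"
  using integrable_cube[OF assms(1,2)] integrable_cube[OF assms(3,4)]
  by (simp add: avg_def right_diff_distrib)

lemma avg_minus_const:
  assumes "u \<in> borel_measurable lebesgue" "lp_energy lebesgue P u < \<infinity>"
  shows "avg k (\<lambda>y. u y - c) x = avg k u x - c"
proof -
  have "(LINT y|lebesgue. indicator (dcube k x) y * (u y - c)) = (LINT y|lebesgue. indicator (dcube k x) y * u y - c * indicator (dcube k x) y)"
    by (intro Bochner_Integration.integral_cong) (auto simp: algebra_simps)
  also have "\<dots> = (LINT y|lebesgue. indicator (dcube k x) y * u y) - c * (1 / cn k)"
    using integrable_cube[OF assms] integrable_indicator_dcube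
    by (subst Bochner_Integration.integral_diff) (auto simp: measure_dcube simp del: measure_completion)
  finally show ?thesis using cn_pos[of k] by (simp add: avg_def right_diff_distrib)
qed

text \<open>
  Two points of a cube of generation \<open>k\<close> have distance at most \<open>N 2\<^sup>-\<^sup>k\<close>, so there the kernel \<open>\<bar>x - y\<bar>\<^sup>-\<^sup>2\<^sup>N\<close> dominates the squared
  reciprocal of the volume.
\<close>

lemma osc_pointwise:
  assumes "snd z \<in> dcube k (fst z)"
  shows "cn k ^ 2 * \<bar>u (fst z) - u (snd z)\<bar> powr P \<le> real N ^ (2 * N) * \<bar>dq u z\<bar> powr P"
proof (cases "fst z = snd z")
  case False
  define n where "n = norm (fst z - snd z)"
  have n: "0 < n" using False by (simp add: n_def)
  have "2 ^ k * n \<le> real N" using dcube_norm_le[OF assms] by (simp add: n_def N_def field_simps)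
  then have "(2 ^ k * n) ^ (2 * N) \<le> real N ^ (2 * N)" using n by (intro power_mono) auto
  also have "(2 ^ k * n) ^ (2 * N) = cn k ^ 2 * n ^ (2 * N)"
    by (simp add: cn_def power_mult_distrib power_mult[symmetric] mult_ac)
  finally have "cn k ^ 2 \<le> real N ^ (2 * N) / n ^ (2 * N)" using n by (simp add: le_divide_eq)
  then have "cn k ^ 2 * \<bar>u (fst z) - u (snd z)\<bar> powr P \<le> real N ^ (2 * N) / n ^ (2 * N) * \<bar>u (fst z) - u (snd z)\<bar> powr P"
    by (intro mult_right_mono) auto
  then show ?thesis by (simp add: dq_powr n_def N_def)
qed (simp add: dq_def)

text \<open>
  By Jensen's inequality \<open>\<bar>u - avg k u\<bar>\<^sup>P\<close> is at most the average of \<open>\<bar>u x - u y\<bar>\<^sup>P\<close> over the cube of \<open>x\<close>. The kernel exceeds the weight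
  \<open>cn k\<close> of this average by a further factor of order \<open>cn k\<close> on pairs in a common cube.
\<close>

lemma avg_approx:
  assumes [measurable]: "u \<in> borel_measurable lebesgue" and f: "lp_energy lebesgue P u < \<infinity>"
  shows "lp_energy lebesgue P (\<lambda>x. u x - avg k u x) \<le> ennreal (real N ^ (2 * N) / cn k) * gagliardo_energy s u"
proof -
  note [measurable] = indicator_dcube_measurable
  have m: "(\<lambda>z. indicator (dcube k (fst z)) (snd z) * ennreal (\<bar>u (fst z) - u (snd z)\<bar> powr P)) \<in> borel_measurable leb2"
    by measurable
  have "lp_energy lebesgue P (\<lambda>x. u x - avg k u x)
      \<le> (\<integral>\<^sup>+x. ennreal (cn k) * (\<integral>\<^sup>+y. indicator (dcube k x) y * ennreal (\<bar>u x - u y\<bar> powr P) \<partial>lebesgue) \<partial>lebesgue)"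
    unfolding lp_energy_def
  proof (intro nn_integral_mono)
    fix x
    have "u x - avg k u x = - avg k (\<lambda>y. u y - u x) x"
      by (simp add: avg_minus_const[OF assms])
    then show "ennreal (\<bar>u x - avg k u x\<bar> powr P) \<le> ennreal (cn k) * (\<integral>\<^sup>+y. indicator (dcube k x) y * ennreal (\<bar>u x - u y\<bar> powr P) \<partial>lebesgue)"
      using avg_jensen[of "\<lambda>y. u y - u x" k x] by (simp add: abs_minus_commute)
  qed
  also have "\<dots> = ennreal (cn k) * (\<integral>\<^sup>+z. indicator (dcube k (fst z)) (snd z) * ennreal (\<bar>u (fst z) - u (snd z)\<bar> powr P) \<partial>leb2)"
    using lebesgue.borel_measurable_nn_integral_fst[OF m] lebesgue.nn_integral_fst[OF m]
    by (subst nn_integral_cmult) auto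
  also have "\<dots> \<le> ennreal (cn k) * (\<integral>\<^sup>+z. ennreal (real N ^ (2 * N) / cn k ^ 2) * ennreal (\<bar>dq u z\<bar> powr P) \<partial>leb2)"
  proof (intro mult_left_mono nn_integral_mono)
    fix z
    show "indicator (dcube k (fst z)) (snd z) * ennreal (\<bar>u (fst z) - u (snd z)\<bar> powr P)
        \<le> ennreal (real N ^ (2 * N) / cn k ^ 2) * ennreal (\<bar>dq u z\<bar> powr P)"
      using osc_pointwise[of z k u] cn_pos[of k]
      by (auto split: split_indicator simp: field_simps simp flip: ennreal_mult intro!: ennreal_leI)
  qed simp
  also have "\<dots> = ennreal (cn k) * (ennreal (real N ^ (2 * N) / cn k ^ 2) * gagliardo_energy s u)"
    by (subst nn_integral_cmult) (auto simp: gagliardo_eq lp_energy_def)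
  also have "\<dots> = ennreal (real N ^ (2 * N) / cn k) * gagliardo_energy s u"
    using cn_pos[of k] by (simp add: mult.assoc[symmetric] power2_eq_square flip: ennreal_mult)
  finally show ?thesis .
qed

end

section \<open>A Trudinger-Moser inequality\<close>

context fractional_space
begin

text \<open>
  The \<open>P\<close>-th power of the mean oscillation of \<open>u\<close> on the dyadic cube of generation \<open>k\<close> around \<open>x\<close>.
\<close>

definition cube_osc :: "(real^'n \<Rightarrow> real) \<Rightarrow> nat \<Rightarrow> real^'n \<Rightarrow> ennreal" where
  "cube_osc u k x = ennreal (cn k ^ 2) *
    (\<integral>\<^sup>+z. indicator (dcube k x \<times> dcube k x) z * ennreal (\<bar>u (fst z) - u (snd z)\<bar> powr P) \<partial>leb2)"

lemma indicator_dcube_times_measurable: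
  "(\<lambda>w. indicator (dcube k (fst w) \<times> dcube k (fst w)) (snd w) :: ennreal) \<in> borel_measurable (leb \<Otimes>\<^sub>M leb2)"
proof -
  have [measurable]: "Measurable.pred (leb \<Otimes>\<^sub>M leb2) (\<lambda>w. fst (snd w) \<in> dcube k (fst w))"
    "Measurable.pred (leb \<Otimes>\<^sub>M leb2) (\<lambda>w. snd (snd w) \<in> dcube k (fst w))"
    by (rule dcube_pred_measurable; measurable)+
  show ?thesis unfolding indicator_def mem_Times_iff by measurable
qed

lemma increment_measurable:
  assumes "u \<in> borel_measurable leb"
  shows "(\<lambda>z. ennreal (\<bar>u (fst z) - u (snd z)\<bar> powr P)) \<in> borel_measurable leb2"
  using measurable_pair_lebesgue(1,2)[OF assms] by measurable

lemma sigma_finite_leb2: "sigma_finite_measure leb2"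
  by (rule lebesgue_pair.sigma_finite_measure_axioms)

lemma cube_osc_measurable:
  assumes u: "u \<in> borel_measurable leb"
  shows "cube_osc u k \<in> borel_measurable leb"
proof -
  interpret l2: sigma_finite_measure leb2 by (rule sigma_finite_leb2)
  note [measurable] = indicator_dcube_times_measurable increment_measurable[OF u]
  have "(\<lambda>(x, z). indicator (dcube k x \<times> dcube k x) z * ennreal (\<bar>u (fst z) - u (snd z)\<bar> powr P)) \<in> borel_measurable (leb \<Otimes>\<^sub>M leb2)"
    unfolding case_prod_beta by measurable
  then show ?thesis unfolding cube_osc_def[abs_def]
    using sigma_finite_measure.borel_measurable_nn_integral[OF sigma_finite_leb2] by (intro borel_measurable_times_ennreal) auto
qed

definition C1 :: real where "C1 = 2 * real N ^ (2 * N)"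

lemma N_ge_2: "2 \<le> N" using dim by (simp add: N_def)

lemma C1_pos: "0 < C1" using N_ge_2 by (simp add: C1_def)

text \<open>
  A pair of points lies in a common cube only up to some generation, and the weights \<open>(cn k)\<^sup>2\<close> grow geometrically; so the sum is
  comparable to its last term, which the kernel controls.
\<close>

lemma osc_sum_le:
  "(\<Sum>k<K. ennreal (cn k ^ 2) * (indicator (dcube k (fst z)) (snd z) * ennreal (\<bar>u (fst z) - u (snd z)\<bar> powr P)))
    \<le> ennreal C1 * ennreal (\<bar>dq u z\<bar> powr P)"
proof -
  define t where "t = \<bar>u (fst z) - u (snd z)\<bar> powr P"
  have "(\<Sum>k<K. ennreal (cn k ^ 2) * (indicator (dcube k (fst z)) (snd z) * ennreal t))
      = ennreal (\<Sum>k<K. (if snd z \<in> dcube k (fst z) then cn k ^ 2 else 0) * t)"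
    by (subst sum_ennreal[symmetric]) (auto simp: t_def ennreal_mult intro!: sum.cong split: split_indicator)
  also have "(\<Sum>k<K. (if snd z \<in> dcube k (fst z) then cn k ^ 2 else 0) * t) \<le> C1 * \<bar>dq u z\<bar> powr P"
  proof (cases "t = 0")
    case False
    then have t: "0 < t" by (simp add: t_def)
    have cn2: "cn k ^ 2 = (4 ^ N) ^ k" for k
    proof -
      have "cn k ^ 2 = 2 ^ (2 * N * k)" by (simp only: cn_def power_mult[symmetric] mult_ac)
      moreover have "(4::real) ^ N = 2 ^ (2 * N)" by (simp add: power_mult)
      ultimately show ?thesis by (simp only: power_mult)
    qed
    have "(\<Sum>k<K. if snd z \<in> dcube k (fst z) then (4 ^ N) ^ k else 0) \<le> 2 * (real N ^ (2 * N) * \<bar>dq u z\<bar> powr P / t)"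
    proof (rule geometric_sum_downward_closed)
      show "(2::real) \<le> 4 ^ N" using N_ge_2 self_le_power[of "4::real" N] by simp
      show "0 \<le> real N ^ (2 * N) * \<bar>dq u z\<bar> powr P / t" using t by simp
      show "snd z \<in> dcube k (fst z)" if "snd z \<in> dcube (Suc k) (fst z)" for k
        using that dcube_Suc by blast
      show "(4 ^ N) ^ k \<le> real N ^ (2 * N) * \<bar>dq u z\<bar> powr P / t" if "snd z \<in> dcube k (fst z)" for k
        using osc_pointwise[OF that, of u] t by (simp add: cn2 t_def[symmetric] le_divide_eq)
    qed
    then have "(\<Sum>k<K. if snd z \<in> dcube k (fst z) then (4 ^ N) ^ k else 0) * t \<le> C1 * \<bar>dq u z\<bar> powr P"
      using t by (simp add: C1_def field_simps)
    then show ?thesis unfolding cn2 by (simp only: sum_distrib_right)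
  qed (simp add: C1_def)
  finally show ?thesis using C1_pos by (simp add: ennreal_leI t_def ennreal_mult less_imp_le)
qed

lemma osc_integral_sum_le:
  assumes u: "u \<in> borel_measurable leb"
  shows "(\<Sum>k<K. ennreal (cn k ^ 2) * (\<integral>\<^sup>+z. indicator (dcube k (fst z)) (snd z) * ennreal (\<bar>u (fst z) - u (snd z)\<bar> powr P) \<partial>leb2))
    \<le> ennreal C1 * gagliardo_energy s u"
proof -
  note [measurable] = indicator_dcube_measurable increment_measurable[OF u] dq_measurable[OF u]
  have "(\<Sum>k<K. ennreal (cn k ^ 2) * (\<integral>\<^sup>+z. indicator (dcube k (fst z)) (snd z) * ennreal (\<bar>u (fst z) - u (snd z)\<bar> powr P) \<partial>leb2))
    = (\<integral>\<^sup>+z. (\<Sum>k<K. ennreal (cn k ^ 2) * (indicator (dcube k (fst z)) (snd z) * ennreal (\<bar>u (fst z) - u (snd z)\<bar> powr P))) \<partial>leb2)"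
    by (subst nn_integral_sum) (auto simp: nn_integral_cmult intro!: sum.cong)
  also have "\<dots> \<le> (\<integral>\<^sup>+z. ennreal C1 * ennreal (\<bar>dq u z\<bar> powr P) \<partial>leb2)"
    by (intro nn_integral_mono osc_sum_le)
  also have "\<dots> = ennreal C1 * gagliardo_energy s u"
    by (subst nn_integral_cmult) (auto simp: gagliardo_eq lp_energy_def)
  finally show ?thesis .
qed

text \<open>
  The bound is uniform in the point: the cubes shrinking to \<open>x\<close> share the energy of \<open>u\<close>, each pair of points being
  charged a bounded multiple of its kernel.
\<close>

lemma cube_osc_sum_le:
  assumes u: "u \<in> borel_measurable leb"
  shows "(\<Sum>k<K. cube_osc u k x) \<le> ennreal C1 * gagliardo_energy s u"
proof -
  have "cube_osc u k x \<le> ennreal (cn k ^ 2) * (\<integral>\<^sup>+z. indicator (dcube k (fst z)) (snd z) * ennreal (\<bar>u (fst z) - u (snd z)\<bar> powr P) \<partial>leb2)" for k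
    unfolding cube_osc_def
    by (intro mult_left_mono nn_integral_mono mult_right_mono)
      (auto split: split_indicator dest: dcube_eq)
  then show ?thesis by (intro order_trans[OF sum_mono osc_integral_sum_le[OF u]]) auto
qed

text \<open>
  The factor \<open>cn k\<close> turns integration over \<open>x\<close> into a sum over the cubes of generation \<open>k\<close>; together with \<open>osc_integral_sum_le\<close> the mean
  oscillations are summable over all dyadic cubes.
\<close>

lemma nn_integral_cube_osc:
  assumes u: "u \<in> borel_measurable leb"
  shows "(\<integral>\<^sup>+x. ennreal (cn k) * cube_osc u k x \<partial>leb)
    = ennreal (cn k ^ 2) * (\<integral>\<^sup>+z. indicator (dcube k (fst z)) (snd z) * ennreal (\<bar>u (fst z) - u (snd z)\<bar> powr P) \<partial>leb2)"
proof -
  interpret l2: sigma_finite_measure leb2 by (rule sigma_finite_leb2)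
  interpret ll: pair_sigma_finite leb leb2 ..
  note [measurable] = indicator_dcube_times_measurable increment_measurable[OF u] indicator_dcube_measurable cube_osc_measurable[OF u]
  let ?g = "\<lambda>z. ennreal (\<bar>u (fst z) - u (snd z)\<bar> powr P)"
  have m: "(\<lambda>(x, z). indicator (dcube k x \<times> dcube k x) z * ?g z) \<in> borel_measurable (leb \<Otimes>\<^sub>M leb2)"
    unfolding case_prod_beta by measurable
  have "(\<integral>\<^sup>+x. ennreal (cn k) * cube_osc u k x \<partial>leb) = ennreal (cn k) * (ennreal (cn k ^ 2) *
      (\<integral>\<^sup>+x. \<integral>\<^sup>+z. indicator (dcube k x \<times> dcube k x) z * ?g z \<partial>leb2 \<partial>leb))"
    unfolding cube_osc_def using sigma_finite_measure.borel_measurable_nn_integral[OF sigma_finite_leb2 m]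
    by (simp add: nn_integral_cmult)
  also have "(\<integral>\<^sup>+x. \<integral>\<^sup>+z. indicator (dcube k x \<times> dcube k x) z * ?g z \<partial>leb2 \<partial>leb)
      = (\<integral>\<^sup>+z. \<integral>\<^sup>+x. indicator (dcube k x \<times> dcube k x) z * ?g z \<partial>leb \<partial>leb2)"
    using ll.Fubini'[OF m] by simp
  also have "\<dots> = (\<integral>\<^sup>+z. ennreal (1 / cn k) * (indicator (dcube k (fst z)) (snd z) * ?g z) \<partial>leb2)"
  proof (intro nn_integral_cong)
    fix z :: "(real^'n) \<times> (real^'n)"
    have "(\<integral>\<^sup>+x. indicator (dcube k x \<times> dcube k x) z * ?g z \<partial>leb)
      = (\<integral>\<^sup>+x. (indicator (dcube k (fst z)) (snd z) * ?g z) * indicator (dcube k (fst z)) x \<partial>leb)"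
    proof (intro nn_integral_cong)
      fix x
      show "indicator (dcube k x \<times> dcube k x) z * ?g z = (indicator (dcube k (fst z)) (snd z) * ?g z) * indicator (dcube k (fst z)) x"
      proof (cases "x \<in> dcube k (fst z)")
        case True
        have "dcube k x = dcube k (fst z)" by (rule dcube_eq[OF True])
        then show ?thesis by (simp add: indicator_def mem_Times_iff True)
      next
        case False
        then have "fst z \<notin> dcube k x" using dcube_sym by blast
        then show ?thesis using False by (auto simp: mem_Times_iff)
      qed
    qed
    then show "(\<integral>\<^sup>+x. indicator (dcube k x \<times> dcube k x) z * ?g z \<partial>leb) = ennreal (1 / cn k) * (indicator (dcube k (fst z)) (snd z) * ?g z)"
      by (simp only: nn_integral_cmult_indicator[OF dcube_sets] emeasure_dcube') (simp only: mult.commute)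
  qed
  also have "\<dots> = ennreal (1 / cn k) * (\<integral>\<^sup>+z. indicator (dcube k (fst z)) (snd z) * ?g z \<partial>leb2)"
    by (intro nn_integral_cmult) measurable
  also have "ennreal (cn k) * (ennreal (cn k ^ 2) * (ennreal (1 / cn k) * (\<integral>\<^sup>+z. indicator (dcube k (fst z)) (snd z) * ?g z \<partial>leb2)))
     = ennreal (cn k ^ 2) * (\<integral>\<^sup>+z. indicator (dcube k (fst z)) (snd z) * ?g z \<partial>leb2)"
    using cn_pos[of k] by (simp add: mult.assoc[symmetric] flip: ennreal_mult)
  finally show ?thesis .
qed

text \<open>
  Jensen's inequality twice, over the small and over the large cube; \<open>2\<^sup>N\<close> is the ratio of their volumes.
\<close>

lemma avg_step_le:
  assumes [measurable]: "u \<in> borel_measurable leb" and f: "lp_energy lebesgue P u < \<infinity>"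
  shows "ennreal (\<bar>avg (Suc k) u x - avg k u x\<bar> powr P) \<le> ennreal (2 ^ N) * cube_osc u k x"
proof -
  note [measurable] = indicator_dcube_measurable
  let ?g = "\<lambda>y z. ennreal (\<bar>u y - u z\<bar> powr P)"
  have m: "(\<lambda>z. indicator (dcube k x \<times> dcube k x) z * ?g (fst z) (snd z)) \<in> borel_measurable leb2"
  proof -
    have [measurable]: "dcube k x \<times> dcube k x \<in> sets leb2" by (intro pair_measureI dcube_sets)
    show ?thesis using increment_measurable[OF assms(1)] by measurable
  qed
  have "avg (Suc k) u x - avg k u x = avg (Suc k) (\<lambda>y. u y - avg k u x) x"
    by (simp add: avg_minus_const[OF assms])
  then have "ennreal (\<bar>avg (Suc k) u x - avg k u x\<bar> powr P)
      \<le> ennreal (cn (Suc k)) * (\<integral>\<^sup>+y. indicator (dcube (Suc k) x) y * ennreal (\<bar>u y - avg k u x\<bar> powr P) \<partial>leb)"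
    using avg_jensen[of "\<lambda>y. u y - avg k u x" "Suc k" x] by simp
  also have "\<dots> \<le> ennreal (cn (Suc k)) * (\<integral>\<^sup>+y. ennreal (cn k) * (\<integral>\<^sup>+z. indicator (dcube k x \<times> dcube k x) (y, z) * ?g y z \<partial>leb) \<partial>leb)"
  proof (intro mult_left_mono nn_integral_mono)
    fix y
    show "indicator (dcube (Suc k) x) y * ennreal (\<bar>u y - avg k u x\<bar> powr P)
        \<le> ennreal (cn k) * (\<integral>\<^sup>+z. indicator (dcube k x \<times> dcube k x) (y, z) * ?g y z \<partial>leb)"
    proof (cases "y \<in> dcube (Suc k) x")
      case True
      then have y: "y \<in> dcube k x" using dcube_Suc by blast
      have "avg k (\<lambda>z. u z - u y) x = avg k u x - u y" by (rule avg_minus_const[OF assms])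
      then have "ennreal (\<bar>u y - avg k u x\<bar> powr P) \<le> ennreal (cn k) * (\<integral>\<^sup>+z. indicator (dcube k x) z * ennreal (\<bar>u z - u y\<bar> powr P) \<partial>leb)"
        using avg_jensen[of "\<lambda>z. u z - u y" k x] by (simp add: abs_minus_commute)
      also have "(\<integral>\<^sup>+z. indicator (dcube k x) z * ennreal (\<bar>u z - u y\<bar> powr P) \<partial>leb)
          = (\<integral>\<^sup>+z. indicator (dcube k x \<times> dcube k x) (y, z) * ?g y z \<partial>leb)"
        using y by (intro nn_integral_cong) (auto split: split_indicator simp: abs_minus_commute)
      finally show ?thesis using True by simp
    qed simp
  qed simp
  also have "\<dots> = ennreal (cn (Suc k)) * (ennreal (cn k) * (\<integral>\<^sup>+z. indicator (dcube k x \<times> dcube k x) z * ?g (fst z) (snd z) \<partial>leb2))"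
    using lebesgue.borel_measurable_nn_integral_fst[OF m] lebesgue.nn_integral_fst[OF m]
    by (simp add: nn_integral_cmult)
  also have "\<dots> = ennreal (2 ^ N) * cube_osc u k x"
  proof -
    have "ennreal (cn (Suc k)) = ennreal (2 ^ N) * ennreal (cn k)"
      using cn_pos[of k] by (simp add: cn_def power_add flip: ennreal_mult)
    moreover have "ennreal (cn k ^ 2) = ennreal (cn k) * ennreal (cn k)"
      using cn_pos[of k] by (simp add: power2_eq_square ennreal_mult)
    ultimately show ?thesis by (simp only: cube_osc_def mult.assoc)
  qed
  finally show ?thesis .
qed

text \<open>
  The series is geometric, and its ratio approaches \<open>1\<close> as \<open>r\<close> grows. The resulting linear growth in \<open>r\<close> is the source of the
  factor \<open>r\<^sup>r\<^sup>/\<^sup>P\<^sup>'\<close> in the moment bound.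
\<close>

lemma cn_powr_sum_le:
  assumes r: "P \<le> r"
  shows "(\<Sum>k<K. cn k powr (- (P' / r))) \<le> 2 * r"
proof -
  have r2: "2 < r" using r P_gt_2 by simp
  define y where "y = 2 powr (- (real N * P' / r))"
  have "cn k powr (- (P' / r)) = y ^ k" for k
  proof -
    have "cn k = 2 powr (real k * real N)" by (simp add: cn_def powr_realpow flip: of_nat_mult)
    then have "cn k powr (- (P' / r)) = y powr real k" by (simp add: y_def powr_powr mult_ac)
    then show ?thesis by (simp add: powr_realpow y_def)
  qed
  moreover have y: "y \<le> r / (r + 1)"
  proof -
    have "1 / r \<le> real N * P' / r * ln 2"
    proof -
      have "1 \<le> 2 * (2 / 3 :: real)" by simp
      also have "\<dots> \<le> (real N * P') * ln 2"
        using N_ge_2 P' ln2_ge_two_thirds mult_mono[of 2 "real N" 1 P'] by (intro mult_mono) auto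
      finally show ?thesis using r2 by (simp add: divide_right_mono)
    qed
    then have "y \<le> exp (- (1 / r))" by (simp add: y_def powr_def)
    also have "\<dots> = 1 / exp (1 / r)" by (simp add: exp_minus inverse_eq_divide)
    also have "\<dots> \<le> 1 / (1 + 1 / r)"
      using r2 exp_ge_add_one_self[of "1 / r"] by (intro divide_left_mono) (auto intro!: mult_pos_pos add_pos_pos)
    finally show ?thesis using r2 by (simp add: field_simps)
  qed
  moreover have "(\<Sum>k<K. y ^ k) \<le> 1 / (1 - y)"
  proof -
    have "0 < y" by (simp add: y_def)
    moreover have y1: "y < 1" 
    proof -
      have "r / (r + 1) < 1" using r2 by simp
      with y show ?thesis by linarith
    qed
    ultimately show ?thesis by (simp add: sum_gp_strict divide_right_mono)
  qed
  moreover have "1 / (1 - y) \<le> r + 1"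
  proof -
    have "1 / (r + 1) = 1 - r / (r + 1)" using r2 by (simp add: field_simps)
    then have le: "1 / (r + 1) \<le> 1 - y" using y by linarith
    have pos: "0 < 1 / (r + 1)" using r2 by simp
    have "1 / (1 - y) \<le> 1 / (1 / (r + 1))"
    proof (rule divide_left_mono[OF le])
      show "0 < (1 - y) * (1 / (r + 1))" using pos le by (intro mult_pos_pos) linarith+
    qed simp
    then show ?thesis by simp
  qed
  ultimately show ?thesis using r2 by simp
qed

definition D1 :: real where "D1 = 8 * 2 powr s"

lemma D1_ge_1: "1 \<le> D1"
proof -
  have "1 \<le> 2 powr s" using s01 by (intro ge_one_powr_ge_zero) auto
  then show ?thesis unfolding D1_def by linarith
qed

text \<open>
  The averages telescope, and by \<open>avg_step_le\<close> each increment is at most \<open>2\<^sup>s m\<^sup>1\<^sup>/\<^sup>P\<close> with \<open>m\<close> the oscillation \<open>cube_osc\<close>. The oscillations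
  have sum at most \<open>1\<close> along the cubes around every point, and their integrals weighted with \<open>cn k\<close> have sum at most \<open>1\<close> as well;
  the weighted Hoelder inequality \<open>sum_powr_weighted_le\<close> combines the two bounds.
\<close>

lemma avg_moment_le:
  assumes u[measurable]: "u \<in> borel_measurable leb" and lp: "lp_energy lebesgue P u \<le> 1"
    and gag: "ennreal C1 * gagliardo_energy s u \<le> 1" and r: "P \<le> r"
  shows "(\<integral>\<^sup>+x. ennreal (\<bar>avg K u x\<bar> powr r) \<partial>leb) \<le> ennreal (D1 powr r * r powr (r / P'))"
proof -
  have f: "lp_energy lebesgue P u < \<infinity>" using lp by (rule le_less_trans) simp
  have r0: "0 < r" "2 < r" using r P_gt_2 by auto
  note [measurable] = cube_osc_measurable[OF u]
  have sum1: "(\<Sum>k<K. cube_osc u k x) \<le> 1" for x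
    using cube_osc_sum_le[OF u] gag by (rule order_trans)
  have fin: "cube_osc u k x < \<infinity>" if "k < K" for k x
  proof -
    have "cube_osc u k x \<le> (\<Sum>k<K. cube_osc u k x)" using that by (intro member_le_sum) auto
    then have "cube_osc u k x \<le> 1" using sum1[of x] by (rule order_trans)
    then show ?thesis by (rule le_less_trans) simp
  qed
  define m where "m k x = enn2real (cube_osc u k x)" for k x
  have cube_osc_eq: "cube_osc u k x = ennreal (m k x)" if "k < K" for k x
    using fin[OF that] by (simp add: m_def)
  have m0: "0 \<le> m k x" for k x by (simp add: m_def)
  have msum: "(\<Sum>k<K. m k x) \<le> 1" for x
  proof -
    have "ennreal (\<Sum>k<K. m k x) = (\<Sum>k<K. cube_osc u k x)"
      using m0 by (subst sum_ennreal[symmetric]) (auto simp: cube_osc_eq intro!: sum.cong)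
    then have "ennreal (\<Sum>k<K. m k x) \<le> ennreal 1" using sum1[of x] by (simp only: ennreal_1)
    then show ?thesis by (simp only: ennreal_le_iff zero_le_one)
  qed
  have step: "\<bar>avg (Suc k) u x - avg k u x\<bar> \<le> 2 powr s * m k x powr (1 / P)" if k: "k < K" for k x
  proof -
    have "ennreal (\<bar>avg (Suc k) u x - avg k u x\<bar> powr P) \<le> ennreal (2 ^ N * m k x)"
      using avg_step_le[OF u f, of k x] m0 by (simp add: cube_osc_eq[OF k] ennreal_mult)
    then have "\<bar>avg (Suc k) u x - avg k u x\<bar> powr P \<le> 2 ^ N * m k x"
      using m0 by (subst (asm) ennreal_le_iff) auto
    then have "(\<bar>avg (Suc k) u x - avg k u x\<bar> powr P) powr (1 / P) \<le> (2 ^ N * m k x) powr (1 / P)"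
      using P_gt_2 by (intro powr_mono2) auto
    also have "(2 ^ N * m k x) powr (1 / P) = 2 powr s * m k x powr (1 / P)"
    proof -
      have "(2::real) ^ N = 2 powr (s * P)" using powr_realpow[of 2 N] CARD_eq by (simp flip: N_def)
      then show ?thesis using P_gt_2 by (simp add: powr_mult powr_powr)
    qed
    finally show ?thesis using P_gt_2 by (simp add: powr_powr)
  qed
  have tele: "\<bar>avg n u x\<bar> \<le> \<bar>avg 0 u x\<bar> + 2 powr s * (\<Sum>k<n. m k x powr (1 / P))" if "n \<le> K" for n x
    using that
  proof (induction n)
    case (Suc n)
    then show ?case using step[of n x] by (simp add: distrib_left)
  qed simp
  have hold: "(\<Sum>k<K. m k x powr (1 / P)) powr r \<le> (2 * r) powr (r / P') * (\<Sum>k<K. m k x * cn k)" for x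
    using P_gt_2 r r0 m0 msum cn_pos cn_powr_sum_le[OF r] by (intro sum_powr_weighted_le) (auto simp: P'_def)
  have avg0: "\<bar>avg 0 u x\<bar> powr r \<le> \<bar>avg 0 u x\<bar> powr P" for x
  proof -
    have "ennreal (\<bar>avg 0 u x\<bar> powr P) \<le> ennreal (cn 0) * (\<integral>\<^sup>+y. indicator (dcube 0 x) y * ennreal (\<bar>u y\<bar> powr P) \<partial>lebesgue)"
      by (rule avg_jensen[OF u])
    also have "\<dots> \<le> 1 * lp_energy lebesgue P u"
      unfolding lp_energy_def by (intro mult_mono nn_integral_mono) (auto simp: cn_def split: split_indicator)
    also have "\<dots> \<le> ennreal 1" using lp by simp
    finally have "\<bar>avg 0 u x\<bar> powr P \<le> 1" by (simp only: ennreal_le_iff)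
    then have "\<bar>avg 0 u x\<bar> \<le> 1"
      using P_gt_2 by (metis abs_ge_zero gr_one_powr less_trans not_less zero_less_numeral)
    then show ?thesis using r by (cases "avg 0 u x = 0") (auto intro!: powr_mono')
  qed
  define B where "B = 2 powr (s * r) * (2 * r) powr (r / P')"
  have B: "0 \<le> B" by (simp add: B_def)
  have pw: "\<bar>avg K u x\<bar> powr r \<le> 2 powr r * (\<bar>avg 0 u x\<bar> powr P + B * (\<Sum>k<K. cn k * m k x))" for x
  proof -
    have "\<bar>avg K u x\<bar> powr r \<le> \<bar>\<bar>avg 0 u x\<bar> + 2 powr s * (\<Sum>k<K. m k x powr (1 / P))\<bar> powr r"
      using tele[of K x] r0 by (intro powr_mono2) auto
    also have "\<dots> \<le> 2 powr r * (\<bar>avg 0 u x\<bar> powr r + (2 powr s * (\<Sum>k<K. m k x powr (1 / P))) powr r)"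
      using abs_add_powr_le[of r "\<bar>avg 0 u x\<bar>" "2 powr s * (\<Sum>k<K. m k x powr (1 / P))"] r0 by (simp add: sum_nonneg)
    also have "(2 powr s * (\<Sum>k<K. m k x powr (1 / P))) powr r = 2 powr (s * r) * (\<Sum>k<K. m k x powr (1 / P)) powr r"
      by (simp add: powr_mult powr_powr)
    also have "\<dots> \<le> 2 powr (s * r) * ((2 * r) powr (r / P') * (\<Sum>k<K. m k x * cn k))"
      by (intro mult_left_mono hold) auto
    also have "\<dots> = B * (\<Sum>k<K. cn k * m k x)" by (simp add: B_def mult.commute mult.left_commute)
    finally show ?thesis using avg0[of x] by (simp add: mult_left_mono) (smt (verit) mult_left_mono powr_ge_zero)
  qed
  have "(\<integral>\<^sup>+x. ennreal (\<bar>avg K u x\<bar> powr r) \<partial>leb)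
      \<le> (\<integral>\<^sup>+x. ennreal (2 powr r) * (ennreal (\<bar>avg 0 u x\<bar> powr P) + ennreal B * (\<Sum>k<K. ennreal (cn k) * cube_osc u k x)) \<partial>leb)"
  proof (intro nn_integral_mono)
    fix x
    have "(\<Sum>k<K. ennreal (cn k) * cube_osc u k x) = ennreal (\<Sum>k<K. cn k * m k x)"
      using m0 cn_pos by (subst sum_ennreal[symmetric]) (auto simp: cube_osc_eq ennreal_mult less_imp_le intro!: sum.cong)
    then show "ennreal (\<bar>avg K u x\<bar> powr r) \<le> ennreal (2 powr r) * (ennreal (\<bar>avg 0 u x\<bar> powr P) + ennreal B * (\<Sum>k<K. ennreal (cn k) * cube_osc u k x))"
      using pw[of x] B m0 cn_pos
      by (simp add: sum_nonneg less_imp_le flip: ennreal_mult ennreal_plus)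
  qed
  also have "\<dots> = ennreal (2 powr r) * (lp_energy lebesgue P (avg 0 u) + ennreal B * (\<Sum>k<K. \<integral>\<^sup>+x. ennreal (cn k) * cube_osc u k x \<partial>leb))"
    by (simp add: nn_integral_cmult nn_integral_add nn_integral_sum lp_energy_def)
  also have "(\<Sum>k<K. \<integral>\<^sup>+x. ennreal (cn k) * cube_osc u k x \<partial>leb) \<le> 1"
    unfolding nn_integral_cube_osc[OF u] using osc_integral_sum_le[OF u] gag by (rule order_trans)
  also have "lp_energy lebesgue P (avg 0 u) \<le> 1" using lp_energy_avg_le[OF u] lp by (rule order_trans)
  finally have "(\<integral>\<^sup>+x. ennreal (\<bar>avg K u x\<bar> powr r) \<partial>leb) \<le> ennreal (2 powr r) * (1 + ennreal B * 1)"
    by (simp add: mult_left_mono add_mono)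
  also have "\<dots> = ennreal (2 powr r * (1 + B))"
    using B by (simp add: ennreal_mult)
  also have "\<dots> \<le> ennreal (D1 powr r * r powr (r / P'))"
  proof (intro ennreal_leI)
    have B1: "1 \<le> B"
    proof -
      have "1 \<le> 2 powr (s * r)" using s01 r0 by (intro ge_one_powr_ge_zero) auto
      moreover have "1 \<le> (2 * r) powr (r / P')" using r0 P' by (intro ge_one_powr_ge_zero) auto
      ultimately show ?thesis unfolding B_def by (metis mult_mono mult_1 zero_le_one order_trans)
    qed
    have e1: "(2 * r) powr (r / P') \<le> 2 powr r * r powr (r / P')"
    proof -
      have "r * 1 \<le> r * P'" using r0 P' by (intro mult_left_mono) auto
      then have "r / P' \<le> r" using P' by (simp add: divide_le_eq)
      then have "2 powr (r / P') \<le> 2 powr r" by simp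
      then show ?thesis using r0 by (simp add: powr_mult mult_right_mono)
    qed
    have "2 powr r * (1 + B) \<le> 2 powr r * (2 powr r * B)"
    proof -
      have "2 \<le> 2 powr r" using r0 powr_mono[of 1 r 2] by simp
      then have "2 * B \<le> 2 powr r * B" using B by (intro mult_right_mono) auto
      then have "1 + B \<le> 2 powr r * B" using B1 by linarith
      then show ?thesis by (intro mult_left_mono) auto
    qed
    also have "\<dots> \<le> 2 powr r * (2 powr r * (2 powr (s * r) * (2 powr r * r powr (r / P'))))"
      unfolding B_def by (intro mult_left_mono e1) auto
    also have "\<dots> = D1 powr r * r powr (r / P')"
    proof -
      have "D1 powr r = (2 * (2 * (2 powr s * 2))) powr r" by (simp add: D1_def)
      also have "\<dots> = 2 powr r * (2 powr r * (2 powr (s * r) * 2 powr r))"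
        by (simp only: powr_mult powr_powr)
      finally show ?thesis by (simp only: mult_ac)
    qed
    finally show "2 powr r * (1 + B) \<le> D1 powr r * r powr (r / P')" .
  qed
  finally show ?thesis .
qed

definition K0 :: real where "K0 = D1 powr P * P powr (P - 1) * exp 1"
definition K1 :: real where "K1 = D1 powr P' * P * exp P"
definition \<beta>0 :: real where "\<beta>0 = 1 / (2 * K1)"

lemma K_pos: "0 < K0" "0 < K1" "0 < \<beta>0"
  using P_gt_2 D1_ge_1 by (auto simp: K0_def K1_def \<beta>0_def)

text \<open>The growth \<open>r\<^sup>r\<^sup>/\<^sup>P\<^sup>'\<close> of the moments is exactly what the factorials compensate when \<open>r = P + P' j\<close>.\<close>

lemma moment_coefficient_le:
  "\<beta>0 ^ j / fact j * (D1 powr (P + P' * j) * (P + P' * j) powr ((P + P' * j) / P')) \<le> K0 * (1 / 2) ^ j"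
proof -
  define x where "x = real j + 1"
  have x: "1 \<le> x" by (simp add: x_def)
  have e: "(P + P' * j) / P' = P - 1 + j" using P' by (simp add: add_divide_distrib)
  have "P + P' * j \<le> P * x"
    using P' P_gt_2 mult_right_mono[of P' P "real j"] by (simp add: x_def algebra_simps)
  then have "(P + P' * j) powr (P - 1 + j) \<le> (P * x) powr (P - 1 + j)"
    using P_gt_2 P' by (intro powr_mono2) auto
  also have "\<dots> = P powr (P - 1) * P ^ j * (x powr (P - 1) * x ^ j)"
    using P_gt_2 x by (simp add: powr_mult powr_add powr_realpow)
  also have "\<dots> \<le> P powr (P - 1) * P ^ j * (exp (j * (P - 1)) * (exp (j + 1) * fact j))"
  proof (intro mult_left_mono mult_mono)
    have "x \<le> exp (real j)" using exp_ge_add_one_self[of "real j"] by (simp add: x_def add.commute)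
    then have "x powr (P - 1) \<le> exp (real j) powr (P - 1)" using x P_gt_2 by (intro powr_mono2) auto
    then show "x powr (P - 1) \<le> exp (j * (P - 1))" by (simp add: powr_def mult.commute)
    have "x ^ j / fact j \<le> exp x" using x
    proof -
      have "(\<Sum>n\<in>{j}. inverse (fact n) *\<^sub>R x ^ n) \<le> (\<Sum>n. inverse (fact n) *\<^sub>R x ^ n)"
        using x by (intro sum_le_suminf summable_exp_generic) auto
      then show ?thesis by (simp add: exp_def divide_inverse mult.commute)
    qed
    then show "x ^ j \<le> exp (j + 1) * fact j" by (simp add: x_def divide_le_eq add.commute)
  qed (use x P_gt_2 in auto)
  also have "\<dots> = P powr (P - 1) * P ^ j * (exp (j * P) * exp 1 * fact j)"
    by (simp add: algebra_simps flip: exp_add)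
  finally have main: "(P + P' * j) powr (P - 1 + j) \<le> P powr (P - 1) * P ^ j * (exp (j * P) * exp 1 * fact j)" .
  have "\<beta>0 ^ j / fact j * (D1 powr (P + P' * j) * (P + P' * j) powr ((P + P' * j) / P'))
      \<le> \<beta>0 ^ j / fact j * (D1 powr (P + P' * j) * (P powr (P - 1) * P ^ j * (exp (j * P) * exp 1 * fact j)))"
    unfolding e using K_pos by (intro mult_left_mono main) auto
  also have "\<dots> = K0 * (\<beta>0 * K1) ^ j"
  proof -
    have "D1 powr (P + P' * j) = D1 powr P * (D1 powr P') ^ j"
      using D1_ge_1 by (simp add: powr_add powr_powr[symmetric] powr_realpow)
    moreover have "exp (j * P) = exp P ^ j" by (simp add: exp_of_nat_mult)
    ultimately show ?thesis by (simp add: K0_def K1_def power_mult_distrib)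
  qed
  also have "\<beta>0 * K1 = 1 / 2" using K_pos by (simp add: \<beta>0_def)
  finally show ?thesis .
qed

text \<open>Expand the exponential and sum the moments of order \<open>P + P' j\<close>.\<close>

lemma avg_exponential_le:
  assumes u[measurable]: "u \<in> borel_measurable leb" and lp: "lp_energy lebesgue P u \<le> 1"
    and gag: "ennreal C1 * gagliardo_energy s u \<le> 1"
  shows "(\<integral>\<^sup>+x. ennreal (\<bar>avg K u x\<bar> powr P * exp (\<beta>0 * \<bar>avg K u x\<bar> powr P')) \<partial>leb) \<le> ennreal (2 * K0)"
proof -
  have series: "(\<lambda>j. \<beta>0 ^ j / fact j * t powr (P + P' * j)) sums (t powr P * exp (\<beta>0 * t powr P'))" if "0 \<le> t" for t
  proof -
    have "(\<lambda>j. t powr P * ((\<beta>0 * t powr P') ^ j /\<^sub>R fact j)) sums (t powr P * exp (\<beta>0 * t powr P'))"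
      by (intro sums_mult exp_converges)
    moreover have "t powr P * ((\<beta>0 * t powr P') ^ j /\<^sub>R fact j) = \<beta>0 ^ j / fact j * t powr (P + P' * j)" for j
    proof (cases "t = 0")
      case False
      then show ?thesis using that
        by (simp add: powr_add powr_powr[symmetric] powr_realpow power_mult_distrib divide_inverse)
    qed simp
    ultimately show ?thesis by simp
  qed
  have "(\<integral>\<^sup>+x. ennreal (\<bar>avg K u x\<bar> powr P * exp (\<beta>0 * \<bar>avg K u x\<bar> powr P')) \<partial>leb)
      = (\<integral>\<^sup>+x. (\<Sum>j. ennreal (\<beta>0 ^ j / fact j) * ennreal (\<bar>avg K u x\<bar> powr (P + P' * j))) \<partial>leb)"
  proof (intro nn_integral_cong)
    fix x
    have "(\<Sum>j. ennreal (\<beta>0 ^ j / fact j * \<bar>avg K u x\<bar> powr (P + P' * j))) = ennreal (\<bar>avg K u x\<bar> powr P * exp (\<beta>0 * \<bar>avg K u x\<bar> powr P'))"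
      using K_pos by (intro suminf_ennreal_eq series) auto
    then show "ennreal (\<bar>avg K u x\<bar> powr P * exp (\<beta>0 * \<bar>avg K u x\<bar> powr P')) = (\<Sum>j. ennreal (\<beta>0 ^ j / fact j) * ennreal (\<bar>avg K u x\<bar> powr (P + P' * j)))"
      using K_pos by (simp only: ennreal_mult[symmetric] less_imp_le divide_nonneg_pos zero_le_power fact_gt_zero powr_ge_zero)
  qed
  also have "\<dots> = (\<Sum>j. ennreal (\<beta>0 ^ j / fact j) * (\<integral>\<^sup>+x. ennreal (\<bar>avg K u x\<bar> powr (P + P' * j)) \<partial>leb))"
    by (subst nn_integral_suminf) (auto simp: nn_integral_cmult)
  also have "\<dots> \<le> (\<Sum>j. ennreal (K0 * (1 / 2) ^ j))"
  proof (intro suminf_le)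
    fix j
    have "ennreal (\<beta>0 ^ j / fact j) * (\<integral>\<^sup>+x. ennreal (\<bar>avg K u x\<bar> powr (P + P' * j)) \<partial>leb)
        \<le> ennreal (\<beta>0 ^ j / fact j) * ennreal (D1 powr (P + P' * j) * (P + P' * j) powr ((P + P' * j) / P'))"
      using P' by (intro mult_left_mono avg_moment_le assms) auto
    also have "\<dots> \<le> ennreal (K0 * (1 / 2) ^ j)"
      using moment_coefficient_le[of j] K_pos D1_ge_1 by (simp add: ennreal_leI flip: ennreal_mult)
    finally show "ennreal (\<beta>0 ^ j / fact j) * (\<integral>\<^sup>+x. ennreal (\<bar>avg K u x\<bar> powr (P + P' * j)) \<partial>leb) \<le> ennreal (K0 * (1 / 2) ^ j)" .
  qed auto
  also have "\<dots> = ennreal (K0 * 2)"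
    using K_pos sums_mult[OF geometric_sums[of "1 / 2 :: real"], of K0]
    by (intro suminf_ennreal_eq) auto
  finally show ?thesis by (simp add: mult.commute)
qed

lemma lp_energy_approx_lim:
  assumes u: "u \<in> borel_measurable leb" and f: "lp_energy lebesgue P u < \<infinity>" "gagliardo_energy s u < \<infinity>"
  shows "(\<lambda>k. lp_energy lebesgue P (\<lambda>x. u x - avg k u x)) \<longlonglongrightarrow> 0"
    "lp_energy lebesgue P (\<lambda>x. u x - avg k u x) < \<infinity>"
proof -
  obtain g where g: "gagliardo_energy s u = ennreal g" "0 \<le> g" using f(2) by (cases "gagliardo_energy s u") auto
  have le: "lp_energy lebesgue P (\<lambda>x. u x - avg k u x) \<le> ennreal (real N ^ (2 * N) * g * (1 / 2 ^ N) ^ k)" for k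
  proof -
    have "1 / cn k = (1 / 2 ^ N) ^ k" by (simp add: cn_def power_one_over power_mult mult.commute[of k])
    then have "real N ^ (2 * N) / cn k = real N ^ (2 * N) * (1 / 2 ^ N) ^ k" by (simp add: divide_inverse)
    then show ?thesis using avg_approx[OF u f(1), of k] g by (simp add: mult_ac flip: ennreal_mult)
  qed
  have "(1 / 2 ^ N :: real) < 1" using N_ge_2 by simp
  then have "(\<lambda>k. real N ^ (2 * N) * g * (1 / 2 ^ N) ^ k) \<longlonglongrightarrow> real N ^ (2 * N) * g * 0"
    by (intro tendsto_mult tendsto_const LIMSEQ_realpow_zero) auto
  then have lim: "(\<lambda>k. ennreal (real N ^ (2 * N) * g * (1 / 2 ^ N) ^ k)) \<longlonglongrightarrow> 0"
    using tendsto_ennrealI by fastforce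
  show "(\<lambda>k. lp_energy lebesgue P (\<lambda>x. u x - avg k u x)) \<longlonglongrightarrow> 0"
    by (rule tendsto_sandwich[OF _ _ tendsto_const lim]) (use le in auto)
  show "lp_energy lebesgue P (\<lambda>x. u x - avg k u x) < \<infinity>"
    by (rule le_less_trans[OF le]) simp
qed

definition \<eta>0 :: real where "\<eta>0 = min V0 (1 / C1)"

lemma \<eta>0_pos: "0 < \<eta>0" using V0 C1_pos by (simp add: \<eta>0_def)

text \<open>
  The averages converge to \<open>u\<close> almost everywhere along a subsequence, and Fatou's lemma carries their bound over to \<open>u\<close>.
\<close>

theorem trudinger_moser:
  assumes u[measurable]: "u \<in> borel_measurable leb" and E: "E u \<le> ennreal \<eta>0"
  shows "(\<integral>\<^sup>+x. ennreal (\<bar>u x\<bar> powr P * exp (\<beta>0 * \<bar>u x\<bar> powr P')) \<partial>leb) \<le> ennreal (2 * K0)"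
proof -
  have "ennreal V0 * lp_energy lebesgue P u \<le> ennreal V0 * 1"
    using lp_le_E[OF u] E by (rule order_trans[OF order_trans]) (simp add: \<eta>0_def ennreal_leI)
  then have lp: "lp_energy lebesgue P u \<le> 1"
    using V0(1) by (subst (asm) ennreal_mult_le_mult_iff) auto
  have "gagliardo_energy s u \<le> E u" by (simp add: gagliardo_eq E_eq)
  then have g: "gagliardo_energy s u \<le> ennreal (1 / C1)"
    using E by (rule order_trans[OF order_trans]) (simp add: \<eta>0_def ennreal_leI)
  have "ennreal C1 * gagliardo_energy s u \<le> ennreal C1 * ennreal (1 / C1)"
    by (intro mult_left_mono g) simp
  also have "\<dots> = 1" using C1_pos by (simp flip: ennreal_mult)
  finally have gag: "ennreal C1 * gagliardo_energy s u \<le> 1" .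
  have f: "lp_energy lebesgue P u < \<infinity>" "gagliardo_energy s u < \<infinity>"
    using lp g by (auto intro: le_less_trans)
  obtain \<sigma> where \<sigma>: "AE x in leb. (\<lambda>n. u x - avg (\<sigma> n) u x) \<longlonglongrightarrow> 0"
    using lp_energy_AE_subseq[of "\<lambda>k x. u x - avg k u x" leb P] lp_energy_approx_lim[OF u f] P_gt_2
    by auto
  let ?g = "\<lambda>t. ennreal (\<bar>t\<bar> powr P * exp (\<beta>0 * \<bar>t\<bar> powr P'))"
  have "(\<integral>\<^sup>+x. ?g (u x) \<partial>leb) = (\<integral>\<^sup>+x. liminf (\<lambda>n. ?g (avg (\<sigma> n) u x)) \<partial>leb)"
  proof (intro nn_integral_cong_AE, use \<sigma> in eventually_elim)
    fix x assume "(\<lambda>n. u x - avg (\<sigma> n) u x) \<longlonglongrightarrow> 0"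
    then have "(\<lambda>n. avg (\<sigma> n) u x) \<longlonglongrightarrow> u x" 
      using tendsto_diff[OF tendsto_const[of "u x"], of "\<lambda>n. u x - avg (\<sigma> n) u x" 0] by simp
    then have "(\<lambda>n. ?g (avg (\<sigma> n) u x)) \<longlonglongrightarrow> ?g (u x)"
      using P_gt_2 P' by (intro tendsto_ennrealI tendsto_intros tendsto_powr') auto
    then show "?g (u x) = liminf (\<lambda>n. ?g (avg (\<sigma> n) u x))"
      using lim_imp_Liminf[OF trivial_limit_sequentially] by force
  qed
  also have "\<dots> \<le> liminf (\<lambda>n. \<integral>\<^sup>+x. ?g (avg (\<sigma> n) u x) \<partial>leb)"
    by (intro nn_integral_liminf) measurable
  also have "\<dots> \<le> ennreal (2 * K0)"
    using avg_exponential_le[OF u lp gag] by (intro Liminf_le) auto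
  finally show ?thesis .
qed

end

section \<open>Compactness\<close>

lemma diagonal_convergent_subsequence:
  fixes a :: "nat \<Rightarrow> 'i::countable \<Rightarrow> real"
  assumes "\<And>n i. \<bar>a n i\<bar> \<le> b i"
  shows "\<exists>\<sigma>. strict_mono (\<sigma> :: nat \<Rightarrow> nat) \<and> (\<forall>i. convergent (\<lambda>n. a (\<sigma> n) i))"
proof -
  interpret subseqs "\<lambda>m s. convergent (\<lambda>n. a (s n) (from_nat m))"
  proof
    fix m and \<tau> :: "nat \<Rightarrow> nat"
    have "bounded (range (\<lambda>n. a (\<tau> n) (from_nat m)))"
      using assms by (auto intro!: boundedI)
    then obtain l \<rho> where "strict_mono \<rho>" "((\<lambda>n. a (\<tau> n) (from_nat m)) \<circ> \<rho>) \<longlonglongrightarrow> l"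
      using bounded_imp_convergent_subsequence by blast
    then show "\<exists>\<rho>. strict_mono \<rho> \<and> convergent (\<lambda>n. a ((\<tau> \<circ> \<rho>) n) (from_nat m))"
      by (auto simp: convergent_def o_def)
  qed
  have "convergent (\<lambda>n. a (diagseq n) i)" for i
  proof -
    have "convergent (\<lambda>n. a ((diagseq \<circ> (+) (Suc (to_nat i))) n) (from_nat (to_nat i)))"
    proof (rule diagseq_holds)
      fix \<rho> \<tau> :: "nat \<Rightarrow> nat" and m
      assume "strict_mono \<rho>" "convergent (\<lambda>n. a (\<tau> n) (from_nat m))"
      then show "convergent (\<lambda>n. a ((\<tau> \<circ> \<rho>) n) (from_nat m))"
        using convergent_subseq_convergent[of "\<lambda>n. a (\<tau> n) (from_nat m)" \<rho>] by (simp add: o_def)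
    qed
    then have "convergent (\<lambda>n. a (diagseq (n + Suc (to_nat i))) i)" by (simp add: o_def add.commute)
    then show ?thesis by (subst (asm) convergent_ignore_initial_segment)
  qed
  then show ?thesis using subseq_diagseq by blast
qed

text \<open>The classical argument: a subsequence with summable increments converges almost everywhere, and Fatou's lemma does the rest.\<close>

lemma lp_energy_complete:
  fixes u :: "nat \<Rightarrow> 'a \<Rightarrow> real"
  assumes q: "0 < q" and m[measurable]: "\<And>n. u n \<in> borel_measurable M"
    and cauchy: "\<And>e::real. 0 < e \<Longrightarrow> \<exists>n0. \<forall>n\<ge>n0. \<forall>m\<ge>n0. lp_energy M q (\<lambda>x. u n x - u m x) \<le> ennreal e"
  shows "\<exists>v. v \<in> borel_measurable M \<and> (\<lambda>n. lp_energy M q (\<lambda>x. u n x - v x)) \<longlonglongrightarrow> 0"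
proof -
  define \<epsilon> where "\<epsilon> j = (1 / 2) ^ j / (2 powr q) ^ j" for j :: nat
  have \<epsilon>: "0 < \<epsilon> j" for j by (simp add: \<epsilon>_def)
  then have "\<forall>j. \<exists>n0. \<forall>n\<ge>n0. \<forall>m\<ge>n0. lp_energy M q (\<lambda>x. u n x - u m x) \<le> ennreal (\<epsilon> j)"
    using cauchy by blast
  then obtain \<nu> where \<nu>: "\<And>j n m. n \<ge> \<nu> j \<Longrightarrow> m \<ge> \<nu> j \<Longrightarrow> lp_energy M q (\<lambda>x. u n x - u m x) \<le> ennreal (\<epsilon> j)"
    by metis
  define \<tau> where "\<tau> j = (\<Sum>i\<le>j. \<nu> i) + j" for j
  have \<tau>: "\<nu> j \<le> \<tau> j" "\<tau> j \<le> \<tau> (Suc j)" "j \<le> \<tau> j" for j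
    using member_le_sum[of j "{..j}" \<nu>] by (auto simp: \<tau>_def)
  define d where "d j x = u (\<tau> (Suc j)) x - u (\<tau> j) x" for j x
  have [measurable]: "d j \<in> borel_measurable M" for j unfolding d_def[abs_def] by measurable
  have "(\<integral>\<^sup>+x. (\<Sum>j. ennreal ((2 powr q) ^ j) * ennreal (\<bar>d j x\<bar> powr q)) \<partial>M)
      = (\<Sum>j. ennreal ((2 powr q) ^ j) * lp_energy M q (d j))"
    unfolding lp_energy_def by (subst nn_integral_suminf) (auto simp: nn_integral_cmult)
  also have "\<dots> \<le> (\<Sum>j. ennreal ((1 / 2) ^ j))"
  proof (intro suminf_le)
    fix j
    have "lp_energy M q (d j) \<le> ennreal (\<epsilon> j)"
      unfolding d_def[abs_def] using \<tau>[of j] by (intro \<nu>) auto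
    then have "ennreal ((2 powr q) ^ j) * lp_energy M q (d j) \<le> ennreal ((2 powr q) ^ j) * ennreal (\<epsilon> j)"
      by (intro mult_left_mono) auto
    also have "\<dots> = ennreal ((1 / 2) ^ j)" by (simp add: \<epsilon>_def flip: ennreal_mult)
    finally show "ennreal ((2 powr q) ^ j) * lp_energy M q (d j) \<le> ennreal ((1 / 2) ^ j)" .
  qed auto
  also have "\<dots> = ennreal 2"
    using geometric_sums[of "1 / 2 :: real"] by (intro suminf_ennreal_eq) auto
  also have "\<dots> < \<infinity>" by simp
  finally have "AE x in M. (\<Sum>j. ennreal ((2 powr q) ^ j) * ennreal (\<bar>d j x\<bar> powr q)) \<noteq> \<infinity>"
    by (intro nn_integral_noteq_infinite) auto
  then have conv: "AE x in M. convergent (\<lambda>j. u (\<tau> j) x)"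
  proof eventually_elim
    case (elim x)
    define b where "b j = (2 powr q) ^ j * \<bar>d j x\<bar> powr q" for j
    have "(\<Sum>j. ennreal (b j)) \<noteq> top" using elim by (simp add: b_def ennreal_mult)
    then have "summable b" by (intro summable_suminf_not_top) (auto simp: b_def)
    then have "b \<longlonglongrightarrow> 0" by (rule summable_LIMSEQ_zero)
    then have "\<forall>\<^sub>F j in sequentially. b j < 1" by (intro order_tendstoD) auto
    then have "\<forall>\<^sub>F j in sequentially. norm (d j x) \<le> (1 / 2) ^ j"
    proof eventually_elim
      case (elim j)
      have "(2 ^ j * \<bar>d j x\<bar>) powr q = b j"
        by (simp add: b_def powr_mult powr_powr powr_realpow[symmetric] mult.commute)
      then have "(2 ^ j * \<bar>d j x\<bar>) powr q < 1" using elim by simp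
      then have "2 ^ j * \<bar>d j x\<bar> < 1"
        using ge_one_powr_ge_zero[of "2 ^ j * \<bar>d j x\<bar>" q] q by linarith
      then show ?case by (simp add: power_one_over field_simps)
    qed
    then have "summable (\<lambda>j. d j x)"
      by (rule summable_comparison_test_ev) (auto intro: summable_geometric)
    then have "convergent (\<lambda>n. \<Sum>j<n. d j x)" by (simp add: summable_iff_convergent)
    then have "convergent (\<lambda>n. u (\<tau> 0) x + (\<Sum>j<n. d j x))" by (rule convergent_add[OF convergent_const])
    moreover have "u (\<tau> 0) x + (\<Sum>j<n. d j x) = u (\<tau> n) x" for n
      using sum_lessThan_telescope[of "\<lambda>j. u (\<tau> j) x" n] by (simp add: d_def)
    ultimately show ?case by simp
  qed
  define v where "v x = lim (\<lambda>j. u (\<tau> j) x)" for x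
  have [measurable]: "v \<in> borel_measurable M" unfolding v_def[abs_def] by measurable
  have v: "AE x in M. (\<lambda>j. u (\<tau> j) x) \<longlonglongrightarrow> v x"
    using conv by eventually_elim (simp add: v_def convergent_LIMSEQ_iff)
  have "(\<lambda>n. lp_energy M q (\<lambda>x. u n x - v x)) \<longlonglongrightarrow> 0"
  proof (rule order_tendstoI)
    fix e :: ennreal assume "0 < e"
    then obtain e' where e': "0 < e'" "e' < e" using dense by blast
    obtain e'' where e'': "0 < e''" "ennreal e'' = e'"
    proof -
      have "e' < top" using e'(2) less_le_trans top_greatest by blast
      then show ?thesis using that[of "enn2real e'"] e'(1) by (simp add: enn2real_positive_iff)
    qed
    obtain n0 where n0: "\<And>n m. n \<ge> n0 \<Longrightarrow> m \<ge> n0 \<Longrightarrow> lp_energy M q (\<lambda>x. u n x - u m x) \<le> ennreal e''"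
      using cauchy[OF e''(1)] by blast
    have "lp_energy M q (\<lambda>x. u n x - v x) < e" if "n \<ge> n0" for n
    proof -
      have "lp_energy M q (\<lambda>x. u n x - v x) \<le> liminf (\<lambda>j. lp_energy M q (\<lambda>x. u n x - u (\<tau> j) x))"
        by (rule lp_energy_fatou[OF _ q]) (use v in \<open>auto elim!: eventually_mono intro!: tendsto_intros\<close>)
      also have "\<dots> \<le> limsup (\<lambda>j. lp_energy M q (\<lambda>x. u n x - u (\<tau> j) x))"
        by (rule Liminf_le_Limsup) simp
      also have "\<dots> \<le> e'"
      proof (rule Limsup_bounded)
        show "\<forall>\<^sub>F j in sequentially. lp_energy M q (\<lambda>x. u n x - u (\<tau> j) x) \<le> e'"
          unfolding eventually_sequentially e''(2)[symmetric]
          using n0[OF that] \<tau>(3) by (meson le_trans)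
      qed
      finally show ?thesis using e'(2) by simp
    qed
    then show "\<forall>\<^sub>F n in sequentially. lp_energy M q (\<lambda>x. u n x - v x) < e"
      by (auto simp: eventually_sequentially)
  qed simp
  then show ?thesis by (intro exI[of _ v]) simp
qed

context fractional_space
begin

text \<open>
  Cubes of generation at least \<open>k0\<close> fit into balls of the radius \<open>r\<close> of \<open>cond_V2\<close>. Split \<open>w\<close> according to \<open>V > c\<close> and \<open>V \<le> c\<close>. The first part is small in
  \<open>L\<^sup>P\<close>, since the energy controls \<open>\<integral>V \<bar>w\<bar>\<^sup>P\<close>. The second part occupies a small portion of each cube far out, so that Jensen's
  inequality on that portion leaves a small factor. The radius depends on \<open>k\<close>, but not on \<open>w\<close>.
\<close>

lemma avg_tail:
  assumes V2: "cond_V2 V" and K: "0 \<le> K" and e: "0 < e"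
  shows "\<exists>k0. \<forall>k\<ge>k0. \<exists>R. \<forall>w. w \<in> borel_measurable leb \<and> E w \<le> ennreal K \<longrightarrow>
    (\<integral>\<^sup>+x. indicator {x. R \<le> norm x} x * ennreal (\<bar>avg k w x\<bar> powr P) \<partial>leb) \<le> ennreal e"
proof -
  obtain r where r: "0 < r" "\<And>c. 0 < c \<Longrightarrow> ((\<lambda>y. measure lebesgue {x \<in> ball y r. V x \<le> c}) \<longlongrightarrow> 0) at_infinity"
    using V2 by (auto simp: cond_V2_def)
  obtain k0 where k0: "real N / r < 2 ^ k0" using real_arch_pow[of 2] by auto
  have sub: "dcube k x \<subseteq> ball x r" if "k0 \<le> k" for k and x :: "real^'n"
  proof
    fix y assume "y \<in> dcube k x"
    then have "norm (x - y) \<le> real N / 2 ^ k" by (simp add: dcube_norm_le N_def)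
    also have "\<dots> \<le> real N / 2 ^ k0" using that by (intro divide_left_mono power_increasing) auto
    also have "\<dots> < r" using k0 r(1) by (simp add: field_simps)
    finally show "y \<in> ball x r" by (simp add: dist_norm)
  qed
  show ?thesis
  proof (intro exI[of _ k0] allI impI)
    fix k assume k: "k0 \<le> k"
    \<comment> \<open>The constants make each of the two contributions at most \<open>e/2\<close>.\<close>
    define c where "c = 2 * 2 powr P * (K + 1) / e"
    have c: "0 < c" using K e by (simp add: c_def)
    define \<eta> where "\<eta> = (e * V0 / (2 * 2 powr P * (K + 1))) powr (1 / (P - 1)) / cn k"
    have \<eta>: "0 < \<eta>" using K e V0 cn_pos[of k] by (simp add: \<eta>_def)
    have \<eta>P: "(cn k * \<eta>) powr (P - 1) = e * V0 / (2 * 2 powr P * (K + 1))"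
      using K e V0 cn_pos[of k] P_gt_2 by (simp add: \<eta>_def powr_powr)
    have "\<forall>\<^sub>F y in at_infinity. measure lebesgue {x \<in> ball y r. V x \<le> c} < \<eta>"
      using r(2)[OF c] \<eta> by (rule order_tendstoD)
    then obtain R where R: "\<And>y. R \<le> norm y \<Longrightarrow> measure lebesgue {x \<in> ball y r. V x \<le> c} < \<eta>"
      by (auto simp: eventually_at_infinity)
    define H where "H = {x. c < V x}"
    have H[measurable]: "H \<in> sets leb"
    proof -
      have "{x \<in> space leb. c < V x} \<in> sets leb" by measurable
      then show ?thesis by (simp add: H_def)
    qed
    show "\<exists>R. \<forall>w. w \<in> borel_measurable leb \<and> E w \<le> ennreal K \<longrightarrow>
      (\<integral>\<^sup>+x. indicator {x. R \<le> norm x} x * ennreal (\<bar>avg k w x\<bar> powr P) \<partial>leb) \<le> ennreal e"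
    proof (intro exI[of _ R] allI impI)
      fix w :: "real^'n \<Rightarrow> real" assume "w \<in> borel_measurable leb \<and> E w \<le> ennreal K"
      then have w[measurable]: "w \<in> borel_measurable leb" and Ew: "E w \<le> ennreal K" by auto
      have Ef: "E w < \<infinity>" using Ew by (rule le_less_trans) simp
      have lpV: "ennreal V0 * lp_energy leb P w \<le> ennreal K" using lp_le_E[OF w] Ew by (rule order_trans)
      have lpf: "lp_energy leb P w < \<infinity>"
      proof -
        have "ennreal V0 * lp_energy leb P w < top" using lpV by (rule le_less_trans) simp
        then show ?thesis using V0(1) by (auto simp: ennreal_mult_less_top)
      qed
      define w1 where "w1 x = indicator H x * w x" for x
      define w2 where "w2 x = w x - w1 x" for x
      have [measurable]: "w1 \<in> borel_measurable leb" "w2 \<in> borel_measurable leb"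
        unfolding w1_def[abs_def] w2_def[abs_def] by measurable
      have lp1: "ennreal c * lp_energy leb P w1 \<le> ennreal K"
      proof -
        have "ennreal c * lp_energy leb P w1 = (\<integral>\<^sup>+x. ennreal c * ennreal (\<bar>w1 x\<bar> powr P) \<partial>leb)"
          unfolding lp_energy_def by (subst nn_integral_cmult) auto
        also have "\<dots> \<le> lp_energy leb P (vq w)"
          unfolding lp_energy_def vq_powr using c
          by (intro nn_integral_mono)
            (auto simp: w1_def H_def less_imp_le[OF V_pos] split: split_indicator simp flip: ennreal_mult intro!: ennreal_leI mult_right_mono)
        also have "\<dots> \<le> ennreal K" using Ew by (rule order_trans[rotated]) (simp add: E_eq)
        finally show ?thesis .
      qed
      have lp1f: "lp_energy leb P w1 < \<infinity>"
        by (rule le_less_trans[OF lp_energy_mono_AE[of _ w] lpf])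
          (use P_gt_2 in \<open>auto simp: w1_def split: split_indicator\<close>)
      have far: "ennreal (\<bar>avg k w2 x\<bar> powr P) \<le> ennreal ((cn k * \<eta>) powr (P - 1)) *
          (ennreal (cn k) * (\<integral>\<^sup>+y. indicator (dcube k x) y * ennreal (\<bar>w y\<bar> powr P) \<partial>leb))"
        if x: "R \<le> norm x" for x
      proof -
        define S where "S = dcube k x - H"
        have S[measurable]: "S \<in> sets leb" unfolding S_def by (rule sets.Diff[OF dcube_sets H])
        have Sfin: "emeasure leb S < \<infinity>"
          using emeasure_mono[of S "dcube k x" leb] dcube_sets emeasure_dcube_finite[of k x]
          by (auto simp: S_def simp del: emeasure_completion intro: le_less_trans)
        define \<mu> where "\<mu> = measure leb S"
        have S\<mu>: "emeasure leb S = ennreal \<mu>"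
          using Sfin by (simp add: \<mu>_def emeasure_eq_ennreal_measure less_top del: emeasure_completion measure_completion)
        have \<mu>\<eta>: "\<mu> \<le> \<eta>"
        proof -
          have fm: "{y \<in> ball x r. V y \<le> c} \<in> lmeasurable"
          proof (rule fmeasurableI2[OF lmeasurable_ball])
            have eq: "{y \<in> ball x r. V y \<le> c} = ball x r - H" by (auto simp: H_def)
            show "{y \<in> ball x r. V y \<le> c} \<in> sets leb" unfolding eq by (intro sets.Diff H) simp
          qed auto
          have "\<mu> \<le> measure leb {y \<in> ball x r. V y \<le> c}"
            unfolding \<mu>_def
            by (rule measure_mono_fmeasurable[OF _ S fm]) (use sub[OF k, of x] in \<open>auto simp: S_def H_def\<close>)
          then show ?thesis using R[OF x] by simp
        qed
        have eq: "(LINT y|leb. indicator (dcube k x) y * w2 y) = (LINT y|leb. indicator S y * w y)"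
          by (intro Bochner_Integration.integral_cong) (auto simp: w2_def w1_def S_def split: split_indicator)
        show ?thesis
        proof (cases "\<mu> = 0")
          case True
          then have "AE y in leb. indicator S y * w y = 0"
            using S\<mu> by (intro AE_I[of _ _ S]) (auto split: split_indicator_asm simp del: emeasure_completion)
          then have "(LINT y|leb. indicator S y * w y) = (LINT y|leb. 0)"
            by (intro integral_cong_AE) auto
          then show ?thesis by (simp add: avg_def eq)
        next
          case False
          then have \<mu>: "0 < \<mu>" by (simp add: \<mu>_def zero_less_measure_iff del: measure_completion)
          have "avg k w2 x = cn k * \<mu> * ((LINT y|leb. indicator S y * w y) / \<mu>)"
            using \<mu> by (simp add: avg_def eq)
          then have "\<bar>avg k w2 x\<bar> powr P = (cn k * \<mu>) powr P * \<bar>(LINT y|leb. indicator S y * w y) / \<mu>\<bar> powr P"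
            using \<mu> cn_pos[of k] by (simp only: abs_mult powr_mult)
          then have "ennreal (\<bar>avg k w2 x\<bar> powr P) = ennreal ((cn k * \<mu>) powr P) * ennreal (\<bar>(LINT y|leb. indicator S y * w y) / \<mu>\<bar> powr P)"
            by (simp add: ennreal_mult)
          also have "\<dots> \<le> ennreal ((cn k * \<mu>) powr P) * (ennreal (1 / \<mu>) * (\<integral>\<^sup>+y. indicator S y * ennreal (\<bar>w y\<bar> powr P) \<partial>leb))"
            using P_gt_2 by (intro mult_left_mono average_powr_le w S S\<mu> \<mu>) auto
          also have "\<dots> \<le> ennreal ((cn k * \<mu>) powr P) * (ennreal (1 / \<mu>) * (\<integral>\<^sup>+y. indicator (dcube k x) y * ennreal (\<bar>w y\<bar> powr P) \<partial>leb))"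
            by (intro mult_left_mono nn_integral_mono mult_right_mono) (auto simp: S_def split: split_indicator)
          also have "\<dots> = ennreal ((cn k * \<mu>) powr (P - 1)) * (ennreal (cn k) * (\<integral>\<^sup>+y. indicator (dcube k x) y * ennreal (\<bar>w y\<bar> powr P) \<partial>leb))"
          proof -
            have "(cn k * \<mu>) powr P * (1 / \<mu>) = (cn k * \<mu>) powr (P - 1) * cn k"
            proof -
              have "(cn k * \<mu>) powr P = cn k * \<mu> * (cn k * \<mu>) powr (P - 1)"
                using \<mu> cn_pos[of k] powr_mult_base[of "cn k * \<mu>" "P - 1"] by simp
              then show ?thesis using \<mu> by (simp only:) simp
            qed
            then have "ennreal ((cn k * \<mu>) powr P) * ennreal (1 / \<mu>) = ennreal ((cn k * \<mu>) powr (P - 1)) * ennreal (cn k)"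
              using \<mu> cn_pos[of k] by (simp only: ennreal_mult[symmetric] powr_ge_zero less_imp_le zero_less_divide_1_iff)
            then show ?thesis by (simp only: mult.assoc[symmetric])
          qed
          also have "\<dots> \<le> ennreal ((cn k * \<eta>) powr (P - 1)) * (ennreal (cn k) * (\<integral>\<^sup>+y. indicator (dcube k x) y * ennreal (\<bar>w y\<bar> powr P) \<partial>leb))"
            using \<mu>\<eta> \<mu> cn_pos[of k] P_gt_2
            by (intro mult_right_mono ennreal_leI powr_mono2) auto
          finally show ?thesis .
        qed
      qed
      define J where "J x = ennreal (cn k) * (\<integral>\<^sup>+y. indicator (dcube k x) y * ennreal (\<bar>w y\<bar> powr P) \<partial>leb)" for x
      have [measurable]: "J \<in> borel_measurable leb"
      proof -
        note [measurable] = indicator_dcube_measurable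
        have "(\<lambda>(x, y). indicator (dcube k x) y * ennreal (\<bar>w y\<bar> powr P)) \<in> borel_measurable leb2"
          unfolding case_prod_beta by measurable
        then show ?thesis unfolding J_def[abs_def]
          using lebesgue.borel_measurable_nn_integral by (intro borel_measurable_times_ennreal) auto
      qed
      have Jint: "(\<integral>\<^sup>+x. J x \<partial>leb) = lp_energy leb P w"
        unfolding J_def by (subst nn_integral_avg) (auto simp: lp_energy_def)
      have pw: "indicator {x. R \<le> norm x} x * ennreal (\<bar>avg k w x\<bar> powr P)
          \<le> ennreal (2 powr P) * (ennreal (\<bar>avg k w1 x\<bar> powr P) + ennreal ((cn k * \<eta>) powr (P - 1)) * J x)" for x
      proof (cases "R \<le> norm x")
        case True
        have "avg k w2 x = avg k w x - avg k w1 x"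
          unfolding w2_def[abs_def] by (rule avg_diff) (use lpf lp1f in auto)
        then have "avg k w x = avg k w1 x + avg k w2 x" by simp
        then have "ennreal (\<bar>avg k w x\<bar> powr P) \<le> ennreal (2 powr P * (\<bar>avg k w1 x\<bar> powr P + \<bar>avg k w2 x\<bar> powr P))"
          using abs_add_powr_le[of P] P_gt_2 by (intro ennreal_leI) auto
        also have "\<dots> = ennreal (2 powr P) * (ennreal (\<bar>avg k w1 x\<bar> powr P) + ennreal (\<bar>avg k w2 x\<bar> powr P))"
          by (simp add: ennreal_mult)
        also have "\<dots> \<le> ennreal (2 powr P) * (ennreal (\<bar>avg k w1 x\<bar> powr P) + ennreal ((cn k * \<eta>) powr (P - 1)) * J x)"
          using far[OF True] unfolding J_def by (intro mult_left_mono add_mono) auto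
        finally show ?thesis using True by simp
      qed simp
      have "(\<integral>\<^sup>+x. indicator {x. R \<le> norm x} x * ennreal (\<bar>avg k w x\<bar> powr P) \<partial>leb)
          \<le> (\<integral>\<^sup>+x. ennreal (2 powr P) * (ennreal (\<bar>avg k w1 x\<bar> powr P) + ennreal ((cn k * \<eta>) powr (P - 1)) * J x) \<partial>leb)"
        by (intro nn_integral_mono pw)
      also have "\<dots> = ennreal (2 powr P) * (lp_energy leb P (avg k w1) + ennreal ((cn k * \<eta>) powr (P - 1)) * lp_energy leb P w)"
        by (simp add: nn_integral_cmult nn_integral_add Jint) (simp add: lp_energy_def)
      also have "\<dots> \<le> ennreal (2 powr P) * (ennreal (K / c) + ennreal ((cn k * \<eta>) powr (P - 1)) * ennreal (K / V0))"
      proof (intro mult_left_mono add_mono)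
        have div: "A \<le> ennreal (K / d)" if "ennreal d * A \<le> ennreal K" "0 < d" for d A
        proof -
          have "ennreal (1 / d) * (ennreal d * A) \<le> ennreal (1 / d) * ennreal K"
            using that by (intro mult_left_mono) auto
          then show ?thesis using that(2) K by (simp add: mult.assoc[symmetric] flip: ennreal_mult)
        qed
        have "lp_energy leb P w1 \<le> ennreal (K / c)" by (rule div[OF lp1 c])
        then show "lp_energy leb P (avg k w1) \<le> ennreal (K / c)"
          using lp_energy_avg_le[of w1 k] by simp
        show "lp_energy leb P w \<le> ennreal (K / V0)" by (rule div[OF lpV V0(1)])
      qed auto
      also have "\<dots> = ennreal (2 powr P * (K / c + e * V0 / (2 * 2 powr P * (K + 1)) * (K / V0)))"
      proof -
        have gen: "ennreal A * (ennreal a + ennreal b * ennreal d) = ennreal (A * (a + b * d))"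
          if "0 \<le> A" "0 \<le> a" "0 \<le> b" "0 \<le> d" for A a b d
          using that by (simp add: ennreal_mult)
        show ?thesis unfolding \<eta>P by (rule gen) (use c V0(1) e K in auto)
      qed
      also have "\<dots> \<le> ennreal e"
      proof (intro ennreal_leI)
        have "2 powr P * (K / c + e * V0 / (2 * 2 powr P * (K + 1)) * (K / V0)) = e * (K / (K + 1))"
        proof -
          have gen: "D * (K / (2 * D * L / e) + e * V0 / (2 * D * L) * (K / V0)) = e * (K / L)"
            if "0 < D" "0 < L" for D L :: real
            using that V0(1) e by (simp add: field_simps)
          show ?thesis unfolding c_def by (rule gen) (use K in auto)
        qed
        also have "\<dots> \<le> e * 1" using e K by (intro mult_left_mono) (auto simp: divide_le_eq)
        finally show "2 powr P * (K / c + e * V0 / (2 * 2 powr P * (K + 1)) * (K / V0)) \<le> e" by simp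
      qed
      finally show "(\<integral>\<^sup>+x. indicator {x. R \<le> norm x} x * ennreal (\<bar>avg k w x\<bar> powr P) \<partial>leb) \<le> ennreal e" .
    qed
  qed
qed

text \<open>The generation is chosen first, such that \<open>w - avg k w\<close> is small, and then the radius.\<close>

lemma lp_energy_split_avg:
  assumes V2: "cond_V2 V" and K: "0 \<le> K" and e: "0 < e"
  shows "\<exists>k R. \<forall>w. w \<in> borel_measurable leb \<and> E w \<le> ennreal K \<longrightarrow>
    lp_energy leb P w \<le> ennreal e +
      ennreal (2 powr P) * (\<integral>\<^sup>+x. indicator {x. norm x < R} x * ennreal (\<bar>avg k w x\<bar> powr P) \<partial>leb)"
proof -
  define e' where "e' = e / (2 * 2 powr P)"
  have e': "0 < e'" using e by (simp add: e'_def)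
  obtain k0 where k0: "\<And>k. k0 \<le> k \<Longrightarrow> \<exists>R. \<forall>w. w \<in> borel_measurable leb \<and> E w \<le> ennreal K \<longrightarrow>
    (\<integral>\<^sup>+x. indicator {x. R \<le> norm x} x * ennreal (\<bar>avg k w x\<bar> powr P) \<partial>leb) \<le> ennreal e'"
    using avg_tail[OF V2 K e'] by blast
  have "(\<lambda>k. real N ^ (2 * N) * K * (1 / 2 ^ N) ^ k) \<longlonglongrightarrow> real N ^ (2 * N) * K * 0"
    using N_ge_2 by (intro tendsto_mult tendsto_const LIMSEQ_realpow_zero) auto
  then have "\<forall>\<^sub>F k in sequentially. real N ^ (2 * N) * K * (1 / 2 ^ N) ^ k < e'"
    using e' by (intro order_tendstoD) auto
  then have "\<forall>\<^sub>F k in sequentially. k0 \<le> k \<and> real N ^ (2 * N) * K * (1 / 2 ^ N) ^ k < e'"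
    using eventually_ge_at_top by (rule eventually_conj[rotated])
  then obtain k where k: "k0 \<le> k" "real N ^ (2 * N) * K * (1 / 2 ^ N) ^ k < e'"
    by (auto simp: eventually_sequentially)
  obtain R where R: "\<And>w. w \<in> borel_measurable leb \<Longrightarrow> E w \<le> ennreal K \<Longrightarrow>
    (\<integral>\<^sup>+x. indicator {x. R \<le> norm x} x * ennreal (\<bar>avg k w x\<bar> powr P) \<partial>leb) \<le> ennreal e'"
    using k0[OF k(1)] by blast
  have "lp_energy leb P w \<le> ennreal e +
      ennreal (2 powr P) * (\<integral>\<^sup>+x. indicator {x. norm x < R} x * ennreal (\<bar>avg k w x\<bar> powr P) \<partial>leb)"
    if w[measurable]: "w \<in> borel_measurable leb" and Ew: "E w \<le> ennreal K" for w
  proof -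
    have lpf: "lp_energy leb P w < \<infinity>"
    proof -
      have "ennreal V0 * lp_energy leb P w < top"
        using order_trans[OF lp_le_E[OF w] Ew] by (rule le_less_trans) simp
      then show ?thesis using V0(1) by (auto simp: ennreal_mult_less_top)
    qed
    have norm_sets[measurable]: "{x. norm x < R} \<in> sets leb" "{x. R \<le> norm x} \<in> sets leb"
    proof -
      have eq: "{x::real^'n. norm x < R} = ball 0 R" "{x::real^'n. R \<le> norm x} = - ball 0 R"
        by (auto simp: ball_def)
      show "{x. norm x < R} \<in> sets leb" "{x. R \<le> norm x} \<in> sets leb" unfolding eq by simp_all
    qed
    have "lp_energy leb P w = lp_energy leb P (\<lambda>x. (w x - avg k w x) + avg k w x)" by simp
    also have "\<dots> \<le> ennreal (2 powr P) * (lp_energy leb P (\<lambda>x. w x - avg k w x) + lp_energy leb P (avg k w))"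
      using P_gt_2 by (intro lp_energy_add) auto
    also have "\<dots> \<le> ennreal (2 powr P) * (ennreal e' + (ennreal e' + (\<integral>\<^sup>+x. indicator {x. norm x < R} x * ennreal (\<bar>avg k w x\<bar> powr P) \<partial>leb)))"
    proof (intro mult_left_mono add_mono)
      have "1 / cn k = (1 / 2 ^ N) ^ k" by (simp add: cn_def power_one_over power_mult mult.commute[of k])
      then have c: "real N ^ (2 * N) / cn k * K = real N ^ (2 * N) * K * (1 / 2 ^ N) ^ k" by (simp add: divide_inverse)
      have "lp_energy leb P (\<lambda>x. w x - avg k w x) \<le> ennreal (real N ^ (2 * N) / cn k) * gagliardo_energy s w"
        by (rule avg_approx[OF w lpf])
      also have "\<dots> \<le> ennreal (real N ^ (2 * N) / cn k) * ennreal K"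
        using Ew by (intro mult_left_mono order_trans[OF _ Ew]) (auto simp: gagliardo_eq E_eq)
      also have "\<dots> = ennreal (real N ^ (2 * N) * K * (1 / 2 ^ N) ^ k)"
        unfolding c[symmetric] using K cn_pos[of k] by (subst ennreal_mult) auto
      also have "\<dots> \<le> ennreal e'" using k(2) by (intro ennreal_leI) simp
      finally show "lp_energy leb P (\<lambda>x. w x - avg k w x) \<le> ennreal e'" .
      have "lp_energy leb P (avg k w) = (\<integral>\<^sup>+x. indicator {x. R \<le> norm x} x * ennreal (\<bar>avg k w x\<bar> powr P)
          + indicator {x. norm x < R} x * ennreal (\<bar>avg k w x\<bar> powr P) \<partial>leb)"
        unfolding lp_energy_def by (intro nn_integral_cong) (auto split: split_indicator)
      also have "\<dots> = (\<integral>\<^sup>+x. indicator {x. R \<le> norm x} x * ennreal (\<bar>avg k w x\<bar> powr P) \<partial>leb)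
          + (\<integral>\<^sup>+x. indicator {x. norm x < R} x * ennreal (\<bar>avg k w x\<bar> powr P) \<partial>leb)"
        by (intro nn_integral_add) measurable
      also have "\<dots> \<le> ennreal e' + (\<integral>\<^sup>+x. indicator {x. norm x < R} x * ennreal (\<bar>avg k w x\<bar> powr P) \<partial>leb)"
        by (intro add_right_mono R w Ew)
      finally show "lp_energy leb P (avg k w) \<le> ennreal e' + (\<integral>\<^sup>+x. indicator {x. norm x < R} x * ennreal (\<bar>avg k w x\<bar> powr P) \<partial>leb)" .
    qed simp
    also have "\<dots> = ennreal e + ennreal (2 powr P) * (\<integral>\<^sup>+x. indicator {x. norm x < R} x * ennreal (\<bar>avg k w x\<bar> powr P) \<partial>leb)"
    proof -
      have "ennreal (2 powr P) * ennreal e' + ennreal (2 powr P) * ennreal e' = ennreal e"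
        using e by (simp add: e'_def flip: ennreal_mult ennreal_plus)
      then show ?thesis by (simp add: distrib_left add.assoc[symmetric])
    qed
    finally show ?thesis .
  qed
  then show ?thesis by blast
qed

text \<open>
  A diagonal subsequence makes the averages of all generations converge at every point. By \<open>lp_energy_split_avg\<close>, applied to the differences \<open>u n - u m\<close>,
  an \<open>L\<^sup>P\<close> distance is controlled up to \<open>e\<close> by averages of one generation on a ball, where dominated convergence applies. So the
  subsequence is Cauchy in \<open>L\<^sup>P\<close>.
\<close>

theorem compact_embedding:
  assumes V2: "cond_V2 V" and K: "0 \<le> K"
    and m[measurable]: "\<And>n. u n \<in> borel_measurable leb" and EK: "\<And>n. E (u n) \<le> ennreal K"
  shows "\<exists>\<sigma> v. strict_mono (\<sigma> :: nat \<Rightarrow> nat) \<and> v \<in> borel_measurable leb \<and>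
    (\<lambda>n. lp_energy leb P (\<lambda>x. u (\<sigma> n) x - v x)) \<longlonglongrightarrow> 0"
proof -
  have lpK: "lp_energy leb P (u n) \<le> ennreal (K / V0)" for n
  proof -
    have "ennreal (1 / V0) * (ennreal V0 * lp_energy leb P (u n)) \<le> ennreal (1 / V0) * ennreal K"
      using lp_le_E[OF m, of n] EK[of n] by (intro mult_left_mono) auto
    then show ?thesis using V0(1) K by (simp add: mult.assoc[symmetric] flip: ennreal_mult)
  qed
  have lpf: "lp_energy leb P (u n) < \<infinity>" for n using lpK[of n] by (rule le_less_trans) simp
  define b where "b k = (cn k * (K / V0)) powr (1 / P)" for k
  have bound: "\<bar>avg k (u n) x\<bar> \<le> b k" for k n x
  proof -
    have "ennreal (\<bar>avg k (u n) x\<bar> powr P) \<le> ennreal (cn k) * (\<integral>\<^sup>+y. indicator (dcube k x) y * ennreal (\<bar>u n y\<bar> powr P) \<partial>leb)"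
      by (rule avg_jensen[OF m])
    also have "\<dots> \<le> ennreal (cn k) * lp_energy leb P (u n)"
      unfolding lp_energy_def by (intro mult_left_mono nn_integral_mono) (auto split: split_indicator)
    also have "\<dots> \<le> ennreal (cn k) * ennreal (K / V0)" by (intro mult_left_mono lpK) auto
    also have "\<dots> = ennreal (cn k * (K / V0))" using cn_pos[of k] V0(1) K by (subst ennreal_mult) auto
    finally have "\<bar>avg k (u n) x\<bar> powr P \<le> cn k * (K / V0)"
      using cn_pos[of k] V0(1) K by (subst (asm) ennreal_le_iff) auto
    then have "(\<bar>avg k (u n) x\<bar> powr P) powr (1 / P) \<le> b k"
      unfolding b_def using P_gt_2 by (intro powr_mono2) auto
    then show ?thesis using P_gt_2 by (simp add: powr_powr)
  qed
  \<comment> \<open>The averages take countably many values, one for each dyadic cube, which is represented by its corner.\<close>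
  define corner where "corner k j = (\<chi> i. real_of_int (j $ i) / 2 ^ k)" for k :: nat and j :: "int ^ 'n"
  have corner: "\<exists>j. corner k j \<in> dcube k x" for k and x :: "real^'n"
    by (intro exI[of _ "\<chi> i. \<lfloor>2 ^ k * x $ i\<rfloor>"]) (simp add: corner_def dcube_def)
  have "\<exists>\<sigma>. strict_mono (\<sigma> :: nat \<Rightarrow> nat) \<and> (\<forall>i. convergent (\<lambda>n. case i of (k, j) \<Rightarrow> avg k (u (\<sigma> n)) (corner k j)))"
    by (rule diagonal_convergent_subsequence[where b = "\<lambda>i. b (fst i)"]) (auto simp: bound)
  then obtain \<sigma> where \<sigma>: "strict_mono \<sigma>" "\<And>k j. convergent (\<lambda>n. avg k (u (\<sigma> n)) (corner k j))" by auto
  have conv: "convergent (\<lambda>n. avg k (u (\<sigma> n)) x)" for k x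
  proof -
    obtain j where j: "corner k j \<in> dcube k x" using corner by blast
    show ?thesis using \<sigma>(2)[of k j] by (simp add: avg_cong_cube[OF j])
  qed
  define g where "g k x = lim (\<lambda>n. avg k (u (\<sigma> n)) x)" for k x
  have g_lim: "(\<lambda>n. avg k (u (\<sigma> n)) x) \<longlonglongrightarrow> g k x" for k x
    using conv by (simp add: g_def convergent_LIMSEQ_iff)
  have [measurable]: "g k \<in> borel_measurable leb" for k
    unfolding g_def[abs_def] by measurable
  have g_le: "\<bar>g k x\<bar> \<le> b k" for k x
    by (rule tendsto_upperbound[OF tendsto_rabs[OF g_lim]]) (auto simp: bound)
  have inner: "(\<lambda>n. \<integral>\<^sup>+x. indicator {x. norm x < R} x * ennreal (\<bar>avg k (u (\<sigma> n)) x - g k x\<bar> powr P) \<partial>leb) \<longlonglongrightarrow> 0" for k R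
  proof -
    have B[measurable]: "{x. norm x < R} \<in> sets leb" and Bf: "emeasure leb {x. norm x < R} < \<infinity>"
    proof -
      have eq: "{x::real^'n. norm x < R} = ball 0 R" by (auto simp: ball_def)
      show "{x. norm x < R} \<in> sets leb" unfolding eq by simp
      show "emeasure leb {x. norm x < R} < \<infinity>" unfolding eq using emeasure_bounded_finite[of "ball (0::real^'n) R"] by simp
    qed
    have "(\<lambda>n. \<integral>\<^sup>+x. indicator {x. norm x < R} x * ennreal (\<bar>avg k (u (\<sigma> n)) x - g k x\<bar> powr P) \<partial>leb) \<longlonglongrightarrow> (\<integral>\<^sup>+x. 0 \<partial>leb)"
    proof (rule nn_integral_dominated_convergence[where w = "\<lambda>x. ennreal ((2 * b k) powr P) * indicator {x. norm x < R} x"])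
      show "AE x in leb. indicator {x. norm x < R} x * ennreal (\<bar>avg k (u (\<sigma> n)) x - g k x\<bar> powr P)
          \<le> ennreal ((2 * b k) powr P) * indicator {x. norm x < R} x" for n
      proof (intro AE_I2)
        fix x
        have "\<bar>avg k (u (\<sigma> n)) x - g k x\<bar> \<le> 2 * b k" using bound[of k "\<sigma> n" x] g_le[of k x] by linarith
        then have "\<bar>avg k (u (\<sigma> n)) x - g k x\<bar> powr P \<le> (2 * b k) powr P"
          using P_gt_2 by (intro powr_mono2) auto
        then show "indicator {x. norm x < R} x * ennreal (\<bar>avg k (u (\<sigma> n)) x - g k x\<bar> powr P)
          \<le> ennreal ((2 * b k) powr P) * indicator {x. norm x < R} x"
          by (auto split: split_indicator intro!: ennreal_leI)
      qed
      show "(\<integral>\<^sup>+x. ennreal ((2 * b k) powr P) * indicator {x. norm x < R} x \<partial>leb) < \<infinity>"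
        using Bf by (simp add: nn_integral_cmult_indicator[OF B] ennreal_mult_less_top del: emeasure_completion)
      show "AE x in leb. (\<lambda>n. indicator {x. norm x < R} x * ennreal (\<bar>avg k (u (\<sigma> n)) x - g k x\<bar> powr P)) \<longlonglongrightarrow> 0"
      proof (intro AE_I2)
        fix x
        have "(\<lambda>n. avg k (u (\<sigma> n)) x - g k x) \<longlonglongrightarrow> 0" using g_lim[of k x] by (simp add: LIM_zero_iff)
        then have "(\<lambda>n. \<bar>avg k (u (\<sigma> n)) x - g k x\<bar> powr P) \<longlonglongrightarrow> \<bar>0\<bar> powr P"
          using P_gt_2 by (intro tendsto_powr' tendsto_rabs tendsto_const) auto
        then have "(\<lambda>n. ennreal (\<bar>avg k (u (\<sigma> n)) x - g k x\<bar> powr P)) \<longlonglongrightarrow> ennreal 0"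
          by (intro tendsto_ennrealI) simp
        then show "(\<lambda>n. indicator {x. norm x < R} x * ennreal (\<bar>avg k (u (\<sigma> n)) x - g k x\<bar> powr P)) \<longlonglongrightarrow> 0"
          by (cases "norm x < R") auto
      qed
    qed measurable
    then show ?thesis by simp
  qed
  define K' where "K' = 2 powr P * (2 * K)"
  have K': "0 \<le> K'" using K by (simp add: K'_def)
  have Ediff: "E (\<lambda>x. u n x - u l x) \<le> ennreal K'" for n l
  proof -
    have "E (\<lambda>x. u n x + - 1 * u l x) \<le> ennreal (2 powr P) * (E (u n) + E (\<lambda>x. - 1 * u l x))"
      by (intro E_add) measurable
    also have "E (\<lambda>x. - 1 * u l x) = E (u l)" by (subst E_scale) auto
    also have "ennreal (2 powr P) * (E (u n) + E (u l)) \<le> ennreal (2 powr P) * (ennreal K + ennreal K)"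
      by (intro mult_left_mono add_mono EK) auto
    also have "\<dots> = ennreal K'" using K by (simp add: K'_def flip: ennreal_mult ennreal_plus)
    finally show ?thesis by simp
  qed
  have "\<exists>n0. \<forall>n\<ge>n0. \<forall>l\<ge>n0. lp_energy leb P (\<lambda>x. u (\<sigma> n) x - u (\<sigma> l) x) \<le> ennreal e" if e: "0 < e" for e :: real
  proof -
    have e2: "0 < e / 2" using e by simp
    obtain k R where kR: "\<And>w. w \<in> borel_measurable leb \<Longrightarrow> E w \<le> ennreal K' \<Longrightarrow>
      lp_energy leb P w \<le> ennreal (e / 2) +
      ennreal (2 powr P) * (\<integral>\<^sup>+x. indicator {x. norm x < R} x * ennreal (\<bar>avg k w x\<bar> powr P) \<partial>leb)"
      using lp_energy_split_avg[OF V2 K' e2] by blast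
    define \<epsilon> where "\<epsilon> = e / (4 * (2 powr P * 2 powr P))"
    have \<epsilon>: "0 < \<epsilon>" using e by (simp add: \<epsilon>_def)
    have [measurable]: "{x::real^'n. norm x < R} \<in> sets leb"
    proof -
      have eq: "{x::real^'n. norm x < R} = ball 0 R" by (auto simp: ball_def)
      show ?thesis unfolding eq by simp
    qed
    define I where "I n = (\<integral>\<^sup>+x. indicator {x. norm x < R} x * ennreal (\<bar>avg k (u (\<sigma> n)) x - g k x\<bar> powr P) \<partial>leb)" for n
    have "\<forall>\<^sub>F n in sequentially. I n < ennreal \<epsilon>"
      unfolding I_def using inner[of R k] \<epsilon> by (intro order_tendstoD) auto
    then obtain n0 where n0: "\<And>n. n \<ge> n0 \<Longrightarrow> I n < ennreal \<epsilon>" by (auto simp: eventually_sequentially)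
    have "lp_energy leb P (\<lambda>x. u (\<sigma> n) x - u (\<sigma> l) x) \<le> ennreal e" if nl: "n \<ge> n0" "l \<ge> n0" for n l
    proof -
      have "(\<integral>\<^sup>+x. indicator {x. norm x < R} x * ennreal (\<bar>avg k (\<lambda>x. u (\<sigma> n) x - u (\<sigma> l) x) x\<bar> powr P) \<partial>leb)
        \<le> (\<integral>\<^sup>+x. ennreal (2 powr P) * (indicator {x. norm x < R} x * ennreal (\<bar>avg k (u (\<sigma> n)) x - g k x\<bar> powr P)
            + indicator {x. norm x < R} x * ennreal (\<bar>avg k (u (\<sigma> l)) x - g k x\<bar> powr P)) \<partial>leb)"
      proof (intro nn_integral_mono)
        fix x
        have "avg k (\<lambda>x. u (\<sigma> n) x - u (\<sigma> l) x) x = (avg k (u (\<sigma> n)) x - g k x) + (g k x - avg k (u (\<sigma> l)) x)"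
          by (subst avg_diff) (use lpf in auto)
        then have "\<bar>avg k (\<lambda>x. u (\<sigma> n) x - u (\<sigma> l) x) x\<bar> powr P
            \<le> 2 powr P * (\<bar>avg k (u (\<sigma> n)) x - g k x\<bar> powr P + \<bar>avg k (u (\<sigma> l)) x - g k x\<bar> powr P)"
          using abs_add_powr_le[of P "avg k (u (\<sigma> n)) x - g k x" "g k x - avg k (u (\<sigma> l)) x"] P_gt_2
          by (simp add: abs_minus_commute)
        then show "indicator {x. norm x < R} x * ennreal (\<bar>avg k (\<lambda>x. u (\<sigma> n) x - u (\<sigma> l) x) x\<bar> powr P)
          \<le> ennreal (2 powr P) * (indicator {x. norm x < R} x * ennreal (\<bar>avg k (u (\<sigma> n)) x - g k x\<bar> powr P)
            + indicator {x. norm x < R} x * ennreal (\<bar>avg k (u (\<sigma> l)) x - g k x\<bar> powr P))"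
          by (auto split: split_indicator simp flip: ennreal_mult ennreal_plus intro!: ennreal_leI)
      qed
      also have "\<dots> = ennreal (2 powr P) * (I n + I l)"
        unfolding I_def by (subst nn_integral_cmult) (auto simp: nn_integral_add)
      also have "\<dots> \<le> ennreal (2 powr P) * (ennreal \<epsilon> + ennreal \<epsilon>)"
        using n0 nl by (intro mult_left_mono add_mono) (auto intro: less_imp_le)
      also have "\<dots> = ennreal (2 powr P * (2 * \<epsilon>))" using \<epsilon> by (simp flip: ennreal_mult ennreal_plus)
      finally have le: "(\<integral>\<^sup>+x. indicator {x. norm x < R} x * ennreal (\<bar>avg k (\<lambda>x. u (\<sigma> n) x - u (\<sigma> l) x) x\<bar> powr P) \<partial>leb)
        \<le> ennreal (2 powr P * (2 * \<epsilon>))" .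
      have "lp_energy leb P (\<lambda>x. u (\<sigma> n) x - u (\<sigma> l) x) \<le> ennreal (e / 2) +
        ennreal (2 powr P) * (\<integral>\<^sup>+x. indicator {x. norm x < R} x * ennreal (\<bar>avg k (\<lambda>x. u (\<sigma> n) x - u (\<sigma> l) x) x\<bar> powr P) \<partial>leb)"
        by (intro kR Ediff) measurable
      also have "\<dots> \<le> ennreal (e / 2) + ennreal (2 powr P) * ennreal (2 powr P * (2 * \<epsilon>))"
        by (intro add_left_mono mult_left_mono le) simp
      also have "\<dots> = ennreal (e / 2 + 2 powr P * (2 powr P * (2 * \<epsilon>)))"
        using \<epsilon> e by (simp flip: ennreal_mult ennreal_plus)
      also have "e / 2 + 2 powr P * (2 powr P * (2 * \<epsilon>)) = e" by (simp add: \<epsilon>_def)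
      finally show ?thesis .
    qed
    then show ?thesis by blast
  qed
  then obtain v where "v \<in> borel_measurable leb" "(\<lambda>n. lp_energy leb P (\<lambda>x. u (\<sigma> n) x - v x)) \<longlonglongrightarrow> 0"
    using lp_energy_complete[of P "\<lambda>n. u (\<sigma> n)" leb] P_gt_2 by auto
  then show ?thesis using \<sigma>(1) by blast
qed

end

section \<open>Test functions\<close>

definition smooth :: "(real^'n \<Rightarrow> real) \<Rightarrow> bool" where
  "smooth \<phi> \<longleftrightarrow> (\<forall>k. C_k k \<phi>)"

lemma smooth_derivative:
  assumes "smooth \<phi>"
  shows "(\<phi> has_derivative frechet_derivative \<phi> (at x)) (at x)"
    and "smooth (\<lambda>x. frechet_derivative \<phi> (at x) (axis i 1))"
    and "continuous_on UNIV \<phi>"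
proof -
  have C: "C_k (Suc k) \<phi>" for k using assms by (simp add: smooth_def del: C_k.simps)
  from C show "(\<phi> has_derivative frechet_derivative \<phi> (at x)) (at x)"
    by (simp add: frechet_derivative_works[symmetric])
  from C show "smooth (\<lambda>x. frechet_derivative \<phi> (at x) (axis i 1))"
    by (simp add: smooth_def)
  show "continuous_on UNIV \<phi>" using assms[unfolded smooth_def, rule_format, of 0] by simp
qed

text \<open>Smoothness is coinductive: a class of functions closed under partial derivatives consists of smooth functions.\<close>

lemma smooth_coinduct:
  assumes "\<phi> \<in> S"
    and S: "\<And>\<phi>. \<phi> \<in> S \<Longrightarrow> \<exists>D. (\<forall>x. (\<phi> has_derivative D x) (at x)) \<and> (\<forall>i. (\<lambda>x. D x (axis i 1)) \<in> S)"
  shows "smooth \<phi>"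
proof -
  have "C_k k \<phi>" if "\<phi> \<in> S" for k \<phi>
    using that
  proof (induction k arbitrary: \<phi>)
    case 0
    then obtain D where "\<And>x. (\<phi> has_derivative D x) (at x)" using S by blast
    then show ?case by (auto intro!: continuous_at_imp_continuous_on has_derivative_continuous)
  next
    case (Suc k)
    then obtain D where D: "\<And>x. (\<phi> has_derivative D x) (at x)" "\<And>i. (\<lambda>x. D x (axis i 1)) \<in> S" using S by blast
    have "frechet_derivative \<phi> (at x) = D x" for x
      using frechet_derivative_at[OF D(1)] by simp
    then show ?case using D Suc.IH by (auto simp: differentiable_def)
  qed
  then show ?thesis using assms(1) by (simp add: smooth_def)
qed

text \<open>
  The functions \<open>q(1/t) exp(-1/t)\<close>, \<open>t > 0\<close>, with polynomial \<open>q\<close>: a class containing the standard flat function and closed under differentiation.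
\<close>

definition flat_exp :: "real poly \<Rightarrow> real \<Rightarrow> real" where
  "flat_exp p t = (if t \<le> 0 then 0 else poly p (1 / t) * exp (- (1 / t)))"

lemma poly_div_exp_tendsto_0: "((\<lambda>y. poly p y / exp y) \<longlongrightarrow> (0::real)) at_top"
proof -
  have "((\<lambda>y. \<Sum>i\<le>degree p. coeff p i * (y ^ i / exp y)) \<longlongrightarrow> (\<Sum>i\<le>degree p. coeff p i * 0)) at_top"
    by (intro tendsto_sum tendsto_mult tendsto_const tendsto_power_div_exp_0)
  then show ?thesis by (simp add: poly_altdef sum_divide_distrib)
qed

lemma has_real_derivative_flat_exp:
  "(flat_exp p has_real_derivative flat_exp ([:0, 0, 1:] * (p - pderiv p)) t) (at t)"
proof -
  consider "t < 0" | "t = 0" | "0 < t" by linarith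
  then show ?thesis
  proof cases
    case 1
    have "\<forall>\<^sub>F u in nhds t. flat_exp p u = 0"
      using eventually_nhds_in_open[of "{..<0}" t] 1 by (auto simp: flat_exp_def elim: eventually_mono)
    then show ?thesis using 1 by (subst DERIV_cong_ev) (auto simp: flat_exp_def)
  next
    case 3
    have "\<forall>\<^sub>F u in nhds t. flat_exp p u = poly p (1 / u) * exp (- (1 / u))"
      using eventually_nhds_in_open[of "{0<..}" t] 3 by (auto simp: flat_exp_def elim: eventually_mono)
    moreover have "((\<lambda>u. poly p (1 / u) * exp (- (1 / u))) has_real_derivative
        flat_exp ([:0, 0, 1:] * (p - pderiv p)) t) (at t)"
    proof -
      have 1: "((\<lambda>u::real. 1 / u) has_real_derivative - (1 / t\<^sup>2)) (at t)"
        using 3 by (auto intro!: derivative_eq_intros simp: power2_eq_square)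
      have 2: "((\<lambda>u. poly p (1 / u)) has_real_derivative poly (pderiv p) (1 / t) * - (1 / t\<^sup>2)) (at t)"
        by (rule DERIV_chain2[OF poly_DERIV 1])
      show ?thesis
        by (rule DERIV_cong[OF DERIV_mult[OF 2 DERIV_fun_exp[OF DERIV_minus[OF 1]]]])
          (use 3 in \<open>simp add: flat_exp_def algebra_simps power2_eq_square\<close>)
    qed
    ultimately show ?thesis by (simp add: DERIV_cong_ev)
  next
    case 2
    have "((\<lambda>y. poly (pCons 0 p) y / exp y) \<longlongrightarrow> 0) at_top" by (rule poly_div_exp_tendsto_0)
    then have "((\<lambda>h. poly (pCons 0 p) (inverse h) / exp (inverse h)) \<longlongrightarrow> 0) (at_right (0::real))"
      by (rule filterlim_compose[OF _ filterlim_inverse_at_top_right])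
    then have "((\<lambda>h. flat_exp p h / h) \<longlongrightarrow> 0) (at_right 0)"
      by (rule Lim_transform_eventually)
        (auto simp: eventually_at_filter flat_exp_def exp_minus divide_inverse intro!: always_eventually)
    moreover have "((\<lambda>h. flat_exp p h / h) \<longlongrightarrow> 0) (at_left 0)"
      by (rule Lim_transform_eventually[OF tendsto_const])
        (auto simp: eventually_at_filter flat_exp_def intro!: always_eventually)
    ultimately have "((\<lambda>h. flat_exp p h / h) \<longlongrightarrow> 0) (at 0)" by (simp add: filterlim_split_at)
    then show ?thesis using 2 by (simp add: DERIV_def flat_exp_def)
  qed
qed

text \<open>
  A class closed under partial derivatives, hence consisting of smooth functions. It is large enough for regularised absolute values
  (\<open>powr\<close>, with \<open>a = 1/2\<close>) and for bump functions (\<open>flat\<close>).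
\<close>

inductive_set smooth_algebra :: "(real^'n \<Rightarrow> real) set" where
  base: "smooth \<phi> \<Longrightarrow> \<phi> \<in> smooth_algebra"
| const: "(\<lambda>x. c) \<in> smooth_algebra"
| add: "\<phi> \<in> smooth_algebra \<Longrightarrow> \<psi> \<in> smooth_algebra \<Longrightarrow> (\<lambda>x. \<phi> x + \<psi> x) \<in> smooth_algebra"
| mult: "\<phi> \<in> smooth_algebra \<Longrightarrow> \<psi> \<in> smooth_algebra \<Longrightarrow> (\<lambda>x. \<phi> x * \<psi> x) \<in> smooth_algebra"
| powr: "smooth \<phi> \<Longrightarrow> 0 < c \<Longrightarrow> (\<lambda>x. ((\<phi> x)\<^sup>2 + c) powr a) \<in> smooth_algebra"
| flat: "(\<lambda>x. flat_exp p (c * x $ i + b)) \<in> smooth_algebra"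

lemma smooth_algebra_smooth:
  assumes "\<phi> \<in> smooth_algebra"
  shows "smooth (\<phi> :: real^'n \<Rightarrow> real)"
proof (rule smooth_coinduct[OF assms])
  fix \<phi> :: "real^'n \<Rightarrow> real"
  assume "\<phi> \<in> smooth_algebra"
  then show "\<exists>D. (\<forall>x. (\<phi> has_derivative D x) (at x)) \<and> (\<forall>i. (\<lambda>x. D x (axis i 1)) \<in> smooth_algebra)"
  proof induction
    case (base \<phi>)
    then show ?case
      by (intro exI[of _ "\<lambda>x. frechet_derivative \<phi> (at x)"])
        (auto intro: smooth_derivative smooth_algebra.base)
  next
    case (const c)
    then show ?case by (intro exI[of _ "\<lambda>x v. 0"]) (auto intro: smooth_algebra.const)
  next
    case (add \<phi> \<psi>)
    then obtain D1 D2 where "\<And>x. (\<phi> has_derivative D1 x) (at x)" "\<And>i. (\<lambda>x. D1 x (axis i 1)) \<in> smooth_algebra"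
      "\<And>x. (\<psi> has_derivative D2 x) (at x)" "\<And>i. (\<lambda>x. D2 x (axis i 1)) \<in> smooth_algebra" by blast
    then show ?case
      by (intro exI[of _ "\<lambda>x v. D1 x v + D2 x v"]) (auto intro: has_derivative_add smooth_algebra.add)
  next
    case (mult \<phi> \<psi>)
    then obtain D1 D2 where "\<And>x. (\<phi> has_derivative D1 x) (at x)" "\<And>i. (\<lambda>x. D1 x (axis i 1)) \<in> smooth_algebra"
      "\<And>x. (\<psi> has_derivative D2 x) (at x)" "\<And>i. (\<lambda>x. D2 x (axis i 1)) \<in> smooth_algebra" by blast
    then show ?case using mult.hyps
      by (intro exI[of _ "\<lambda>x v. \<phi> x * D2 x v + D1 x v * \<psi> x"])
        (auto intro!: has_derivative_mult smooth_algebra.add smooth_algebra.mult)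
  next
    case (powr \<phi> c a)
    define D where "D x v = (a * ((\<phi> x)\<^sup>2 + c) powr (a - 1)) * (2 * \<phi> x * frechet_derivative \<phi> (at x) v)" for x v
    have "((\<lambda>x. ((\<phi> x)\<^sup>2 + c) powr a) has_derivative D x) (at x)" for x
    proof -
      have pos: "0 < (\<phi> x)\<^sup>2 + c" using powr(2) by (simp add: add_nonneg_pos)
      have 1: "((\<lambda>x. (\<phi> x)\<^sup>2 + c) has_derivative (\<lambda>v. 2 * \<phi> x * frechet_derivative \<phi> (at x) v)) (at x)"
        using smooth_derivative(1)[OF powr(1), of x] by (auto intro!: derivative_eq_intros)
      have 2: "((\<lambda>t. t powr a) has_real_derivative a * ((\<phi> x)\<^sup>2 + c) powr (a - 1)) (at ((\<phi> x)\<^sup>2 + c))"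
        using pos by (rule has_real_derivative_powr)
      show ?thesis
        using has_derivative_compose[OF 1 2[unfolded has_field_derivative_def]] by (simp add: D_def[abs_def])
    qed
    moreover have "(\<lambda>x. D x (axis i 1)) \<in> smooth_algebra" for i
      unfolding D_def using powr
      by (intro smooth_algebra.mult smooth_algebra.const smooth_algebra.powr)
        (auto intro: smooth_algebra.base smooth_derivative)
    ultimately show ?case by blast
  next
    case (flat p c i b)
    define D where "D x v = flat_exp ([:0, 0, 1:] * (p - pderiv p)) (c * x $ i + b) * (c * v $ i)" for x v :: "real^'n"
    have "((\<lambda>x. flat_exp p (c * x $ i + b)) has_derivative D x) (at x)" for x
    proof -
      have 1: "((\<lambda>x::real^'n. c * x $ i + b) has_derivative (\<lambda>v. c * v $ i)) (at x)"
        by (auto intro!: derivative_eq_intros bounded_linear.has_derivative[OF bounded_linear_vec_nth])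
      show ?thesis
        using has_derivative_compose[OF 1 has_real_derivative_flat_exp[unfolded has_field_derivative_def]]
        by (simp add: D_def[abs_def])
    qed
    moreover have "(\<lambda>x. D x (axis j 1)) \<in> smooth_algebra" for j
      unfolding D_def by (intro smooth_algebra.mult smooth_algebra.const smooth_algebra.flat)
    ultimately show ?case by blast
  qed
qed

lemma test_function_iff: "\<phi> \<in> test_functions \<longleftrightarrow> smooth \<phi> \<and> bounded {x. \<phi> x \<noteq> 0}"
  by (simp add: test_functions_def smooth_def compact_closure)

lemma test_function_combination:
  assumes "\<phi> \<in> test_functions" "\<psi> \<in> test_functions"
  shows "(\<lambda>x. a * \<phi> x + b * \<psi> x) \<in> test_functions"
proof -
  have "(\<lambda>x. a * \<phi> x + b * \<psi> x) \<in> smooth_algebra"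
    using assms by (intro smooth_algebra.add smooth_algebra.mult smooth_algebra.const smooth_algebra.base) (auto simp: test_function_iff)
  moreover have "bounded {x. a * \<phi> x + b * \<psi> x \<noteq> 0}"
    by (rule bounded_subset[of "{x. \<phi> x \<noteq> 0} \<union> {x. \<psi> x \<noteq> 0}"]) (use assms in \<open>auto simp: test_function_iff\<close>)
  ultimately show ?thesis by (simp add: test_function_iff smooth_algebra_smooth)
qed

lemma zero_test_function: "(\<lambda>x. 0) \<in> test_functions"
  by (simp add: test_function_iff smooth_algebra_smooth[OF smooth_algebra.const])

lemma test_function_regularized_abs:
  assumes "\<phi> \<in> test_functions" "0 < e"
  shows "(\<lambda>x. sqrt ((\<phi> x)\<^sup>2 + e\<^sup>2) - e) \<in> test_functions"
proof -
  have "(\<lambda>x. ((\<phi> x)\<^sup>2 + e\<^sup>2) powr (1 / 2) + - e) \<in> smooth_algebra"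
    using assms by (intro smooth_algebra.add smooth_algebra.powr smooth_algebra.const) (auto simp: test_function_iff)
  moreover have "(\<lambda>x. ((\<phi> x)\<^sup>2 + e\<^sup>2) powr (1 / 2) + - e) = (\<lambda>x. sqrt ((\<phi> x)\<^sup>2 + e\<^sup>2) - e)"
    by (simp add: powr_half_sqrt)
  moreover have "bounded {x. sqrt ((\<phi> x)\<^sup>2 + e\<^sup>2) - e \<noteq> 0}"
    by (rule bounded_subset[of "{x. \<phi> x \<noteq> 0}"]) (use assms in \<open>auto simp: test_function_iff\<close>)
  ultimately show ?thesis by (simp add: test_function_iff smooth_algebra_smooth)
qed

text \<open>A product over the coordinates of flat functions of one variable.\<close>

lemma bump_function:
  fixes r :: real
  shows "\<exists>\<psi>. \<psi> \<in> test_functions \<and> (\<forall>x::real^'n. 0 \<le> \<psi> x) \<and> (\<forall>x. norm x < r \<longrightarrow> 0 < \<psi> x)"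
proof -
  define \<psi> where "\<psi> x = (\<Prod>i\<in>UNIV. flat_exp 1 (1 * x $ i + r) * flat_exp 1 (- 1 * x $ i + r))" for x :: "real^'n"
  have "(\<lambda>x. \<Prod>i\<in>I. flat_exp 1 (1 * x $ i + r) * flat_exp 1 (- 1 * x $ i + r)) \<in> smooth_algebra"
    if "finite I" for I :: "'n set"
    using that
  proof (induction I)
    case empty
    show ?case by (simp add: smooth_algebra.const)
  next
    case (insert i I)
    have "(\<lambda>x. (flat_exp 1 (1 * x $ i + r) * flat_exp 1 (- 1 * x $ i + r)) *
        (\<Prod>i\<in>I. flat_exp 1 (1 * x $ i + r) * flat_exp 1 (- 1 * x $ i + r))) \<in> smooth_algebra"
      by (intro smooth_algebra.mult smooth_algebra.flat insert.IH)
    then show ?case by (simp only: prod.insert[OF insert.hyps])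
  qed
  then have sm: "\<psi> \<in> smooth_algebra" by (simp add: \<psi>_def[abs_def])
  have fe: "0 \<le> flat_exp 1 t" "0 < flat_exp 1 t \<longleftrightarrow> 0 < t" for t by (auto simp: flat_exp_def)
  have zero: "\<psi> x = 0" if out: "\<not> (\<forall>i. \<bar>x $ i\<bar> < r)" for x
  proof -
    obtain i where "\<not> \<bar>x $ i\<bar> < r" using out by blast
    then have "flat_exp 1 (1 * x $ i + r) * flat_exp 1 (- 1 * x $ i + r) = 0" by (auto simp: flat_exp_def)
    then show ?thesis unfolding \<psi>_def by (intro prod_zero) auto
  qed
  have "bounded {x. \<psi> x \<noteq> 0}"
  proof (rule boundedI)
    fix x assume "x \<in> {x. \<psi> x \<noteq> 0}"
    then have "\<bar>x $ i\<bar> \<le> r" for i using zero by (metis (mono_tags) less_imp_le mem_Collect_eq)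
    then have "(\<Sum>i\<in>UNIV. \<bar>x $ i\<bar>) \<le> (\<Sum>i\<in>(UNIV::'n set). r)" by (intro sum_mono)
    then show "norm x \<le> real CARD('n) * r" using norm_le_l1_cart[of x] by simp
  qed
  then have "\<psi> \<in> test_functions" using sm by (simp add: test_function_iff smooth_algebra_smooth)
  moreover have "0 < \<psi> x" if "norm x < r" for x
    unfolding \<psi>_def
  proof (intro prod_pos mult_pos_pos)
    fix i
    have "\<bar>x $ i\<bar> < r" using that component_le_norm_cart[of x i] by simp
    then show "0 < flat_exp 1 (1 * x $ i + r)" "0 < flat_exp 1 (- 1 * x $ i + r)" by (auto simp: fe)
  qed
  moreover have "0 \<le> \<psi> x" for x unfolding \<psi>_def by (intro prod_nonneg) (auto simp: fe)
  ultimately show ?thesis by blast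
qed

lemma test_function_bounded_lipschitz:
  assumes "\<phi> \<in> test_functions"
  shows "\<exists>L. 0 < L \<and> (\<forall>x. \<bar>\<phi> x\<bar> \<le> L) \<and> (\<forall>x y :: real^'n. \<bar>\<phi> x - \<phi> y\<bar> \<le> L * norm (x - y))"
proof -
  have sm: "smooth \<phi>" and bd: "bounded {x. \<phi> x \<noteq> 0}" using assms by (auto simp: test_function_iff)
  obtain R where R: "{x. \<phi> x \<noteq> 0} \<subseteq> ball 0 R" using bounded_subset_ballD[OF bd] by blast
  define D where "D x = frechet_derivative \<phi> (at x)" for x
  have D: "(\<phi> has_derivative D x) (at x)" for x unfolding D_def by (rule smooth_derivative(1)[OF sm])
  have bdd: "\<exists>B. \<forall>x. \<bar>g x\<bar> \<le> B" if g: "continuous_on UNIV g" "\<And>x. x \<notin> cball 0 R \<Longrightarrow> g x = 0" for g :: "real^'n \<Rightarrow> real"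
  proof -
    have "compact (g ` cball 0 R)"
      by (intro compact_continuous_image continuous_on_subset[OF g(1)]) auto
    then have "bounded (g ` cball 0 R)" by (rule compact_imp_bounded)
    then obtain B where "\<forall>v\<in>g ` cball 0 R. norm v \<le> B" by (auto simp: bounded_iff)
    then have "\<And>x. x \<in> cball 0 R \<Longrightarrow> \<bar>g x\<bar> \<le> B" by auto
    then show ?thesis using g(2) by (intro exI[of _ "max B 0"]) (metis abs_zero max.coboundedI1 max.cobounded2)
  qed
  obtain B0 where B0: "\<And>x. \<bar>\<phi> x\<bar> \<le> B0"
    using bdd[of \<phi>] smooth_derivative(3)[OF sm] R by fastforce
  have "\<exists>B. \<forall>x. \<bar>D x (axis i 1)\<bar> \<le> B" for i
  proof (rule bdd)
    show "continuous_on UNIV (\<lambda>x. D x (axis i 1))"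
      unfolding D_def by (rule smooth_derivative(3)[OF smooth_derivative(2)[OF sm]])
    fix x :: "real^'n" assume x: "x \<notin> cball 0 R"
    have "(\<phi> has_derivative (\<lambda>v. 0)) (at x)"
    proof (rule has_derivative_transform_within_open[OF has_derivative_const[of 0]])
      show "open (- cball 0 R :: (real^'n) set)" by auto
      show "x \<in> - cball 0 R" using x by simp
      show "0 = \<phi> y" if "y \<in> - cball 0 R" for y
      proof -
        have "y \<notin> ball 0 R" using that by auto
        then show ?thesis using R by auto
      qed
    qed
    then have "D x = (\<lambda>v. 0)" using D has_derivative_unique by blast
    then show "D x (axis i 1) = 0" by simp
  qed
  then obtain B where B: "\<And>i x. \<bar>D x (axis i 1)\<bar> \<le> B i" by metis
  define L where "L = 1 + \<bar>B0\<bar> + (\<Sum>i\<in>UNIV. \<bar>B i\<bar>)"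
  have "0 \<le> (\<Sum>i\<in>UNIV. \<bar>B i\<bar>)" by (simp add: sum_nonneg)
  then have L: "0 < L" "B0 \<le> L" "(\<Sum>i\<in>UNIV. \<bar>B i\<bar>) \<le> L" unfolding L_def by linarith+
  have on: "onorm (D x) \<le> L" for x
  proof (rule onorm_bound)
    fix v :: "real^'n"
    have lin: "linear (D x)" using D[of x] by (rule has_derivative_linear)
    have "D x v = (\<Sum>i\<in>UNIV. v $ i * D x (axis i 1))"
    proof -
      have "D x v = D x (\<Sum>i\<in>UNIV. v $ i *s axis i 1)" by (simp add: basis_expansion)
      also have "\<dots> = (\<Sum>i\<in>UNIV. v $ i * D x (axis i 1))"
        by (simp add: linear_sum[OF lin] scalar_mult_eq_scaleR linear_scale[OF lin])
      finally show ?thesis .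
    qed
    then have "\<bar>D x v\<bar> \<le> (\<Sum>i\<in>UNIV. \<bar>v $ i * D x (axis i 1)\<bar>)" by simp
    also have "\<dots> \<le> (\<Sum>i\<in>UNIV. norm v * \<bar>B i\<bar>)"
    proof (intro sum_mono)
      fix i
      have "\<bar>D x (axis i 1)\<bar> \<le> \<bar>B i\<bar>" using B[of x i] by linarith
      then show "\<bar>v $ i * D x (axis i 1)\<bar> \<le> norm v * \<bar>B i\<bar>"
        unfolding abs_mult by (intro mult_mono component_le_norm_cart) auto
    qed
    also have "\<dots> = (\<Sum>i\<in>UNIV. \<bar>B i\<bar>) * norm v" by (simp add: sum_distrib_left mult.commute)
    also have "\<dots> \<le> L * norm v" using L by (intro mult_right_mono) auto
    finally show "norm (D x v) \<le> L * norm v" by simp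
  qed (use L in simp)
  have "\<bar>\<phi> x - \<phi> y\<bar> \<le> L * norm (x - y)" for x y :: "real^'n"
    using differentiable_bound[of UNIV \<phi> D L x y] D on by (auto simp: has_derivative_at_withinI)
  moreover have "\<bar>\<phi> x\<bar> \<le> L" for x using B0[of x] L(2) by linarith
  ultimately show ?thesis using L(1) by blast
qed

lemma ennreal_term_le_suminf: "(f j :: ennreal) \<le> (\<Sum>i. f i)"
  using sum_le_suminf[of f "{j}"] by simp

lemma dyadic_below_one:
  fixes t :: real
  assumes "0 < t" "t \<le> 1"
  shows "\<exists>j. (1 / 2) ^ Suc j < t \<and> t \<le> (1 / 2) ^ j"
proof -
  obtain n where n: "(1 / 2) ^ n < t" using real_arch_pow_inv[of t "1 / 2"] assms by auto
  define m where "m = (LEAST n. (1 / 2) ^ n < t)"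
  have m: "(1 / 2) ^ m < t" unfolding m_def by (rule LeastI[of _ n]) (rule n)
  have "m \<noteq> 0" using m assms by (intro notI) simp
  then obtain j where j: "m = Suc j" by (cases m) auto
  have "\<not> (1 / 2) ^ j < t" using not_less_Least[of j "\<lambda>n. (1 / 2) ^ n < t"] j m_def by simp
  then show ?thesis using m j by (intro exI[of _ j]) auto
qed

lemma dyadic_above_one:
  fixes t :: real
  assumes "1 < t"
  shows "\<exists>j. 2 ^ j < t \<and> t \<le> 2 ^ Suc j"
proof -
  obtain n where n: "t \<le> 2 ^ n" using real_arch_pow[of 2 t] by (auto intro: less_imp_le)
  define m where "m = (LEAST n. t \<le> 2 ^ n)"
  have m: "t \<le> 2 ^ m" unfolding m_def by (rule LeastI[of _ n]) (rule n)
  have "m \<noteq> 0" using m assms by (intro notI) simp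
  then obtain j where j: "m = Suc j" by (cases m) auto
  have "\<not> t \<le> 2 ^ j" using not_less_Least[of j "\<lambda>n. t \<le> 2 ^ n"] j m_def by simp
  then show ?thesis using m j by (intro exI[of _ j]) auto
qed

lemma nn_integral_lebesgue_translate:
  fixes m :: "'a::euclidean_space \<Rightarrow> ennreal"
  assumes [measurable]: "m \<in> borel_measurable borel" and even: "\<And>z. m (- z) = m z"
  shows "(\<integral>\<^sup>+y. m (x - y) \<partial>lebesgue) = (\<integral>\<^sup>+y. m y \<partial>lborel)"
proof -
  have "(\<integral>\<^sup>+y. m (x - y) \<partial>lebesgue) = (\<integral>\<^sup>+y. m (x - y) \<partial>lborel)" by (rule nn_integral_completion)
  also have "\<dots> = (\<integral>\<^sup>+y. m (- x + y) \<partial>lborel)"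
    by (intro nn_integral_cong) (metis even minus_diff_eq uminus_add_conv_diff)
  also have "\<dots> = (\<integral>\<^sup>+y. m y \<partial>distr lborel borel ((+) (- x)))" by (subst nn_integral_distr) auto
  also have "\<dots> = (\<integral>\<^sup>+y. m y \<partial>lborel)" by (simp only: lborel_distr_plus)
  finally show ?thesis .
qed

context fractional_space
begin

text \<open>The Gagliardo kernel of a bounded Lipschitz function, split into dyadic shells. Near the origin the series
  converges because \<open>s < 1\<close>, that is \<open>P > N\<close>.\<close>

lemma kernel_integrable:
  assumes L: "0 < L"
  shows "(\<integral>\<^sup>+z. ennreal (min (L * norm z) (2 * L) powr P / norm z ^ (2 * N)) \<partial>(lborel :: (real^'n) measure)) < \<infinity>"
proof -
  have PN: "real N < P" using s01 N_ge_2 by (simp add: P_def N_def less_divide_eq)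
  define \<kappa> where "\<kappa> = 2 powr (- (P - N))"
  have "\<kappa> < 2 powr 0" unfolding \<kappa>_def using PN by (intro powr_less_mono) auto
  then have \<kappa>: "0 < \<kappa>" "\<kappa> < 1" by (auto simp: \<kappa>_def)
  define a where "a j = L powr P * 2 ^ N * (2 ^ N * \<kappa>) ^ j" for j :: nat
  define b where "b j = (2 * L) powr P / (4 ^ N) ^ j" for j :: nat
  have ab: "0 \<le> a j" "0 \<le> b j" for j using \<kappa> by (auto simp: a_def b_def)
  define B1 where "B1 j = (cball 0 ((1 / 2) ^ j) :: (real^'n) set)" for j :: nat
  define B2 where "B2 j = (cball 0 (2 ^ Suc j) :: (real^'n) set)" for j :: nat
  have Bs[measurable]: "B1 j \<in> sets lborel" "B2 j \<in> sets lborel" for j by (auto simp: B1_def B2_def)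
  have pw: "ennreal (min (L * norm z) (2 * L) powr P / norm z ^ (2 * N))
      \<le> (\<Sum>j. ennreal (a j) * indicator (B1 j) z) + (\<Sum>j. ennreal (b j) * indicator (B2 j) z)" for z
  proof -
    define t where "t = norm z"
    consider "t = 0" | "0 < t" "t \<le> 1" | "1 < t" unfolding t_def using norm_ge_zero[of z] by linarith
    then show ?thesis
    proof cases
      case 1
      then show ?thesis using N_ge_2 L by (simp add: t_def min_def)
    next
      case 2
      then obtain j where j: "(1 / 2) ^ Suc j < t" "t \<le> (1 / 2) ^ j" using dyadic_below_one by blast
      have "min (L * t) (2 * L) powr P / t ^ (2 * N) \<le> (L * t) powr P / t ^ (2 * N)"
        using 2 L P_gt_2 by (intro divide_right_mono powr_mono2) auto
      also have "\<dots> = L powr P * (t powr (P - N) * (1 / t) ^ N)"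
      proof -
        have "t powr P = t powr (P - N) * t ^ N"
          using 2 by (simp add: powr_diff powr_realpow)
        then show ?thesis using 2 L by (simp add: powr_mult power_mult power2_eq_square power_mult_distrib field_simps)
      qed
      also have "\<dots> \<le> L powr P * (\<kappa> ^ j * (2 ^ Suc j) ^ N)"
      proof (intro mult_left_mono mult_mono)
        have "t powr (P - N) \<le> ((1 / 2) ^ j) powr (P - N)" using j(2) 2 PN by (intro powr_mono2) auto
        also have "\<dots> = \<kappa> ^ j"
        proof -
          have "(1 / 2 :: real) ^ j = 2 powr (- real j)" by (simp add: powr_minus_divide powr_realpow power_one_over)
          moreover have "\<kappa> ^ j = \<kappa> powr real j" using \<kappa> by (simp add: powr_realpow)
          ultimately show ?thesis by (simp add: \<kappa>_def powr_powr algebra_simps)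
        qed
        finally show "t powr (P - N) \<le> \<kappa> ^ j" .
        have "1 / t \<le> 2 ^ Suc j" using j(1) 2 by (simp add: field_simps power_one_over)
        then show "(1 / t) ^ N \<le> (2 ^ Suc j) ^ N" using 2 by (intro power_mono) auto
      qed (use \<kappa> 2 in auto)
      also have "\<dots> = a j"
        by (simp add: a_def power_mult_distrib power_mult[symmetric] mult_ac)
      finally have "ennreal (min (L * t) (2 * L) powr P / t ^ (2 * N)) \<le> ennreal (a j) * indicator (B1 j) z"
        using j(2) by (auto simp: B1_def t_def intro: ennreal_leI)
      also have "\<dots> \<le> (\<Sum>j. ennreal (a j) * indicator (B1 j) z)"
        by (rule ennreal_term_le_suminf)
      finally show ?thesis unfolding t_def by (rule order_trans) simp
    next
      case 3
      then obtain j where j: "2 ^ j < t" "t \<le> 2 ^ Suc j" using dyadic_above_one by blast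
      have "min (L * t) (2 * L) powr P / t ^ (2 * N) \<le> (2 * L) powr P / t ^ (2 * N)"
        using 3 L P_gt_2 by (intro divide_right_mono powr_mono2) auto
      also have "\<dots> \<le> (2 * L) powr P / (2 ^ j) ^ (2 * N)"
        using j 3 by (intro divide_left_mono power_mono) auto
      also have "\<dots> = b j"
      proof -
        have "((2::real) ^ j) ^ (2 * N) = (4 ^ N) ^ j"
          by (metis (no_types) mult.commute power_mult numeral_power_eq_of_nat_cancel_iff power2_eq_square four_x_squared mult_2 numeral_Bit0 power_even_eq)
        then show ?thesis by (simp add: b_def)
      qed
      finally have "ennreal (min (L * t) (2 * L) powr P / t ^ (2 * N)) \<le> ennreal (b j) * indicator (B2 j) z"
        using j(2) by (auto simp: B2_def t_def intro: ennreal_leI)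
      also have "\<dots> \<le> (\<Sum>j. ennreal (b j) * indicator (B2 j) z)"
        by (rule ennreal_term_le_suminf)
      finally show ?thesis unfolding t_def by (rule order_trans) simp
    qed
  qed
  define \<omega> where "\<omega> = unit_ball_vol (real N)"
  have \<omega>: "0 < \<omega>" unfolding \<omega>_def by (rule unit_ball_vol_pos) simp
  have em: "emeasure lborel (cball 0 r :: (real^'n) set) = ennreal (\<omega> * r ^ N)" if "0 \<le> r" for r
    using emeasure_cball[OF that, of "0::real^'n"] by (simp add: \<omega>_def N_def)
  have "(\<integral>\<^sup>+z. ennreal (min (L * norm z) (2 * L) powr P / norm z ^ (2 * N)) \<partial>(lborel :: (real^'n) measure))
      \<le> (\<integral>\<^sup>+z. (\<Sum>j. ennreal (a j) * indicator (B1 j) z) + (\<Sum>j. ennreal (b j) * indicator (B2 j) z) \<partial>lborel)"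
    by (intro nn_integral_mono pw)
  also have "\<dots> = (\<Sum>j. ennreal (a j) * emeasure lborel (B1 j)) + (\<Sum>j. ennreal (b j) * emeasure lborel (B2 j))"
    by (simp add: nn_integral_add nn_integral_suminf nn_integral_cmult_indicator[OF Bs(1)] nn_integral_cmult_indicator[OF Bs(2)])
  also have "(\<Sum>j. ennreal (a j) * emeasure lborel (B1 j)) = (\<Sum>j. ennreal (L powr P * 2 ^ N * \<omega> * \<kappa> ^ j))"
  proof (intro suminf_cong)
    fix j
    have "a j * (\<omega> * ((1 / 2) ^ j) ^ N) = L powr P * 2 ^ N * \<omega> * \<kappa> ^ j"
      by (simp add: a_def power_mult_distrib power_one_over power_mult[symmetric] mult.commute[of N j])
    moreover have "ennreal (a j) * emeasure lborel (B1 j) = ennreal (a j * (\<omega> * ((1 / 2) ^ j) ^ N))"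
      using ab \<omega> unfolding B1_def by (subst em) (auto intro!: ennreal_mult[symmetric])
    ultimately show "ennreal (a j) * emeasure lborel (B1 j) = ennreal (L powr P * 2 ^ N * \<omega> * \<kappa> ^ j)"
      by (simp only:)
  qed
  also have "\<dots> = ennreal (L powr P * 2 ^ N * \<omega> * (1 / (1 - \<kappa>)))"
    using \<kappa> \<omega> by (intro suminf_ennreal_eq sums_mult geometric_sums) auto
  also have "(\<Sum>j. ennreal (b j) * emeasure lborel (B2 j)) = (\<Sum>j. ennreal ((2 * L) powr P * 2 ^ N * \<omega> * (1 / 2 ^ N) ^ j))"
  proof (intro suminf_cong)
    fix j
    have e4: "(4::real) ^ N = 2 ^ N * 2 ^ N" by (simp flip: power_mult_distrib)
    have e2: "((2::real) ^ Suc j) ^ N = 2 ^ N * (2 ^ N) ^ j" by (simp add: power_mult_distrib power_mult[symmetric] mult.commute)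
    have "b j * (\<omega> * (2 ^ Suc j) ^ N) = (2 * L) powr P * 2 ^ N * \<omega> * (1 / 2 ^ N) ^ j"
      unfolding b_def e4 e2 by (simp add: power_mult_distrib power_one_over field_simps)
    moreover have "ennreal (b j) * emeasure lborel (B2 j) = ennreal (b j * (\<omega> * (2 ^ Suc j) ^ N))"
      using ab \<omega> unfolding B2_def by (subst em) (auto intro!: ennreal_mult[symmetric] simp del: power_Suc)
    ultimately show "ennreal (b j) * emeasure lborel (B2 j) = ennreal ((2 * L) powr P * 2 ^ N * \<omega> * (1 / 2 ^ N) ^ j)"
      by (simp only:)
  qed
  also have "\<dots> = ennreal ((2 * L) powr P * 2 ^ N * \<omega> * (1 / (1 - 1 / 2 ^ N)))"
    using N_ge_2 \<omega> by (intro suminf_ennreal_eq sums_mult geometric_sums) auto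
  also have "ennreal (L powr P * 2 ^ N * \<omega> * (1 / (1 - \<kappa>))) + ennreal ((2 * L) powr P * 2 ^ N * \<omega> * (1 / (1 - 1 / 2 ^ N))) < \<infinity>"
    by simp
  finally show ?thesis .
qed

lemma continuous_measurable_lebesgue:
  fixes \<phi> :: "real^'n \<Rightarrow> real"
  assumes "continuous_on UNIV \<phi>"
  shows "\<phi> \<in> borel_measurable leb"
  using assms by (intro measurable_completion) (simp add: borel_measurable_continuous_onI)

lemma test_measurable: "\<phi> \<in> test_functions \<Longrightarrow> \<phi> \<in> borel_measurable leb"
  by (intro continuous_measurable_lebesgue) (auto simp: test_function_iff smooth_derivative)

text \<open>
  A pair of points contributes only if one of them lies in the support, and the kernel integrated in the other point is a constant.
\<close>

lemma test_energy_finite: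
  assumes \<phi>: "\<phi> \<in> test_functions"
  shows "E \<phi> < \<infinity>"
proof -
  obtain L where L: "0 < L" "\<And>x. \<bar>\<phi> x\<bar> \<le> L" "\<And>x y. \<bar>\<phi> x - \<phi> y\<bar> \<le> L * norm (x - y)"
    using test_function_bounded_lipschitz[OF \<phi>] by blast
  obtain R where R: "{x. \<phi> x \<noteq> 0} \<subseteq> ball 0 R"
    using bounded_subset_ballD \<phi> by (fastforce simp: test_function_iff)
  define B where "B = (ball 0 R :: (real^'n) set)"
  have B[measurable]: "B \<in> sets leb" and Bf: "emeasure leb B < \<infinity>"
    using emeasure_bounded_finite[of B] by (auto simp: B_def)
  define m where "m z = ennreal (min (L * norm z) (2 * L) powr P / norm z ^ (2 * N))" for z :: "real^'n"
  have m[measurable]: "m \<in> borel_measurable borel" unfolding m_def[abs_def] by measurable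
  have meven: "m (- z) = m z" for z by (simp add: m_def)
  define J where "J = (\<integral>\<^sup>+z. m z \<partial>lborel)"
  have J: "J < \<infinity>" unfolding J_def m_def by (rule kernel_integrable[OF L(1)])
  have mm[measurable]: "(\<lambda>z. m (fst z - snd z)) \<in> borel_measurable leb2"
  proof -
    have [measurable]: "fst \<in> leb2 \<rightarrow>\<^sub>M borel" by (rule measurable_compose[OF measurable_fst id_lebesgue_borel])
    have [measurable]: "snd \<in> leb2 \<rightarrow>\<^sub>M borel" by (rule measurable_compose[OF measurable_snd id_lebesgue_borel])
    show ?thesis by measurable
  qed
  have [measurable]: "(\<lambda>z. indicator B (fst z) * m (fst z - snd z)) \<in> borel_measurable leb2"
    "(\<lambda>z. indicator B (snd z) * m (fst z - snd z)) \<in> borel_measurable leb2" by measurable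
  have "gagliardo_energy s \<phi> \<le> (\<integral>\<^sup>+z. indicator B (fst z) * m (fst z - snd z) + indicator B (snd z) * m (fst z - snd z) \<partial>leb2)"
    unfolding gagliardo_energy_def
  proof (intro nn_integral_mono)
    fix z :: "(real^'n) \<times> (real^'n)"
    have "\<bar>\<phi> (fst z) - \<phi> (snd z)\<bar> \<le> min (L * norm (fst z - snd z)) (2 * L)"
      using L(2)[of "fst z"] L(2)[of "snd z"] L(3)[of "fst z" "snd z"] by auto
    then have "\<bar>\<phi> (fst z) - \<phi> (snd z)\<bar> powr P / norm (fst z - snd z) ^ (2 * N)
        \<le> min (L * norm (fst z - snd z)) (2 * L) powr P / norm (fst z - snd z) ^ (2 * N)"
      using P_gt_2 by (intro divide_right_mono powr_mono2) auto
    then have le: "ennreal (\<bar>\<phi> (fst z) - \<phi> (snd z)\<bar> powr P / norm (fst z - snd z) ^ (2 * N)) \<le> m (fst z - snd z)"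
      unfolding m_def by (rule ennreal_leI)
    then have le': "ennreal (\<bar>\<phi> (fst z) - \<phi> (snd z)\<bar> powr (real CARD('n) / s) / norm (fst z - snd z) ^ (2 * CARD('n))) \<le> m (fst z - snd z)"
      by (simp only: P_def N_def)
    show "ennreal (\<bar>\<phi> (fst z) - \<phi> (snd z)\<bar> powr (real CARD('n) / s) / norm (fst z - snd z) ^ (2 * CARD('n)))
        \<le> indicator B (fst z) * m (fst z - snd z) + indicator B (snd z) * m (fst z - snd z)"
    proof (cases "fst z \<in> B \<or> snd z \<in> B")
      case True
      then have "m (fst z - snd z) \<le> indicator B (fst z) * m (fst z - snd z) + indicator B (snd z) * m (fst z - snd z)"
        by (auto split: split_indicator)
      with le' show ?thesis by (rule order_trans)
    next
      case False
      then have "\<phi> (fst z) = 0" "\<phi> (snd z) = 0" using R by (auto simp: B_def)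
      then show ?thesis by simp
    qed
  qed
  also have "\<dots> = (\<integral>\<^sup>+z. indicator B (fst z) * m (fst z - snd z) \<partial>leb2) + (\<integral>\<^sup>+z. indicator B (snd z) * m (fst z - snd z) \<partial>leb2)"
    by (intro nn_integral_add) auto
  also have "(\<integral>\<^sup>+z. indicator B (fst z) * m (fst z - snd z) \<partial>leb2) = (\<integral>\<^sup>+x. \<integral>\<^sup>+y. indicator B x * m (x - y) \<partial>leb \<partial>leb)"
    by (subst lebesgue.nn_integral_fst[symmetric]) auto
  also have "\<dots> = (\<integral>\<^sup>+x. J * indicator B x \<partial>leb)"
  proof (intro nn_integral_cong)
    fix x
    have "(\<integral>\<^sup>+y. indicator B x * m (x - y) \<partial>leb) = indicator B x * (\<integral>\<^sup>+y. m (x - y) \<partial>leb)"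
      by (auto split: split_indicator)
    then show "(\<integral>\<^sup>+y. indicator B x * m (x - y) \<partial>leb) = J * indicator B x"
      by (simp add: nn_integral_lebesgue_translate[OF m meven] J_def mult.commute)
  qed
  also have "(\<integral>\<^sup>+z. indicator B (snd z) * m (fst z - snd z) \<partial>leb2) = (\<integral>\<^sup>+y. \<integral>\<^sup>+x. indicator B y * m (x - y) \<partial>leb \<partial>leb)"
    by (subst lebesgue_pair.nn_integral_snd[symmetric]) auto
  also have "\<dots> = (\<integral>\<^sup>+y. J * indicator B y \<partial>leb)"
  proof (intro nn_integral_cong)
    fix y
    have "m (x - y) = m (y - x)" for x using meven[of "x - y"] by simp
    then have "(\<integral>\<^sup>+x. indicator B y * m (x - y) \<partial>leb) = indicator B y * (\<integral>\<^sup>+x. m (y - x) \<partial>leb)"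
      by (auto split: split_indicator)
    then show "(\<integral>\<^sup>+x. indicator B y * m (x - y) \<partial>leb) = J * indicator B y"
      by (simp add: nn_integral_lebesgue_translate[OF m meven] J_def mult.commute)
  qed
  also have "(\<integral>\<^sup>+x. J * indicator B x \<partial>leb) = J * emeasure leb B" by (rule nn_integral_cmult_indicator[OF B])
  finally have "gagliardo_energy s \<phi> \<le> J * emeasure leb B + J * emeasure leb B" .
  also have "\<dots> < \<infinity>" using J Bf by (simp add: ennreal_mult_less_top del: emeasure_completion)
  finally have g: "gagliardo_energy s \<phi> < \<infinity>" .
  have cV: "continuous_on UNIV V" using V1 by (simp add: cond_V1_def)
  have "compact (V ` cball 0 R)"
    by (intro compact_continuous_image continuous_on_subset[OF cV]) auto
  then have "bounded (V ` cball 0 R)" by (rule compact_imp_bounded)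
  then obtain W where "\<forall>v\<in>V ` cball 0 R. norm v \<le> W" by (auto simp: bounded_iff)
  then have "\<And>x. x \<in> B \<Longrightarrow> norm (V x) \<le> W" by (auto simp: B_def)
  then have W: "\<And>x. x \<in> B \<Longrightarrow> V x \<le> W" by fastforce
  have "lp_energy leb P (vq \<phi>) \<le> (\<integral>\<^sup>+x. ennreal (W * L powr P) * indicator B x \<partial>leb)"
    unfolding lp_energy_def vq_powr
  proof (intro nn_integral_mono)
    fix x
    show "ennreal (V x * \<bar>\<phi> x\<bar> powr P) \<le> ennreal (W * L powr P) * indicator B x"
    proof (cases "x \<in> B")
      case True
      have "V x * \<bar>\<phi> x\<bar> powr P \<le> W * L powr P"
        using W[OF True] V_pos[of x] L P_gt_2 by (intro mult_mono powr_mono2) auto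
      then show ?thesis using True by (simp add: ennreal_leI)
    next
      case False
      then have "\<phi> x = 0" using R by (auto simp: B_def)
      then show ?thesis by simp
    qed
  qed
  also have "\<dots> < \<infinity>" using Bf by (simp add: nn_integral_cmult_indicator[OF B] ennreal_mult_less_top del: emeasure_completion)
  finally show ?thesis using g by (simp add: E_eq gagliardo_eq)
qed

section \<open>The function space\<close>

abbreviation "WV \<equiv> WV_space s V"

lemma WV_measurable: "u \<in> WV \<Longrightarrow> u \<in> borel_measurable leb"
  by (simp add: WV_space_def)

lemma E_combination:
  assumes [measurable]: "u \<in> borel_measurable leb" "v \<in> borel_measurable leb"
  shows "E (\<lambda>x. a * u x + b * v x) \<le> ennreal (2 powr P) * (ennreal (\<bar>a\<bar> powr P) * E u + ennreal (\<bar>b\<bar> powr P) * E v)"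
  using E_add[of "\<lambda>x. a * u x" "\<lambda>x. b * v x"] by (simp add: E_scale)

lemma E_diff_le:
  assumes "u \<in> borel_measurable leb" "v \<in> borel_measurable leb"
  shows "E (\<lambda>x. u x - v x) \<le> ennreal (2 powr P) * (E u + E v)"
  using E_combination[OF assms, of 1 "-1"] by simp

lemma WV_closed:
  assumes v: "\<And>n. v n \<in> WV" and u[measurable]: "u \<in> borel_measurable leb"
    and lim: "(\<lambda>n. E (\<lambda>x. u x - v n x)) \<longlonglongrightarrow> 0"
  shows "u \<in> WV"
proof -
  have "\<exists>\<phi>. \<phi> \<in> test_functions \<and> E (\<lambda>x. v n x - \<phi> x) < ennreal (1 / Suc n)" for n
  proof -
    obtain \<phi> where \<phi>: "\<And>k::nat. \<phi> k \<in> test_functions" "(\<lambda>k. E (\<lambda>x. v n x - \<phi> k x)) \<longlonglongrightarrow> 0"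
      using v[of n] by (auto simp: WV_space_def)
    have "\<forall>\<^sub>F k in sequentially. E (\<lambda>x. v n x - \<phi> k x) < ennreal (1 / Suc n)"
      using \<phi>(2) by (rule order_tendstoD) simp
    then show ?thesis using \<phi>(1) by (auto simp: eventually_sequentially)
  qed
  then obtain \<psi> where \<psi>: "\<And>n. \<psi> n \<in> test_functions" "\<And>n. E (\<lambda>x. v n x - \<psi> n x) < ennreal (1 / Suc n)" by metis
  note m[measurable] = WV_measurable[OF v] test_measurable[OF \<psi>(1)]
  have le: "E (\<lambda>x. u x - \<psi> n x) \<le> ennreal (2 powr P) * (E (\<lambda>x. u x - v n x) + ennreal (1 / Suc n))" for n
  proof -
    have "E (\<lambda>x. (u x - v n x) + (v n x - \<psi> n x)) \<le> ennreal (2 powr P) * (E (\<lambda>x. u x - v n x) + E (\<lambda>x. v n x - \<psi> n x))"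
      by (intro E_add) measurable
    also have "\<dots> \<le> ennreal (2 powr P) * (E (\<lambda>x. u x - v n x) + ennreal (1 / Suc n))"
      using \<psi>(2)[of n] by (intro mult_left_mono add_left_mono) auto
    finally show ?thesis by simp
  qed
  have "(\<lambda>n. ennreal (1 / Suc n)) \<longlonglongrightarrow> ennreal 0"
    using LIMSEQ_inverse_real_of_nat by (intro tendsto_ennrealI) (simp add: inverse_eq_divide)
  then have "(\<lambda>n. ennreal (2 powr P) * (E (\<lambda>x. u x - v n x) + ennreal (1 / Suc n))) \<longlonglongrightarrow> ennreal (2 powr P) * (0 + ennreal 0)"
    by (intro ennreal_tendsto_cmult tendsto_add lim) auto
  then have l: "(\<lambda>n. ennreal (2 powr P) * (E (\<lambda>x. u x - v n x) + ennreal (1 / Suc n))) \<longlonglongrightarrow> 0" by simp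
  have "(\<lambda>n. E (\<lambda>x. u x - \<psi> n x)) \<longlonglongrightarrow> 0"
    by (rule tendsto_sandwich[OF _ _ tendsto_const l]) (intro always_eventually allI le zero_le)+
  then show ?thesis using \<psi>(1) u by (auto simp: WV_space_def)
qed

lemma WV_finite:
  assumes "u \<in> WV"
  shows "E u < \<infinity>"
proof -
  note [measurable] = WV_measurable[OF assms]
  obtain \<phi> where \<phi>: "\<And>k::nat. \<phi> k \<in> test_functions" "(\<lambda>k. E (\<lambda>x. u x - \<phi> k x)) \<longlonglongrightarrow> 0"
    using assms by (auto simp: WV_space_def)
  have "\<forall>\<^sub>F k in sequentially. E (\<lambda>x. u x - \<phi> k x) < 1" using \<phi>(2) by (rule order_tendstoD) simp
  then obtain k where k: "E (\<lambda>x. u x - \<phi> k x) < 1" by (auto simp: eventually_sequentially)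
  note [measurable] = test_measurable[OF \<phi>(1)]
  have "E (\<lambda>x. (u x - \<phi> k x) + \<phi> k x) \<le> ennreal (2 powr P) * (E (\<lambda>x. u x - \<phi> k x) + E (\<phi> k))"
    by (intro E_add) measurable
  also have "\<dots> < \<infinity>"
    using k test_energy_finite[OF \<phi>(1), of k] by (auto simp: ennreal_mult_less_top intro: less_trans)
  finally show ?thesis by simp
qed

lemma test_in_WV: "\<phi> \<in> test_functions \<Longrightarrow> \<phi> \<in> WV"
  using test_measurable[of \<phi>] P_gt_2
  by (auto simp: WV_space_def intro!: exI[of _ "\<lambda>_. \<phi>"])
    (simp add: WV_energy_def gagliardo_energy_def)

lemma WV_combination:
  assumes u: "u \<in> WV" and v: "v \<in> WV"
  shows "(\<lambda>x. a * u x + b * v x) \<in> WV"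
proof -
  note [measurable] = WV_measurable[OF u] WV_measurable[OF v]
  obtain \<phi> where \<phi>: "\<And>k::nat. \<phi> k \<in> test_functions" "(\<lambda>k. E (\<lambda>x. u x - \<phi> k x)) \<longlonglongrightarrow> 0"
    using u by (auto simp: WV_space_def)
  obtain \<psi> where \<psi>: "\<And>k::nat. \<psi> k \<in> test_functions" "(\<lambda>k. E (\<lambda>x. v x - \<psi> k x)) \<longlonglongrightarrow> 0"
    using v by (auto simp: WV_space_def)
  note [measurable] = test_measurable[OF \<phi>(1)] test_measurable[OF \<psi>(1)]
  have le: "E (\<lambda>x. (a * u x + b * v x) - (a * \<phi> k x + b * \<psi> k x)) \<le>
     ennreal (2 powr P) * (ennreal (\<bar>a\<bar> powr P) * E (\<lambda>x. u x - \<phi> k x) + ennreal (\<bar>b\<bar> powr P) * E (\<lambda>x. v x - \<psi> k x))" for k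
    using E_combination[of "\<lambda>x. u x - \<phi> k x" "\<lambda>x. v x - \<psi> k x" a b] by (simp add: algebra_simps)
  have "(\<lambda>k. ennreal (2 powr P) * (ennreal (\<bar>a\<bar> powr P) * E (\<lambda>x. u x - \<phi> k x) + ennreal (\<bar>b\<bar> powr P) * E (\<lambda>x. v x - \<psi> k x)))
     \<longlonglongrightarrow> ennreal (2 powr P) * (ennreal (\<bar>a\<bar> powr P) * 0 + ennreal (\<bar>b\<bar> powr P) * 0)"
    by (intro ennreal_tendsto_cmult tendsto_add \<phi> \<psi>) auto
  then have l: "(\<lambda>k. ennreal (2 powr P) * (ennreal (\<bar>a\<bar> powr P) * E (\<lambda>x. u x - \<phi> k x) + ennreal (\<bar>b\<bar> powr P) * E (\<lambda>x. v x - \<psi> k x))) \<longlonglongrightarrow> 0"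
    by simp
  have "(\<lambda>k. E (\<lambda>x. (a * u x + b * v x) - (a * \<phi> k x + b * \<psi> k x))) \<longlonglongrightarrow> 0"
    by (rule tendsto_sandwich[OF _ _ tendsto_const l]) (intro always_eventually allI le zero_le)+
  then show ?thesis using test_function_combination[OF \<phi>(1) \<psi>(1)]
    by (auto simp: WV_space_def intro!: exI[of _ "\<lambda>k x. a * \<phi> k x + b * \<psi> k x"])
qed

lemma WV_linear:
  assumes "u \<in> WV"
  shows "(\<lambda>x. c * u x) \<in> WV" and "v \<in> WV \<Longrightarrow> (\<lambda>x. u x + v x) \<in> WV" and "v \<in> WV \<Longrightarrow> (\<lambda>x. u x - v x) \<in> WV"
  using WV_combination[OF assms assms, of c 0] WV_combination[OF assms, of v 1 1] WV_combination[OF assms, of v 1 "-1"]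
  by simp_all

text \<open>
  A substitute for Mazur's lemma. The sets of all elements of the space with energy at most \<open>K\<close> and \<open>L\<^sup>P\<close> distance at most
  \<open>1/(n+1)\<close> from \<open>u\<close> are convex and decrease in \<open>n\<close>; by Clarkson's inequality almost-minimisers of the energy on
  them form a Cauchy sequence, whose limit can only be \<open>u\<close>.
\<close>

lemma WV_weakly_closed:
  assumes v: "\<And>n. v n \<in> WV" and EK: "\<And>n. E (v n) \<le> ennreal K" and K: "0 \<le> K" and u[measurable]: "u \<in> borel_measurable leb"
    and lim: "(\<lambda>n. lp_energy leb P (\<lambda>x. v n x - u x)) \<longlonglongrightarrow> 0"
  shows "u \<in> WV"
proof -
  define C where "C n = {w \<in> WV. E w \<le> ennreal K \<and> lp_energy leb P (\<lambda>x. w x - u x) \<le> ennreal (1 / Suc n)}" for n :: nat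
  have ne: "C n \<noteq> {}" for n
  proof -
    have "\<forall>\<^sub>F k in sequentially. lp_energy leb P (\<lambda>x. v k x - u x) < ennreal (1 / Suc n)"
      using lim by (rule order_tendstoD) simp
    then obtain k where "lp_energy leb P (\<lambda>x. v k x - u x) < ennreal (1 / Suc n)" by (auto simp: eventually_sequentially)
    then have "v k \<in> C n" using v EK by (auto simp: C_def)
    then show ?thesis by blast
  qed
  have anti: "C m \<subseteq> C n" if "n \<le> m" for n m
  proof -
    have "ennreal (1 / Suc m) \<le> ennreal (1 / Suc n)" using that by (intro ennreal_leI) (simp add: frac_le)
    then show ?thesis by (auto simp: C_def intro: order_trans)
  qed
  have ErK: "Er w \<le> K" if "w \<in> C n" for w n
  proof -
    have "ennreal (Er w) \<le> ennreal K" using that WV_finite[of w] by (auto simp: C_def E_eq_Er)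
    then show ?thesis using K by (simp add: ennreal_le_iff)
  qed
  define d where "d n = (INF w\<in>C n. Er w)" for n
  have bb: "bdd_below (Er ` C n)" for n by (rule bdd_belowI2[where m = 0]) (rule Er_nonneg)
  have d_le: "d n \<le> Er w" if "w \<in> C n" for n w unfolding d_def using bb that by (rule cINF_lower)
  have dK: "d n \<le> K" for n using ne[of n] d_le ErK by (meson ex_in_conv order_trans)
  have dmono: "d n \<le> d m" if "n \<le> m" for n m
    unfolding d_def using ne bb anti[OF that] by (intro cINF_superset_mono) auto
  have "0 \<le> d n" for n unfolding d_def by (rule cINF_greatest[OF ne Er_nonneg])
  then have "Bseq d" using dK by (intro BseqI'[of _ K]) simp
  then have "convergent d" using dmono by (intro Bseq_mono_convergent) auto
  then obtain l where l: "d \<longlonglongrightarrow> l" by (auto simp: convergent_def)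
  have d_l: "d n \<le> l" for n using l dmono by (intro incseq_le) (auto simp: incseq_def)
  have "\<exists>w\<in>C n. Er w < d n + 1 / Suc n" for n
  proof -
    have "(INF w\<in>C n. Er w) < d n + 1 / Suc n" by (simp add: d_def)
    then show ?thesis using cINF_less_iff[OF ne bb] by blast
  qed
  then obtain w where w: "\<And>n. w n \<in> C n" "\<And>n. Er (w n) < d n + 1 / Suc n" by metis
  have wW: "w n \<in> WV" "E (w n) < \<infinity>" "lp_energy leb P (\<lambda>x. w n x - u x) \<le> ennreal (1 / Suc n)" for n
    using w(1)[of n] WV_finite by (auto simp: C_def)
  note [measurable] = WV_measurable[OF wW(1)]
  have half_sum: "ennreal (1 - 1 / 2) * c + ennreal (1 / 2) * c = c" for c
  proof -
    have "ennreal (1 - 1 / 2) + ennreal (1 / 2) = ennreal (1 - 1 / 2 + 1 / 2)" by (rule ennreal_plus[symmetric]) auto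
    then show ?thesis by (simp only: distrib_right[symmetric]) simp
  qed
  have cauchy: "E (\<lambda>x. (w n x - w m x) / 2) \<le> ennreal (1 / Suc n + (l - d n) / 2)" if nm: "n \<le> m" for n m
  proof -
    define h where "h x = (w n x + w m x) / 2" for x
    have h_eq: "h = (\<lambda>x. (1 - 1 / 2) * w n x + 1 / 2 * w m x)" by (simp add: h_def fun_eq_iff field_simps)
    have wm: "w m \<in> C n" using w(1)[of m] anti[OF nm] by blast
    have hC: "h \<in> C n"
    proof -
      have "h \<in> WV" unfolding h_eq by (intro WV_combination wW)
      moreover have "E h \<le> ennreal K"
      proof -
        have "E h \<le> ennreal (1 - 1 / 2) * E (w n) + ennreal (1 / 2) * E (w m)" unfolding h_eq by (intro E_convex) auto
        also have "\<dots> \<le> ennreal (1 - 1 / 2) * ennreal K + ennreal (1 / 2) * ennreal K"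
          using w(1)[of n] wm by (intro add_mono mult_left_mono) (auto simp: C_def)
        also have "\<dots> = ennreal K" by (rule half_sum)
        finally show ?thesis .
      qed
      moreover have "lp_energy leb P (\<lambda>x. h x - u x) \<le> ennreal (1 / Suc n)"
      proof -
        have "(\<lambda>x. h x - u x) = (\<lambda>x. (1 - 1 / 2) * (w n x - u x) + 1 / 2 * (w m x - u x))"
          by (simp add: h_def fun_eq_iff field_simps)
        then have "lp_energy leb P (\<lambda>x. h x - u x)
            \<le> ennreal (1 - 1 / 2) * lp_energy leb P (\<lambda>x. w n x - u x) + ennreal (1 / 2) * lp_energy leb P (\<lambda>x. w m x - u x)"
          using P_gt_2 lp_energy_convex[of "\<lambda>x. w n x - u x" leb "\<lambda>x. w m x - u x" P "1 / 2"] by simp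
        also have "\<dots> \<le> ennreal (1 - 1 / 2) * ennreal (1 / Suc n) + ennreal (1 / 2) * ennreal (1 / Suc n)"
          using w(1)[of n] wm by (intro add_mono mult_left_mono) (auto simp: C_def)
        also have "\<dots> = ennreal (1 / Suc n)" by (rule half_sum)
        finally show ?thesis .
      qed
      ultimately show ?thesis by (simp add: C_def)
    qed
    define g where "g x = (w n x - w m x) / 2" for x
    have gW: "g \<in> WV" using WV_combination[OF wW(1) wW(1), of "1 / 2" n "- 1 / 2" m] by (simp add: g_def[abs_def] field_simps)
    have "2 * (E h + E g) \<le> E (w n) + E (w m)" unfolding h_def[abs_def] g_def[abs_def] by (rule E_clarkson) measurable
    then have "ennreal (2 * (Er h + Er g)) \<le> ennreal (Er (w n) + Er (w m))"
      using hC WV_finite[OF gW] WV_finite[of h] wW(2) Er_nonneg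
      by (simp add: C_def E_eq_Er ennreal_mult)
    then have "2 * (Er h + Er g) \<le> Er (w n) + Er (w m)"
      using Er_nonneg by (subst (asm) ennreal_le_iff) (auto intro: add_nonneg_nonneg)
    moreover have "d n \<le> Er h" using hC by (rule d_le)
    moreover have "1 / real (Suc m) \<le> 1 / real (Suc n)" using nm by (simp add: frac_le)
    moreover have "y \<le> a + (l - c) / 2"
      if "2 * (x + y) \<le> p + q" "c \<le> x" "b \<le> a" "p < c + a" "q < c' + b" "c' \<le> l" for a b c c' x y p q :: real
      using that by (simp add: field_simps)
    ultimately have "Er g \<le> 1 / Suc n + (l - d n) / 2" using w(2)[of n] w(2)[of m] d_l[of m] by blast
    then show ?thesis using E_eq_Er[OF WV_finite[OF gW]] by (simp add: g_def[abs_def] ennreal_leI)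
  qed
  have lpw: "(\<lambda>n. lp_energy leb P (\<lambda>x. w n x - u x)) \<longlonglongrightarrow> 0"
  proof -
    have "(\<lambda>n. ennreal (1 / Suc n)) \<longlonglongrightarrow> ennreal 0"
      using LIMSEQ_inverse_real_of_nat by (intro tendsto_ennrealI) (simp add: inverse_eq_divide)
    then have l0: "(\<lambda>n. ennreal (1 / Suc n)) \<longlonglongrightarrow> 0" by simp
    show ?thesis by (rule tendsto_sandwich[OF _ _ tendsto_const l0]) (intro always_eventually allI wW(3) zero_le)+
  qed
  have lpf: "lp_energy leb P (\<lambda>x. w n x - u x) < \<infinity>" for n using wW(3)[of n] by (rule le_less_trans) simp
  obtain \<sigma> where \<sigma>: "strict_mono \<sigma>" "AE x in leb. (\<lambda>n. w (\<sigma> n) x - u x) \<longlonglongrightarrow> 0"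
    using lp_energy_AE_subseq[of "\<lambda>n x. w n x - u x" leb P] lpw lpf P_gt_2 by auto
  have half: "E (\<lambda>x. (w n x - u x) / 2) \<le> ennreal (1 / Suc n + (l - d n) / 2)" for n
  proof -
    have "E (\<lambda>x. (w n x - u x) / 2) \<le> liminf (\<lambda>m. E (\<lambda>x. (w n x - w (\<sigma> m) x) / 2))"
    proof (rule E_fatou)
      show "AE x in leb. (\<lambda>m. (w n x - w (\<sigma> m) x) / 2) \<longlonglongrightarrow> (w n x - u x) / 2"
        using \<sigma>(2) by eventually_elim (intro tendsto_intros, simp_all add: LIM_zero_iff)
    qed measurable
    also have "\<dots> \<le> limsup (\<lambda>m. E (\<lambda>x. (w n x - w (\<sigma> m) x) / 2))" by (rule Liminf_le_Limsup) simp
    also have "\<dots> \<le> ennreal (1 / Suc n + (l - d n) / 2)"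
    proof (rule Limsup_bounded)
      have "n \<le> \<sigma> m" if "n \<le> m" for m using that seq_suble[OF \<sigma>(1), of m] by simp
      then show "\<forall>\<^sub>F m in sequentially. E (\<lambda>x. (w n x - w (\<sigma> m) x) / 2) \<le> ennreal (1 / Suc n + (l - d n) / 2)"
        using cauchy by (auto simp: eventually_sequentially)
    qed
    finally show ?thesis .
  qed
  have "(\<lambda>n. E (\<lambda>x. u x - w n x)) \<longlonglongrightarrow> 0"
  proof -
    have eq: "E (\<lambda>x. u x - w n x) = ennreal (2 powr P) * E (\<lambda>x. (w n x - u x) / 2)" for n
    proof -
      have "E (\<lambda>x. u x - w n x) = E (\<lambda>x. (- 2) * ((w n x - u x) / 2))"
        by (intro arg_cong[where f = E] ext) (simp add: field_simps)
      also have "\<dots> = ennreal (\<bar>- 2\<bar> powr P) * E (\<lambda>x. (w n x - u x) / 2)" by (rule E_scale) measurable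
      finally show ?thesis by simp
    qed
    have "(\<lambda>n. 1 / Suc n + (l - d n) / 2) \<longlonglongrightarrow> 0 + (l - l) / 2"
      using LIMSEQ_inverse_real_of_nat by (intro tendsto_intros l) (simp_all add: inverse_eq_divide)
    then have "(\<lambda>n. ennreal (2 powr P) * ennreal (1 / Suc n + (l - d n) / 2)) \<longlonglongrightarrow> ennreal (2 powr P) * ennreal 0"
      by (intro ennreal_tendsto_cmult tendsto_ennrealI) auto
    then have l0: "(\<lambda>n. ennreal (2 powr P) * ennreal (1 / Suc n + (l - d n) / 2)) \<longlonglongrightarrow> 0" by simp
    show ?thesis
      by (rule tendsto_sandwich[OF _ _ tendsto_const l0]) (unfold eq, (intro always_eventually allI mult_left_mono half zero_le)+)
  qed
  then show ?thesis by (intro WV_closed[OF wW(1)] u)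
qed

text \<open>
  For a test function \<open>\<phi>\<close> the functions \<open>sqrt (\<phi>\<^sup>2 + e\<^sup>2) - e\<close> are test functions of no larger energy, being contractions of \<open>\<phi>\<close>, and converge to
  \<open>\<bar>\<phi>\<bar>\<close> in \<open>L\<^sup>P\<close>. Convergence in energy is not obvious, and \<open>WV_weakly_closed\<close> makes it unnecessary; the same argument
  then passes from test functions to \<open>u\<close>.
\<close>

lemma WV_abs:
  assumes u: "u \<in> WV"
  shows "(\<lambda>x. \<bar>u x\<bar>) \<in> WV"
proof -
  have test: "(\<lambda>x. \<bar>\<phi> x\<bar>) \<in> WV" if \<phi>: "\<phi> \<in> test_functions" for \<phi>
  proof (rule WV_weakly_closed)
    note [measurable] = test_measurable[OF \<phi>]
    define e where "e n = 1 / real (Suc n)" for n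
    have e: "0 < e n" "e \<longlonglongrightarrow> 0" for n
      using LIMSEQ_inverse_real_of_nat by (auto simp: e_def[abs_def] inverse_eq_divide)
    let ?v = "\<lambda>n x. sqrt ((\<phi> x)\<^sup>2 + (e n)\<^sup>2) - e n"
    have bounds: "0 \<le> ?v n x" "?v n x \<le> \<bar>\<phi> x\<bar>" for n x
    proof -
      have "sqrt ((e n)\<^sup>2) \<le> sqrt ((\<phi> x)\<^sup>2 + (e n)\<^sup>2)" by (intro real_sqrt_le_mono) simp
      then show "0 \<le> ?v n x" using e(1)[of n] by simp
      have "sqrt ((\<phi> x)\<^sup>2 + (e n)\<^sup>2) \<le> sqrt ((\<phi> x)\<^sup>2) + sqrt ((e n)\<^sup>2)" by (rule sqrt_add_le_add_sqrt) auto
      then show "?v n x \<le> \<bar>\<phi> x\<bar>" using e(1)[of n] by simp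
    qed
    show "?v n \<in> WV" for n using \<phi> e by (intro test_in_WV test_function_regularized_abs)
    show "E (?v n) \<le> ennreal (Er \<phi>)" for n
    proof -
      have "E (?v n) \<le> E \<phi>"
      proof (rule E_contraction)
        fix x y
        have "\<bar>norm (\<phi> x, e n) - norm (\<phi> y, e n)\<bar> \<le> norm ((\<phi> x, e n) - (\<phi> y, e n))" by (rule norm_triangle_ineq3)
        then show "\<bar>?v n x - ?v n y\<bar> \<le> \<bar>\<phi> x - \<phi> y\<bar>" by (simp add: norm_Pair)
        show "\<bar>?v n x\<bar> \<le> \<bar>\<phi> x\<bar>" using bounds[where n = n and x = x] by simp
      qed
      then show ?thesis using test_energy_finite[OF \<phi>] by (simp add: E_eq_Er)
    qed
    show "0 \<le> Er \<phi>" by (rule Er_nonneg)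
    show "(\<lambda>x. \<bar>\<phi> x\<bar>) \<in> borel_measurable leb" by measurable
    have "(\<lambda>n. \<integral>\<^sup>+x. ennreal (\<bar>?v n x - \<bar>\<phi> x\<bar>\<bar> powr P) \<partial>leb) \<longlonglongrightarrow> (\<integral>\<^sup>+x. 0 \<partial>leb)"
    proof (rule nn_integral_dominated_convergence[where w = "\<lambda>x. ennreal (\<bar>\<phi> x\<bar> powr P)"])
      show "AE x in leb. ennreal (\<bar>?v n x - \<bar>\<phi> x\<bar>\<bar> powr P) \<le> ennreal (\<bar>\<phi> x\<bar> powr P)" for n
      proof (intro AE_I2 ennreal_leI powr_mono2)
        show "\<bar>?v n x - \<bar>\<phi> x\<bar>\<bar> \<le> \<bar>\<phi> x\<bar>" for x using bounds[where n = n and x = x] by linarith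
      qed (use P_gt_2 in auto)
      show "AE x in leb. (\<lambda>n. ennreal (\<bar>?v n x - \<bar>\<phi> x\<bar>\<bar> powr P)) \<longlonglongrightarrow> 0"
      proof (intro AE_I2)
        fix x
        have "(\<lambda>n. ?v n x - \<bar>\<phi> x\<bar>) \<longlonglongrightarrow> sqrt ((\<phi> x)\<^sup>2 + 0\<^sup>2) - 0 - \<bar>\<phi> x\<bar>"
          by (intro tendsto_intros e)
        then have "(\<lambda>n. \<bar>?v n x - \<bar>\<phi> x\<bar>\<bar> powr P) \<longlonglongrightarrow> \<bar>0\<bar> powr P"
          using P_gt_2 by (intro tendsto_powr' tendsto_rabs tendsto_const) auto
        then have "(\<lambda>n. ennreal (\<bar>?v n x - \<bar>\<phi> x\<bar>\<bar> powr P)) \<longlonglongrightarrow> ennreal 0"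
          by (intro tendsto_ennrealI) simp
        then show "(\<lambda>n. ennreal (\<bar>?v n x - \<bar>\<phi> x\<bar>\<bar> powr P)) \<longlonglongrightarrow> 0" by simp
      qed
      have "ennreal V0 * lp_energy leb P \<phi> < \<infinity>"
        using lp_le_E[OF test_measurable[OF \<phi>]] test_energy_finite[OF \<phi>] by (rule le_less_trans)
      then show "(\<integral>\<^sup>+x. ennreal (\<bar>\<phi> x\<bar> powr P) \<partial>leb) < \<infinity>"
        using V0(1) by (auto simp: ennreal_mult_less_top lp_energy_def)
    qed measurable
    then show "(\<lambda>n. lp_energy leb P (\<lambda>x. ?v n x - \<bar>\<phi> x\<bar>)) \<longlonglongrightarrow> 0" by (simp add: lp_energy_def)
  qed
  note [measurable] = WV_measurable[OF u]
  obtain \<phi> where \<phi>: "\<And>k::nat. \<phi> k \<in> test_functions" "(\<lambda>k. E (\<lambda>x. u x - \<phi> k x)) \<longlonglongrightarrow> 0"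
    using u by (auto simp: WV_space_def)
  note [measurable] = test_measurable[OF \<phi>(1)]
  have "\<forall>\<^sub>F k in sequentially. E (\<lambda>x. u x - \<phi> k x) < 1" using \<phi>(2) by (rule order_tendstoD) simp
  then obtain k0 where k0: "\<And>k. k0 \<le> k \<Longrightarrow> E (\<lambda>x. u x - \<phi> k x) < 1" by (auto simp: eventually_sequentially)
  define K where "K = 2 powr P * (1 + Er u)"
  show ?thesis
  proof (rule WV_weakly_closed[where v = "\<lambda>n x. \<bar>\<phi> (n + k0) x\<bar>" and K = K])
    show "(\<lambda>x. \<bar>\<phi> (n + k0) x\<bar>) \<in> WV" for n by (rule test[OF \<phi>(1)])
    show "0 \<le> K" using Er_nonneg by (simp add: K_def)
    show "E (\<lambda>x. \<bar>\<phi> (n + k0) x\<bar>) \<le> ennreal K" for n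
    proof -
      have "E (\<lambda>x. \<bar>\<phi> (n + k0) x\<bar>) \<le> E (\<lambda>x. u x - (u x - \<phi> (n + k0) x))"
        by (intro E_contraction) auto
      also have "\<dots> \<le> ennreal (2 powr P) * (E u + E (\<lambda>x. u x - \<phi> (n + k0) x))" by (intro E_diff_le) measurable
      also have "\<dots> \<le> ennreal (2 powr P) * (ennreal (Er u) + 1)"
        using k0[of "n + k0"] E_eq_Er[OF WV_finite[OF u]] by (intro mult_left_mono add_mono) auto
      also have "\<dots> = ennreal K" using Er_nonneg[of u] by (simp add: K_def ennreal_mult add.commute)
      finally show ?thesis .
    qed
    have le: "lp_energy leb P (\<lambda>x. \<bar>\<phi> (n + k0) x\<bar> - \<bar>u x\<bar>) \<le> ennreal (1 / V0) * E (\<lambda>x. u x - \<phi> (n + k0) x)" for n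
    proof -
      have "lp_energy leb P (\<lambda>x. \<bar>\<phi> (n + k0) x\<bar> - \<bar>u x\<bar>) \<le> lp_energy leb P (\<lambda>x. u x - \<phi> (n + k0) x)"
        using P_gt_2 by (intro lp_energy_mono_AE AE_I2) auto
      also have "\<dots> = ennreal (1 / V0) * (ennreal V0 * lp_energy leb P (\<lambda>x. u x - \<phi> (n + k0) x))"
        using V0(1) by (simp add: mult.assoc[symmetric] flip: ennreal_mult)
      also have "\<dots> \<le> ennreal (1 / V0) * E (\<lambda>x. u x - \<phi> (n + k0) x)"
        by (intro mult_left_mono lp_le_E) auto
      finally show ?thesis .
    qed
    have "(\<lambda>n. ennreal (1 / V0) * E (\<lambda>x. u x - \<phi> (n + k0) x)) \<longlonglongrightarrow> ennreal (1 / V0) * 0"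
      using LIMSEQ_ignore_initial_segment[OF \<phi>(2)] by (intro ennreal_tendsto_cmult) auto
    then have l0: "(\<lambda>n. ennreal (1 / V0) * E (\<lambda>x. u x - \<phi> (n + k0) x)) \<longlonglongrightarrow> 0" by simp
    show "(\<lambda>n. lp_energy leb P (\<lambda>x. \<bar>\<phi> (n + k0) x\<bar> - \<bar>u x\<bar>)) \<longlonglongrightarrow> 0"
      by (rule tendsto_sandwich[OF _ _ tendsto_const l0]) (intro always_eventually allI le zero_le)+
  qed measurable
qed

end

section \<open>Primitives and exponential bounds\<close>

lemma primitive_eq_integral:
  assumes "0 \<le> t" "continuous_on {0..t} g"
  shows "primitive g t = integral {0..t} g"
proof -
  have "set_integrable lborel {0..t} g" by (rule borel_integrable_atLeastAtMost') (rule assms)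
  then show ?thesis
    using interval_integral_eq_integral[of 0 t g] assms(1) by (simp add: primitive_def zero_ereal_def)
qed

lemma primitive_eq_lebesgue_integral:
  assumes "0 \<le> t"
  shows "primitive g t = (LINT \<tau>|lborel. indicator {0..t} \<tau> * g \<tau>)"
  using interval_integral_Icc[of 0 t g] assms
  by (simp add: primitive_def zero_ereal_def set_lebesgue_integral_def)

lemma exp_remainder_le:
  fixes z :: real
  assumes "0 \<le> z"
  shows "exp z - (\<Sum>j<n. z ^ j / fact j) \<le> z ^ n * exp z"
proof -
  have s: "(\<lambda>j. z ^ j / fact j) sums exp z"
    using exp_converges[of z] by (simp add: divide_inverse mult.commute)
  have s1: "(\<lambda>j. z ^ (j + n) / fact (j + n)) sums (exp z - (\<Sum>j<n. z ^ j / fact j))"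
    using sums_split_initial_segment[OF s, of n] .
  have s2: "(\<lambda>j. z ^ n * (z ^ j / fact j)) sums (z ^ n * exp z)" by (rule sums_mult[OF s])
  have "z ^ (j + n) / fact (j + n) \<le> z ^ n * (z ^ j / fact j)" for j
  proof -
    have "(fact j :: real) \<le> fact (j + n)" by (rule fact_mono) simp
    then have "z ^ (j + n) / fact (j + n) \<le> z ^ (j + n) / fact j"
      using assms by (intro divide_left_mono) auto
    then show ?thesis by (simp add: power_add mult.commute)
  qed
  then show ?thesis using s1 s2 by (rule sums_le)
qed

lemma powr_le_exp:
  fixes b y :: real
  assumes "0 \<le> b"
  shows "\<exists>K>0. \<forall>y\<ge>0. y powr b \<le> K * exp y"
proof -
  obtain n :: nat where n: "b \<le> real n" using real_arch_simple by blast
  have "y powr b \<le> (1 + fact n) * exp y" if y: "0 \<le> y" for y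
  proof -
    have "y powr b \<le> 1 + y ^ n"
    proof (cases "y \<le> 1")
      case True
      then have "y powr b \<le> 1" using y assms by (intro powr_le1) auto
      then show ?thesis using y by (simp add: add_increasing2)
    next
      case False
      then have "y powr b \<le> y powr real n" using n by (intro powr_mono) auto
      then show ?thesis using False by (simp add: powr_realpow)
    qed
    also have "y ^ n \<le> fact n * exp y"
    proof -
      have "(\<Sum>i\<in>{n}. inverse (fact i) *\<^sub>R y ^ i) \<le> (\<Sum>i. inverse (fact i) *\<^sub>R y ^ i)"
        using y by (intro sum_le_suminf summable_exp_generic) auto
      then have "y ^ n / fact n \<le> exp y" by (simp add: exp_def divide_inverse mult.commute)
      then show ?thesis by (simp add: divide_le_eq mult.commute)
    qed
    also have "1 + fact n * exp y \<le> (1 + fact n) * exp y" using y by (simp add: distrib_right)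
    finally show ?thesis by simp
  qed
  then show ?thesis by (intro exI[of _ "1 + fact n"]) (auto simp: add_pos_pos)
qed

locale kirchhoff_problem = fractional_space s P N V
  for s P :: real and N :: nat and V :: "real^'n \<Rightarrow> real" +
  fixes p \<theta> :: real and M :: "real \<Rightarrow> real" and f :: "real^'n \<Rightarrow> real \<Rightarrow> real" and h :: "real^'n \<Rightarrow> real"
  assumes V2: "cond_V2 V" and Mk: "kirchhoff_function M" and M1: "cond_M1 M" and M2: "cond_M2 M \<theta>"
    and fn: "nonlinearity f" and f1: "cond_f1 s \<theta> f" and f2: "cond_f2 s \<theta> f" and f3: "cond_f3 s \<theta> V M f"
    and p: "1 < p" "p < P" and h_meas: "h \<in> borel_measurable lebesgue" and h_nonneg: "\<And>x. 0 \<le> h x"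
    and h_int: "integrable lebesgue (\<lambda>x. \<bar>h x\<bar> powr (real CARD('n) / (real CARD('n) - s * p)))"
    and h_nt: "nontrivial h"
begin

section \<open>The Kirchhoff function\<close>

abbreviation "MM \<equiv> primitive M"

lemma M_cont: "continuous_on {0..} M" and M_nonneg: "0 \<le> t \<Longrightarrow> 0 \<le> M t"
  using Mk by (auto simp: kirchhoff_function_def)

lemma MM_eq: "0 \<le> t \<Longrightarrow> MM t = integral {0..t} M"
  by (rule primitive_eq_integral) (auto intro: continuous_on_subset[OF M_cont])

lemma M_integrable: "0 \<le> a \<Longrightarrow> M integrable_on {a..b}"
  by (intro integrable_continuous_real continuous_on_subset[OF M_cont]) auto

lemma MM_deriv:
  assumes "0 \<le> t"
  shows "(MM has_real_derivative M t) (at t within {0..})"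
proof -
  have "((\<lambda>x. integral {0..x} M) has_real_derivative M t) (at t within {0..t + 1})"
    by (rule integral_has_real_derivative) (use assms in \<open>auto intro: continuous_on_subset[OF M_cont]\<close>)
  moreover have "at t within {0..t + 1} = at t within {0..}"
    by (rule at_within_nhd[of t "{..<t + 1}"]) auto
  ultimately have "((\<lambda>x. integral {0..x} M) has_real_derivative M t) (at t within {0..})" by simp
  then show ?thesis
    by (rule has_field_derivative_transform_within[where d = 1]) (use assms MM_eq in auto)
qed

lemma MM_deriv_at:
  assumes "0 < t"
  shows "(MM has_real_derivative M t) (at t)"
proof -
  have "at t within {0..} = at t" using assms by (intro at_within_interior) auto
  then show ?thesis using MM_deriv[of t] assms by simp
qed

lemma MM_continuous: "continuous_on {0..} MM"
  by (rule DERIV_continuous_on) (use MM_deriv in auto)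

lemma MM_zero [simp]: "MM 0 = 0"
  by (simp add: MM_eq)

lemma MM_mono:
  assumes "0 \<le> a" "a \<le> b"
  shows "MM a \<le> MM b"
  using assms by (simp add: MM_eq) (intro integral_subset_le M_integrable, auto simp: M_nonneg)

lemma MM_nonneg: "0 \<le> t \<Longrightarrow> 0 \<le> MM t"
  using MM_mono[of 0 t] by simp

text \<open>By \<open>cond_M1\<close> the derivative of \<open>MM\<close> is bounded below away from \<open>0\<close>.\<close>

lemma MM_lower:
  assumes "0 < e"
  shows "\<exists>c>0. \<forall>t\<ge>e. c * t \<le> MM t"
proof -
  have "0 < e / 2" using assms by simp
  then obtain \<kappa> where \<kappa>: "0 < \<kappa>" "\<And>t. e / 2 \<le> t \<Longrightarrow> \<kappa> \<le> M t"
    using M1 unfolding cond_M1_def by blast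
  have "\<kappa> / 2 * t \<le> MM t" if t: "e \<le> t" for t
  proof -
    have "\<kappa> * (t - e / 2) = integral {e / 2..t} (\<lambda>_. \<kappa>)" using t assms by (simp add: mult.commute)
    also have "\<dots> \<le> integral {e / 2..t} M"
      using \<kappa> assms by (intro integral_le M_integrable) auto
    also have "\<dots> \<le> MM t"
      unfolding MM_eq[OF order_trans[OF less_imp_le[OF assms] t]]
      using assms by (intro integral_subset_le M_integrable) (auto simp: M_nonneg)
    finally have "\<kappa> * (t - e / 2) \<le> MM t" .
    moreover have "\<kappa> * (t / 2) \<le> \<kappa> * (t - e / 2)" using \<kappa>(1) t by (intro mult_left_mono) auto
    ultimately show ?thesis by simp
  qed
  then show ?thesis using \<kappa>(1) by (intro exI[of _ "\<kappa> / 2"]) auto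
qed

lemma MM_1_pos: "0 < MM 1"
  using MM_lower[of 1] by force

lemma \<theta>_ge_1: "1 \<le> \<theta>" and M2': "0 \<le> t \<Longrightarrow> t * M t \<le> \<theta> * MM t"
  using M2 by (auto simp: cond_M2_def)

text \<open>By \<open>cond_M2\<close> the quotient \<open>MM t / t\<^sup>\<theta>\<close> is nonincreasing.\<close>

lemma MM_ge_powr:
  assumes t: "0 < t" "t \<le> 1"
  shows "MM 1 * t powr \<theta> \<le> MM t"
proof -
  define g where "g x = MM x * x powr (- \<theta>)" for x
  have "g 1 \<le> g t"
  proof (rule DERIV_nonpos_imp_nonincreasing[OF t(2)])
    fix x assume x: "t \<le> x" "x \<le> 1"
    then have x0: "0 < x" using t by simp
    have "(g has_real_derivative M x * x powr (- \<theta>) + (- \<theta> * x powr (- \<theta> - 1)) * MM x) (at x)"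
      unfolding g_def[abs_def] by (rule DERIV_mult[OF MM_deriv_at[OF x0] has_real_derivative_powr[OF x0]])
    moreover have "M x * x powr (- \<theta>) + (- \<theta> * x powr (- \<theta> - 1)) * MM x = x powr (- \<theta> - 1) * (x * M x - \<theta> * MM x)"
    proof -
      have "x powr (- \<theta>) = x * x powr (- \<theta> - 1)" using x0 powr_mult_base[of x "- \<theta> - 1"] by simp
      then show ?thesis by (simp add: algebra_simps)
    qed
    moreover have "x powr (- \<theta> - 1) * (x * M x - \<theta> * MM x) \<le> 0"
      using M2'[of x] x0 by (intro mult_nonneg_nonpos) auto
    ultimately show "\<exists>y. (g has_real_derivative y) (at x) \<and> y \<le> 0" by auto
  qed
  then have "MM 1 \<le> MM t * t powr (- \<theta>)" by (simp add: g_def)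
  then have "MM 1 * t powr \<theta> \<le> MM t * t powr (- \<theta>) * t powr \<theta>" by (rule mult_right_mono) simp
  also have "\<dots> = MM t" using t by (simp add: mult.assoc flip: powr_add)
  finally show ?thesis .
qed

lemma MM_upper: "\<exists>C>0. \<forall>t. 0 \<le> t \<and> t \<le> 1 \<longrightarrow> MM t \<le> C * t"
proof -
  have "compact (M ` {0..1})" by (intro compact_continuous_image continuous_on_subset[OF M_cont]) auto
  then have "bounded (M ` {0..1})" by (rule compact_imp_bounded)
  then obtain C where "\<forall>v\<in>M ` {0..1}. norm v \<le> C" by (auto simp: bounded_iff)
  then have "\<And>t. 0 \<le> t \<Longrightarrow> t \<le> 1 \<Longrightarrow> norm (M t) \<le> C" by auto
  then have C: "\<And>t. 0 \<le> t \<Longrightarrow> t \<le> 1 \<Longrightarrow> M t \<le> C" by (simp add: abs_le_iff)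
  have "MM t \<le> (\<bar>C\<bar> + 1) * t" if t: "0 \<le> t" "t \<le> 1" for t
  proof -
    have "integral {0..t} M \<le> integral {0..t} (\<lambda>_. \<bar>C\<bar> + 1)"
    proof (intro integral_le M_integrable)
      fix x assume "x \<in> {0..t}"
      then show "M x \<le> \<bar>C\<bar> + 1" using C[of x] t by auto
    qed auto
    then show ?thesis using t by (simp add: MM_eq mult.commute)
  qed
  then show ?thesis by (intro exI[of _ "\<bar>C\<bar> + 1"]) auto
qed

section \<open>The nonlinearity\<close>

abbreviation "F x \<equiv> primitive (f x)"

lemma f_cont: "continuous_on UNIV (\<lambda>(x, t). f x t)" and f_nonpos: "t \<le> 0 \<Longrightarrow> f x t = 0"
  using fn by (auto simp: nonlinearity_def)

lemma f_cont1: "continuous_on S (f x)"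
proof -
  have "continuous_on UNIV ((\<lambda>(x, t). f x t) \<circ> Pair x)"
    by (intro continuous_on_compose continuous_on_subset[OF f_cont] continuous_intros) auto
  then have "continuous_on UNIV (f x)" by (simp add: o_def)
  then show ?thesis by (rule continuous_on_subset) simp
qed

lemma F_nonpos:
  assumes "t \<le> 0"
  shows "F x t = 0"
proof (cases "t = 0")
  case True
  then show ?thesis by (simp add: primitive_eq_integral)
next
  case False
  have "(LBINT \<tau>=ereal t..ereal 0. f x \<tau>) = integral {t..0} (f x)"
    using assms by (intro interval_integral_eq_integral borel_integrable_atLeastAtMost' f_cont1)
  also have "\<dots> = integral {t..0} (\<lambda>_. 0)" by (intro integral_cong) (auto simp: f_nonpos)
  finally have "(LBINT \<tau>=ereal t..ereal 0. f x \<tau>) = 0" by simp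
  then show ?thesis
    unfolding primitive_def zero_ereal_def by (subst interval_integral_endpoints_reverse) simp
qed

lemma F_deriv: "(F x has_real_derivative f x t) (at t)"
proof -
  define b where "b = \<bar>t\<bar> + 1"
  have F_eq: "F x r = integral {- b..r} (f x)" if "- b \<le> r" for r
  proof -
    have z: "integral {- b..c} (f x) = 0" if "c \<le> 0" for c
    proof -
      have "integral {- b..c} (f x) = integral {- b..c} (\<lambda>_. 0)" using that by (intro integral_cong) (auto simp: f_nonpos)
      then show ?thesis by simp
    qed
    show ?thesis
    proof (cases "0 \<le> r")
      case True
      have "integral {- b..0} (f x) + integral {0..r} (f x) = integral {- b..r} (f x)"
        using True by (intro Henstock_Kurzweil_Integration.integral_combine integrable_continuous_real f_cont1) (auto simp: b_def)
      then show ?thesis using True z[of 0] by (simp add: primitive_eq_integral f_cont1)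
    next
      case False
      then show ?thesis using z[of r] F_nonpos[of r x] by simp
    qed
  qed
  have "((\<lambda>r. integral {- b..r} (f x)) has_real_derivative f x t) (at t within {- b..b})"
    by (rule integral_has_real_derivative) (auto simp: f_cont1 b_def)
  moreover have "at t within {- b..b} = at t" by (rule at_within_interior) (auto simp: b_def)
  ultimately have "((\<lambda>r. integral {- b..r} (f x)) has_real_derivative f x t) (at t)" by simp
  then show ?thesis
  proof (rule has_field_derivative_transform_within[where d = 1])
    show "integral {- b..r} (f x) = F x r" if "dist r t < 1" for r
      by (rule F_eq[symmetric]) (use that in \<open>auto simp: b_def dist_real_def\<close>)
  qed auto
qed

lemma f_measurable:
  assumes [measurable]: "u \<in> borel_measurable leb"
  shows "(\<lambda>x. f x (u x)) \<in> borel_measurable leb"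
proof -
  have [measurable]: "(\<lambda>(x, t). f x t) \<in> borel_measurable (borel \<Otimes>\<^sub>M borel)"
    unfolding borel_prod by (rule borel_measurable_continuous_onI[OF f_cont])
  have "(\<lambda>x. (x, u x)) \<in> leb \<rightarrow>\<^sub>M (borel \<Otimes>\<^sub>M borel)"
    using id_lebesgue_borel by measurable
  then have "(\<lambda>x. (\<lambda>(x, t). f x t) (x, u x)) \<in> borel_measurable leb" by measurable
  then show ?thesis by simp
qed

lemma F_measurable:
  assumes [measurable]: "u \<in> borel_measurable leb"
  shows "(\<lambda>x. F x (u x)) \<in> borel_measurable leb"
proof -
  have [measurable]: "(\<lambda>(x, t). f x t) \<in> borel_measurable (borel \<Otimes>\<^sub>M borel)"
    unfolding borel_prod by (rule borel_measurable_continuous_onI[OF f_cont])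
  have [measurable]: "(\<lambda>z. (fst z, snd z)) \<in> leb \<Otimes>\<^sub>M lborel \<rightarrow>\<^sub>M (borel \<Otimes>\<^sub>M borel)"
    using measurable_compose[OF measurable_fst id_lebesgue_borel] by measurable
  have "(\<lambda>z. (\<lambda>(x, t). f x t) (fst z, snd z)) \<in> borel_measurable (leb \<Otimes>\<^sub>M lborel)" by measurable
  then have [measurable]: "(\<lambda>z. f (fst z) (snd z)) \<in> borel_measurable (leb \<Otimes>\<^sub>M lborel)" by simp
  have "(\<lambda>z. indicator {0..u (fst z)} (snd z) * f (fst z) (snd z)) \<in> borel_measurable (leb \<Otimes>\<^sub>M lborel)"
    unfolding indicator_def atLeastAtMost_iff by measurable
  then have "(\<lambda>(x, \<tau>). indicator {0..u x} \<tau> * f x \<tau>) \<in> borel_measurable (leb \<Otimes>\<^sub>M lborel)"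
    by (simp add: case_prod_beta)
  then have "(\<lambda>x. LINT \<tau>|lborel. indicator {0..u x} \<tau> * f x \<tau>) \<in> borel_measurable leb"
    by (rule lborel.borel_measurable_lebesgue_integral)
  moreover have "(LINT \<tau>|lborel. indicator {0..u x} \<tau> * f x \<tau>) = F x (u x)" for x
  proof (cases "0 \<le> u x")
    case True
    then show ?thesis by (simp add: primitive_eq_lebesgue_integral)
  next
    case False
    then show ?thesis by (simp add: F_nonpos)
  qed
  ultimately show ?thesis by simp
qed

text \<open>
  By \<open>cond_f2\<close> the quotient \<open>F x t / t\<^sup>\<mu>\<close> is nondecreasing in \<open>t > 0\<close>.
\<close>

lemma F_superhomogeneous:
  obtains \<mu> where "\<theta> * P < \<mu>" "\<And>x \<tau> t. 1 \<le> \<tau> \<Longrightarrow> \<tau> powr \<mu> * F x t \<le> F x (\<tau> * t)"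
proof -
  obtain \<mu> where \<mu>: "\<theta> * real CARD('n) / s < \<mu>" "\<And>x t. 0 < t \<Longrightarrow> \<mu> * F x t \<le> f x t * t"
    using f2 by (auto simp: cond_f2_def)
  show ?thesis
  proof (rule that[of \<mu>])
    show "\<theta> * P < \<mu>" using \<mu>(1) by (simp add: P_def)
    fix x \<tau> t assume \<tau>: "(1::real) \<le> \<tau>"
    show "\<tau> powr \<mu> * F x t \<le> F x (\<tau> * t)"
    proof (cases "0 < t")
      case False
      then show ?thesis using \<tau> by (simp add: F_nonpos mult_nonneg_nonpos)
    next
      case t: True
      define g where "g r = F x r * r powr (- \<mu>)" for r
      have le: "t \<le> \<tau> * t" using \<tau> t by simp
      have "g t \<le> g (\<tau> * t)"
      proof (rule DERIV_nonneg_imp_nondecreasing[OF le])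
        fix r assume r: "t \<le> r" "r \<le> \<tau> * t"
        then have r0: "0 < r" using t by simp
        have "(g has_real_derivative f x r * r powr (- \<mu>) + (- \<mu> * r powr (- \<mu> - 1)) * F x r) (at r)"
          unfolding g_def[abs_def] by (rule DERIV_mult[OF F_deriv has_real_derivative_powr[OF r0]])
        moreover have "f x r * r powr (- \<mu>) + (- \<mu> * r powr (- \<mu> - 1)) * F x r = r powr (- \<mu> - 1) * (f x r * r - \<mu> * F x r)"
        proof -
          have "r powr (- \<mu>) = r * r powr (- \<mu> - 1)" using r0 powr_mult_base[of r "- \<mu> - 1"] by simp
          then show ?thesis by (simp add: algebra_simps)
        qed
        moreover have "0 \<le> r powr (- \<mu> - 1) * (f x r * r - \<mu> * F x r)"
          using \<mu>(2)[OF r0] by (intro mult_nonneg_nonneg) auto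
        ultimately show "\<exists>y. (g has_real_derivative y) (at r) \<and> 0 \<le> y" by auto
      qed
      then have "F x t * t powr (- \<mu>) * (\<tau> * t) powr \<mu> \<le> F x (\<tau> * t) * (\<tau> * t) powr (- \<mu>) * (\<tau> * t) powr \<mu>"
        unfolding g_def by (rule mult_right_mono) simp
      moreover have "t powr (- \<mu>) * (\<tau> * t) powr \<mu> = \<tau> powr \<mu>" using \<tau> t by (simp add: powr_mult powr_minus field_simps)
      moreover have "(\<tau> * t) powr (- \<mu>) * (\<tau> * t) powr \<mu> = 1" using \<tau> t by (simp flip: powr_add)
      ultimately show ?thesis by (simp only: mult.assoc mult_1_right) (simp only: mult.commute)
    qed
  qed
qed

lemma F_pos: "0 < t \<Longrightarrow> 0 < F x t" and f_nonneg: "0 \<le> f x t"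
proof -
  obtain \<mu> where \<mu>: "\<theta> * real CARD('n) / s < \<mu>" "\<And>x t. 0 < t \<Longrightarrow> 0 < \<mu> * F x t \<and> \<mu> * F x t \<le> f x t * t"
    using f2 by (auto simp: cond_f2_def)
  have "0 < \<theta> * real CARD('n) / s" using \<theta>_ge_1 s01 by simp
  then have m0: "0 < \<mu>" using \<mu>(1) by linarith
  show F: "0 < F x t" if "0 < t" for t using \<mu>(2)[OF that, of x] m0 by (simp add: zero_less_mult_iff)
  show "0 \<le> f x t"
  proof (cases "0 < t")
    case True
    then have "0 < f x t * t" using \<mu>(2)[OF True, of x] by linarith
    then show ?thesis using True by (simp add: zero_less_mult_iff)
  qed (simp add: f_nonpos)
qed

lemma F_nonneg: "0 \<le> F x t"
  using F_pos[of t x] F_nonpos[of t x] by (cases "0 < t") auto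

lemma F_le_abs: "F x t \<le> F x \<bar>t\<bar>"
  using F_nonneg[of x "\<bar>t\<bar>"] F_nonpos[of t x] by (cases "0 \<le> t") auto

lemma P'_eq: "P' = real CARD('n) / (real CARD('n) - s)"
proof -
  have "s < real CARD('n)" using s01 dim by simp
  then show ?thesis unfolding P'_def unfolding P_def using s01 by (simp add: field_simps)
qed

text \<open>Subexponential factors are absorbed into the exponential, at the cost of a larger exponent.\<close>

lemma f_growth:
  obtains C \<beta> where "0 < C" "0 < \<beta>" "\<And>x t. \<bar>f x t\<bar> \<le> C * (\<bar>t\<bar> powr (P - 1) * exp (\<beta> * \<bar>t\<bar> powr P'))"
proof -
  obtain b1 b2 \<alpha> where b: "0 < b1" "0 < b2" "0 < \<alpha>"
    "\<And>x t. 0 < t \<Longrightarrow> \<bar>f x t\<bar> \<le> b1 * t powr (\<theta> * real CARD('n) / s - 1) + b2 * Phi CARD('n) s \<alpha> t"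
    using f1 unfolding cond_f1_def by blast
  define j0 where "j0 = nat \<lceil>P - 1\<rceil>"
  have j0: "P - 1 \<le> real j0" using P_gt_2 by (simp add: j0_def)
  have set_eq: "{j. real j < P - 1} = {..<j0}"
    using P_gt_2 by (auto simp: j0_def) linarith+
  have Phi_le: "Phi CARD('n) s \<alpha> t \<le> \<alpha> ^ j0 * (\<bar>t\<bar> powr P') ^ j0 * exp (\<alpha> * \<bar>t\<bar> powr P')" for t
  proof -
    have "Phi CARD('n) s \<alpha> t = exp (\<alpha> * \<bar>t\<bar> powr P') - (\<Sum>j<j0. (\<alpha> * \<bar>t\<bar> powr P') ^ j / fact j)"
      unfolding Phi_def P'_eq[symmetric] P_def[symmetric] set_eq by (simp add: power_mult_distrib)
    also have "\<dots> \<le> (\<alpha> * \<bar>t\<bar> powr P') ^ j0 * exp (\<alpha> * \<bar>t\<bar> powr P')"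
      using b by (intro exp_remainder_le) auto
    finally show ?thesis by (simp add: power_mult_distrib)
  qed
  obtain K1 where K1: "0 < K1" "\<And>y. 0 \<le> y \<Longrightarrow> y powr ((\<theta> - 1) * P / P') \<le> K1 * exp y"
    using powr_le_exp[of "(\<theta> - 1) * P / P'"] \<theta>_ge_1 P_gt_2 P' by auto
  have e2: "0 \<le> real j0 - (P - 1) / P'"
  proof -
    have "(P - 1) / P' \<le> P - 1" using P' P_gt_2 by (simp add: divide_le_eq mult_le_cancel_left1)
    then show ?thesis using j0 by linarith
  qed
  obtain K2 where K2: "0 < K2" "\<And>y. 0 \<le> y \<Longrightarrow> y powr (real j0 - (P - 1) / P') \<le> K2 * exp y"
    using powr_le_exp[OF e2] by auto
  define C where "C = b1 * K1 + b2 * \<alpha> ^ j0 * K2"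
  have C: "0 < C" using b K1 K2 by (auto simp: C_def intro!: add_pos_pos)
  have "\<bar>f x t\<bar> \<le> C * (\<bar>t\<bar> powr (P - 1) * exp ((1 + \<alpha>) * \<bar>t\<bar> powr P'))" for x t
  proof (cases "0 < t")
    case False
    then show ?thesis using C by (simp add: f_nonpos)
  next
    case t: True
    define y where "y = t powr P'"
    have y: "0 < y" using t by (simp add: y_def)
    have yp: "t = y powr (1 / P')" using t P' by (simp add: y_def powr_powr)
    have a: "t powr (\<theta> * real CARD('n) / s - 1) = t powr (P - 1) * y powr ((\<theta> - 1) * P / P')"
    proof -
      have "\<theta> * real CARD('n) / s = \<theta> * P" by (simp add: P_def)
      then have eq: "\<theta> * real CARD('n) / s - 1 = (P - 1) + (\<theta> - 1) * P" by (simp add: algebra_simps)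
      show ?thesis unfolding eq using t P' by (simp add: y_def powr_powr powr_add)
    qed
    have b': "y ^ j0 = t powr (P - 1) * y powr (real j0 - (P - 1) / P')"
    proof -
      have "t powr (P - 1) = y powr ((P - 1) / P')" using t P' by (simp add: y_def powr_powr)
      then show ?thesis using y by (simp add: powr_realpow powr_add[symmetric])
    qed
    have "\<bar>f x t\<bar> \<le> b1 * t powr (\<theta> * real CARD('n) / s - 1) + b2 * Phi CARD('n) s \<alpha> t" by (rule b(4)[OF t])
    also have "\<dots> \<le> b1 * (t powr (P - 1) * y powr ((\<theta> - 1) * P / P')) + b2 * (\<alpha> ^ j0 * y ^ j0 * exp (\<alpha> * y))"
      unfolding a using Phi_le[of t] b t by (intro add_left_mono mult_left_mono) (auto simp: y_def)
    also have "\<dots> \<le> b1 * (t powr (P - 1) * (K1 * exp y * exp (\<alpha> * y))) + b2 * (\<alpha> ^ j0 * (t powr (P - 1) * (K2 * exp y)) * exp (\<alpha> * y))"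
      unfolding b'
    proof (intro add_mono mult_left_mono mult_right_mono)
      have "y powr ((\<theta> - 1) * P / P') \<le> K1 * exp y" using K1 y by simp
      also have "\<dots> \<le> K1 * exp y * exp (\<alpha> * y)" using K1 b y by (intro mult_left_mono[of 1 "exp (\<alpha> * y)" "K1 * exp y", simplified]) auto
      finally show "y powr ((\<theta> - 1) * P / P') \<le> K1 * exp y * exp (\<alpha> * y)" .
      show "y powr (real j0 - (P - 1) / P') \<le> K2 * exp y" using K2 y by simp
    qed (use b in auto)
    also have "\<dots> = C * (t powr (P - 1) * exp ((1 + \<alpha>) * y))"
      by (simp add: C_def algebra_simps exp_add)
    finally show ?thesis using t by (simp add: y_def)
  qed
  then show ?thesis using that[of C "1 + \<alpha>"] C b by simp
qed

lemma powr_le_exp_P':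
  assumes "0 \<le> a" "0 < c"
  shows "\<exists>K>0. \<forall>t\<ge>0. t powr a \<le> K * exp (c * t powr P')"
proof -
  obtain K where K: "0 < K" "\<And>y. 0 \<le> y \<Longrightarrow> y powr (a / P') \<le> K * exp y"
    using powr_le_exp[of "a / P'"] assms P' by auto
  have "t powr a \<le> (1 / c) powr (a / P') * K * exp (c * t powr P')" if t: "0 \<le> t" for t
  proof -
    have "t powr a = (1 / c * (c * t powr P')) powr (a / P')"
      using assms P' t by (simp add: powr_powr)
    also have "\<dots> = (1 / c) powr (a / P') * (c * t powr P') powr (a / P')"
      using assms by (simp only: powr_mult)
    also have "\<dots> \<le> (1 / c) powr (a / P') * (K * exp (c * t powr P'))"
      using assms by (intro mult_left_mono K) auto
    finally show ?thesis by (simp add: mult.assoc)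
  qed
  then show ?thesis using K(1) assms by (intro exI[of _ "(1 / c) powr (a / P') * K"]) auto
qed

text \<open>Homogeneity turns the Trudinger-Moser inequality into a bound of order \<open>nrm u\<^sup>q\<close>, for any exponential rate,
  on a ball of a radius depending on the rate.\<close>

lemma trudinger_moser_scaled:
  assumes \<beta>: "0 < \<beta>" and q: "P \<le> q"
  shows "\<exists>\<rho>>0. \<exists>C>0. \<forall>u. u \<in> borel_measurable leb \<and> E u < \<infinity> \<and> nrm u \<le> \<rho> \<longrightarrow>
    integrable leb (\<lambda>x. \<bar>u x\<bar> powr q * exp (\<beta> * \<bar>u x\<bar> powr P')) \<and>
    (LINT x|leb. \<bar>u x\<bar> powr q * exp (\<beta> * \<bar>u x\<bar> powr P')) \<le> C * nrm u powr q"
proof -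
  have \<beta>0: "0 < \<beta>0 / 2" using K_pos by simp
  obtain K where K: "0 < K" "\<And>t. 0 \<le> t \<Longrightarrow> t powr (q - P) \<le> K * exp (\<beta>0 / 2 * t powr P')"
    using powr_le_exp_P'[OF _ \<beta>0, of "q - P"] q by auto
  define \<kappa> where "\<kappa> = \<eta>0 powr (1 / P)"
  have \<kappa>: "0 < \<kappa>" using \<eta>0_pos by (simp add: \<kappa>_def)
  define \<rho> where "\<rho> = \<kappa> * (\<beta>0 / (2 * \<beta>)) powr (1 / P')"
  have \<rho>: "0 < \<rho>" using \<kappa> K_pos \<beta> by (simp add: \<rho>_def)
  define C where "C = (1 / \<kappa>) powr q * K * (2 * K0)"
  have C: "0 < C" using \<kappa> K K_pos by (simp add: C_def)
  have "integrable leb (\<lambda>x. \<bar>u x\<bar> powr q * exp (\<beta> * \<bar>u x\<bar> powr P')) \<and>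
    (LINT x|leb. \<bar>u x\<bar> powr q * exp (\<beta> * \<bar>u x\<bar> powr P')) \<le> C * nrm u powr q"
    if u[measurable]: "u \<in> borel_measurable leb" and Ef: "E u < \<infinity>" and le: "nrm u \<le> \<rho>" for u
  proof (cases "nrm u = 0")
    case True
    then have "Er u = 0" by (simp add: nrm_zero_iff)
    then have "V0 * (LINT x|leb. \<bar>u x\<bar> powr P) \<le> 0" using lp_bound(2)[OF u Ef] by simp
    then have "(LINT x|leb. \<bar>u x\<bar> powr P) = 0"
      using V0(1) by (intro antisym) (auto simp: mult_le_0_iff integral_nonneg_AE)
    then have "AE x in leb. \<bar>u x\<bar> powr P = 0"
      using integral_nonneg_eq_0_iff_AE[OF lp_bound(1)[OF u Ef]] by simp
    then have z: "AE x in leb. \<bar>u x\<bar> powr q * exp (\<beta> * \<bar>u x\<bar> powr P') = 0"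
      by eventually_elim simp
    have "integrable leb (\<lambda>x. \<bar>u x\<bar> powr q * exp (\<beta> * \<bar>u x\<bar> powr P')) \<longleftrightarrow> integrable leb (\<lambda>x. 0 :: real)"
      by (rule integrable_cong_AE) (use z in auto)
    moreover have "(LINT x|leb. \<bar>u x\<bar> powr q * exp (\<beta> * \<bar>u x\<bar> powr P')) = (LINT x|leb. 0)"
      by (rule integral_cong_AE) (use z in auto)
    ultimately show ?thesis using C by simp
  next
    case False
    define n where "n = nrm u"
    have n: "0 < n" using False nrm_nonneg[of u] by (simp add: n_def)
    define v where "v x = \<kappa> / n * u x" for x
    have [measurable]: "v \<in> borel_measurable leb" unfolding v_def[abs_def] by measurable
    have uv: "\<bar>u x\<bar> = n / \<kappa> * \<bar>v x\<bar>" for x using n \<kappa> by (simp add: v_def abs_mult)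
    have Ev: "E v \<le> ennreal \<eta>0"
    proof -
      have "E v = ennreal ((\<kappa> / n) powr P) * E u" unfolding v_def[abs_def] using n \<kappa> by (subst E_scale) auto
      also have "\<dots> = ennreal ((\<kappa> / n) powr P * n powr P)"
        unfolding E_eq_Er[OF Ef] n_def nrm_powr by (subst ennreal_mult) (auto simp: Er_nonneg)
      also have "(\<kappa> / n) powr P * n powr P = \<eta>0"
        using n \<kappa> P_gt_2 \<eta>0_pos by (simp add: \<kappa>_def powr_divide powr_powr)
      finally show ?thesis by simp
    qed
    have pw: "\<bar>u x\<bar> powr q * exp (\<beta> * \<bar>u x\<bar> powr P') \<le> (n / \<kappa>) powr q * K * (\<bar>v x\<bar> powr P * exp (\<beta>0 * \<bar>v x\<bar> powr P'))" for x
    proof -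
      define t where "t = \<bar>v x\<bar>"
      have t: "0 \<le> t" by (simp add: t_def)
      have "\<beta> * (n / \<kappa> * t) powr P' \<le> \<beta>0 / 2 * t powr P'"
      proof -
        have "n / \<kappa> \<le> (\<beta>0 / (2 * \<beta>)) powr (1 / P')" using le \<kappa> by (simp add: \<rho>_def n_def field_simps)
        then have "(n / \<kappa>) powr P' \<le> ((\<beta>0 / (2 * \<beta>)) powr (1 / P')) powr P'" using n \<kappa> P' by (intro powr_mono2) auto
        also have "\<dots> = \<beta>0 / (2 * \<beta>)" using P' K_pos \<beta> by (simp add: powr_powr)
        finally have "\<beta> * (n / \<kappa>) powr P' \<le> \<beta>0 / 2" using \<beta> by (simp add: field_simps)
        then have "\<beta> * (n / \<kappa>) powr P' * t powr P' \<le> \<beta>0 / 2 * t powr P'" by (rule mult_right_mono) simp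
        moreover have "(n / \<kappa> * t) powr P' = (n / \<kappa>) powr P' * t powr P'" by (rule powr_mult)
        ultimately show ?thesis by (simp only: mult.assoc)
      qed
      then have "\<bar>u x\<bar> powr q * exp (\<beta> * \<bar>u x\<bar> powr P') \<le> (n / \<kappa> * t) powr q * exp (\<beta>0 / 2 * t powr P')"
        unfolding uv t_def[symmetric] by (intro mult_left_mono) auto
      also have "(n / \<kappa> * t) powr q = (n / \<kappa>) powr q * (t powr P * t powr (q - P))"
        using powr_mult[of "n / \<kappa>" t q] powr_add[of t P "q - P"] by simp
      also have "\<dots> * exp (\<beta>0 / 2 * t powr P') \<le> (n / \<kappa>) powr q * (t powr P * (K * exp (\<beta>0 / 2 * t powr P'))) * exp (\<beta>0 / 2 * t powr P')"
        using t K by (intro mult_right_mono mult_left_mono) auto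
      also have "\<dots> = (n / \<kappa>) powr q * K * (t powr P * (exp (\<beta>0 / 2 * t powr P') * exp (\<beta>0 / 2 * t powr P')))"
        by (simp only: mult_ac)
      also have "exp (\<beta>0 / 2 * t powr P') * exp (\<beta>0 / 2 * t powr P') = exp (\<beta>0 * t powr P')"
        by (simp flip: exp_add)
      finally show ?thesis by (simp only: t_def)
    qed
    have vint: "integrable leb (\<lambda>x. \<bar>v x\<bar> powr P * exp (\<beta>0 * \<bar>v x\<bar> powr P'))"
      using trudinger_moser[OF _ Ev] by (intro integrableI_nonneg) (auto intro: le_less_trans)
    have vle: "(LINT x|leb. \<bar>v x\<bar> powr P * exp (\<beta>0 * \<bar>v x\<bar> powr P')) \<le> 2 * K0"
    proof -
      have "ennreal (LINT x|leb. \<bar>v x\<bar> powr P * exp (\<beta>0 * \<bar>v x\<bar> powr P')) \<le> ennreal (2 * K0)"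
        using trudinger_moser[OF _ Ev] by (subst nn_integral_eq_integral[OF vint, symmetric]) auto
      then show ?thesis using K_pos by (subst (asm) ennreal_le_iff) auto
    qed
    have int: "integrable leb (\<lambda>x. \<bar>u x\<bar> powr q * exp (\<beta> * \<bar>u x\<bar> powr P'))"
    proof (rule Bochner_Integration.integrable_bound)
      show "integrable leb (\<lambda>x. (n / \<kappa>) powr q * K * (\<bar>v x\<bar> powr P * exp (\<beta>0 * \<bar>v x\<bar> powr P')))"
        using vint by (rule integrable_mult_right)
      show "AE x in leb. norm (\<bar>u x\<bar> powr q * exp (\<beta> * \<bar>u x\<bar> powr P'))
          \<le> norm ((n / \<kappa>) powr q * K * (\<bar>v x\<bar> powr P * exp (\<beta>0 * \<bar>v x\<bar> powr P')))"
        using K by (intro AE_I2) (auto simp: abs_mult intro!: order_trans[OF pw])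
    qed measurable
    have "(LINT x|leb. \<bar>u x\<bar> powr q * exp (\<beta> * \<bar>u x\<bar> powr P')) \<le> (LINT x|leb. (n / \<kappa>) powr q * K * (\<bar>v x\<bar> powr P * exp (\<beta>0 * \<bar>v x\<bar> powr P')))"
      using vint by (intro integral_mono int integrable_mult_right pw)
    also have "\<dots> = (n / \<kappa>) powr q * K * (LINT x|leb. \<bar>v x\<bar> powr P * exp (\<beta>0 * \<bar>v x\<bar> powr P'))"
      by (rule integral_mult_right_zero)
    also have "\<dots> \<le> (n / \<kappa>) powr q * K * (2 * K0)" using K vle by (intro mult_left_mono) auto
    also have "\<dots> = C * nrm u powr q" using n \<kappa> by (simp add: C_def n_def powr_divide)
    finally show ?thesis using int by simp
  qed
  then show ?thesis using \<rho> C by blast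
qed

end

section \<open>The energy functional on a small ball\<close>

context kirchhoff_problem
begin

definition rhs :: "real \<Rightarrow> real^'n \<Rightarrow> real \<Rightarrow> real" where
  "rhs lam x t = f x t + lam * h x * max t 0 powr (p - 1)"

definition rhs_primitive :: "real \<Rightarrow> real^'n \<Rightarrow> real \<Rightarrow> real" where
  "rhs_primitive lam x t = F x t + lam / p * (h x * max t 0 powr p)"

lemma max_powr_deriv: "((\<lambda>t. max t 0 powr p) has_real_derivative p * max t 0 powr (p - 1)) (at (t::real))"
proof -
  consider "t > 0" | "t < 0" | "t = 0" by linarith
  then show ?thesis
  proof cases
    case 1
    have "((\<lambda>t. t powr p) has_real_derivative p * t powr (p - 1)) (at t)"
      using 1 by (rule has_real_derivative_powr)
    moreover have "\<forall>\<^sub>F r in nhds t. max r 0 powr p = r powr p"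
      using eventually_nhds_in_open[of "{0<..}" t] 1 by (auto elim: eventually_mono)
    ultimately show ?thesis using 1 by (simp add: DERIV_cong_ev max_def)
  next
    case 2
    have ev: "\<forall>\<^sub>F r in nhds t. max r 0 powr p = 0"
      using eventually_nhds_in_open[of "{..<0}" t] 2 by (auto simp: max_def elim: eventually_mono)
    show ?thesis using 2 by (subst DERIV_cong_ev[OF refl ev refl]) (simp add: max_def)
  next
    case 3
    have "((\<lambda>r. \<bar>r\<bar> powr (p - 1)) \<longlongrightarrow> 0) (at 0)"
      by (rule tendsto_eq_intros | use p in \<open>auto intro!: always_eventually\<close>)+
    then have "((\<lambda>r. max r 0 powr p / r) \<longlongrightarrow> 0) (at 0)"
    proof (rule Lim_null_comparison[rotated])
      show "\<forall>\<^sub>F r in at 0. norm (max r 0 powr p / r) \<le> \<bar>r\<bar> powr (p - 1)"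
        by (intro always_eventually allI) (auto simp: powr_diff max_def intro!: divide_nonneg_nonpos)
    qed
    then show ?thesis using 3 by (simp add: DERIV_def)
  qed
qed

lemma rhs_primitive_deriv: "(rhs_primitive lam x has_real_derivative rhs lam x t) (at t)"
proof -
  have "(rhs_primitive lam x has_real_derivative f x t + lam / p * (h x * (p * max t 0 powr (p - 1)))) (at t)"
    unfolding rhs_primitive_def[abs_def] by (intro DERIV_add F_deriv DERIV_cmult max_powr_deriv)
  moreover have "f x t + lam / p * (h x * (p * max t 0 powr (p - 1))) = rhs lam x t"
    using p by (simp add: rhs_def)
  ultimately show ?thesis by simp
qed

lemma rhs_primitive_zero [simp]: "rhs_primitive lam x 0 = 0"
  by (simp add: rhs_primitive_def F_nonpos)

lemma rhs_primitive_measurable: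
  assumes [measurable]: "u \<in> borel_measurable leb"
  shows "(\<lambda>x. rhs_primitive lam x (u x)) \<in> borel_measurable leb" "(\<lambda>x. rhs lam x (u x)) \<in> borel_measurable leb"
proof -
  note [measurable] = f_measurable[OF assms] F_measurable[OF assms] h_meas
  show "(\<lambda>x. rhs_primitive lam x (u x)) \<in> borel_measurable leb" "(\<lambda>x. rhs lam x (u x)) \<in> borel_measurable leb"
    unfolding rhs_primitive_def rhs_def by measurable
qed

definition growth where
  "growth = (SOME cb. 0 < fst cb \<and> 0 < snd cb \<and>
    (\<forall>x t. \<bar>f x t\<bar> \<le> fst cb * (\<bar>t\<bar> powr (P - 1) * exp (snd cb * \<bar>t\<bar> powr P'))))"

lemma growth: "0 < fst growth" "0 < snd growth"
  "\<bar>f x t\<bar> \<le> fst growth * (\<bar>t\<bar> powr (P - 1) * exp (snd growth * \<bar>t\<bar> powr P'))"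
proof -
  obtain C \<beta> where "0 < C" "0 < \<beta>" "\<And>x t. \<bar>f x t\<bar> \<le> C * (\<bar>t\<bar> powr (P - 1) * exp (\<beta> * \<bar>t\<bar> powr P'))"
    using f_growth by blast
  then have "\<exists>cb. 0 < fst cb \<and> 0 < snd cb \<and>
    (\<forall>x t. \<bar>f x t\<bar> \<le> fst cb * (\<bar>t\<bar> powr (P - 1) * exp (snd cb * \<bar>t\<bar> powr P')))"
    by (intro exI[of _ "(C, \<beta>)"]) auto
  from someI_ex[OF this, folded growth_def]
  show "0 < fst growth" "0 < snd growth"
    "\<bar>f x t\<bar> \<le> fst growth * (\<bar>t\<bar> powr (P - 1) * exp (snd growth * \<bar>t\<bar> powr P'))" by auto
qed

text \<open>The majorant of the nonlinearity: \<open>h_majorant\<close> belongs to \<open>L\<^sup>P\<^sup>'\<close>, and \<open>f_majorant (2 \<bar>u\<bar>)\<close> does for small \<open>u\<close> by the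
  Trudinger-Moser inequality.\<close>

definition h_majorant :: "real^'n \<Rightarrow> real" where "h_majorant x = h x powr ((P - 1) / (P - p))"

definition f_majorant :: "real \<Rightarrow> real" where
  "f_majorant t = (fst growth + 1) * (t powr (P - 1) * exp (snd growth * t powr P'))"

lemma f_majorant_nonneg: "0 \<le> f_majorant t"
  using growth by (simp add: f_majorant_def)

lemma f_majorant_mono:
  assumes "0 \<le> a" "a \<le> b"
  shows "f_majorant a \<le> f_majorant b"
  unfolding f_majorant_def using assms growth P_gt_2 P'
  by (intro mult_left_mono mult_mono powr_mono2) (auto intro!: mult_left_mono powr_mono2)

lemma f_majorant_measurable [measurable]: "f_majorant \<in> borel_measurable borel"
  unfolding f_majorant_def[abs_def] by measurable

lemma h_majorant_nonneg: "0 \<le> h_majorant x" by (simp add: h_majorant_def)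

lemma h_majorant_measurable [measurable]: "h_majorant \<in> borel_measurable leb"
  unfolding h_majorant_def[abs_def] using h_meas by measurable

lemma h_pow_integrable: "integrable leb (\<lambda>x. h x powr (P / (P - p)))"
proof -
  have "0 < P - p" using p by simp
  then have "real CARD('n) - s * p \<noteq> 0" using s01 by (simp add: P_def field_simps)
  then have "real CARD('n) / (real CARD('n) - s * p) = P / (P - p)"
    unfolding P_def using s01 by (simp add: field_simps)
  then show ?thesis using h_int h_nonneg by (simp only: abs_of_nonneg)
qed

lemma h_majorant_integrable: "integrable leb (\<lambda>x. h_majorant x powr P')"
proof -
  have "h_majorant x powr P' = h x powr (P / (P - p))" for x by (simp add: h_majorant_def powr_powr P'(4))
  then show ?thesis using h_pow_integrable by simp
qed

lemma rhs_growth: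
  assumes lam: "0 \<le> lam" "lam \<le> 1"
  shows "\<bar>rhs lam x t\<bar> \<le> h_majorant x + f_majorant \<bar>t\<bar>"
proof -
  have young: "\<bar>t\<bar> powr (p - 1) * h x \<le> \<bar>t\<bar> powr (P - 1) + h_majorant x"
  proof -
    define q where "q = (P - 1) / (p - 1)"
    have q: "1 < q" using p by (simp add: q_def)
    have "q - 1 = (P - p) / (p - 1)" using p by (simp add: q_def field_simps)
    then have q': "q / (q - 1) = (P - 1) / (P - p)" using p by (simp add: q_def)
    have "\<bar>t\<bar> powr (p - 1) * h x \<le> (1 * \<bar>t\<bar> powr (p - 1)) powr q + (h x / 1) powr (q / (q - 1))"
      by (rule young_powr_scaled) (use q h_nonneg in auto)
    also have "(1 * \<bar>t\<bar> powr (p - 1)) powr q = \<bar>t\<bar> powr (P - 1)" using p by (simp add: powr_powr q_def)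
    finally show ?thesis by (simp add: q' h_majorant_def)
  qed
  have "\<bar>rhs lam x t\<bar> \<le> \<bar>f x t\<bar> + \<bar>lam * h x * max t 0 powr (p - 1)\<bar>" by (simp add: rhs_def)
  moreover have "\<bar>lam * h x * max t 0 powr (p - 1)\<bar> \<le> 1 * h x * \<bar>t\<bar> powr (p - 1)"
    using lam h_nonneg[of x] p by (auto simp: abs_mult intro!: mult_mono powr_mono2 mult_left_le_one_le)
  moreover have "1 * h x * \<bar>t\<bar> powr (p - 1) \<le> \<bar>t\<bar> powr (P - 1) + h_majorant x" using young by (simp add: mult.commute)
  moreover have "\<bar>f x t\<bar> \<le> fst growth * (\<bar>t\<bar> powr (P - 1) * exp (snd growth * \<bar>t\<bar> powr P'))" by (rule growth)
  moreover have "\<bar>t\<bar> powr (P - 1) \<le> \<bar>t\<bar> powr (P - 1) * exp (snd growth * \<bar>t\<bar> powr P')"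
    using growth by (simp add: mult_le_cancel_left1)
  ultimately show ?thesis unfolding f_majorant_def distrib_right by linarith
qed

lemma rhs_primitive_diff_le:
  assumes lam: "0 \<le> lam" "lam \<le> 1"
  shows "\<bar>rhs_primitive lam x a - rhs_primitive lam x b\<bar> \<le> \<bar>a - b\<bar> * (h_majorant x + (f_majorant \<bar>a\<bar> + f_majorant \<bar>b\<bar>))"
proof -
  have main: "\<bar>rhs_primitive lam x a - rhs_primitive lam x b\<bar> \<le> \<bar>a - b\<bar> * (h_majorant x + (f_majorant \<bar>a\<bar> + f_majorant \<bar>b\<bar>))" if ba: "b < a" for a b
  proof -
    obtain z where z: "b < z" "z < a" "rhs_primitive lam x a - rhs_primitive lam x b = (a - b) * rhs lam x z"
      using MVT2[OF ba, of "rhs_primitive lam x" "rhs lam x"] rhs_primitive_deriv by blast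
    have "\<bar>z\<bar> \<le> max \<bar>a\<bar> \<bar>b\<bar>" using z by linarith
    then have "f_majorant \<bar>z\<bar> \<le> f_majorant (max \<bar>a\<bar> \<bar>b\<bar>)" by (intro f_majorant_mono) auto
    also have "\<dots> \<le> f_majorant \<bar>a\<bar> + f_majorant \<bar>b\<bar>" using f_majorant_nonneg by (simp add: max_def)
    finally have "\<bar>rhs lam x z\<bar> \<le> h_majorant x + (f_majorant \<bar>a\<bar> + f_majorant \<bar>b\<bar>)" using rhs_growth[OF lam, of x z] by linarith
    then show ?thesis unfolding z(3) abs_mult by (rule mult_left_mono) simp
  qed
  consider "b < a" | "a < b" | "a = b" by linarith
  then show ?thesis
  proof cases
    case 2
    then show ?thesis using main[OF 2] by (simp add: abs_minus_commute add.commute)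
  qed (use main in auto)
qed

definition \<beta>2 where "\<beta>2 = snd growth * P' * 2 powr P'"
definition C2 where "C2 = (fst growth + 1) powr P' * 2 powr P"

lemma f_majorant_powr:
  assumes "0 \<le> t"
  shows "f_majorant (2 * t) powr P' = C2 * (t powr P * exp (\<beta>2 * t powr P'))"
proof -
  have "(exp c) powr P' = exp (c * P')" for c by (simp add: powr_def mult.commute)
  then show ?thesis
    using growth P' by (simp add: f_majorant_def powr_mult powr_powr C2_def \<beta>2_def mult_ac)
qed

definition tm_constants where
  "tm_constants = (SOME rc. 0 < fst rc \<and> 0 < snd rc \<and> (\<forall>u. u \<in> borel_measurable leb \<and> E u < \<infinity> \<and> nrm u \<le> fst rc \<longrightarrow>
    integrable leb (\<lambda>x. \<bar>u x\<bar> powr P * exp (\<beta>2 * \<bar>u x\<bar> powr P')) \<and>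
    (LINT x|leb. \<bar>u x\<bar> powr P * exp (\<beta>2 * \<bar>u x\<bar> powr P')) \<le> snd rc * nrm u powr P))"

text \<open>On the ball of radius \<open>\<rho>1\<close> all integrals of the problem converge.\<close>

definition \<rho>1 where "\<rho>1 = fst tm_constants"
definition C3 where "C3 = C2 * snd tm_constants"

lemma \<rho>1_pos: "0 < \<rho>1" and C3_pos: "0 < C3"
  and tm_bound: "u \<in> borel_measurable leb \<Longrightarrow> E u < \<infinity> \<Longrightarrow> nrm u \<le> \<rho>1 \<Longrightarrow> integrable leb (\<lambda>x. f_majorant (2 * \<bar>u x\<bar>) powr P')"
    "u \<in> borel_measurable leb \<Longrightarrow> E u < \<infinity> \<Longrightarrow> nrm u \<le> \<rho>1 \<Longrightarrow> (LINT x|leb. f_majorant (2 * \<bar>u x\<bar>) powr P') \<le> C3 * nrm u powr P"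
proof -
  have \<beta>2: "0 < \<beta>2" and C2: "0 < C2" using growth P' by (auto simp: \<beta>2_def C2_def)
  obtain \<rho> C where "0 < \<rho>" "0 < C" "\<forall>u. u \<in> borel_measurable leb \<and> E u < \<infinity> \<and> nrm u \<le> \<rho> \<longrightarrow>
    integrable leb (\<lambda>x. \<bar>u x\<bar> powr P * exp (\<beta>2 * \<bar>u x\<bar> powr P')) \<and>
    (LINT x|leb. \<bar>u x\<bar> powr P * exp (\<beta>2 * \<bar>u x\<bar> powr P')) \<le> C * nrm u powr P"
    using trudinger_moser_scaled[OF \<beta>2 order_refl] by blast
  then have "\<exists>rc. 0 < fst rc \<and> 0 < snd rc \<and> (\<forall>u. u \<in> borel_measurable leb \<and> E u < \<infinity> \<and> nrm u \<le> fst rc \<longrightarrow>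
    integrable leb (\<lambda>x. \<bar>u x\<bar> powr P * exp (\<beta>2 * \<bar>u x\<bar> powr P')) \<and>
    (LINT x|leb. \<bar>u x\<bar> powr P * exp (\<beta>2 * \<bar>u x\<bar> powr P')) \<le> snd rc * nrm u powr P)"
    by (intro exI[of _ "(\<rho>, C)"]) auto
  note tm_constants = someI_ex[OF this, folded tm_constants_def]
  show "0 < \<rho>1" "0 < C3" using tm_constants C2 by (auto simp: \<rho>1_def C3_def)
  assume u: "u \<in> borel_measurable leb" "E u < \<infinity>" "nrm u \<le> \<rho>1"
  then have *: "integrable leb (\<lambda>x. \<bar>u x\<bar> powr P * exp (\<beta>2 * \<bar>u x\<bar> powr P'))"
    "(LINT x|leb. \<bar>u x\<bar> powr P * exp (\<beta>2 * \<bar>u x\<bar> powr P')) \<le> snd tm_constants * nrm u powr P"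
    using tm_constants by (auto simp: \<rho>1_def)
  show "integrable leb (\<lambda>x. f_majorant (2 * \<bar>u x\<bar>) powr P')" using *(1) by (simp add: f_majorant_powr)
  show "(LINT x|leb. f_majorant (2 * \<bar>u x\<bar>) powr P') \<le> C3 * nrm u powr P"
    using *(2) C2 by (simp add: f_majorant_powr C3_def mult.assoc)
qed

lemma conj_P: "1 < P" "P' = P / (P - 1)" using P_gt_2 by (auto simp: P'_def)

lemma majorant_integrable:
  assumes u[measurable]: "u \<in> borel_measurable leb" and fu: "E u < \<infinity>" "nrm u \<le> \<rho>1"
    and v[measurable]: "v \<in> borel_measurable leb" and fv: "E v < \<infinity>" "nrm v \<le> \<rho>1"
  shows "integrable leb (\<lambda>x. \<bar>h_majorant x + (f_majorant \<bar>u x\<bar> + f_majorant \<bar>v x\<bar>)\<bar> powr P')"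
    and "(LINT x|leb. \<bar>h_majorant x + (f_majorant \<bar>u x\<bar> + f_majorant \<bar>v x\<bar>)\<bar> powr P')
      \<le> 2 powr P' * ((LINT x|leb. h_majorant x powr P') + 2 powr P' * (2 * (C3 * \<rho>1 powr P)))"
proof -
  let ?b = "\<lambda>x. 2 powr P' * (h_majorant x powr P' + 2 powr P' * (f_majorant (2 * \<bar>u x\<bar>) powr P' + f_majorant (2 * \<bar>v x\<bar>) powr P'))"
  have le: "\<bar>h_majorant x + (f_majorant \<bar>u x\<bar> + f_majorant \<bar>v x\<bar>)\<bar> powr P' \<le> ?b x" for x
  proof -
    have "\<bar>h_majorant x + (f_majorant \<bar>u x\<bar> + f_majorant \<bar>v x\<bar>)\<bar> powr P' \<le> 2 powr P' * (\<bar>h_majorant x\<bar> powr P' + \<bar>f_majorant \<bar>u x\<bar> + f_majorant \<bar>v x\<bar>\<bar> powr P')"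
      using P' by (intro abs_add_powr_le) auto
    also have "\<bar>f_majorant \<bar>u x\<bar> + f_majorant \<bar>v x\<bar>\<bar> powr P' \<le> \<bar>f_majorant (2 * \<bar>u x\<bar>) + f_majorant (2 * \<bar>v x\<bar>)\<bar> powr P'"
      using P' f_majorant_nonneg f_majorant_mono[of "\<bar>u x\<bar>" "2 * \<bar>u x\<bar>"] f_majorant_mono[of "\<bar>v x\<bar>" "2 * \<bar>v x\<bar>"]
      by (intro powr_mono2) (auto simp: abs_of_nonneg add_mono)
    also have "\<dots> \<le> 2 powr P' * (\<bar>f_majorant (2 * \<bar>u x\<bar>)\<bar> powr P' + \<bar>f_majorant (2 * \<bar>v x\<bar>)\<bar> powr P')"
      using P' by (intro abs_add_powr_le) auto
    finally show ?thesis using h_majorant_nonneg f_majorant_nonneg by (simp add: mult_left_mono)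
  qed
  have ib: "integrable leb ?b"
    using h_majorant_integrable tm_bound(1)[OF u fu] tm_bound(1)[OF v fv] by auto
  show int: "integrable leb (\<lambda>x. \<bar>h_majorant x + (f_majorant \<bar>u x\<bar> + f_majorant \<bar>v x\<bar>)\<bar> powr P')"
    by (rule Bochner_Integration.integrable_bound[OF ib]) (auto intro!: AE_I2 order_trans[OF le])
  have pm: "nrm w powr P \<le> \<rho>1 powr P" if "nrm w \<le> \<rho>1" for w
    using that nrm_nonneg P_gt_2 by (intro powr_mono2) auto
  have "(LINT x|leb. \<bar>h_majorant x + (f_majorant \<bar>u x\<bar> + f_majorant \<bar>v x\<bar>)\<bar> powr P') \<le> (LINT x|leb. ?b x)"
    by (intro integral_mono int ib le)
  also have "\<dots> = 2 powr P' * ((LINT x|leb. h_majorant x powr P') + 2 powr P' * ((LINT x|leb. f_majorant (2 * \<bar>u x\<bar>) powr P') + (LINT x|leb. f_majorant (2 * \<bar>v x\<bar>) powr P')))"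
    using h_majorant_integrable tm_bound(1)[OF u fu] tm_bound(1)[OF v fv] by simp
  also have "\<dots> \<le> 2 powr P' * ((LINT x|leb. h_majorant x powr P') + 2 powr P' * (C3 * \<rho>1 powr P + C3 * \<rho>1 powr P))"
    using C3_pos pm[OF fu(2)] pm[OF fv(2)] tm_bound(2)[OF u fu] tm_bound(2)[OF v fv]
    by (intro mult_left_mono add_left_mono add_mono) (auto intro: order_trans mult_left_mono)
  finally show "(LINT x|leb. \<bar>h_majorant x + (f_majorant \<bar>u x\<bar> + f_majorant \<bar>v x\<bar>)\<bar> powr P')
      \<le> 2 powr P' * ((LINT x|leb. h_majorant x powr P') + 2 powr P' * (2 * (C3 * \<rho>1 powr P)))" by simp
qed

lemma zero_facts: "(\<lambda>x. 0) \<in> WV" "E (\<lambda>x::real^'n. 0) = 0" "nrm (\<lambda>x::real^'n. 0) = 0" "Er (\<lambda>x::real^'n. 0) = 0"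
proof -
  show "(\<lambda>x. 0) \<in> WV" by (rule test_in_WV[OF zero_test_function])
  show E0: "E (\<lambda>x::real^'n. 0) = 0" by (simp add: WV_energy_def gagliardo_energy_def)
  then show "nrm (\<lambda>x::real^'n. 0) = 0" "Er (\<lambda>x::real^'n. 0) = 0" by (simp_all add: WV_norm_def Er_def)
qed

lemma rhs_primitive_diff_integrable:
  assumes lam: "0 \<le> lam" "lam \<le> 1"
    and u[measurable]: "u \<in> borel_measurable leb" and fu: "E u < \<infinity>" "nrm u \<le> \<rho>1"
  shows "integrable leb (\<lambda>x. rhs_primitive lam x (u x))"
    and "\<bar>LINT x|leb. rhs_primitive lam x (u x)\<bar> \<le> \<rho>1 powr P / V0 +
      2 powr P' * ((LINT x|leb. h_majorant x powr P') + 2 powr P' * (2 * (C3 * \<rho>1 powr P)))"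
proof -
  have z: "(\<lambda>x::real^'n. 0) \<in> borel_measurable leb" "E (\<lambda>x::real^'n. 0) < \<infinity>" "nrm (\<lambda>x::real^'n. 0) \<le> \<rho>1"
    using zero_facts \<rho>1_pos by auto
  note maj = majorant_integrable[OF u fu z]
  let ?b = "\<lambda>x. h_majorant x + (f_majorant \<bar>u x\<bar> + f_majorant \<bar>0\<bar>)"
  have mb: "?b \<in> borel_measurable leb" by measurable
  have le: "\<bar>rhs_primitive lam x (u x)\<bar> \<le> \<bar>u x * ?b x\<bar>" for x
    using rhs_primitive_diff_le[OF lam, of x "u x" 0] h_majorant_nonneg[of x] f_majorant_nonneg[of "\<bar>u x\<bar>"] f_majorant_nonneg[of 0] by (simp add: abs_mult)
  note hol = integrable_mult_conjugate[OF conj_P zero_less_one u mb lp_bound(1)[OF u fu(1)] maj(1)]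
  show int: "integrable leb (\<lambda>x. rhs_primitive lam x (u x))"
    by (rule Bochner_Integration.integrable_bound[OF hol(1)]) (use le rhs_primitive_measurable(1)[OF u] in auto)
  have "\<bar>LINT x|leb. rhs_primitive lam x (u x)\<bar> \<le> (LINT x|leb. \<bar>rhs_primitive lam x (u x)\<bar>)" by (rule integral_abs_bound)
  also have "\<dots> \<le> (LINT x|leb. \<bar>u x * ?b x\<bar>)"
    using int hol(1) by (intro integral_mono integrable_abs le)
  also have "\<dots> \<le> (LINT x|leb. \<bar>u x\<bar> powr P) + (LINT x|leb. \<bar>?b x\<bar> powr P')" using hol(2) by simp
  also have "(LINT x|leb. \<bar>u x\<bar> powr P) \<le> \<rho>1 powr P / V0"
  proof -
    have "nrm u powr P \<le> \<rho>1 powr P" using fu(2) nrm_nonneg P_gt_2 by (intro powr_mono2) auto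
    then have "V0 * (LINT x|leb. \<bar>u x\<bar> powr P) \<le> \<rho>1 powr P"
      using lp_bound(2)[OF u fu(1)] by (simp add: nrm_powr)
    then show ?thesis using V0(1) by (simp add: le_divide_eq mult.commute)
  qed
  finally show "\<bar>LINT x|leb. rhs_primitive lam x (u x)\<bar> \<le> \<rho>1 powr P / V0 +
      2 powr P' * ((LINT x|leb. h_majorant x powr P') + 2 powr P' * (2 * (C3 * \<rho>1 powr P)))"
    using maj(2) by simp
qed

text \<open>
  The increments of \<open>rhs_primitive\<close> are products of an increment of \<open>u\<close>, small in \<open>L\<^sup>P\<close>, and a factor bounded in \<open>L\<^sup>P\<^sup>'\<close>.
\<close>

lemma rhs_primitive_continuous:
  assumes lam: "0 \<le> lam" "lam \<le> 1"
    and u: "\<And>n. u n \<in> borel_measurable leb" "\<And>n. E (u n) < \<infinity>" "\<And>n. nrm (u n) \<le> \<rho>1"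
    and v: "v \<in> borel_measurable leb" "E v < \<infinity>" "nrm v \<le> \<rho>1"
    and lim: "(\<lambda>n. lp_energy leb P (\<lambda>x. u n x - v x)) \<longlonglongrightarrow> 0"
  shows "(\<lambda>n. LINT x|leb. rhs_primitive lam x (u n x)) \<longlonglongrightarrow> (LINT x|leb. rhs_primitive lam x (v x))"
proof -
  note [measurable] = u(1) v(1)
  have fin: "lp_energy leb P (\<lambda>x. u n x - v x) < \<infinity>" for n
  proof -
    have "ennreal V0 * lp_energy leb P (\<lambda>x. u n x - v x) \<le> E (\<lambda>x. u n x - v x)" by (rule lp_le_E) measurable
    also have "\<dots> \<le> ennreal (2 powr P) * (E (u n) + E v)" by (rule E_diff_le) measurable
    also have "\<dots> < \<infinity>" using u(2)[of n] v(2) by (simp add: ennreal_mult_less_top)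
    finally show ?thesis using V0(1) by (auto simp: ennreal_mult_less_top)
  qed
  have m: "(\<lambda>x. u n x - v x) \<in> borel_measurable leb" for n by measurable
  note lpf = lp_energy_finite[OF m fin]
  let ?b = "\<lambda>n x. h_majorant x + (f_majorant \<bar>u n x\<bar> + f_majorant \<bar>v x\<bar>)"
  have mb: "?b n \<in> borel_measurable leb" for n by measurable
  have lim0: "(\<lambda>n. LINT x|leb. \<bar>u n x - v x\<bar> powr P) \<longlonglongrightarrow> 0"
    using lim unfolding lpf(2) by (simp add: integral_nonneg_AE flip: ennreal_0)
  have conv: "(\<lambda>n. LINT x|leb. \<bar>(u n x - v x) * ?b n x\<bar>) \<longlonglongrightarrow> 0"
    by (rule tendsto_integral_mult_conjugate[OF conj_P m mb lpf(1) majorant_integrable(1)[OF u v] lim0 majorant_integrable(2)[OF u v]])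
  have "(\<lambda>n. (LINT x|leb. rhs_primitive lam x (u n x)) - (LINT x|leb. rhs_primitive lam x (v x))) \<longlonglongrightarrow> 0"
  proof (rule Lim_null_comparison[OF always_eventually conv], intro allI)
    fix n
    have i: "integrable leb (\<lambda>x. rhs_primitive lam x (u n x))" "integrable leb (\<lambda>x. rhs_primitive lam x (v x))"
      by (rule rhs_primitive_diff_integrable[OF lam] u v)+
    have "norm ((LINT x|leb. rhs_primitive lam x (u n x)) - (LINT x|leb. rhs_primitive lam x (v x))) = \<bar>LINT x|leb. rhs_primitive lam x (u n x) - rhs_primitive lam x (v x)\<bar>"
      using i by simp
    also have "\<dots> \<le> (LINT x|leb. \<bar>rhs_primitive lam x (u n x) - rhs_primitive lam x (v x)\<bar>)" by (rule integral_abs_bound)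
    also have "\<dots> \<le> (LINT x|leb. \<bar>(u n x - v x) * ?b n x\<bar>)"
    proof (intro integral_mono integrable_abs Bochner_Integration.integrable_diff i)
      show "integrable leb (\<lambda>x. (u n x - v x) * ?b n x)"
        by (rule integrable_mult_conjugate(1)[OF conj_P zero_less_one m mb lpf(1) majorant_integrable(1)[OF u v]])
      show "\<bar>rhs_primitive lam x (u n x) - rhs_primitive lam x (v x)\<bar> \<le> \<bar>(u n x - v x) * ?b n x\<bar>" for x
        using rhs_primitive_diff_le[OF lam, of x "u n x" "v x"] h_majorant_nonneg[of x] f_majorant_nonneg[of "\<bar>u n x\<bar>"] f_majorant_nonneg[of "\<bar>v x\<bar>"]
        by (simp add: abs_mult)
    qed
    finally show "norm ((LINT x|leb. rhs_primitive lam x (u n x)) - (LINT x|leb. rhs_primitive lam x (v x))) \<le> (LINT x|leb. \<bar>(u n x - v x) * ?b n x\<bar>)" .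
  qed
  then show ?thesis by (simp add: LIM_zero_iff)
qed

text \<open>
  An application of \<open>nemytskii_remainder\<close>. As \<open>f_majorant\<close> is increasing, its value at \<open>\<bar>u + t\<bar>\<close> is at most the sum of its values at
  \<open>2 \<bar>u\<bar>\<close> and \<open>2 \<bar>t\<bar>\<close>, which separates the point from the increment.
\<close>

lemma rhs_primitive_frechet:
  assumes lam: "0 \<le> lam" "lam \<le> 1"
    and u[measurable]: "u \<in> borel_measurable leb" and fu: "E u < \<infinity>" "nrm u \<le> \<rho>1" and e: "0 < e"
  shows "\<exists>\<delta>>0. \<forall>\<phi>\<in>WV. nrm \<phi> < \<delta> \<and> nrm (\<lambda>x. u x + \<phi> x) \<le> \<rho>1 \<longrightarrow>
    \<bar>(LINT x|leb. rhs_primitive lam x (u x + \<phi> x)) - (LINT x|leb. rhs_primitive lam x (u x)) - (LINT x|leb. rhs lam x (u x) * \<phi> x)\<bar> \<le> e * nrm \<phi>"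
proof -
  define A where "A x = 2 * h_majorant x + 3 * f_majorant (2 * \<bar>u x\<bar>)" for x
  define B where "B t = f_majorant (2 * t)" for t
  define C where "C = 1 / V0 + C3"
  have C: "0 < C" using V0(1) C3_pos by (simp add: C_def add_pos_pos)
  note mFF = rhs_primitive_measurable
  let ?R = "\<lambda>\<phi> x. rhs_primitive lam x (u x + \<phi> x) - rhs_primitive lam x (u x) - rhs lam x (u x) * \<phi> x"
  have "\<exists>\<delta>>0. \<forall>\<phi>\<in>WV. nrm \<phi> < \<delta> \<longrightarrow> integrable leb (?R \<phi>) \<and> (LINT x|leb. \<bar>?R \<phi> x\<bar>) \<le> e * nrm \<phi>"
  proof (rule nemytskii_remainder[where F = "rhs_primitive lam" and f = "rhs lam" and \<phi> = "\<lambda>\<phi>. \<phi>" and r = nrm and I = WV and e = e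
        and q' = P' and q = P and u = u and M = leb and A = A and B = B and \<rho> = \<rho>1 and C = C])
    show "1 < P" "P' = P / (P - 1)" by (rule conj_P)+
    show "(rhs_primitive lam x has_real_derivative rhs lam x (u x)) (at (u x))" for x by (rule rhs_primitive_deriv)
    show "\<bar>rhs_primitive lam x (u x + t) - rhs_primitive lam x (u x) - rhs lam x (u x) * t\<bar> \<le> \<bar>t\<bar> * (A x + B \<bar>t\<bar>)" for x t
    proof -
      have "\<bar>rhs_primitive lam x (u x + t) - rhs_primitive lam x (u x)\<bar> \<le> \<bar>t\<bar> * (h_majorant x + (f_majorant \<bar>u x + t\<bar> + f_majorant \<bar>u x\<bar>))"
        using rhs_primitive_diff_le[OF lam, of x "u x + t" "u x"] by simp
      moreover have "\<bar>rhs lam x (u x) * t\<bar> \<le> \<bar>t\<bar> * (h_majorant x + f_majorant \<bar>u x\<bar>)"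
        using rhs_growth[OF lam, of x "u x"] by (simp add: abs_mult mult.commute mult_left_mono)
      ultimately have "\<bar>rhs_primitive lam x (u x + t) - rhs_primitive lam x (u x) - rhs lam x (u x) * t\<bar>
          \<le> \<bar>t\<bar> * (h_majorant x + (f_majorant \<bar>u x + t\<bar> + f_majorant \<bar>u x\<bar>)) + \<bar>t\<bar> * (h_majorant x + f_majorant \<bar>u x\<bar>)" by linarith
      also have "\<dots> = \<bar>t\<bar> * (2 * h_majorant x + (f_majorant \<bar>u x + t\<bar> + 2 * f_majorant \<bar>u x\<bar>))" by (simp add: algebra_simps)
      also have "\<dots> \<le> \<bar>t\<bar> * (A x + B \<bar>t\<bar>)"
      proof (intro mult_left_mono)
        have "f_majorant \<bar>u x + t\<bar> \<le> f_majorant (max (2 * \<bar>u x\<bar>) (2 * \<bar>t\<bar>))" by (intro f_majorant_mono) auto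
        also have "\<dots> \<le> f_majorant (2 * \<bar>u x\<bar>) + f_majorant (2 * \<bar>t\<bar>)" using f_majorant_nonneg by (simp add: max_def)
        finally show "2 * h_majorant x + (f_majorant \<bar>u x + t\<bar> + 2 * f_majorant \<bar>u x\<bar>) \<le> A x + B \<bar>t\<bar>"
          using f_majorant_mono[of "\<bar>u x\<bar>" "2 * \<bar>u x\<bar>"] unfolding A_def B_def by simp
      qed simp
      finally show ?thesis .
    qed
    show "0 \<le> A x" for x using h_majorant_nonneg f_majorant_nonneg by (simp add: A_def)
    show "0 \<le> B t" for t using f_majorant_nonneg by (simp add: B_def)
    show "A \<in> borel_measurable leb" unfolding A_def[abs_def] by measurable
    show "B \<in> borel_measurable borel" unfolding B_def[abs_def] by measurable
    show "integrable leb (\<lambda>x. A x powr P')"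
    proof (rule Bochner_Integration.integrable_bound)
      show "integrable leb (\<lambda>x. 2 powr P' * (2 powr P' * h_majorant x powr P' + 3 powr P' * f_majorant (2 * \<bar>u x\<bar>) powr P'))"
        using h_majorant_integrable tm_bound(1)[OF u fu] by auto
      show "AE x in leb. norm (A x powr P') \<le> norm (2 powr P' * (2 powr P' * h_majorant x powr P' + 3 powr P' * f_majorant (2 * \<bar>u x\<bar>) powr P'))"
        using abs_add_powr_le[of P' "2 * h_majorant _" "3 * f_majorant (2 * \<bar>u _\<bar>)"] P' h_majorant_nonneg f_majorant_nonneg
        by (intro AE_I2) (simp add: A_def powr_mult abs_of_nonneg)
      show "(\<lambda>x. A x powr P') \<in> borel_measurable leb" unfolding A_def[abs_def] by measurable
    qed
    fix \<phi> assume \<phi>W: "\<phi> \<in> WV"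
    note \<phi>[measurable] = WV_measurable[OF \<phi>W] and f\<phi> = WV_finite[OF \<phi>W]
    show "\<phi> \<in> borel_measurable leb" by (rule \<phi>)
    show "?R \<phi> \<in> borel_measurable leb"
      using mFF(1)[OF u] mFF(2)[OF u] mFF(1)[of "\<lambda>x. u x + \<phi> x"] by measurable
    show "integrable leb (\<lambda>x. \<bar>\<phi> x\<bar> powr P)" by (rule lp_bound(1)[OF \<phi> f\<phi>])
    have "(LINT x|leb. \<bar>\<phi> x\<bar> powr P) \<le> 1 / V0 * nrm \<phi> powr P"
      using lp_bound(2)[OF \<phi> f\<phi>] V0(1) by (simp add: nrm_powr le_divide_eq mult.commute)
    also have "\<dots> \<le> C * nrm \<phi> powr P" using C3_pos by (intro mult_right_mono) (auto simp: C_def)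
    finally show "(LINT x|leb. \<bar>\<phi> x\<bar> powr P) \<le> C * nrm \<phi> powr P" .
    show "0 \<le> nrm \<phi>" by (rule nrm_nonneg)
    assume r: "nrm \<phi> \<le> \<rho>1"
    show "integrable leb (\<lambda>x. B \<bar>\<phi> x\<bar> powr P')" unfolding B_def by (rule tm_bound(1)[OF \<phi> f\<phi> r])
    have "(LINT x|leb. B \<bar>\<phi> x\<bar> powr P') \<le> C3 * nrm \<phi> powr P" unfolding B_def by (rule tm_bound(2)[OF \<phi> f\<phi> r])
    also have "\<dots> \<le> C * nrm \<phi> powr P" using V0(1) by (intro mult_right_mono) (auto simp: C_def)
    finally show "(LINT x|leb. B \<bar>\<phi> x\<bar> powr P') \<le> C * nrm \<phi> powr P" .
  qed (use \<rho>1_pos C e in auto)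
  then obtain \<delta> where \<delta>: "0 < \<delta>" "\<And>\<phi>. \<phi> \<in> WV \<Longrightarrow> nrm \<phi> < \<delta> \<Longrightarrow> integrable leb (?R \<phi>) \<and> (LINT x|leb. \<bar>?R \<phi> x\<bar>) \<le> e * nrm \<phi>"
    by blast
  have "\<bar>(LINT x|leb. rhs_primitive lam x (u x + \<phi> x)) - (LINT x|leb. rhs_primitive lam x (u x)) - (LINT x|leb. rhs lam x (u x) * \<phi> x)\<bar> \<le> e * nrm \<phi>"
    if \<phi>: "\<phi> \<in> WV" "nrm \<phi> < \<delta>" "nrm (\<lambda>x. u x + \<phi> x) \<le> \<rho>1" for \<phi>
  proof -
    note [measurable] = WV_measurable[OF \<phi>(1)]
    have i1: "integrable leb (\<lambda>x. rhs_primitive lam x (u x))" by (rule rhs_primitive_diff_integrable(1)[OF lam u fu])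
    have i2: "integrable leb (\<lambda>x. rhs_primitive lam x (u x + \<phi> x))"
      by (rule rhs_primitive_diff_integrable(1)[OF lam _ nrm_triangle(1)[OF u _ fu(1) WV_finite[OF \<phi>(1)]] \<phi>(3)]) measurable
    have i3: "integrable leb (?R \<phi>)" using \<delta>(2)[OF \<phi>(1,2)] by blast
    have "integrable leb (\<lambda>x. rhs_primitive lam x (u x + \<phi> x) - rhs_primitive lam x (u x) - ?R \<phi> x)"
      by (intro Bochner_Integration.integrable_diff i1 i2 i3)
    then have i4: "integrable leb (\<lambda>x. rhs lam x (u x) * \<phi> x)" by simp
    have "(LINT x|leb. rhs_primitive lam x (u x + \<phi> x)) - (LINT x|leb. rhs_primitive lam x (u x)) - (LINT x|leb. rhs lam x (u x) * \<phi> x) = (LINT x|leb. ?R \<phi> x)"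
      using i1 i2 i4 by simp
    then show ?thesis using \<delta>(2)[OF \<phi>(1,2)] integral_abs_bound[of leb "?R \<phi>"] by (simp only:) linarith
  qed
  then show ?thesis using \<delta>(1) by blast
qed

abbreviation "I lam \<equiv> energy_functional s p V M f h lam"

definition H :: "(real^'n \<Rightarrow> real) \<Rightarrow> real" where
  "H u = (LINT x|leb. h x * max (u x) 0 powr p)"

lemma I_eq: "I lam u = MM (Er u) / P - (LINT x|leb. F x (u x)) - lam / p * H u"
  using s01 nrm_powr[of u] unfolding energy_functional_def H_def
  by (simp add: P_def[symmetric]) (simp add: P_def)

lemma h_young: "h x * t powr p \<le> h x powr (P / (P - p)) + t powr P" if "0 \<le> t"
proof -
  define q where "q = P / p"
  have q: "1 < q" using p by (simp add: q_def)
  have "q - 1 = (P - p) / p" using p by (simp add: q_def field_simps)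
  then have q': "q / (q - 1) = P / (P - p)" using p by (simp add: q_def)
  have "t powr p * h x \<le> (1 * t powr p) powr q + (h x / 1) powr (q / (q - 1))"
    by (rule young_powr_scaled) (use q h_nonneg in auto)
  also have "(1 * t powr p) powr q = t powr P" using p by (simp add: powr_powr q_def)
  finally show ?thesis by (simp add: q' mult.commute)
qed

lemma H_integrable:
  assumes [measurable]: "u \<in> borel_measurable leb" and f: "E u < \<infinity>"
  shows "integrable leb (\<lambda>x. h x * max (u x) 0 powr p)"
proof (rule Bochner_Integration.integrable_bound)
  show "integrable leb (\<lambda>x. h x powr (P / (P - p)) + \<bar>u x\<bar> powr P)"
    using h_pow_integrable lp_bound(1)[OF assms] by auto
  show "AE x in leb. norm (h x * max (u x) 0 powr p) \<le> norm (h x powr (P / (P - p)) + \<bar>u x\<bar> powr P)"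
  proof (intro AE_I2)
    fix x
    have "max (u x) 0 powr P \<le> \<bar>u x\<bar> powr P" using P_gt_2 by (intro powr_mono2) auto
    then show "norm (h x * max (u x) 0 powr p) \<le> norm (h x powr (P / (P - p)) + \<bar>u x\<bar> powr P)"
      using h_young[of "max (u x) 0" x] h_nonneg[of x] by (simp add: abs_mult)
  qed
  show "(\<lambda>x. h x * max (u x) 0 powr p) \<in> borel_measurable leb" using h_meas by measurable
qed

lemma H_nonneg: "0 \<le> H u"
  unfolding H_def using h_nonneg by (intro integral_nonneg_AE) auto

lemma H_scale: "0 \<le> t \<Longrightarrow> H (\<lambda>x. t * u x) = t powr p * H u"
proof -
  assume t: "0 \<le> t"
  then have "max (t * u x) 0 = t * max (u x) 0" for x by (simp add: max_mult_distrib_left)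
  then have eq: "h x * max (t * u x) 0 powr p = t powr p * (h x * max (u x) 0 powr p)" for x
    by (simp add: powr_mult)
  show ?thesis unfolding H_def eq by (rule integral_mult_right_zero)
qed

definition CH where "CH = (LINT x|leb. h x powr (P / (P - p))) + 1 / V0"

lemma CH_pos: "0 < CH"
  using V0(1) by (simp add: CH_def add_nonneg_pos integral_nonneg_AE)

lemma H_le:
  assumes [measurable]: "u \<in> borel_measurable leb" and f: "E u < \<infinity>"
  shows "H u \<le> CH * nrm u powr p"
proof (cases "nrm u = 0")
  case True
  then have "V0 * (LINT x|leb. \<bar>u x\<bar> powr P) \<le> 0" using lp_bound(2)[OF assms] nrm_zero_iff[of u] by simp
  then have "(LINT x|leb. \<bar>u x\<bar> powr P) = 0"
    using V0(1) by (intro antisym) (auto simp: mult_le_0_iff integral_nonneg_AE)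
  then have "AE x in leb. \<bar>u x\<bar> powr P = 0"
    using integral_nonneg_eq_0_iff_AE[OF lp_bound(1)[OF assms]] by simp
  then have "AE x in leb. h x * max (u x) 0 powr p = 0" by eventually_elim simp
  then have "H u = (LINT x|leb. 0)" unfolding H_def
    using h_meas by (intro integral_cong_AE) auto
  then show ?thesis using True p by simp
next
  case False
  define n where "n = nrm u"
  have n: "0 < n" using False nrm_nonneg[of u] by (simp add: n_def)
  have le: "h x * max (u x) 0 powr p \<le> n powr p * h x powr (P / (P - p)) + n powr p / n powr P * \<bar>u x\<bar> powr P" for x
  proof -
    have "max (u x) 0 = n * (max (u x) 0 / n)" using n by simp
    then have "h x * max (u x) 0 powr p = n powr p * (h x * (max (u x) 0 / n) powr p)"
      using powr_mult[of n "max (u x) 0 / n" p] by simp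
    also have "\<dots> \<le> n powr p * (h x powr (P / (P - p)) + (max (u x) 0 / n) powr P)"
      using n by (intro mult_left_mono h_young) auto
    also have "\<dots> \<le> n powr p * (h x powr (P / (P - p)) + \<bar>u x\<bar> powr P / n powr P)"
      using n P_gt_2 by (intro mult_left_mono add_left_mono) (auto simp: powr_divide intro!: divide_right_mono powr_mono2)
    finally show ?thesis by (simp add: distrib_left)
  qed
  have "H u \<le> (LINT x|leb. n powr p * h x powr (P / (P - p)) + n powr p / n powr P * \<bar>u x\<bar> powr P)"
    unfolding H_def using h_pow_integrable lp_bound(1)[OF assms]
    by (intro integral_mono H_integrable[OF assms] le) auto
  also have "\<dots> = n powr p * (LINT x|leb. h x powr (P / (P - p))) + n powr p / n powr P * (LINT x|leb. \<bar>u x\<bar> powr P)"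
    using h_pow_integrable lp_bound(1)[OF assms] by simp
  also have "\<dots> \<le> n powr p * (LINT x|leb. h x powr (P / (P - p))) + n powr p / n powr P * (n powr P / V0)"
    using lp_bound(2)[OF assms] V0(1) n Er_nonneg[of u]
    by (intro add_left_mono mult_left_mono) (auto simp: n_def nrm_powr le_divide_eq mult.commute)
  also have "\<dots> = CH * n powr p" using n by (simp add: CH_def algebra_simps)
  finally show ?thesis by (simp add: n_def)
qed

lemma F_integrable:
  assumes "u \<in> borel_measurable leb" "E u < \<infinity>" "nrm u \<le> \<rho>1"
  shows "integrable leb (\<lambda>x. F x (u x))"
  using rhs_primitive_diff_integrable(1)[of 0, OF _ _ assms] by (simp add: rhs_primitive_def)

lemma I_eq_rhs_primitive:
  assumes "u \<in> borel_measurable leb" "E u < \<infinity>" "nrm u \<le> \<rho>1"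
  shows "I lam u = MM (Er u) / P - (LINT x|leb. rhs_primitive lam x (u x))"
  using F_integrable[OF assms] H_integrable[OF assms(1,2)]
  by (simp add: I_eq rhs_primitive_def H_def)

section \<open>Critical points of nonpositive energy\<close>

text \<open>
  The difference quotients of \<open>I\<close> along the ray \<open>t w\<close>, \<open>t \<down> 1\<close>, tend to \<open>0\<close>, and superhomogeneity bounds \<open>\<integral>F(x,t w)\<close> from
  below by \<open>t\<^sup>\<mu> \<integral>F(x,w)\<close>. Outside the small ball \<open>F(x,w)\<close> could fail to be integrable, and the Bochner integral of such a function is \<open>0\<close> by
  convention. This is harmless: if \<open>\<integral>F(x,w)\<close> is nonzero, then by continuity of \<open>I\<close> at \<open>w\<close> the integrals for \<open>t\<close> close to \<open>1\<close> are
  nonzero too, and hence they converge; otherwise the lower bound is trivial.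
\<close>

lemma critical_point_nehari:
  assumes crit: "critical_point s p V M f h lam w" and \<mu>: "\<And>x \<tau> t. 1 \<le> \<tau> \<Longrightarrow> \<tau> powr \<mu> * F x t \<le> F x (\<tau> * t)"
  shows "\<mu> * (LINT x|leb. F x (w x)) \<le> Er w * M (Er w) - lam * H w"
proof -
  have wW: "w \<in> WV" using crit by (simp add: critical_point_def)
  note w[measurable] = WV_measurable[OF wW] and fw = WV_finite[OF wW]
  define A where "A = Er w"
  define J where "J = (LINT x|leb. F x (w x))"
  define JJ where "JJ t = (LINT x|leb. F x (t * w x))" for t
  have J0: "0 \<le> J" unfolding J_def by (intro integral_nonneg_AE) (simp add: F_nonneg)
  have JJ0: "0 \<le> JJ t" for t unfolding JJ_def by (intro integral_nonneg_AE) (simp add: F_nonneg)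
  define n where "n = nrm w"
  have n: "0 \<le> n" by (simp add: n_def nrm_nonneg)
  have It: "I lam (\<lambda>x. t * w x) = MM (t powr P * A) / P - JJ t - lam / p * (t powr p * H w)" if "0 < t" for t
    using that by (simp add: I_eq nrm_scale[OF w] H_scale JJ_def A_def)
  have I1: "I lam w = MM A / P - J - lam / p * H w" by (simp add: I_eq A_def J_def)
  have close: "\<forall>\<^sub>F t in at_right 1. \<bar>I lam (\<lambda>x. t * w x) - I lam w\<bar> \<le> e * ((t - 1) * n)" if e: "0 < e" for e
  proof -
    obtain \<delta> where \<delta>: "0 < \<delta>" "\<And>\<phi>. \<phi> \<in> WV \<Longrightarrow> nrm \<phi> < \<delta> \<Longrightarrow> \<bar>I lam (\<lambda>x. w x + \<phi> x) - I lam w\<bar> \<le> e * nrm \<phi>"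
      using crit e by (auto simp: critical_point_def)
    have "\<forall>\<^sub>F t in at_right 1. t < 1 + \<delta> / (n + 1)"
      using \<delta>(1) n by (auto simp: eventually_at_right_field add_nonneg_pos intro!: exI[of _ "1 + \<delta> / (n + 1)"])
    then show ?thesis
      using eventually_at_right_less[of "1::real"]
    proof eventually_elim
      case (elim t)
      have "(t - 1) * n < \<delta>"
      proof -
        have "(t - 1) * n \<le> (t - 1) * (n + 1)" using elim by (intro mult_left_mono) auto
        also have "\<dots> < \<delta>" 
        proof -
          have "t - 1 < \<delta> / (n + 1)" using elim by simp
          then show ?thesis using n by (simp add: pos_less_divide_eq)
        qed
        finally show ?thesis .
      qed
      moreover have "nrm (\<lambda>x. (t - 1) * w x) = (t - 1) * n" using elim by (simp add: nrm_scale(2)[OF w] n_def)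
      ultimately have "\<bar>I lam (\<lambda>x. w x + (t - 1) * w x) - I lam w\<bar> \<le> e * ((t - 1) * n)"
        using \<delta>(2)[OF WV_linear(1)[OF wW], of "t - 1"] by simp
      then show ?case by (simp add: algebra_simps)
    qed
  qed
  define B where "B t = MM (t powr P * A) / P - lam / p * (t powr p * H w)" for t
  have B_deriv: "(B has_real_derivative A * M A - lam * H w) (at 1)"
  proof -
    have 1: "((\<lambda>t. t powr P * A) has_real_derivative P * 1 powr (P - 1) * A) (at 1)"
      by (intro DERIV_cmult_right has_real_derivative_powr) simp
    have "((\<lambda>t. MM (t powr P * A)) has_real_derivative M (1 powr P * A) * (P * 1 powr (P - 1) * A)) (at 1)"
    proof (cases "A = 0")
      case True
      then show ?thesis by simp
    next
      case False
      then have "0 < A" using Er_nonneg[of w] by (simp add: A_def)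
      then show ?thesis by (intro DERIV_chain2[OF MM_deriv_at 1]) simp
    qed
    then have "((\<lambda>t. MM (t powr P * A) / P) has_real_derivative M (1 powr P * A) * (P * 1 powr (P - 1) * A) / P) (at 1)"
      by (rule DERIV_cdivide)
    moreover have "((\<lambda>t. lam / p * (t powr p * H w)) has_real_derivative lam / p * (p * 1 powr (p - 1) * H w)) (at 1)"
      by (intro DERIV_cmult DERIV_cmult_right has_real_derivative_powr) simp
    ultimately have "(B has_real_derivative M (1 powr P * A) * (P * 1 powr (P - 1) * A) / P - lam / p * (p * 1 powr (p - 1) * H w)) (at 1)"
      unfolding B_def[abs_def] by (rule DERIV_diff)
    then show ?thesis using P_gt_2 p by (simp add: mult.commute)
  qed
  have eqB: "I lam (\<lambda>x. t * w x) - I lam w = (B t - B 1) - (JJ t - J)" if "0 < t" for t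
    using It[OF that] I1 by (simp add: B_def)
  have JJ_ge: "\<forall>\<^sub>F t in at_right 1. t powr \<mu> * J \<le> JJ t"
  proof (cases "J = 0")
    case True
    then show ?thesis using JJ0 by simp
  next
    case False
    then have Jpos: "0 < J" using J0 by simp
    then have intw: "integrable leb (\<lambda>x. F x (w x))" unfolding J_def using not_integrable_integral_eq by fastforce
    have "isCont B 1" using B_deriv by (rule DERIV_isCont)
    then have "(B \<longlongrightarrow> B 1) (at_right 1)" unfolding isCont_def by (rule tendsto_within_subset) simp
    then have "((\<lambda>t. J + (B t - B 1) - 1 * ((t - 1) * n)) \<longlongrightarrow> J + (B 1 - B 1) - 1 * ((1 - 1) * n)) (at_right 1)"
      by (intro tendsto_intros)
    then have "\<forall>\<^sub>F t in at_right 1. 0 < J + (B t - B 1) - 1 * ((t - 1) * n)"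
      using Jpos by (intro order_tendstoD) auto
    then show ?thesis using close[OF zero_less_one] eventually_at_right_less[of "1::real"]
    proof eventually_elim
      case (elim t)
      have "0 < JJ t" using elim eqB[of t] by auto
      then have intt: "integrable leb (\<lambda>x. F x (t * w x))" unfolding JJ_def using not_integrable_integral_eq by fastforce
      have "t powr \<mu> * J = (LINT x|leb. t powr \<mu> * F x (w x))" by (simp add: J_def)
      also have "\<dots> \<le> JJ t" unfolding JJ_def using elim by (intro integral_mono intt integrable_mult_right intw \<mu>) auto
      finally show ?case .
    qed
  qed
  define G where "G t = B t - t powr \<mu> * J" for t
  have G_deriv: "(G has_real_derivative (A * M A - lam * H w) - \<mu> * J) (at 1)"
  proof -
    have "((\<lambda>t. t powr \<mu> * J) has_real_derivative \<mu> * 1 powr (\<mu> - 1) * J) (at 1)"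
      by (intro DERIV_cmult_right has_real_derivative_powr) simp
    from DERIV_diff[OF B_deriv this] show ?thesis unfolding G_def[abs_def] by simp
  qed
  have "- e * n \<le> (A * M A - lam * H w) - \<mu> * J" if e: "0 < e" for e
  proof (rule tendsto_lowerbound)
    show "((\<lambda>t. (G t - G 1) / (t - 1)) \<longlongrightarrow> (A * M A - lam * H w) - \<mu> * J) (at_right 1)"
      using G_deriv unfolding has_field_derivative_iff by (rule tendsto_within_subset) simp
    show "\<forall>\<^sub>F t in at_right 1. - e * n \<le> (G t - G 1) / (t - 1)"
      using close[OF e] JJ_ge eventually_at_right_less[of "1::real"]
    proof eventually_elim
      case (elim t)
      have "- (e * ((t - 1) * n)) \<le> (B t - B 1) - (JJ t - J)" using elim eqB[of t] by auto
      also have "\<dots> \<le> G t - G 1" using elim by (simp add: G_def)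
      finally show ?case using elim by (simp add: le_divide_eq algebra_simps)
    qed
  qed simp
  then have e: "- e * n \<le> (A * M A - lam * H w) - \<mu> * J" if "0 < e" for e using that by blast
  have "0 \<le> (A * M A - lam * H w) - \<mu> * J"
  proof (rule field_le_epsilon)
    fix e :: real assume "0 < e"
    then have "- (e / (n + 1)) * n \<le> (A * M A - lam * H w) - \<mu> * J" using n by (intro e) simp
    moreover have "e / (n + 1) * n \<le> e" using n \<open>0 < e\<close> by (simp add: field_simps)
    ultimately show "0 \<le> (A * M A - lam * H w) - \<mu> * J + e" by simp
  qed
  then show ?thesis by (simp add: A_def J_def)
qed

text \<open>
  If \<open>I lam w \<le> 0\<close>, eliminate \<open>\<integral>F(x,w)\<close> with \<open>critical_point_nehari\<close> and apply \<open>cond_M2\<close>: a positive multiple of \<open>MM (Er w)\<close> is at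
  most \<open>lam CH \<parallel>w\<parallel>\<^sup>p / p\<close>. For \<open>\<parallel>w\<parallel> \<ge> e\<close> the left-hand side is at least a multiple of \<open>\<parallel>w\<parallel>\<^sup>P\<close>, so \<open>lam\<close> cannot be small.
\<close>

lemma critical_points_small:
  assumes e: "0 < e"
  shows "\<exists>\<Lambda>>0. \<forall>lam w. 0 < lam \<and> lam < \<Lambda> \<and> critical_point s p V M f h lam w \<and> I lam w \<le> 0 \<longrightarrow> nrm w < e"
proof -
  obtain \<mu> where \<mu>: "\<theta> * P < \<mu>" "\<And>x \<tau> t. 1 \<le> \<tau> \<Longrightarrow> \<tau> powr \<mu> * F x t \<le> F x (\<tau> * t)"
    using F_superhomogeneous by blast
  have P\<mu>: "0 < \<mu>" "P < \<mu>"
  proof -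
    have "P \<le> \<theta> * P" using mult_right_mono[OF \<theta>_ge_1, of P] P_gt_2 by simp
    then show "0 < \<mu>" "P < \<mu>" using \<mu>(1) P_gt_2 by linarith+
  qed
  define a where "a = 1 / P - \<theta> / \<mu>"
  have a: "0 < a" using \<mu>(1) P_gt_2 P\<mu> by (simp add: a_def field_simps)
  obtain c where c: "0 < c" "\<And>t. e powr P \<le> t \<Longrightarrow> c * t \<le> MM t"
    using MM_lower[of "e powr P"] e by auto
  define \<Lambda> where "\<Lambda> = a * c * p * e powr (P - p) / CH"
  have \<Lambda>: "0 < \<Lambda>" using a c p e CH_pos by (simp add: \<Lambda>_def)
  have "nrm w < e" if lam: "0 < lam" "lam < \<Lambda>" and crit: "critical_point s p V M f h lam w" and Iw: "I lam w \<le> 0" for lam w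
  proof (rule ccontr)
    assume "\<not> nrm w < e"
    then have n: "e \<le> nrm w" "0 < nrm w" using e by auto
    have wW: "w \<in> WV" using crit by (simp add: critical_point_def)
    note w = WV_measurable[OF wW] and fw = WV_finite[OF wW]
    define A where "A = Er w"
    define J where "J = (LINT x|leb. F x (w x))"
    have nA: "nrm w powr P = A" by (simp add: nrm_powr A_def)
    have A0: "0 \<le> A" by (simp add: A_def Er_nonneg)
    have "e powr P \<le> A" unfolding nA[symmetric] using n e P_gt_2 by (intro powr_mono2) auto
    then have cA: "c * A \<le> MM A" by (rule c(2))
    have "\<mu> * J \<le> A * M A - lam * H w" unfolding A_def J_def by (rule critical_point_nehari[OF crit \<mu>(2)])
    also have "\<dots> \<le> \<theta> * MM A - lam * H w" using M2'[OF A0] by simp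
    finally have "J \<le> (\<theta> * MM A - lam * H w) / \<mu>" using P\<mu> by (simp add: le_divide_eq mult.commute)
    moreover have "MM A / P - J - lam / p * H w \<le> 0" using Iw by (simp add: I_eq A_def J_def)
    ultimately have "MM A / P - (\<theta> * MM A - lam * H w) / \<mu> - lam / p * H w \<le> 0" by linarith
    then have "a * MM A \<le> lam / p * H w - lam * H w / \<mu>" by (simp add: a_def algebra_simps diff_divide_distrib)
    also have "\<dots> \<le> lam / p * H w" using lam H_nonneg[of w] P\<mu> by simp
    also have "\<dots> \<le> lam / p * (CH * nrm w powr p)" using lam p H_le[OF w fw] by (intro mult_left_mono) auto
    finally have 1: "a * (c * A) \<le> lam / p * (CH * nrm w powr p)"
      using mult_left_mono[OF cA, of a] a by linarith
    have "A = nrm w powr (P - p) * nrm w powr p" using n unfolding nA[symmetric] by (simp flip: powr_add)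
    then have "a * c * nrm w powr (P - p) * nrm w powr p \<le> lam / p * CH * nrm w powr p" using 1 by (simp add: mult.assoc)
    then have "a * c * nrm w powr (P - p) \<le> lam / p * CH" by (rule mult_right_le_imp_le) (use n in simp)
    moreover have "a * c * e powr (P - p) \<le> a * c * nrm w powr (P - p)"
      using a c n e p by (intro mult_left_mono powr_mono2) auto
    ultimately have "a * c * e powr (P - p) \<le> lam / p * CH" by linarith
    then have "\<Lambda> \<le> lam" using CH_pos p by (simp add: \<Lambda>_def field_simps)
    then show False using lam by simp
  qed
  then show ?thesis using \<Lambda> by blast
qed

end

section \<open>Geometry of the functional\<close>

context kirchhoff_problem
begin

text \<open>
  Condition \<open>cond_f3\<close> bounds \<open>F x t / t\<^sup>\<theta>\<^sup>P\<close> near \<open>0\<close>. As \<open>F\<close> is positive, it also forces \<open>lambda_1\<close> to be positive.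
\<close>

lemma F_small:
  obtains c0 \<delta> where "0 < c0" "c0 < MM 1 / P * lambda_1 s \<theta> V" "0 < \<delta>"
    "\<And>x t. 0 < t \<Longrightarrow> t < \<delta> \<Longrightarrow> F x t \<le> c0 * t powr (\<theta> * P)"
proof -
  have q: "\<theta> * real CARD('n) / s = \<theta> * P" by (simp add: P_def)
  have r: "s * primitive M 1 / real CARD('n) * lambda_1 s \<theta> V = MM 1 / P * lambda_1 s \<theta> V"
    using s01 by (simp add: P_def)
  obtain c0' where c0': "Limsup (at_right 0) (\<lambda>t. SUP x. ereal (F x t / t powr (\<theta> * P))) < c0'"
    "c0' < ereal (MM 1 / P * lambda_1 s \<theta> V)"
    using f3 dense unfolding cond_f3_def q r by blast
  have ev: "\<forall>\<^sub>F t in at_right 0. (SUP x. ereal (F x t / t powr (\<theta> * P))) < c0'"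
    by (rule Limsup_lessD[OF c0'(1)])
  then obtain \<delta> where \<delta>: "0 < \<delta>" "\<And>t. 0 < t \<Longrightarrow> t < \<delta> \<Longrightarrow> (SUP x. ereal (F x t / t powr (\<theta> * P))) < c0'"
    by (auto simp: eventually_at_right_field)
  have le: "ereal (F x t / t powr (\<theta> * P)) < c0'" if "0 < t" "t < \<delta>" for x t
    by (rule le_less_trans[OF SUP_upper \<delta>(2)]) (use that in auto)
  have pos: "0 < c0'"
  proof -
    have "ereal 0 \<le> ereal (F undefined (\<delta> / 2) / (\<delta> / 2) powr (\<theta> * P))" using F_nonneg by (simp add: divide_nonneg_nonneg)
    also have "\<dots> < c0'" using \<delta>(1) by (intro le) auto
    finally show ?thesis by (simp add: zero_ereal_def)
  qed
  obtain c0 where c0: "c0' = ereal c0" using pos c0'(2) by (cases c0') auto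
  show ?thesis
  proof (rule that[OF _ _ \<delta>(1)])
    show "0 < c0" "c0 < MM 1 / P * lambda_1 s \<theta> V" using pos c0'(2) by (auto simp: c0)
    show "F x t \<le> c0 * t powr (\<theta> * P)" if "0 < t" "t < \<delta>" for x t
      using le[OF that, of x] that by (simp add: c0 divide_less_eq)
  qed
qed

text \<open>
  If \<open>\<bar>w\<bar>\<^sup>\<theta>\<^sup>P\<close> were not integrable, its integral would be \<open>0\<close> by convention, the quotient of \<open>w\<close> would be \<open>0\<close>, and
  \<open>lambda_1\<close> could not be positive.
\<close>

lemma lambda_1_embedding:
  assumes pos: "0 < lambda_1 s \<theta> V" and w: "w \<in> WV"
  shows "integrable leb (\<lambda>x. \<bar>w x\<bar> powr (\<theta> * P))"
    and "lambda_1 s \<theta> V * (LINT x|leb. \<bar>w x\<bar> powr (\<theta> * P)) \<le> nrm w powr (\<theta> * P)"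
proof -
  have q: "\<theta> * real CARD('n) / s = \<theta> * P" by (simp add: P_def)
  have \<theta>P: "0 < \<theta> * P" using \<theta>_ge_1 P_gt_2 by (intro mult_pos_pos) auto
  note [measurable] = WV_measurable[OF w]
  define a where "a = (LINT x|leb. \<bar>w x\<bar> powr (\<theta> * P))"
  have a0: "0 \<le> a" by (simp add: a_def integral_nonneg_AE)
  have La: "L_norm (\<theta> * P) w powr (\<theta> * P) = a"
  proof -
    have "(a powr (1 / r)) powr r = a" if "0 < r" for r using a0 that by (simp add: powr_powr)
    then show ?thesis unfolding L_norm_def a_def[symmetric] using \<theta>P by blast
  qed
  have "integrable leb (\<lambda>x. \<bar>w x\<bar> powr (\<theta> * P)) \<and> lambda_1 s \<theta> V * a \<le> nrm w powr (\<theta> * P)"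
  proof (cases "nontrivial w")
    case True
    have "lambda_1 s \<theta> V \<le> nrm w powr (\<theta> * P) / L_norm (\<theta> * P) w powr (\<theta> * P)"
      unfolding lambda_1_def q
      by (rule cINF_lower) (use w True in \<open>auto intro!: bdd_belowI2[where m = 0] divide_nonneg_nonneg\<close>)
    then have le: "lambda_1 s \<theta> V \<le> nrm w powr (\<theta> * P) / a" by (simp add: La)
    have apos: "0 < a"
    proof (rule ccontr)
      assume "\<not> 0 < a"
      then have "a = 0" using a0 by simp
      then show False using le pos by simp
    qed
    then have "integrable leb (\<lambda>x. \<bar>w x\<bar> powr (\<theta> * P))"
      unfolding a_def using not_integrable_integral_eq by fastforce
    moreover have "lambda_1 s \<theta> V * a \<le> nrm w powr (\<theta> * P)" using le apos by (simp add: le_divide_eq)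
    ultimately show ?thesis by simp
  next
    case False
    then have z: "AE x in leb. \<bar>w x\<bar> powr (\<theta> * P) = 0" by (auto simp: nontrivial_def elim!: eventually_mono)
    have "integrable leb (\<lambda>x. \<bar>w x\<bar> powr (\<theta> * P)) \<longleftrightarrow> integrable leb (\<lambda>x. 0 :: real)"
      by (rule integrable_cong_AE) (use z in auto)
    moreover have "a = (LINT x|leb. 0)" unfolding a_def by (rule integral_cong_AE) (use z in auto)
    ultimately show ?thesis by simp
  qed
  then show "integrable leb (\<lambda>x. \<bar>w x\<bar> powr (\<theta> * P))"
    "lambda_1 s \<theta> V * (LINT x|leb. \<bar>w x\<bar> powr (\<theta> * P)) \<le> nrm w powr (\<theta> * P)" by (auto simp: a_def)
qed

text \<open>
  Near \<open>0\<close> condition \<open>cond_f3\<close> bounds \<open>F\<close> by \<open>c0 \<bar>t\<bar>\<^sup>\<theta>\<^sup>P\<close>, which \<open>lambda_1\<close> compares with the Kirchhoff term; elsewhere \<open>F\<close> is bounded by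
  a higher power times an exponential, which the Trudinger-Moser inequality turns into the higher order term \<open>\<theta>P + 1\<close>.
\<close>

lemma I_lower:
  "\<exists>\<kappa>>0. \<exists>C>0. \<exists>\<rho>>0. \<rho> \<le> \<rho>1 \<and> \<rho> \<le> 1 \<and> (\<forall>lam\<ge>0. \<forall>u\<in>WV. nrm u \<le> \<rho> \<longrightarrow>
    2 * \<kappa> * nrm u powr (\<theta> * P) - C * nrm u powr (\<theta> * P + 1) - lam / p * CH * nrm u powr p \<le> I lam u)"
proof -
  obtain c0 \<delta> where c0: "0 < c0" "c0 < MM 1 / P * lambda_1 s \<theta> V" and \<delta>: "0 < \<delta>"
    "\<And>x t. 0 < t \<Longrightarrow> t < \<delta> \<Longrightarrow> F x t \<le> c0 * t powr (\<theta> * P)" using F_small by blast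
  define l1 where "l1 = lambda_1 s \<theta> V"
  have MP: "0 < MM 1 / P" using MM_1_pos P_gt_2 by simp
  have l1: "0 < l1"
  proof -
    have "0 < MM 1 / P * l1" using c0 by (simp add: l1_def)
    then show ?thesis using MP by (rule zero_less_mult_pos)
  qed
  have \<theta>P: "P \<le> \<theta> * P" using mult_right_mono[OF \<theta>_ge_1, of P] P_gt_2 by simp
  define q where "q = \<theta> * P + 1"
  have q: "P \<le> q" using \<theta>P by (simp add: q_def)
  define c1 where "c1 = (fst growth + 1) * \<delta> powr (P - q)"
  have c1: "0 < c1" using growth \<delta> by (auto simp: c1_def intro!: mult_pos_pos add_pos_pos)
  have F_le: "F x t \<le> c0 * \<bar>t\<bar> powr (\<theta> * P) + c1 * (\<bar>t\<bar> powr q * exp (snd growth * \<bar>t\<bar> powr P'))" for x t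
  proof -
    have nn: "0 \<le> c0 * \<bar>t\<bar> powr (\<theta> * P)" "0 \<le> c1 * (\<bar>t\<bar> powr q * exp (snd growth * \<bar>t\<bar> powr P'))"
      using c0 c1 by auto
    consider "t \<le> 0" | "0 < t" "t < \<delta>" | "\<delta> \<le> t" "0 < t" by linarith
    then show ?thesis
    proof cases
      case 1
      then show ?thesis using nn F_nonpos[of t x] by simp
    next
      case 2
      then show ?thesis using nn \<delta>(2)[OF 2, of x] by simp
    next
      case 3
      obtain z where z: "0 < z" "z < t" "F x t - F x 0 = (t - 0) * f x z"
        using MVT2[OF 3(2), of "F x" "f x"] F_deriv by blast
      have "f x z \<le> f_majorant z"
      proof -
        have "f x z \<le> fst growth * (z powr (P - 1) * exp (snd growth * z powr P'))" using growth(3)[of x z] z by simp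
        also have "\<dots> \<le> f_majorant z" unfolding f_majorant_def by (intro mult_right_mono) auto
        finally show ?thesis .
      qed
      also have "\<dots> \<le> f_majorant t" using z by (intro f_majorant_mono) auto
      finally have "F x t \<le> t * f_majorant t" using z 3 F_nonpos[of 0 x] by simp
      also have "\<dots> = (fst growth + 1) * (t powr P * exp (snd growth * t powr P'))"
        using powr_mult_base[of t "P - 1"] 3 by (simp add: f_majorant_def mult.left_commute mult.assoc[symmetric])
      also have "\<dots> \<le> (fst growth + 1) * ((\<delta> powr (P - q) * t powr q) * exp (snd growth * t powr P'))"
      proof (intro mult_left_mono mult_right_mono)
        have "t powr (P - q) \<le> \<delta> powr (P - q)" using 3 \<delta> q by (intro powr_mono2') auto
        then have "t powr (P - q) * t powr q \<le> \<delta> powr (P - q) * t powr q" by (rule mult_right_mono) simp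
        then show "t powr P \<le> \<delta> powr (P - q) * t powr q" using 3 by (simp flip: powr_add)
      qed (use growth in auto)
      also have "\<dots> = c1 * (\<bar>t\<bar> powr q * exp (snd growth * \<bar>t\<bar> powr P'))" using 3 by (simp add: c1_def)
      finally show ?thesis using nn by linarith
    qed
  qed
  obtain r C where rC: "0 < r" "0 < C" "\<And>u. u \<in> borel_measurable leb \<Longrightarrow> E u < \<infinity> \<Longrightarrow> nrm u \<le> r \<Longrightarrow>
    integrable leb (\<lambda>x. \<bar>u x\<bar> powr q * exp (snd growth * \<bar>u x\<bar> powr P')) \<and>
    (LINT x|leb. \<bar>u x\<bar> powr q * exp (snd growth * \<bar>u x\<bar> powr P')) \<le> C * nrm u powr q"
    using trudinger_moser_scaled[OF growth(2) q] by blast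
  define \<rho> where "\<rho> = min (min \<rho>1 1) r"
  have \<rho>: "0 < \<rho>" "\<rho> \<le> \<rho>1" "\<rho> \<le> 1" "\<rho> \<le> r" using \<rho>1_pos rC by (auto simp: \<rho>_def)
  define \<kappa> where "\<kappa> = (MM 1 / P - c0 / l1) / 2"
  have \<kappa>: "0 < \<kappa>" using c0(2) l1 by (simp add: \<kappa>_def l1_def divide_less_eq)
  have "2 * \<kappa> * nrm u powr (\<theta> * P) - (c1 * C) * nrm u powr (\<theta> * P + 1) - lam / p * CH * nrm u powr p \<le> I lam u"
    if lam: "0 \<le> lam" and u: "u \<in> WV" and n: "nrm u \<le> \<rho>" for lam u
  proof -
    note um[measurable] = WV_measurable[OF u] and uf = WV_finite[OF u]
    have iF: "integrable leb (\<lambda>x. F x (u x))" by (rule F_integrable[OF um uf]) (use n \<rho> in simp)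
    note emb = lambda_1_embedding[OF l1[unfolded l1_def] u]
    have t: "integrable leb (\<lambda>x. \<bar>u x\<bar> powr q * exp (snd growth * \<bar>u x\<bar> powr P'))"
      "(LINT x|leb. \<bar>u x\<bar> powr q * exp (snd growth * \<bar>u x\<bar> powr P')) \<le> C * nrm u powr q"
      using rC(3)[OF um uf] n \<rho> by auto
    have "(LINT x|leb. F x (u x)) \<le> (LINT x|leb. c0 * \<bar>u x\<bar> powr (\<theta> * P) + c1 * (\<bar>u x\<bar> powr q * exp (snd growth * \<bar>u x\<bar> powr P')))"
      by (intro integral_mono iF F_le Bochner_Integration.integrable_add integrable_mult_right emb t)
    also have "\<dots> = c0 * (LINT x|leb. \<bar>u x\<bar> powr (\<theta> * P)) + c1 * (LINT x|leb. \<bar>u x\<bar> powr q * exp (snd growth * \<bar>u x\<bar> powr P'))"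
      using emb(1) t(1) by simp
    also have "\<dots> \<le> c0 * (nrm u powr (\<theta> * P) / l1) + c1 * (C * nrm u powr q)"
      using c0 c1 l1 emb(2) t(2) by (intro add_mono mult_left_mono) (auto simp: le_divide_eq l1_def mult.commute)
    finally have Fle: "(LINT x|leb. F x (u x)) \<le> c0 / l1 * nrm u powr (\<theta> * P) + c1 * C * nrm u powr q" by simp
    have MMle: "MM 1 * nrm u powr (\<theta> * P) \<le> MM (Er u)"
    proof (cases "Er u = 0")
      case True
      then show ?thesis using nrm_zero_iff[of u] \<theta>P P_gt_2 by simp
    next
      case False
      have "Er u \<le> 1" unfolding nrm_powr[symmetric] using n \<rho> nrm_nonneg P_gt_2 by (intro powr_le1) auto
      then have "MM 1 * Er u powr \<theta> \<le> MM (Er u)" using False Er_nonneg[of u] by (intro MM_ge_powr) auto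
      then show ?thesis unfolding nrm_powr[symmetric] by (simp add: powr_powr mult.commute)
    qed
    have "lam / p * H u \<le> lam / p * (CH * nrm u powr p)"
      using H_le[OF um uf] lam p by (intro mult_left_mono) auto
    moreover have "MM 1 / P * nrm u powr (\<theta> * P) \<le> MM (Er u) / P"
      using divide_right_mono[OF MMle, of P] P_gt_2 by simp
    moreover have "2 * \<kappa> * nrm u powr (\<theta> * P) = MM 1 / P * nrm u powr (\<theta> * P) - c0 / l1 * nrm u powr (\<theta> * P)"
    proof -
      have half: "2 * (a / 2) = a" for a :: real by simp
      have "2 * \<kappa> = MM 1 / P - c0 / l1" unfolding \<kappa>_def by (rule half)
      then show ?thesis by (simp only: left_diff_distrib)
    qed
    moreover have "lam / p * (CH * nrm u powr p) = lam / p * CH * nrm u powr p" by (rule mult.assoc[symmetric])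
    ultimately show ?thesis using Fle unfolding I_eq q_def by linarith
  qed
  then show ?thesis using \<kappa> c1 rC(2) \<rho> by (intro exI[of _ \<kappa>] conjI exI[of _ "c1 * C"] exI[of _ \<rho>]) auto
qed

text \<open>Every sphere of small radius becomes a barrier once the parameter is small.\<close>

lemma sphere_positive:
  "\<exists>\<rho>>0. \<rho> \<le> \<rho>1 \<and> (\<exists>\<Lambda>>0. \<forall>lam u. 0 < lam \<and> lam < \<Lambda> \<and> u \<in> WV \<and> nrm u = \<rho> \<longrightarrow> 0 < I lam u)"
proof -
  obtain \<kappa> C r where k: "0 < \<kappa>" "0 < C" "0 < r" "r \<le> \<rho>1" "r \<le> 1"
    "\<And>lam u. 0 \<le> lam \<Longrightarrow> u \<in> WV \<Longrightarrow> nrm u \<le> r \<Longrightarrow>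
      2 * \<kappa> * nrm u powr (\<theta> * P) - C * nrm u powr (\<theta> * P + 1) - lam / p * CH * nrm u powr p \<le> I lam u"
    using I_lower by blast
  define \<rho> where "\<rho> = min r (\<kappa> / C)"
  have \<rho>: "0 < \<rho>" "\<rho> \<le> r" "C * \<rho> \<le> \<kappa>" using k by (auto simp: \<rho>_def min_def field_simps)
  define \<Lambda> where "\<Lambda> = \<kappa> * \<rho> powr (\<theta> * P) * p / (CH * \<rho> powr p)"
  have \<Lambda>: "0 < \<Lambda>" using k \<rho> p CH_pos by (simp add: \<Lambda>_def)
  have "0 < I lam u" if lam: "0 < lam" "lam < \<Lambda>" and u: "u \<in> WV" "nrm u = \<rho>" for lam u
  proof -
    have "C * \<rho> powr (\<theta> * P + 1) = C * \<rho> * \<rho> powr (\<theta> * P)" using \<rho> by (simp add: powr_add)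
    also have "\<dots> \<le> \<kappa> * \<rho> powr (\<theta> * P)" using \<rho> by (intro mult_right_mono) auto
    finally have 1: "C * \<rho> powr (\<theta> * P + 1) \<le> \<kappa> * \<rho> powr (\<theta> * P)" .
    have "lam / p * CH * \<rho> powr p < \<Lambda> / p * CH * \<rho> powr p"
      using lam p CH_pos \<rho> by (intro mult_strict_right_mono divide_strict_right_mono) auto
    also have "\<dots> = \<kappa> * \<rho> powr (\<theta> * P)" using p CH_pos \<rho> by (simp add: \<Lambda>_def)
    finally have 2: "lam / p * CH * \<rho> powr p < \<kappa> * \<rho> powr (\<theta> * P)" .
    have "2 * \<kappa> * \<rho> powr (\<theta> * P) - C * \<rho> powr (\<theta> * P + 1) - lam / p * CH * \<rho> powr p \<le> I lam u"
      using k(6)[of lam u] lam u \<rho> by simp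
    then show ?thesis using 1 2 by linarith
  qed
  then show ?thesis using \<rho> \<Lambda> k(4) by (intro exI[of _ \<rho>]) (auto intro: order_trans)
qed

lemma exists_H_pos: "\<exists>\<psi>\<in>WV. 0 < H \<psi>"
proof -
  have "\<exists>n::nat. \<not> (AE x in leb. norm x < real n \<longrightarrow> h x = 0)"
  proof (rule ccontr)
    assume "\<not> ?thesis"
    then have "\<forall>n::nat. AE x in leb. norm x < real n \<longrightarrow> h x = 0" by blast
    then have "AE x in leb. \<forall>n::nat. norm x < real n \<longrightarrow> h x = 0" unfolding AE_all_countable .
    then have "AE x in leb. h x = 0"
    proof eventually_elim
      case (elim x)
      obtain n :: nat where "norm x < real n" using reals_Archimedean2 by blast
      then show ?case using elim by blast
    qed
    then show False using h_nt by (simp add: nontrivial_def)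
  qed
  then obtain n :: nat where n: "\<not> (AE x in leb. norm x < real n \<longrightarrow> h x = 0)" by blast
  obtain \<psi> where \<psi>: "\<psi> \<in> test_functions" "\<And>x. 0 \<le> \<psi> x" "\<And>x::real^'n. norm x < real n \<Longrightarrow> 0 < \<psi> x"
    using bump_function[of "real n"] by blast
  have W: "\<psi> \<in> WV" by (rule test_in_WV[OF \<psi>(1)])
  note i = H_integrable[OF WV_measurable[OF W] WV_finite[OF W]]
  have "H \<psi> \<noteq> 0"
  proof
    assume "H \<psi> = 0"
    then have "AE x in leb. h x * max (\<psi> x) 0 powr p = 0"
      using integral_nonneg_eq_0_iff_AE[OF i] h_nonneg by (simp add: H_def)
    then have "AE x in leb. norm x < real n \<longrightarrow> h x = 0"
    proof eventually_elim
      case (elim x)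
      show ?case
      proof
        assume "norm x < real n"
        then have "0 < \<psi> x" by (rule \<psi>(3))
        then show "h x = 0" using elim by (simp add: max_def)
      qed
    qed
    then show False using n by blast
  qed
  then show ?thesis using W H_nonneg[of \<psi>] by (intro bexI[of _ \<psi>]) auto
qed

text \<open>Near the origin the concave term of order \<open>p < P\<close> dominates.\<close>

lemma I_negative:
  assumes lam: "0 < lam" and \<rho>: "0 < \<rho>"
  shows "\<exists>v\<in>WV. nrm v \<le> \<rho> \<and> I lam v < 0"
proof -
  obtain \<psi> where \<psi>: "\<psi> \<in> WV" "0 < H \<psi>" using exists_H_pos by blast
  note pm = WV_measurable[OF \<psi>(1)]
  obtain C where C: "0 < C" "\<And>t. 0 \<le> t \<Longrightarrow> t \<le> 1 \<Longrightarrow> MM t \<le> C * t" using MM_upper by blast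
  define A where "A = Er \<psi>"
  have A: "0 \<le> A" by (simp add: A_def Er_nonneg)
  have "((\<lambda>t. t powr P * A) \<longlongrightarrow> 0 powr P * A) (at_right 0)"
    using P_gt_2 by (intro tendsto_intros tendsto_powr') (auto simp: eventually_at_right_less less_imp_le intro: eventually_mono[OF eventually_at_right_less])
  then have e1: "\<forall>\<^sub>F t in at_right 0. t powr P * A < 1" using P_gt_2 by (intro order_tendstoD) auto
  have "((\<lambda>t. t * nrm \<psi>) \<longlongrightarrow> 0 * nrm \<psi>) (at_right 0)" by (intro tendsto_intros)
  then have e2: "\<forall>\<^sub>F t in at_right 0. t * nrm \<psi> < \<rho>" using \<rho> by (intro order_tendstoD) auto
  have "((\<lambda>t. C / P * A * t powr (P - p)) \<longlongrightarrow> C / P * A * 0 powr (P - p)) (at_right 0)"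
    using p by (intro tendsto_intros tendsto_powr') (auto intro: eventually_mono[OF eventually_at_right_less])
  then have e3: "\<forall>\<^sub>F t in at_right 0. C / P * A * t powr (P - p) < lam / p * H \<psi>"
    using p lam \<psi>(2) by (intro order_tendstoD) auto
  have "\<forall>\<^sub>F t in at_right (0::real). 0 < t \<and> t powr P * A < 1 \<and> t * nrm \<psi> < \<rho> \<and> C / P * A * t powr (P - p) < lam / p * H \<psi>"
    using e1 e2 e3 eventually_at_right_less[of "0::real"] by eventually_elim auto
  then obtain t where t: "0 < t" "t powr P * A < 1" "t * nrm \<psi> < \<rho>" "C / P * A * t powr (P - p) < lam / p * H \<psi>"
    using eventually_happens[of _ "at_right (0::real)"] by auto
  define v where "v x = t * \<psi> x" for x
  have vW: "v \<in> WV" unfolding v_def[abs_def] by (rule WV_linear(1)[OF \<psi>(1)])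
  have nv: "nrm v = t * nrm \<psi>" "Er v = t powr P * A" unfolding v_def[abs_def] using t by (simp_all add: nrm_scale[OF pm] A_def)
  have Hv: "H v = t powr p * H \<psi>" unfolding v_def[abs_def] using t by (intro H_scale) simp
  have "0 \<le> (LINT x|leb. F x (v x))" by (intro integral_nonneg_AE) (simp add: F_nonneg)
  then have "I lam v \<le> MM (t powr P * A) / P - lam / p * (t powr p * H \<psi>)" by (simp add: I_eq nv Hv)
  also have "MM (t powr P * A) / P \<le> C * (t powr P * A) / P"
    using C(2)[of "t powr P * A"] t A P_gt_2 by (intro divide_right_mono) auto
  also have "C * (t powr P * A) / P = (C / P * A * t powr (P - p)) * t powr p"
    using t by (simp add: mult.assoc flip: powr_add)
  also have "\<dots> < (lam / p * H \<psi>) * t powr p" using t by (intro mult_strict_right_mono) auto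
  finally have "I lam v < 0" by (simp add: mult_ac)
  then show ?thesis using vW nv t by (intro bexI[of _ v]) auto
qed

section \<open>Minimisation and the Euler equation\<close>

text \<open>
  The direct method: a subsequence of a minimising sequence converges in \<open>L\<^sup>P\<close> and almost everywhere, and its energies converge to some \<open>A\<close>. The lower order
  terms pass to the limit, and Fatou's lemma gives \<open>Er v \<le> A\<close> for the limit \<open>v\<close>; monotonicity of \<open>MM\<close> suffices from there.
\<close>

lemma minimiser_exists:
  assumes lam: "0 \<le> lam" "lam \<le> 1" and \<rho>: "0 < \<rho>" "\<rho> \<le> \<rho>1"
  shows "\<exists>u\<in>WV. nrm u \<le> \<rho> \<and> (\<forall>v\<in>WV. nrm v \<le> \<rho> \<longrightarrow> I lam u \<le> I lam v)"
proof -
  define B where "B = {u \<in> WV. nrm u \<le> \<rho>}"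
  have B: "u \<in> borel_measurable leb" "E u < \<infinity>" "nrm u \<le> \<rho>1" if "u \<in> B" for u
    using that \<rho> WV_measurable WV_finite by (auto simp: B_def)
  have Iu: "I lam u = MM (Er u) / P - (LINT x|leb. rhs_primitive lam x (u x))" if "u \<in> B" for u
    by (rule I_eq_rhs_primitive[OF B[OF that]])
  obtain K where K: "\<And>u. u \<in> B \<Longrightarrow> \<bar>LINT x|leb. rhs_primitive lam x (u x)\<bar> \<le> K"
    using rhs_primitive_diff_integrable(2)[OF lam B] by blast
  have bb: "bdd_below (I lam ` B)"
  proof (rule bdd_belowI2)
    fix u assume u: "u \<in> B"
    have "0 \<le> MM (Er u) / P" using MM_nonneg[OF Er_nonneg] P_gt_2 by simp
    then show "- K \<le> I lam u" using Iu[OF u] K[OF u] by linarith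
  qed
  have "(\<lambda>x. 0) \<in> B" using zero_facts \<rho> by (simp add: B_def)
  then have ne: "B \<noteq> {}" by blast
  define m where "m = (INF u\<in>B. I lam u)"
  have m_le: "m \<le> I lam u" if "u \<in> B" for u unfolding m_def using bb that by (rule cINF_lower)
  have "\<exists>u\<in>B. I lam u < m + 1 / Suc n" for n
  proof -
    have "(INF u\<in>B. I lam u) < m + 1 / Suc n" by (simp add: m_def)
    then show ?thesis using cINF_less_iff[OF ne bb] by blast
  qed
  then obtain u where u: "\<And>n. u n \<in> B" "\<And>n. I lam (u n) < m + 1 / Suc n" by metis
  define KE where "KE = \<rho> powr P"
  have Er_le: "Er w \<le> KE" if "w \<in> B" for w
    unfolding KE_def nrm_powr[symmetric] using that nrm_nonneg P_gt_2 by (intro powr_mono2) (auto simp: B_def)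
  have EK: "E (u n) \<le> ennreal KE" for n
    using E_eq_Er[OF B(2)[OF u(1)]] Er_le[OF u(1)] by (simp add: ennreal_leI)
  have KE0: "0 \<le> KE" by (simp add: KE_def)
  obtain \<sigma> v where \<sigma>: "strict_mono (\<sigma> :: nat \<Rightarrow> nat)" and v[measurable]: "v \<in> borel_measurable leb"
    and lim: "(\<lambda>n. lp_energy leb P (\<lambda>x. u (\<sigma> n) x - v x)) \<longlonglongrightarrow> 0"
    using compact_embedding[where u = u, OF V2 KE0 B(1)[OF u(1)] EK] by (elim exE conjE) (rule that)
  have vW: "v \<in> WV"
  proof (rule WV_weakly_closed[OF _ EK KE0 v lim])
    show "u (\<sigma> n) \<in> WV" for n using u(1) by (simp add: B_def)
  qed
  note vf = WV_finite[OF vW]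
  \<comment> \<open>A further subsequence along which the functions converge almost everywhere and the energies converge.\<close>
  have "bounded (range (\<lambda>n. Er (u (\<sigma> n))))"
    using Er_le[OF u(1)] Er_nonneg by (intro boundedI[of _ KE]) auto
  then obtain A \<tau> where \<tau>: "strict_mono \<tau>" "((\<lambda>n. Er (u (\<sigma> n))) \<circ> \<tau>) \<longlonglongrightarrow> A"
    using bounded_imp_convergent_subsequence by blast
  define w where "w n = u (\<sigma> (\<tau> n))" for n
  have wB: "w n \<in> B" for n using u(1) by (simp add: w_def)
  note [measurable] = B(1)[OF wB]
  have wA: "(\<lambda>n. Er (w n)) \<longlonglongrightarrow> A" using \<tau>(2) by (simp add: o_def w_def)
  have wlim: "(\<lambda>n. lp_energy leb P (\<lambda>x. w n x - v x)) \<longlonglongrightarrow> 0"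
    using LIMSEQ_subseq_LIMSEQ[OF lim \<tau>(1)] by (simp add: o_def w_def)
  have wfin: "lp_energy leb P (\<lambda>x. w n x - v x) < \<infinity>" for n
  proof -
    have "ennreal V0 * lp_energy leb P (\<lambda>x. w n x - v x) \<le> E (\<lambda>x. w n x - v x)" by (rule lp_le_E) measurable
    also have "\<dots> \<le> ennreal (2 powr P) * (E (w n) + E v)" by (rule E_diff_le) measurable
    also have "\<dots> < \<infinity>" using B(2)[OF wB, of n] vf by (simp add: ennreal_mult_less_top)
    finally show ?thesis using V0(1) by (auto simp: ennreal_mult_less_top)
  qed
  obtain \<nu> where \<nu>: "strict_mono \<nu>" "AE x in leb. (\<lambda>n. w (\<nu> n) x - v x) \<longlonglongrightarrow> 0"
    using lp_energy_AE_subseq[of "\<lambda>n x. w n x - v x" leb P] wlim wfin P_gt_2 by auto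
  have wA': "(\<lambda>n. Er (w (\<nu> n))) \<longlonglongrightarrow> A" using LIMSEQ_subseq_LIMSEQ[OF wA \<nu>(1)] by (simp add: o_def)
  have A0: "0 \<le> A" using wA by (rule LIMSEQ_le_const) (auto simp: Er_nonneg)
  have "E v \<le> liminf (\<lambda>n. E (w (\<nu> n)))"
    using \<nu>(2) by (intro E_fatou) (auto simp: LIM_zero_iff elim!: eventually_mono)
  also have "\<dots> = ennreal A"
  proof (rule lim_imp_Liminf)
    show "(\<lambda>n. E (w (\<nu> n))) \<longlonglongrightarrow> ennreal A"
      unfolding E_eq_Er[OF B(2)[OF wB]] by (intro tendsto_ennrealI wA')
  qed simp
  finally have "Er v \<le> A" using A0 by (simp add: E_eq_Er[OF vf] ennreal_le_iff)
  have "A \<le> KE" using wA by (rule LIMSEQ_le_const2) (auto simp: Er_le[OF wB])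
  have nv: "nrm v \<le> \<rho>"
  proof -
    have "Er v powr (1 / P) \<le> KE powr (1 / P)" using \<open>Er v \<le> A\<close> \<open>A \<le> KE\<close> Er_nonneg P_gt_2 by (intro powr_mono2) auto
    then show ?thesis using \<rho> P_gt_2 by (simp add: nrm_eq KE_def powr_powr)
  qed
  then have vB: "v \<in> B" using vW by (simp add: B_def)
  have MMlim: "(\<lambda>n. MM (Er (w n))) \<longlonglongrightarrow> MM A"
    using continuous_on_tendsto_compose[OF MM_continuous wA] A0 Er_nonneg by auto
  have FFlim: "(\<lambda>n. LINT x|leb. rhs_primitive lam x (w n x)) \<longlonglongrightarrow> (LINT x|leb. rhs_primitive lam x (v x))"
    by (rule rhs_primitive_continuous[OF lam B[OF wB] B[OF vB] wlim])
  have "(\<lambda>n. I lam (w n)) \<longlonglongrightarrow> MM A / P - (LINT x|leb. rhs_primitive lam x (v x))"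
    unfolding Iu[OF wB] using P_gt_2 by (intro tendsto_intros MMlim FFlim) auto
  moreover have "(\<lambda>n. I lam (w n)) \<longlonglongrightarrow> m"
  proof -
    have "strict_mono (\<sigma> \<circ> \<tau>)" using \<sigma> \<tau>(1) by (rule strict_mono_o)
    then have "(\<lambda>n. inverse (real (Suc ((\<sigma> \<circ> \<tau>) n)))) \<longlonglongrightarrow> 0"
      using LIMSEQ_subseq_LIMSEQ[OF LIMSEQ_inverse_real_of_nat, of "\<sigma> \<circ> \<tau>"] by (simp add: o_def)
    then have l: "(\<lambda>n. m + inverse (real (Suc (\<sigma> (\<tau> n))))) \<longlonglongrightarrow> m"
      using tendsto_add[OF tendsto_const[of m]] by fastforce
    show ?thesis
    proof (rule tendsto_sandwich[OF _ _ tendsto_const l])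
      show "\<forall>\<^sub>F n in sequentially. m \<le> I lam (w n)" using m_le[OF wB] by simp
      show "\<forall>\<^sub>F n in sequentially. I lam (w n) \<le> m + inverse (real (Suc (\<sigma> (\<tau> n))))"
        using u(2) unfolding w_def inverse_eq_divide by (intro always_eventually allI less_imp_le)
    qed
  qed
  ultimately have "m = MM A / P - (LINT x|leb. rhs_primitive lam x (v x))" by (rule LIMSEQ_unique[rotated])
  moreover have "MM (Er v) / P \<le> MM A / P" using MM_mono[OF Er_nonneg \<open>Er v \<le> A\<close>] P_gt_2 by (simp add: divide_right_mono)
  ultimately have "I lam v \<le> m" using Iu[OF vB] by linarith
  then show ?thesis using vW nv m_le by (intro bexI[of _ v]) (auto simp: B_def intro: order_trans)
qed

lemma I_abs_le:
  assumes lam: "0 \<le> lam" "lam \<le> 1" and u: "u \<in> WV" and n: "nrm u \<le> \<rho>1"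
  shows "I lam (\<lambda>x. \<bar>u x\<bar>) \<le> I lam u" "nrm (\<lambda>x. \<bar>u x\<bar>) \<le> nrm u"
proof -
  have W: "(\<lambda>x. \<bar>u x\<bar>) \<in> WV" by (rule WV_abs[OF u])
  note fa = WV_finite[OF W] and ma = WV_measurable[OF W] and fu = WV_finite[OF u] and mu = WV_measurable[OF u]
  have "E (\<lambda>x. \<bar>u x\<bar>) \<le> E u" by (intro E_contraction) auto
  then have Er: "Er (\<lambda>x. \<bar>u x\<bar>) \<le> Er u" unfolding E_eq_Er[OF fa] E_eq_Er[OF fu] using Er_nonneg by (simp add: ennreal_le_iff)
  then show na: "nrm (\<lambda>x. \<bar>u x\<bar>) \<le> nrm u" unfolding nrm_eq using Er_nonneg P_gt_2 by (intro powr_mono2) auto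
  have "(LINT x|leb. F x (u x)) \<le> (LINT x|leb. F x \<bar>u x\<bar>)"
    using n na by (intro integral_mono F_integrable[OF mu fu] F_integrable[OF ma fa] F_le_abs) auto
  moreover have "H u \<le> H (\<lambda>x. \<bar>u x\<bar>)"
    unfolding H_def using h_nonneg p
    by (intro integral_mono H_integrable[OF mu fu] H_integrable[OF ma fa] mult_left_mono powr_mono2) auto
  then have "lam / p * H u \<le> lam / p * H (\<lambda>x. \<bar>u x\<bar>)" using lam p by (intro mult_left_mono) auto
  moreover have "MM (Er (\<lambda>x. \<bar>u x\<bar>)) / P \<le> MM (Er u) / P"
    using MM_mono[OF Er_nonneg Er] P_gt_2 by (simp add: divide_right_mono)
  ultimately show "I lam (\<lambda>x. \<bar>u x\<bar>) \<le> I lam u" unfolding I_eq by linarith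
qed

lemma Er_zero_AE:
  assumes "u \<in> borel_measurable leb" "E u < \<infinity>" "Er u = 0"
  shows "AE x in leb. u x = 0"
proof -
  have "V0 * (LINT x|leb. \<bar>u x\<bar> powr P) \<le> 0" using lp_bound(2)[OF assms(1,2)] assms(3) by simp
  then have "(LINT x|leb. \<bar>u x\<bar> powr P) = 0"
    using V0(1) by (intro antisym) (auto simp: mult_le_0_iff integral_nonneg_AE)
  then have "AE x in leb. \<bar>u x\<bar> powr P = 0"
    using integral_nonneg_eq_0_iff_AE[OF lp_bound(1)[OF assms(1,2)]] by simp
  then show ?thesis by eventually_elim simp
qed

lemma I_AE_zero:
  assumes z: "AE x in leb. u x = 0" and u[measurable]: "u \<in> borel_measurable leb"
  shows "I lam u = 0"
proof -
  have "E u = E (\<lambda>x. 0)" by (rule E_cong_AE[OF z])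
  then have "Er u = 0" using zero_facts by (simp add: Er_def)
  moreover have "(LINT x|leb. F x (u x)) = (LINT x|leb. 0)"
    using z F_measurable[OF u] by (intro integral_cong_AE) (auto simp: F_nonpos elim!: eventually_mono)
  moreover have "H u = (LINT x|leb. 0)" unfolding H_def
    using z h_meas by (intro integral_cong_AE) (auto elim!: eventually_mono)
  ultimately show ?thesis by (simp add: I_eq)
qed

definition dI :: "real \<Rightarrow> (real^'n \<Rightarrow> real) \<Rightarrow> (real^'n \<Rightarrow> real) \<Rightarrow> real" where
  "dI lam u \<phi> = M (Er u) * Lin u \<phi> - (LINT x|leb. rhs lam x (u x) * \<phi> x)"

lemma Er_lipschitz:
  assumes u[measurable]: "u \<in> borel_measurable leb" and fu: "E u < \<infinity>"
  shows "\<exists>C>0. \<forall>\<phi>\<in>WV. nrm \<phi> \<le> 1 \<longrightarrow> \<bar>Er (\<lambda>x. u x + \<phi> x) - Er u\<bar> \<le> C * nrm \<phi>"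
proof -
  define a where "a = nrm u"
  have a: "0 \<le> a" by (simp add: a_def nrm_nonneg)
  define C where "C = P * (2 powr (P - 1) + 1) * a powr (P - 1) + P * 2 powr (P - 1) + P * (a powr (P - 2) * a) + 1"
  have C: "0 < C" using P_gt_2 a by (auto simp: C_def intro!: add_nonneg_pos add_nonneg_nonneg mult_nonneg_nonneg)
  have "\<bar>Er (\<lambda>x. u x + \<phi> x) - Er u\<bar> \<le> C * nrm \<phi>" if \<phi>: "\<phi> \<in> WV" "nrm \<phi> \<le> 1" for \<phi>
  proof -
    note m[measurable] = WV_measurable[OF \<phi>(1)] and f\<phi> = WV_finite[OF \<phi>(1)]
    define b where "b = nrm (\<lambda>x. u x + \<phi> x)"
    define t where "t = b - a"
    have b1: "b \<le> a + nrm \<phi>" unfolding b_def a_def by (rule nrm_triangle(2)[OF u m fu f\<phi>])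
    have b2: "a \<le> b + nrm \<phi>"
    proof -
      have m2: "(\<lambda>x. - 1 * \<phi> x) \<in> borel_measurable leb" by measurable
      have f2: "E (\<lambda>x. - 1 * \<phi> x) < \<infinity>" by (subst E_scale[OF m]) (use f\<phi> in \<open>simp add: ennreal_mult_less_top\<close>)
      have m3: "(\<lambda>x. u x + \<phi> x) \<in> borel_measurable leb" by measurable
      have "nrm (\<lambda>x. (u x + \<phi> x) + - 1 * \<phi> x) \<le> b + nrm (\<lambda>x. - 1 * \<phi> x)"
        unfolding b_def by (rule nrm_triangle(2)[OF m3 m2 nrm_triangle(1)[OF u m fu f\<phi>] f2])
      moreover have "nrm (\<lambda>x. - 1 * \<phi> x) = nrm \<phi>" using nrm_scale(2)[OF m, of "- 1"] by simp
      ultimately show ?thesis by (simp add: a_def)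
    qed
    have t: "\<bar>t\<bar> \<le> nrm \<phi>" "\<bar>t\<bar> \<le> 1" using b1 b2 \<phi>(2) by (auto simp: t_def)
    have "0 \<le> b" by (simp add: b_def nrm_nonneg)
    have E: "Er (\<lambda>x. u x + \<phi> x) = \<bar>a + t\<bar> powr P" "Er u = \<bar>a\<bar> powr P"
      using a \<open>0 \<le> b\<close> nrm_powr[of u] nrm_powr[of "\<lambda>x. u x + \<phi> x"] by (simp_all add: t_def a_def[symmetric] b_def[symmetric])
    have "\<bar>\<bar>a + t\<bar> powr P - \<bar>a\<bar> powr P - P * (\<bar>a\<bar> powr (P - 2) * a) * t\<bar>
      \<le> \<bar>t\<bar> * (P * (2 powr (P - 1) + 1) * \<bar>a\<bar> powr (P - 1) + P * 2 powr (P - 1) * \<bar>t\<bar> powr (P - 1))"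
      using P_gt_2 by (intro abs_powr_increment_le) simp
    also have "\<dots> \<le> \<bar>t\<bar> * (P * (2 powr (P - 1) + 1) * \<bar>a\<bar> powr (P - 1) + P * 2 powr (P - 1) * 1)"
      using t(2) P_gt_2 by (intro mult_left_mono add_left_mono powr_le1) auto
    finally have 1: "\<bar>\<bar>a + t\<bar> powr P - \<bar>a\<bar> powr P - P * (\<bar>a\<bar> powr (P - 2) * a) * t\<bar>
      \<le> \<bar>t\<bar> * (P * (2 powr (P - 1) + 1) * a powr (P - 1) + P * 2 powr (P - 1))" using a by simp
    have 2: "\<bar>P * (\<bar>a\<bar> powr (P - 2) * a) * t\<bar> = \<bar>t\<bar> * (P * (a powr (P - 2) * a))" using a P_gt_2 by (simp add: abs_mult)
    have "\<bar>\<bar>a + t\<bar> powr P - \<bar>a\<bar> powr P\<bar> \<le> \<bar>t\<bar> * (P * (2 powr (P - 1) + 1) * a powr (P - 1) + P * 2 powr (P - 1)) + \<bar>t\<bar> * (P * (a powr (P - 2) * a))"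
      using 1 2 by linarith
    also have "\<dots> \<le> \<bar>t\<bar> * C" by (simp add: C_def distrib_left)
    also have "\<dots> \<le> nrm \<phi> * C" using t(1) C by (intro mult_right_mono) auto
    finally show ?thesis by (simp add: E mult.commute)
  qed
  then show ?thesis using C by blast
qed

text \<open>
  The chain rule for \<open>MM (Er u)\<close>, together with \<open>rhs_primitive_frechet\<close>. Positive energy places \<open>Er u\<close> in the interior of
  the domain \<open>[0, \<infinity>)\<close> of \<open>M\<close>.
\<close>

lemma I_frechet:
  assumes lam: "0 \<le> lam" "lam \<le> 1" and uW: "u \<in> WV" and nu: "nrm u < \<rho>1" and pos: "0 < Er u" and e: "0 < e"
  shows "\<exists>\<delta>>0. \<forall>\<phi>\<in>WV. nrm \<phi> < \<delta> \<longrightarrow> \<bar>I lam (\<lambda>x. u x + \<phi> x) - I lam u - dI lam u \<phi>\<bar> \<le> e * nrm \<phi>"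
proof -
  note u = WV_measurable[OF uW] and fu = WV_finite[OF uW]
  define A where "A = Er u"
  have MA: "0 \<le> M A" by (simp add: M_nonneg A_def Er_nonneg)
  obtain C where C: "0 < C" "\<And>\<phi>. \<phi> \<in> WV \<Longrightarrow> nrm \<phi> \<le> 1 \<Longrightarrow> \<bar>Er (\<lambda>x. u x + \<phi> x) - A\<bar> \<le> C * nrm \<phi>"
    using Er_lipschitz[OF u fu] by (auto simp: A_def)
  define e1 where "e1 = e / (3 * C)"
  define e2 where "e2 = e / (3 * (M A + 1))"
  define e3 where "e3 = e / 3"
  have es: "0 < e1" "0 < e2" "0 < e3" using e C MA by (auto simp: e1_def e2_def e3_def)
  have "(MM has_derivative (\<lambda>y. M A * y)) (at A)"
    using MM_deriv_at[of A] pos by (simp add: has_field_derivative_def A_def)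
  then obtain d1 where d1: "0 < d1" "\<And>y. \<bar>y - A\<bar> < d1 \<Longrightarrow> \<bar>MM y - MM A - M A * (y - A)\<bar> \<le> e1 * \<bar>y - A\<bar>"
    using es(1) by (auto simp: has_derivative_at_alt)
  obtain d2 where d2: "0 < d2" "\<And>\<phi>. \<phi> \<in> borel_measurable leb \<Longrightarrow> E \<phi> < \<infinity> \<Longrightarrow> nrm \<phi> < d2 \<Longrightarrow>
    \<bar>Er (\<lambda>x. u x + \<phi> x) - A - P * Lin u \<phi>\<bar> \<le> e2 * nrm \<phi>"
    using Er_frechet[OF u fu es(2)] by (auto simp: A_def)
  obtain d3 where d3: "0 < d3" "\<And>\<phi>. \<phi> \<in> WV \<Longrightarrow> nrm \<phi> < d3 \<Longrightarrow> nrm (\<lambda>x. u x + \<phi> x) \<le> \<rho>1 \<Longrightarrow>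
    \<bar>(LINT x|leb. rhs_primitive lam x (u x + \<phi> x)) - (LINT x|leb. rhs_primitive lam x (u x)) - (LINT x|leb. rhs lam x (u x) * \<phi> x)\<bar> \<le> e3 * nrm \<phi>"
    using rhs_primitive_frechet[OF lam u fu less_imp_le[OF nu] es(3)] by auto
  define \<delta> where "\<delta> = min (min 1 (d1 / C)) (min (min d2 d3) (\<rho>1 - nrm u))"
  have \<delta>: "0 < \<delta>" "\<delta> \<le> 1" "\<delta> \<le> d1 / C" "\<delta> \<le> d2" "\<delta> \<le> d3" "\<delta> \<le> \<rho>1 - nrm u"
    using d1 d2 d3 C nu by (auto simp: \<delta>_def)
  have "\<bar>I lam (\<lambda>x. u x + \<phi> x) - I lam u - dI lam u \<phi>\<bar> \<le> e * nrm \<phi>" if \<phi>: "\<phi> \<in> WV" "nrm \<phi> < \<delta>" for \<phi>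
  proof -
    note m = WV_measurable[OF \<phi>(1)] and f\<phi> = WV_finite[OF \<phi>(1)]
    have W: "(\<lambda>x. u x + \<phi> x) \<in> WV" using WV_linear(2)[OF uW \<phi>(1)] .
    define n where "n = nrm \<phi>"
    have n: "0 \<le> n" by (simp add: n_def nrm_nonneg)
    have nup: "nrm (\<lambda>x. u x + \<phi> x) \<le> \<rho>1" using nrm_triangle(2)[OF u m fu f\<phi>] \<phi>(2) \<delta>(6) by linarith
    define y where "y = Er (\<lambda>x. u x + \<phi> x)"
    have yA: "\<bar>y - A\<bar> \<le> C * n" unfolding y_def n_def by (rule C(2)) (use \<phi> \<delta> in auto)
    also have "C * n < d1"
    proof -
      have "n < d1 / C" using \<phi>(2) \<delta>(3) by (simp add: n_def)
      then show ?thesis using C(1) by (simp add: less_divide_eq mult.commute)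
    qed
    finally have t1: "\<bar>MM y - MM A - M A * (y - A)\<bar> \<le> e1 * \<bar>y - A\<bar>" by (rule d1(2))
    have "e1 * \<bar>y - A\<bar> \<le> e1 * (C * n)" using yA es by (intro mult_left_mono) auto
    also have "\<dots> = e / 3 * n" using C by (simp add: e1_def)
    finally have t1': "\<bar>MM y - MM A - M A * (y - A)\<bar> \<le> e / 3 * n" using t1 by linarith
    have t2: "\<bar>y - A - P * Lin u \<phi>\<bar> \<le> e2 * n" unfolding y_def n_def by (rule d2(2)[OF m f\<phi>]) (use \<phi> \<delta> in auto)
    have t2': "M A * \<bar>y - A - P * Lin u \<phi>\<bar> \<le> e / 3 * n"
    proof -
      have "M A * \<bar>y - A - P * Lin u \<phi>\<bar> \<le> (M A + 1) * (e2 * n)" using t2 MA es n by (intro mult_mono) auto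
      also have "\<dots> = ((M A + 1) * e2) * n" by (rule mult.assoc[symmetric])
      also have "(M A + 1) * e2 = e / 3" using MA by (simp add: e2_def field_simps)
      finally show ?thesis .
    qed
    have t3: "\<bar>(LINT x|leb. rhs_primitive lam x (u x + \<phi> x)) - (LINT x|leb. rhs_primitive lam x (u x)) - (LINT x|leb. rhs lam x (u x) * \<phi> x)\<bar> \<le> e / 3 * n"
      using d3(2)[OF \<phi>(1) _ nup] \<phi>(2) \<delta>(5) by (simp add: e3_def n_def)
    define X where "X = (MM y - MM A - M A * (y - A)) + M A * (y - A - P * Lin u \<phi>)"
    have X: "\<bar>X\<bar> \<le> 2 * (e / 3 * n)"
    proof -
      have "\<bar>M A * (y - A - P * Lin u \<phi>)\<bar> \<le> e / 3 * n" using t2' MA by (simp add: abs_mult)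
      then show ?thesis using t1' unfolding X_def by linarith
    qed
    have "\<bar>X / P\<bar> \<le> \<bar>X\<bar>" using P_gt_2 by (simp add: abs_divide divide_le_eq mult_le_cancel_left1)
    then have XP: "\<bar>X / P\<bar> \<le> 2 * (e / 3 * n)" using X by linarith
    have "X = MM y - MM A - P * (M A * Lin u \<phi>)" by (simp add: X_def algebra_simps)
    then have "X / P = MM y / P - MM A / P - M A * Lin u \<phi>" using P_gt_2 by (simp add: diff_divide_distrib)
    then have "I lam (\<lambda>x. u x + \<phi> x) - I lam u - dI lam u \<phi> = X / P -
      ((LINT x|leb. rhs_primitive lam x (u x + \<phi> x)) - (LINT x|leb. rhs_primitive lam x (u x)) - (LINT x|leb. rhs lam x (u x) * \<phi> x))"
      using I_eq_rhs_primitive[OF u fu less_imp_le[OF nu], of lam] I_eq_rhs_primitive[OF WV_measurable[OF W] WV_finite[OF W] nup, of lam]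
      by (simp add: dI_def y_def A_def)
    moreover have "2 * (e / 3 * n) + e / 3 * n = e * n" by simp
    ultimately show ?thesis using XP t3 unfolding n_def[symmetric] by linarith
  qed
  then show ?thesis using \<delta>(1) by blast
qed

lemma dI_scale: "dI lam u (\<lambda>x. c * \<phi> x) = c * dI lam u \<phi>"
proof -
  have "rhs lam x (u x) * (c * \<phi> x) = c * (rhs lam x (u x) * \<phi> x)" for x by simp
  then have "(LINT x|leb. rhs lam x (u x) * (c * \<phi> x)) = c * (LINT x|leb. rhs lam x (u x) * \<phi> x)"
    by (simp only: integral_mult_right_zero)
  then show ?thesis by (simp add: dI_def Lin_scale right_diff_distrib)
qed

text \<open>
  Compare \<open>u\<close> with \<open>u + t \<psi>\<close> for small \<open>t > 0\<close>, for \<open>\<psi> = \<phi>\<close> and for \<open>\<psi> = -\<phi>\<close>.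
\<close>

lemma interior_minimiser_dI_zero:
  assumes lam: "0 \<le> lam" "lam \<le> 1" and uW: "u \<in> WV" and nu: "nrm u < \<rho>" "\<rho> \<le> \<rho>1" and pos: "0 < Er u"
    and min: "\<And>v. v \<in> WV \<Longrightarrow> nrm v \<le> \<rho> \<Longrightarrow> I lam u \<le> I lam v" and \<phi>: "\<phi> \<in> WV"
  shows "dI lam u \<phi> = 0"
proof -
  note u = WV_measurable[OF uW] and fu = WV_finite[OF uW]
  have ge: "0 \<le> dI lam u \<psi>" if \<psi>: "\<psi> \<in> WV" for \<psi>
  proof (rule field_le_epsilon)
    fix e :: real assume e: "0 < e"
    define n where "n = nrm \<psi>"
    have n: "0 \<le> n" by (simp add: n_def nrm_nonneg)
    note m = WV_measurable[OF \<psi>] and f\<psi> = WV_finite[OF \<psi>]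
    define e' where "e' = e / (n + 1)"
    have e': "0 < e'" using e n by (simp add: e'_def)
    obtain \<delta> where \<delta>: "0 < \<delta>" "\<And>\<phi>. \<phi> \<in> WV \<Longrightarrow> nrm \<phi> < \<delta> \<Longrightarrow> \<bar>I lam (\<lambda>x. u x + \<phi> x) - I lam u - dI lam u \<phi>\<bar> \<le> e' * nrm \<phi>"
      using I_frechet[OF lam uW _ pos e'] nu by auto
    define t where "t = min \<delta> (\<rho> - nrm u) / (2 * (n + 1))"
    have t: "0 < t" using \<delta> nu n by (auto simp: t_def)
    have "t * n \<le> t * (n + 1)" using t by simp
    also have "\<dots> = min \<delta> (\<rho> - nrm u) / 2"
    proof -
      have "a / (2 * b) * b = a / 2" if "b \<noteq> 0" for a b :: real using that by simp
      from this[of "n + 1"] show ?thesis using n unfolding t_def by simp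
    qed
    also have "\<dots> < min \<delta> (\<rho> - nrm u)" using \<delta> nu by auto
    finally have tn: "t * n < \<delta>" "t * n < \<rho> - nrm u" by auto
    have tW: "(\<lambda>x. t * \<psi> x) \<in> WV" by (rule WV_linear(1)[OF \<psi>])
    have nt: "nrm (\<lambda>x. t * \<psi> x) = t * n" using t by (simp add: nrm_scale(2)[OF m] n_def)
    have W: "(\<lambda>x. u x + t * \<psi> x) \<in> WV" by (rule WV_linear(2)[OF uW tW])
    have "nrm (\<lambda>x. u x + t * \<psi> x) \<le> nrm u + t * n"
      using nrm_triangle(2)[OF u WV_measurable[OF tW] fu WV_finite[OF tW]] nt by simp
    then have "I lam u \<le> I lam (\<lambda>x. u x + t * \<psi> x)" using tn by (intro min W) auto
    moreover have "\<bar>I lam (\<lambda>x. u x + t * \<psi> x) - I lam u - t * dI lam u \<psi>\<bar> \<le> e' * (t * n)"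
      using \<delta>(2)[OF tW] nt tn by (simp add: dI_scale)
    ultimately have "0 \<le> t * dI lam u \<psi> + e' * (t * n)" by linarith
    also have "\<dots> = t * (dI lam u \<psi> + e' * n)" by (simp add: algebra_simps)
    finally have "0 \<le> dI lam u \<psi> + e' * n" using t by (simp add: zero_le_mult_iff)
    moreover have "e' * n \<le> e" using n e by (simp add: e'_def divide_le_eq)
    ultimately show "0 \<le> dI lam u \<psi> + e" by linarith
  qed
  have "0 \<le> dI lam u (\<lambda>x. - 1 * \<phi> x)" by (intro ge WV_linear(1)[OF \<phi>])
  then show ?thesis using ge[OF \<phi>] unfolding dI_scale by simp
qed

lemma interior_minimiser_solves:
  assumes lam: "0 \<le> lam" "lam \<le> 1" and uW: "u \<in> WV" and nu: "nrm u < \<rho>" "\<rho> \<le> \<rho>1" and pos: "0 < Er u"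
    and min: "\<And>v. v \<in> WV \<Longrightarrow> nrm v \<le> \<rho> \<Longrightarrow> I lam u \<le> I lam v" and u0: "\<And>x. 0 \<le> u x"
  shows "critical_point s p V M f h lam u" "weak_solution s p V M f h lam u"
proof -
  note zero = interior_minimiser_dI_zero[OF lam uW nu pos min]
  show "critical_point s p V M f h lam u"
    unfolding critical_point_def
  proof (intro conjI uW allI impI)
    fix e :: real assume e: "0 < e"
    obtain \<delta> where "0 < \<delta>" "\<And>\<phi>. \<phi> \<in> WV \<Longrightarrow> nrm \<phi> < \<delta> \<Longrightarrow> \<bar>I lam (\<lambda>x. u x + \<phi> x) - I lam u - dI lam u \<phi>\<bar> \<le> e * nrm \<phi>"
      using I_frechet[OF lam uW _ pos e] nu by auto
    then show "\<exists>\<delta>>0. \<forall>\<phi>\<in>WV. nrm \<phi> < \<delta> \<longrightarrow> \<bar>I lam (\<lambda>x. u x + \<phi> x) - I lam u\<bar> \<le> e * nrm \<phi>"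
      using zero by (intro exI[of _ \<delta>]) auto
  qed
  have rhs_eq: "f x (u x) + lam * h x * \<bar>u x\<bar> powr (p - 2) * u x = rhs lam x (u x)" for x
  proof (cases "u x = 0")
    case False
    then have "0 < u x" using u0[of x] by simp
    then show ?thesis using powr_mult_base[of "u x" "p - 2"] by (simp add: rhs_def mult.commute mult.left_commute)
  qed (simp add: rhs_def)
  show "weak_solution s p V M f h lam u"
    unfolding weak_solution_def P_def[symmetric] nrm_powr rhs_eq
    using uW zero by (auto simp: dI_def Lin_def)
qed

text \<open>
  A critical point of positive energy is no competitor, since the minimum on the ball is negative, and all others lie in the ball by
  \<open>critical_points_small\<close>. The same lemma with arbitrary \<open>e\<close> yields the limit.
\<close>

theorem least_energy_solution_exists:
  "\<exists>lam_star>0. \<exists>u :: real \<Rightarrow> real^'n \<Rightarrow> real.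
    (\<forall>lam. 0 < lam \<and> lam < lam_star \<longrightarrow>
       nontrivial (u lam) \<and> (AE x in lebesgue. u lam x \<ge> 0) \<and>
       weak_solution s p V M f h lam (u lam) \<and>
       least_energy_solution s p V M f h lam (u lam)) \<and>
    ((\<lambda>lam. nrm (u lam)) \<longlongrightarrow> 0) (at_right 0)"
proof -
  obtain \<rho> \<Lambda>1 where \<rho>: "0 < \<rho>" "\<rho> \<le> \<rho>1" and \<Lambda>1: "0 < \<Lambda>1"
    "\<And>lam u. 0 < lam \<Longrightarrow> lam < \<Lambda>1 \<Longrightarrow> u \<in> WV \<Longrightarrow> nrm u = \<rho> \<Longrightarrow> 0 < I lam u"
    using sphere_positive by blast
  obtain \<Lambda>2 where \<Lambda>2: "0 < \<Lambda>2" "\<And>lam w. 0 < lam \<Longrightarrow> lam < \<Lambda>2 \<Longrightarrow> critical_point s p V M f h lam w \<Longrightarrow> I lam w \<le> 0 \<Longrightarrow> nrm w < \<rho>"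
    using critical_points_small[OF \<rho>(1)] by blast
  define ls where "ls = min 1 (min \<Lambda>1 \<Lambda>2)"
  have ls: "0 < ls" "ls \<le> 1" "ls \<le> \<Lambda>1" "ls \<le> \<Lambda>2" using \<Lambda>1 \<Lambda>2 by (auto simp: ls_def)
  have "\<exists>u. nontrivial u \<and> (AE x in lebesgue. u x \<ge> 0) \<and> weak_solution s p V M f h lam u \<and>
      least_energy_solution s p V M f h lam u \<and> I lam u \<le> 0" if lam: "0 < lam" "lam < ls" for lam
  proof -
    have l: "0 \<le> lam" "lam \<le> 1" using lam ls by auto
    obtain u0 where u0: "u0 \<in> WV" "nrm u0 \<le> \<rho>" "\<And>v. v \<in> WV \<Longrightarrow> nrm v \<le> \<rho> \<Longrightarrow> I lam u0 \<le> I lam v"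
      using minimiser_exists[OF l \<rho>] by blast
    define u where "u x = \<bar>u0 x\<bar>" for x
    have uW: "u \<in> WV" unfolding u_def[abs_def] by (rule WV_abs[OF u0(1)])
    have nu: "nrm u \<le> \<rho>" and Iu: "I lam u \<le> I lam u0"
      using I_abs_le[OF l u0(1)] u0(2) \<rho> unfolding u_def[abs_def] by auto
    have min: "I lam u \<le> I lam v" if "v \<in> WV" "nrm v \<le> \<rho>" for v
      using u0(3)[OF that] Iu by linarith
    obtain v where "v \<in> WV" "nrm v \<le> \<rho>" "I lam v < 0" using I_negative[OF lam(1) \<rho>(1)] by blast
    then have neg: "I lam u < 0" using min[of v] by linarith
    have nt: "nontrivial u"
    proof (rule ccontr)
      assume "\<not> nontrivial u"
      then have "I lam u = 0" by (intro I_AE_zero WV_measurable[OF uW]) (simp add: nontrivial_def)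
      then show False using neg by simp
    qed
    have pos: "0 < Er u"
    proof (rule ccontr)
      assume "\<not> 0 < Er u"
      then have "Er u = 0" using Er_nonneg[of u] by simp
      then show False using Er_zero_AE[OF WV_measurable[OF uW] WV_finite[OF uW]] nt by (simp add: nontrivial_def)
    qed
    have "nrm u \<noteq> \<rho>"
    proof
      assume "nrm u = \<rho>"
      then have "0 < I lam u" using lam ls by (intro \<Lambda>1(2) uW) auto
      then show False using neg by simp
    qed
    then have nu': "nrm u < \<rho>" using nu by simp
    have upos: "0 \<le> u x" for x by (simp add: u_def)
    note sol = interior_minimiser_solves[OF l uW nu' \<rho>(2) pos min upos]
    have "I lam u \<le> I lam w" if w: "critical_point s p V M f h lam w" for w
    proof (cases "I lam w \<le> 0")
      case True
      then have "nrm w < \<rho>" using lam ls w by (intro \<Lambda>2(2)[of lam w]) auto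
      moreover have "w \<in> WV" using w by (simp add: critical_point_def)
      ultimately show ?thesis by (intro min) auto
    qed (use neg in linarith)
    then have "least_energy_solution s p V M f h lam u" using nt sol(1) by (simp add: least_energy_solution_def)
    then show ?thesis using nt sol(2) upos neg by (intro exI[of _ u]) auto
  qed
  then have "\<forall>lam. \<exists>u. 0 < lam \<and> lam < ls \<longrightarrow> nontrivial u \<and> (AE x in lebesgue. u x \<ge> 0) \<and>
      weak_solution s p V M f h lam u \<and> least_energy_solution s p V M f h lam u \<and> I lam u \<le> 0"
    by blast
  from choice[OF this] obtain u where u: "\<And>lam. 0 < lam \<Longrightarrow> lam < ls \<Longrightarrow> nontrivial (u lam) \<and> (AE x in lebesgue. u lam x \<ge> 0) \<and>
      weak_solution s p V M f h lam (u lam) \<and> least_energy_solution s p V M f h lam (u lam) \<and> I lam (u lam) \<le> 0"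
    by auto
  have "((\<lambda>lam. nrm (u lam)) \<longlongrightarrow> 0) (at_right 0)"
  proof (rule tendstoI)
    fix e :: real assume e: "0 < e"
    obtain \<Lambda> where \<Lambda>: "0 < \<Lambda>" "\<And>lam w. 0 < lam \<Longrightarrow> lam < \<Lambda> \<Longrightarrow> critical_point s p V M f h lam w \<Longrightarrow> I lam w \<le> 0 \<Longrightarrow> nrm w < e"
      using critical_points_small[OF e] by blast
    have "dist (nrm (u lam)) 0 < e" if "0 < lam" "lam < min \<Lambda> ls" for lam
    proof -
      have "critical_point s p V M f h lam (u lam)" "I lam (u lam) \<le> 0"
        using u[of lam] that by (auto simp: least_energy_solution_def)
      then have "nrm (u lam) < e" using that by (intro \<Lambda>(2)[of lam]) auto
      then show ?thesis using nrm_nonneg[of "u lam"] by simp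
    qed
    then show "\<forall>\<^sub>F lam in at_right 0. dist (nrm (u lam)) 0 < e"
      using \<Lambda>(1) ls(1) by (auto simp: eventually_at_right_field intro!: exI[of _ "min \<Lambda> ls"])
  qed
  then show ?thesis using u ls(1) by (intro exI[of _ ls] conjI exI[of _ u]) auto
qed

end

theorem theorem1p2:
  fixes s p \<theta> :: real
    and V h :: "real^'n \<Rightarrow> real"
    and M :: "real \<Rightarrow> real"
    and f :: "real^'n \<Rightarrow> real \<Rightarrow> real"
  assumes "0 < s" and "s < 1" and "CARD('n) \<ge> 2"
    and "cond_V1 V" and "cond_V2 V"
    and "kirchhoff_function M" and "cond_M1 M" and "cond_M2 M \<theta>"
    and "nonlinearity f" and "cond_f1 s \<theta> f" and "cond_f2 s \<theta> f" and "cond_f3 s \<theta> V M f"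
    and "1 < p" and "p < real CARD('n) / s"
    and "h \<in> borel_measurable lebesgue" and "\<And>x. 0 \<le> h x"
    and "integrable lebesgue (\<lambda>x. \<bar>h x\<bar> powr (real CARD('n) / (real CARD('n) - s * p)))"
    and "nontrivial h"
  shows "\<exists>lam_star>0. \<exists>u :: real \<Rightarrow> real^'n \<Rightarrow> real.
    (\<forall>lam. 0 < lam \<and> lam < lam_star \<longrightarrow>
       nontrivial (u lam) \<and> (AE x in lebesgue. u lam x \<ge> 0) \<and>
       weak_solution s p V M f h lam (u lam) \<and>
       least_energy_solution s p V M f h lam (u lam)) \<and>
    ((\<lambda>lam. WV_norm s V (u lam)) \<longlongrightarrow> 0) (at_right 0)"
proof -
  interpret kirchhoff_problem s "real CARD('n) / s" "CARD('n)" V p \<theta> M f h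
    by unfold_locales (use assms in auto)
  show ?thesis by (rule least_energy_solution_exists)
qed

end
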